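(* Let $W:\mathbb{R}^2\to[0,\infty)$ be locally Hölder continuous and suppose that there are constants $c_1,c_2>0$ and $\bar p>0$ such that $$c_1|y|^{2\bar p}-1\le W(y)\le c_2(|y|^{2\bar p}+1)\qquad\text{for all } y\in\mathbb{R}^2 .$$ Let $a^-,a^+\in\mathbb{R}^2$ with $a_1^-=a_1^+$ and $a_2^-<a_2^+$. Then $$\mathcal{E}(a^-,a^+)\ \ge\ 2\inf_{T\in\mathcal{C}^0_{2\times2}}\mathbf{M}_F(T).$$
   Context: For $M,N\in\mathbb{R}^{2\times 2}$, $M:N=\operatorname{tr}(M^{\mathsf T}N)$ and $|M|=\sqrt{M:M}$. $B_r(x)$ is the open disc of radius $r$ centred at $x\in\mathbb{R}^2$. Energy. For $\epsilon>0$ and $u\in W^{1,2}(B_1(0);\mathbb{R}^2)$ let $E_\epsilon(u;B_1(0))=\frac12\int_{B_1(0)}\left(\epsilon|Du|^2+\frac1\epsilon W(u)\right)dx$. Let $u_0(x)=a^+$ if $x_1>0$ and $u_0(x)=a^-$ if $x_1<0$. Let $\mathcal{U}(a^-,a^+)$ be the set of all families $(u_\epsilon)_{\epsilon>0}$ in $W^{1,2}(B_1(0);\mathbb{R}^2)$ such that $u_\epsilon\to u_0$ in $L^1(B_1(0);\mathbb{R}^2)$ as $\epsilon\searrow0$ and such that there exist $\tau>0$ and $s>2$ with $\lim_{\epsilon\searrow0}\epsilon^{-\tau}\|\operatorname{div}u_\epsilon\|_{L^s(B_1(0))}=0$. Define $$\mathcal{E}(a^-,a^+)=\tfrac12\inf\Bigl\{\liminf_{\epsilon\searrow0}E_\epsilon(u_\epsilon;B_1(0))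 : (u_\epsilon)_{\epsilon>0}\in\mathcal{U}(a^-,a^+)\Bigr\}.$$ Currents. An $\mathbb{R}^2$-valued $1$-current on $\mathbb{R}^2$ is an element $T$ of the dual space of $C_0^\infty(\mathbb{R}^2;\mathbb{R}^{2\times2})$ (smooth, compactly supported). Its boundary is the $\mathbb{R}^2$-valued distribution $\partial T(\xi)=T(D\xi)$, $\xi\in C_0^\infty(\mathbb{R}^2;\mathbb{R}^2)$. $T$ is normal if there is $C\ge0$ with $T(\zeta)+\partial T(\xi)\le C\sup_{x\in\mathbb{R}^2}(|\zeta(x)|+|\xi(x)|)$ for all $\zeta\in C_0^\infty(\mathbb{R}^2;\mathbb{R}^{2\times 2})$, $\xi\in C_0^\infty(\mathbb{R}^2;\mathbb{R}^2)$. For normal $T$ there are a Radon measure $\|T\|$ and a $\|T\|$-measurable $\vec T:\mathbb{R}^2\to\mathbb{R}^{2\times2}$ with $|\vec T|=1$ almost everywhere and $T(\zeta)=\int_{\mathbb{R}^2}\zeta:\vec T\,d\|T\|$ for all $\zeta$. $\mathcal{C}^0_{2\times2}$ denotes the set of all normal $\mathbb{R}^2$-valued $1$-currents $T$ with $\partial T(\xi)=\xi_1(a^+)-\xi_1(a^-)$ for all $\xi=(\xi_1,\xi_2)\in C_0^\infty(\mathbb{R}^2;\mathbb{R}^2)$. $F$-mass. For $y\in\mathbb{R}^2$ and $N=\begin{pmatrix} n_{11} & n_{12} \\ n_{21} & n_{22} \end{pmatrix}$ let $F^*(y,N)=\frac14W(y)\max\{|N|^2-2\det N,(n_{12}-n_{21})^2\}$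 if $\operatorname{tr}N=0$ and $F^*(y,N)=\infty$ otherwise. For $T\in\mathcal{C}^0_{2\times2}$ let $\mathbf{M}_F(T)=\int_{\mathbb{R}^2}\sqrt{F^*(y,\vec T(y))}\,d\|T\|(y)$. *)

theory Defs
  imports "HOL-Analysis.Analysis"
begin

section \<open>Smooth functions with compact support\<close>

fun iterated_derivative ::
    "'a list \<Rightarrow> ('a::euclidean_space \<Rightarrow> 'b::real_normed_vector) \<Rightarrow> 'a \<Rightarrow> 'b" where
  "iterated_derivative [] f = f"
| "iterated_derivative (v # vs) f =
     (\<lambda>x. frechet_derivative (iterated_derivative vs f) (at x) v)"

definition smooth :: "('a::euclidean_space \<Rightarrow> 'b::real_normed_vector) \<Rightarrow> bool" where
  "smooth f \<longleftrightarrow> (\<forall>vs x. iterated_derivative vs f differentiable (at x))"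

definition test_functions ::
    "'a set \<Rightarrow> ('a::euclidean_space \<Rightarrow> 'b::real_normed_vector) set" where
  "test_functions \<Omega> =
     {f. smooth f \<and> compact (closure {x. f x \<noteq> 0}) \<and> closure {x. f x \<noteq> 0} \<subseteq> \<Omega>}"

text \<open>Sequential convergence to zero in the usual topology of the space of test functions. For
  linear functionals on that space, sequential continuity is the same as continuity.\<close>

definition test_null_sequence ::
    "(nat \<Rightarrow> 'a::euclidean_space \<Rightarrow> 'b::real_normed_vector) \<Rightarrow> bool" where
  "test_null_sequence f \<longleftrightarrow>
     (\<forall>n. f n \<in> test_functions UNIV) \<and>
     (\<exists>K. compact K \<and> (\<forall>n. \<forall>x. x \<notin> K \<longrightarrow> f n x = 0)) \<and>
     (\<forall>vs. uniform_limit UNIV (\<lambda>n. iterated_derivative vs (f n)) (\<lambda>_. 0) sequentially)"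

section \<open>Lebesgue and Sobolev spaces\<close>

text \<open>Only used for exponents \<open>r > 0\<close>; in particular \<open>r = 1/2\<close> is the square root
  on \<open>[0, \<infinity>]\<close>.\<close>

definition enn_powr :: "ennreal \<Rightarrow> real \<Rightarrow> ennreal" where
  "enn_powr t r = (if t = \<infinity> then \<infinity> else ennreal (enn2real t powr r))"

definition Lp_norm :: "real \<Rightarrow> 'a measure \<Rightarrow> ('a \<Rightarrow> 'b::real_normed_vector) \<Rightarrow> ennreal" where
  "Lp_norm p M f = enn_powr (\<integral>\<^sup>+x. ennreal (norm (f x) powr p) \<partial>M) (1 / p)"

definition in_Lp :: "real \<Rightarrow> 'a measure \<Rightarrow> ('a \<Rightarrow> 'b::real_normed_vector) \<Rightarrow> bool" where
  "in_Lp p M f \<longleftrightarrow> f \<in> borel_measurable M \<and> Lp_norm p M f < \<infinity>"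

text \<open>The entry \<open>G x $ i $ j\<close> is the weak \<open>j\<close>-th partial derivative of the \<open>i\<close>-th component,
  which is also the convention of the library constant \<open>jacobian\<close>.\<close>

definition has_weak_jacobian ::
    "(real^'n \<Rightarrow> real^'m) \<Rightarrow> (real^'n \<Rightarrow> real^'n^'m) \<Rightarrow> (real^'n) set \<Rightarrow> bool" where
  "has_weak_jacobian u G \<Omega> \<longleftrightarrow>
     (\<forall>\<phi> :: real^'n \<Rightarrow> real. \<phi> \<in> test_functions \<Omega> \<longrightarrow>
        (\<forall>i j. (LINT x|lebesgue_on \<Omega>. u x $ i * frechet_derivative \<phi> (at x) (axis j 1))
             = - (LINT x|lebesgue_on \<Omega>. G x $ i $ j * \<phi> x)))"

definition W12 :: "(real^'n) set \<Rightarrow> (real^'n \<Rightarrow> real^'m) set" where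
  "W12 \<Omega> = {u. in_Lp 2 (lebesgue_on \<Omega>) u \<and>
               (\<exists>G. in_Lp 2 (lebesgue_on \<Omega>) G \<and> has_weak_jacobian u G \<Omega>)}"

text \<open>On an open set the chosen function is determined up to null sets.\<close>

definition weak_jacobian ::
    "(real^'n) set \<Rightarrow> (real^'n \<Rightarrow> real^'m) \<Rightarrow> real^'n \<Rightarrow> real^'n^'m" where
  "weak_jacobian \<Omega> u = (SOME G. in_Lp 2 (lebesgue_on \<Omega>) G \<and> has_weak_jacobian u G \<Omega>)"

definition weak_div :: "(real^'n) set \<Rightarrow> (real^'n \<Rightarrow> real^'n) \<Rightarrow> real^'n \<Rightarrow> real" where
  "weak_div \<Omega> u x = trace (weak_jacobian \<Omega> u x)"

section \<open>The limiting energy of a transition\<close>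

text \<open>The inner product and the norm of the type of matrices are the Frobenius ones.\<close>

lemma inner_matrix_eq_trace:
  fixes M N :: "real^'n^'m"
  shows "M \<bullet> N = trace (transpose M ** N)"
  unfolding inner_vec_def trace_def transpose_def matrix_matrix_mult_def
  by (simp, subst sum.swap, simp)

lemma norm_matrix_eq_sqrt_trace:
  fixes M :: "real^'n^'m"
  shows "norm M = sqrt (trace (transpose M ** M))"
  by (simp add: norm_eq_sqrt_inner inner_matrix_eq_trace)

definition locally_Hoelder_continuous ::
    "('a::metric_space \<Rightarrow> 'b::metric_space) \<Rightarrow> bool" where
  "locally_Hoelder_continuous f \<longleftrightarrow>
     (\<forall>K. compact K \<longrightarrow>
        (\<exists>\<alpha> C. 0 < \<alpha> \<and> \<alpha> \<le> 1 \<and> (\<forall>x\<in>K. \<forall>y\<in>K. dist (f x) (f y) \<le> C * dist x y powr \<alpha>)))"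

abbreviation unit_disc :: "(real^2) set" where
  "unit_disc \<equiv> ball 0 1"

definition energy :: "(real^2 \<Rightarrow> real) \<Rightarrow> real \<Rightarrow> (real^2 \<Rightarrow> real^2) \<Rightarrow> ennreal" where
  "energy W \<epsilon> u =
     ennreal (1/2) * (\<integral>\<^sup>+x. ennreal (\<epsilon> * (norm (weak_jacobian unit_disc u x))\<^sup>2 + 1 / \<epsilon> * W (u x))
                        \<partial>lebesgue_on unit_disc)"

text \<open>The value on the null set \<open>x $ 1 = 0\<close> is immaterial.\<close>

definition jump_function :: "real^2 \<Rightarrow> real^2 \<Rightarrow> real^2 \<Rightarrow> real^2" where
  "jump_function am ap x = (if x $ 1 > 0 then ap else am)"

definition transition_families :: "real^2 \<Rightarrow> real^2 \<Rightarrow> (real \<Rightarrow> real^2 \<Rightarrow> real^2) set" where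
  "transition_families am ap =
     {u. (\<forall>\<epsilon>>0. u \<epsilon> \<in> W12 unit_disc) \<and>
         ((\<lambda>\<epsilon>. Lp_norm 1 (lebesgue_on unit_disc) (\<lambda>x. u \<epsilon> x - jump_function am ap x))
            \<longlongrightarrow> 0) (at_right 0) \<and>
         (\<exists>\<tau>>0. \<exists>s>2.
            ((\<lambda>\<epsilon>. ennreal (\<epsilon> powr (- \<tau>)) *
                   Lp_norm s (lebesgue_on unit_disc) (weak_div unit_disc (u \<epsilon>)))
              \<longlongrightarrow> 0) (at_right 0))}"

definition transition_energy :: "(real^2 \<Rightarrow> real) \<Rightarrow> real^2 \<Rightarrow> real^2 \<Rightarrow> ennreal" where
  "transition_energy W am ap =
     ennreal (1/2) *
       (INF u \<in> transition_families am ap. Liminf (at_right 0) (\<lambda>\<epsilon>. energy W \<epsilon> (u \<epsilon>)))"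

section \<open>Vector-valued currents\<close>

text \<open>A current is given as a functional on all functions, of which only the values on test
  functions matter.\<close>

type_synonym functional = "(real^2 \<Rightarrow> real^2^2) \<Rightarrow> real"

definition current :: "functional \<Rightarrow> bool" where
  "current T \<longleftrightarrow>
     (\<forall>\<zeta>\<in>test_functions UNIV. \<forall>\<eta>\<in>test_functions UNIV. \<forall>a b.
        T (\<lambda>x. a *\<^sub>R \<zeta> x + b *\<^sub>R \<eta> x) = a * T \<zeta> + b * T \<eta>) \<and>
     (\<forall>\<zeta>. test_null_sequence \<zeta> \<longrightarrow> (\<lambda>n. T (\<zeta> n)) \<longlonglongrightarrow> 0)"

definition current_boundary :: "functional \<Rightarrow> (real^2 \<Rightarrow> real^2) \<Rightarrow> real" where
  "current_boundary T \<xi> = T (\<lambda>x. jacobian \<xi> (at x))"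

definition normal_current :: "functional \<Rightarrow> bool" where
  "normal_current T \<longleftrightarrow> current T \<and>
     (\<exists>C\<ge>0. \<forall>\<zeta>\<in>test_functions UNIV. \<forall>\<xi>\<in>test_functions UNIV.
        T \<zeta> + current_boundary T \<xi> \<le> C * (SUP x. norm (\<zeta> x) + norm (\<xi> x)))"

definition transition_currents :: "real^2 \<Rightarrow> real^2 \<Rightarrow> functional set" where
  "transition_currents am ap =
     {T. normal_current T \<and>
         (\<forall>\<xi>\<in>test_functions UNIV. current_boundary T \<xi> = \<xi> ap $ 1 - \<xi> am $ 1)}"

text \<open>On \<open>\<real>\<^sup>2\<close> a Radon measure is a Borel measure that is finite on compact sets. The density,
  which only matters almost everywhere, is taken Borel measurable.\<close>

definition polar_decomposition ::
    "functional \<Rightarrow> (real^2) measure \<Rightarrow> (real^2 \<Rightarrow> real^2^2) \<Rightarrow> bool" where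
  "polar_decomposition T \<mu> V \<longleftrightarrow>
     sets \<mu> = sets borel \<and> (\<forall>K. compact K \<longrightarrow> emeasure \<mu> K < \<infinity>) \<and>
     V \<in> borel_measurable \<mu> \<and> (AE y in \<mu>. norm (V y) = 1) \<and>
     (\<forall>\<zeta>\<in>test_functions UNIV. T \<zeta> = (LINT y|\<mu>. \<zeta> y \<bullet> V y))"

text \<open>For a normal current, the measure is unique and the orientation is unique almost everywhere
  with respect to it.\<close>

definition current_measure :: "functional \<Rightarrow> (real^2) measure" where
  "current_measure T = (SOME \<mu>. \<exists>V. polar_decomposition T \<mu> V)"

definition current_orientation :: "functional \<Rightarrow> real^2 \<Rightarrow> real^2^2" where
  "current_orientation T = (SOME V. polar_decomposition T (current_measure T) V)"

section \<open>The mass associated with the potential\<close>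

definition F_star :: "(real^2 \<Rightarrow> real) \<Rightarrow> real^2 \<Rightarrow> real^2^2 \<Rightarrow> ennreal" where
  "F_star W y N =
     (if trace N = 0
      then ennreal (1/4 * W y * max ((norm N)\<^sup>2 - 2 * det N) ((N $ 1 $ 2 - N $ 2 $ 1)\<^sup>2))
      else \<infinity>)"

definition F_mass :: "(real^2 \<Rightarrow> real) \<Rightarrow> functional \<Rightarrow> ennreal" where
  "F_mass W T =
     (\<integral>\<^sup>+y. enn_powr (F_star W y (current_orientation T y)) (1/2) \<partial>current_measure T)"

end

theory Submission
 imports Defs
begin

text \<open>
  The idea is to construct, from a Sobolev map \<open>u\<close> of small energy, an explicit competitor for
  the mass problem. Mollify \<open>u\<close> in the domain to a smooth map \<open>v\<close> and push the
  trace-free part of \<open>\<phi> \<chi>(v) Dv\<close> forward by \<open>v\<close>, smeared out in the target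
  at a scale \<open>\<rho>\<close> that is a power of \<open>\<epsilon>\<close>; here \<open>\<phi>\<close> is
  a cutoff in the disc and \<open>\<chi>\<close> one in the target. By Young's inequality the mass of this
  matrix-valued density is at most the energy, up to the integral of a determinant, which is of lower order
  because the determinant is a null Lagrangian. The boundary of the density differs from \<open>l\<close>
  times the required one (with \<open>l\<close> close to \<open>2\<close>, the length of the jump line in the
  disc) by terms involving \<open>v - u\<^sub>0\<close>, \<open>D\<chi>\<close> and \<open>div v\<close>. Each
  of them is a functional of averages of a test field and is filled by transporting these averages along rays
  to a fixed ball, at a cost that is linear in the distance and, for averages of the divergence, logarithmic
  in \<open>1/\<rho>\<close>. The latter is beaten by the decay \<open>\<epsilon>\<^sup>\<tau>\<close> of the
  divergence, and the term with \<open>D\<chi>\<close> by choosing the best of many disjoint dyadic rings for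
  the cutoff \<open>\<chi>\<close>.
\<close>

text \<open>Since \<open>F_star\<close> is infinite unless the trace vanishes, every part of the
  competitor, corrections included, must be trace-free. A trace-free density annihilates constant
  fields and the identity. Hence a difference of two means of a field cannot be filled by itself: on
  the identity it equals the displacement of the centres. It has to be paired with half that
  displacement times a mean of the divergence, and such means must then be moved as well. What
  remains after all transports is a combination of two means and one mean of the divergence over a
  fixed square. Its coefficients are never computed: testing with constants and with the identity
  forces them to vanish, and here \<open>am $ 1 = ap $ 1\<close> enters. The scale \<rho> is tied to
  \<epsilon> by the Hoelder exponent of \<open>W\<close>: the oscillation of \<open>W\<close> at
  scale \<rho> must be small against \<epsilon>, by which the energy divides the potential. The
  growth bounds make \<open>W\<close> on a large ball comparable with its values outside a smaller
  square, so that cutting off in a ring costs no more than a multiple of the energy carried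
  there.\<close>

type_synonym R2 = "real^2"

abbreviation ind :: "'a set => 'a => real" where "ind \<equiv> indicat_real"

abbreviation cont :: "('a::topological_space => 'b::topological_space) => bool" where "cont \<equiv> continuous_on UNIV"

text \<open>These names are otherwise taken by the Henstock-Kurzweil integral.\<close>

lemmas integrable_add = Bochner_Integration.integrable_add
lemmas integrable_bound = Bochner_Integration.integrable_bound
lemmas integrable_diff = Bochner_Integration.integrable_diff
lemmas integrable_sum = Bochner_Integration.integrable_sum
lemmas integral_add = Bochner_Integration.integral_add
lemmas integral_cong = Bochner_Integration.integral_cong
lemmas integral_diff = Bochner_Integration.integral_diff
lemmas integral_mult_right_zero = Bochner_Integration.integral_mult_right_zero
lemmas integral_nonneg = Bochner_Integration.integral_nonneg
lemmas integral_sum = Bochner_Integration.integral_sum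

section \<open>Smooth test functions\<close>

text \<open>The powers in the denominator make the family closed under differentiation up to linear
  combinations (\<open>flat_deriv\<close>), so smoothness of everything built from
  \<open>flat 0\<close> follows by induction on the number of derivatives.\<close>

definition flat :: "nat => real => real" where
 "flat n t = (if t > 0 then exp (- (1 / t)) / t ^ n else 0)"

lemma flat_nonneg: "0 \<le> flat n t" by (simp add: flat_def)
lemma flat0_le_1: "flat 0 t \<le> 1" by (simp add: flat_def)
lemma flat0_pos: "0 < t ==> 0 < flat 0 t" by (simp add: flat_def)
lemma flat_nonpos: "t \<le> 0 ==> flat n t = 0" by (simp add: flat_def)

lemma flat_tendsto_0: "(flat n \<longlongrightarrow> 0) (at 0)"
proof -
 have "((\<lambda>t. inverse t ^ n / exp (inverse t)) \<longlongrightarrow> (0::real)) (at_right 0)"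
  by (rule filterlim_compose[OF tendsto_power_div_exp_0 filterlim_inverse_at_top_right])
 moreover have "eventually (\<lambda>t. inverse t ^ n / exp (inverse t) = flat n t) (at_right (0::real))" unfolding eventually_at_right_field
  by (intro exI[of _ 1]) (auto simp: flat_def exp_minus field_simps power_inverse)
 ultimately have r: "(flat n \<longlongrightarrow> 0) (at_right 0)" by (rule Lim_transform_eventually)
 have "eventually (\<lambda>t. 0 = flat n t) (at_left 0)" unfolding eventually_at_left_field by (intro exI[of _ "-1"]) (auto simp: flat_def)
 then have l: "(flat n \<longlongrightarrow> 0) (at_left 0)" by (rule Lim_transform_eventually[OF tendsto_const])
 show ?thesis using l r filterlim_split_at by blast
qed

lemma flat_deriv: "(flat n has_real_derivative (flat (n+2) t - n * flat (n+1) t)) (at t)"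
proof -
 consider "t > 0" | "t < 0" | "t = 0" by linarith
 then show ?thesis
 proof cases
  case 1
  have "((\<lambda>t. exp (- (1 / t)) / t ^ n) has_real_derivative
    (exp (- (1 / t)) * (1 / t^2) * t ^ n - exp (- (1 / t)) * (n * t ^ (n - 1))) / (t ^ n * t ^ n)) (at t)"
   using 1 by (auto intro!: derivative_eq_intros simp: power2_eq_square)
  moreover have "(exp (- (1 / t)) * (1 / t^2) * t ^ n - exp (- (1 / t)) * (n * t ^ (n - 1))) / (t ^ n * t ^ n)
    = flat (n+2) t - n * flat (n+1) t" using 1 by (cases n) (auto simp: flat_def field_simps power2_eq_square power_add)
  ultimately have *: "((\<lambda>t. exp (- (1 / t)) / t ^ n) has_real_derivative (flat (n+2) t - n * flat (n+1) t)) (at t)" by simp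
  show ?thesis
   by (rule DERIV_cong_ev[THEN iffD1, OF refl _ refl *])
    (use 1 eventually_nhds_in_open[of "{0<..}" t] in \<open>auto elim!: eventually_mono simp: flat_def\<close>)
 next
  case 2
  have *: "((\<lambda>t. 0) has_real_derivative (flat (n+2) t - n * flat (n+1) t)) (at t)" using 2 by (simp add: flat_def)
  show ?thesis
   by (rule DERIV_cong_ev[THEN iffD1, OF refl _ refl *])
    (use 2 eventually_nhds_in_open[of "{..<0}" t] in \<open>auto elim!: eventually_mono simp: flat_def\<close>)
 next
  case 3
  \<comment> \<open>At 0 the difference quotient of \<open>flat n\<close> is
    \<open>flat (Suc n)\<close>, which tends to 0.\<close>
  have "((\<lambda>h. (flat n (0 + h) - flat n 0) / h) \<longlongrightarrow> 0) (at 0)"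
   by (rule Lim_transform_eventually[OF flat_tendsto_0[of "Suc n"]])
    (auto simp: flat_def field_simps intro!: always_eventually)
  then show ?thesis using 3 by (simp add: DERIV_def flat_def)
 qed
qed

text \<open>\<open>smooth\<close> quantifies over all lists of directional derivatives, so it is
  proved through a class of functions that is closed under them. The affine arguments provide bumps
  in arbitrary boxes.\<close>

inductive flat_alg :: "('a::euclidean_space => real) => bool" where
 const: "flat_alg (\<lambda>x. c)"
| flat: "flat_alg (\<lambda>x. flat n (c + d * (x \<bullet> b)))"
| add: "flat_alg f ==> flat_alg g ==> flat_alg (\<lambda>x. f x + g x)"
| mult: "flat_alg f ==> flat_alg g ==> flat_alg (\<lambda>x. f x * g x)"

lemma flat_alg_deriv:
 "flat_alg f ==> \<exists>f'. \<forall>x. (f has_derivative f' x) (at x) \<and> (\<forall>v. flat_alg (\<lambda>x. f' x v))"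
proof (induction rule: flat_alg.induct)
 case (const c)
 show ?case by (intro exI[of _ "\<lambda>x v. 0"]) (auto intro: flat_alg.const)
next
 case (flat n c d b)
 show ?case
 proof (intro exI[of _ "\<lambda>x v. (flat (n+2) (c + d * (x \<bullet> b)) + (- real n) * flat (n+1) (c + d * (x \<bullet> b))) * (d * (v \<bullet> b))"] allI conjI)
  fix x :: 'a
  show "((\<lambda>x. flat n (c + d * (x \<bullet> b))) has_derivative
   (\<lambda>v. (flat (n+2) (c + d * (x \<bullet> b)) + (- real n) * flat (n+1) (c + d * (x \<bullet> b))) * (d * (v \<bullet> b)))) (at x)"
   by (rule has_derivative_compose[OF _ flat_deriv[unfolded has_field_derivative_def], THEN has_derivative_eq_rhs])
    (auto intro!: derivative_eq_intros)
 qed (intro flat_alg.intros)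
next
 case (add f g)
 from add.IH obtain f' g' where "\<forall>x. (f has_derivative f' x) (at x) \<and> (\<forall>v. flat_alg (\<lambda>x. f' x v))"
  "\<forall>x. (g has_derivative g' x) (at x) \<and> (\<forall>v. flat_alg (\<lambda>x. g' x v))" by blast
 then show ?case
  by (intro exI[of _ "\<lambda>x v. f' x v + g' x v"]) (auto intro: flat_alg.add has_derivative_add)
next
 case (mult f g)
 from mult.IH obtain f' g' where "\<forall>x. (f has_derivative f' x) (at x) \<and> (\<forall>v. flat_alg (\<lambda>x. f' x v))"
  "\<forall>x. (g has_derivative g' x) (at x) \<and> (\<forall>v. flat_alg (\<lambda>x. g' x v))" by blast
 then show ?case
  by (intro exI[of _ "\<lambda>x v. f x * g' x v + f' x v * g x"])
   (auto intro!: flat_alg.add flat_alg.mult has_derivative_mult mult.hyps)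
qed

text \<open>Both parts share one induction. The constant factor \<open>E\<close> is carried along
  because currents are tested with matrix fields, and scalar bumps times constant matrices are
  enough to determine the measure.\<close>

lemma flat_alg_iterated_derivative:
 assumes "flat_alg f"
 shows "flat_alg (iterated_derivative vs f) \<and>
  iterated_derivative vs (\<lambda>x. f x *\<^sub>R E) = (\<lambda>x. iterated_derivative vs f x *\<^sub>R E)"
proof (induction vs)
 case Nil
 then show ?case using assms by simp
next
 case (Cons v vs)
 obtain f' where f': "\<And>x. (iterated_derivative vs f has_derivative f' x) (at x)"
  "\<And>v. flat_alg (\<lambda>x. f' x v)" using flat_alg_deriv Cons by blast
 have "frechet_derivative (iterated_derivative vs f) (at x) = f' x" for x
  using f' frechet_derivative_at by metis
 moreover have "frechet_derivative (\<lambda>x. iterated_derivative vs f x *\<^sub>R E) (at x) = (\<lambda>v. f' x v *\<^sub>R E)" for x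
  using frechet_derivative_at[OF has_derivative_scaleR_left[OF f'(1)]] by metis
 ultimately show ?case using f' Cons by simp
qed

lemma flat_alg_smooth:
 assumes "flat_alg f" shows "smooth (\<lambda>x. f x *\<^sub>R E)" "smooth f"
proof -
 have *: "iterated_derivative vs f differentiable (at x)" for vs x
  using flat_alg_iterated_derivative[OF assms, of vs] flat_alg_deriv differentiable_def by blast
 then show "smooth f" by (simp add: smooth_def)
 show "smooth (\<lambda>x. f x *\<^sub>R E)" unfolding smooth_def
 proof (intro allI)
  fix vs x
  from * obtain f' where "(iterated_derivative vs f has_derivative f') (at x)" unfolding differentiable_def by blast
  from has_derivative_scaleR_left[OF this]
  show "iterated_derivative vs (\<lambda>x. f x *\<^sub>R E) differentiable (at x)"
   using flat_alg_iterated_derivative[OF assms, of vs E] unfolding differentiable_def by auto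
 qed
qed

lemma flat_alg_prod: "finite A ==> (\<And>i. i \<in> A ==> flat_alg (f i)) ==> flat_alg (\<lambda>x. \<Prod>i\<in>A. f i x)"
 by (induction A rule: finite_induct) (auto intro: flat_alg.intros)

text \<open>For k > 0 this is positive exactly on the open box, and it tends to the indicator of the
  box as k grows; in this way the values of a current on test functions determine integrals over
  boxes.\<close>

definition box_bump :: "real => 'a::euclidean_space => 'a => 'a => real" where
 "box_bump k l u x = (\<Prod>i\<in>Basis. flat 0 (k * (x \<bullet> i - l \<bullet> i)) * flat 0 (k * (u \<bullet> i - x \<bullet> i)))"

lemma flat_alg_box_bump: "flat_alg (box_bump k l u)"
proof -
 have "flat_alg (\<lambda>x. flat 0 (k * (x \<bullet> i - l \<bullet> i)))" "flat_alg (\<lambda>x. flat 0 (k * (u \<bullet> i - x \<bullet> i)))" for i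
  using flat_alg.flat[of 0 "- (k * (l \<bullet> i))" k i] flat_alg.flat[of 0 "k * (u \<bullet> i)" "-k" i]
  by (simp_all add: algebra_simps)
 then show ?thesis unfolding box_bump_def[abs_def] by (intro flat_alg_prod flat_alg.mult) auto
qed

lemma box_bump_bounds: "0 \<le> box_bump k l u x" "box_bump k l u x \<le> 1"
 unfolding box_bump_def by (auto intro!: prod_nonneg prod_le_1 mult_nonneg_nonneg mult_le_one flat_nonneg flat0_le_1)

lemma box_bump_eq_0:
 assumes "0 < k" "x \<notin> box l u" shows "box_bump k l u x = 0"
proof -
 obtain i where i: "i \<in> Basis" "\<not> (l \<bullet> i < x \<bullet> i) \<or> \<not> (x \<bullet> i < u \<bullet> i)" using assms by (auto simp: mem_box)
 then have "flat 0 (k * (x \<bullet> i - l \<bullet> i)) * flat 0 (k * (u \<bullet> i - x \<bullet> i)) = 0"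
  using assms by (auto simp: flat_nonpos mult_le_0_iff)
 then show ?thesis unfolding box_bump_def using i by (meson finite_Basis prod_zero)
qed

lemma box_bump_tendsto_indicator: "(\<lambda>n. box_bump (real (Suc n)) l u x) \<longlonglongrightarrow> indicator (box l u) x"
proof (cases "x \<in> box l u")
 case False
 then show ?thesis using box_bump_eq_0[OF _ False] by simp
next
 case True
 have *: "(\<lambda>n. flat 0 (real (Suc n) * t)) \<longlonglongrightarrow> 1" if "t > 0" for t
 proof -
  have "(\<lambda>n. exp (- (inverse (real (Suc n)) * inverse t))) \<longlonglongrightarrow> exp (- (0 * inverse t))"
   by (intro tendsto_intros LIMSEQ_inverse_real_of_nat)
  moreover have "flat 0 (real (Suc n) * t) = exp (- (inverse (real (Suc n)) * inverse t))" for n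
   using that by (simp add: flat_def divide_inverse del: of_nat_Suc)
  ultimately show ?thesis by simp
 qed
 have "(\<lambda>n. box_bump (real (Suc n)) l u x) \<longlonglongrightarrow> (\<Prod>i\<in>(Basis::'a set). 1 * 1)"
  unfolding box_bump_def using True by (intro tendsto_prod tendsto_mult *) (auto simp: mem_box)
 then show ?thesis using True by simp
qed

lemma box_bump_test:
 assumes "0 < k" "cbox l u \<subseteq> \<Omega>"
 shows "(\<lambda>x. box_bump k l u x *\<^sub>R E) \<in> test_functions \<Omega>" "box_bump k l u \<in> test_functions \<Omega>"
proof -
 have "closure {x. box_bump k l u x *\<^sub>R E \<noteq> 0} \<subseteq> cbox l u" "closure {x. box_bump k l u x \<noteq> 0} \<subseteq> cbox l u"
  using box_bump_eq_0[OF assms(1)] box_subset_cbox by (intro closure_minimal; fastforce)+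
 moreover from this have "compact (closure {x. box_bump k l u x *\<^sub>R E \<noteq> 0})"
   "compact (closure {x. box_bump k l u x \<noteq> 0})"
  by (metis compact_cbox compact_closure compact_imp_bounded bounded_subset closure_subset order_trans)+
 ultimately show "(\<lambda>x. box_bump k l u x *\<^sub>R E) \<in> test_functions \<Omega>" "box_bump k l u \<in> test_functions \<Omega>"
  using assms(2) flat_alg_smooth(1)[OF flat_alg_box_bump, of k l u E] flat_alg_smooth(2)[OF flat_alg_box_bump, of k l u]
  unfolding test_functions_def by blast+
qed

text \<open>Boundary identities are proved for all C1 fields, without decay at infinity. The
  densities in use have bounded support, so nothing is lost, and the constants and the identity
  become admissible test fields; \<open>corrected_density\<close> relies on them.\<close>

definition C1 :: "(R2 => R2) => bool" where
 "C1 \<xi> \<longleftrightarrow> (\<forall>x. \<xi> differentiable (at x)) \<and> cont (\<lambda>x. jacobian \<xi> (at x))"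

lemma smooth_C1:
 assumes "smooth \<xi>" shows "C1 \<xi>"
proof -
 have "\<xi> differentiable (at x)" for x using assms[unfolded smooth_def, rule_format, of "[]"] by simp
 moreover have "(\<lambda>x. frechet_derivative \<xi> (at x) v) differentiable (at x)" for x v
  using assms[unfolded smooth_def, rule_format, of "[v]"] by simp
 then have "cont (\<lambda>x. frechet_derivative \<xi> (at x) v)" for v
  by (meson continuous_at_imp_continuous_on differentiable_imp_continuous_within)
 then have "cont (\<lambda>x. jacobian \<xi> (at x))" unfolding jacobian_def matrix_def by (intro continuous_intros)
 ultimately show ?thesis by (simp add: C1_def)
qed

lemma test_function_bounded:
 fixes f :: "'a::euclidean_space => 'b::real_normed_vector"
 assumes "f \<in> test_functions UNIV"
 obtains C where "\<And>x. norm (f x) \<le> C" "cont f"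
proof -
 have s: "smooth f" and c: "compact (closure {x. f x \<noteq> 0})" using assms by (auto simp: test_functions_def)
 have "f differentiable (at x)" for x using s[unfolded smooth_def, rule_format, of "[]"] by simp
 then have cont: "cont f" by (meson continuous_at_imp_continuous_on differentiable_imp_continuous_within)
 have "bounded (f ` closure {x. f x \<noteq> 0})" by (intro compact_imp_bounded compact_continuous_image continuous_on_subset[OF cont] c) auto
 then obtain C where C: "\<And>x. x \<in> closure {x. f x \<noteq> 0} ==> norm (f x) \<le> C" by (auto simp: bounded_iff)
 have "norm (f x) \<le> max C 0" for x
  using C[of x] closure_subset[of "{x. f x \<noteq> 0}"] by (cases "f x = 0") auto
 then show ?thesis using cont that by blast
qed

section \<open>Currents with a density\<close>

definition density_current :: "(R2 => real^2^2) => functional" where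
 "density_current G \<zeta> = (LBINT y. \<zeta> y \<bullet> G y)"

text \<open>The root of the maximum in \<open>F_star\<close>, because
  \<open>(norm N)\<^sup>2 - 2 * det N\<close> is the sum of the two squares under the root. It is
  the larger of the norms of two linear images of \<open>N\<close>, hence a seminorm.\<close>

definition aniso_norm :: "real^2^2 => real" where
 "aniso_norm N = max (sqrt ((N $ 1 $ 1 - N $ 2 $ 2)\<^sup>2 + (N $ 1 $ 2 + N $ 2 $ 1)\<^sup>2)) \<bar>N $ 1 $ 2 - N $ 2 $ 1\<bar>"

lemma aniso_norm_measurable [measurable]: "aniso_norm \<in> borel_measurable borel"
 unfolding aniso_norm_def[abs_def] by (intro borel_measurable_continuous_onI continuous_intros)

lemma aniso_norm_nonneg: "0 \<le> aniso_norm N" by (simp add: aniso_norm_def)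

lemma aniso_norm_scaleR: "0 \<le> c ==> aniso_norm (c *\<^sub>R N) = c * aniso_norm N"
proof -
 assume c: "0 \<le> c"
 have "(c * a - c * b)\<^sup>2 + (c * d + c * e)\<^sup>2 = c\<^sup>2 * ((a - b)\<^sup>2 + (d + e)\<^sup>2)" for a b d e :: real
  by algebra
 moreover have "\<bar>c * a - c * b\<bar> = c * \<bar>a - b\<bar>" for a b
  using c by (simp add: abs_mult flip: right_diff_distrib)
 ultimately show ?thesis using c unfolding aniso_norm_def
  by (simp add: real_sqrt_mult max_mult_distrib_left)
qed

lemma norm_matrix_2: "(norm (N::real^2^2))\<^sup>2 = (N$1$1)\<^sup>2 + (N$1$2)\<^sup>2 + (N$2$1)\<^sup>2 + (N$2$2)\<^sup>2"
 unfolding power2_norm_eq_inner by (simp add: inner_vec_def sum_2 power2_eq_square)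

lemma sqrt_F_star:
 assumes "0 \<le> W y" "trace N = 0"
 shows "enn_powr (F_star W y N) (1/2) = ennreal (1/2 * sqrt (W y) * aniso_norm N)"
proof -
 have "max ((norm N)\<^sup>2 - 2 * det N) ((N $ 1 $ 2 - N $ 2 $ 1)\<^sup>2) = (aniso_norm N)\<^sup>2"
 proof -
  have d: "(norm N)\<^sup>2 - 2 * det N = (N $ 1 $ 1 - N $ 2 $ 2)\<^sup>2 + (N $ 1 $ 2 + N $ 2 $ 1)\<^sup>2"
   unfolding norm_matrix_2 by (simp add: det_2 power2_eq_square algebra_simps)
  have "max (a\<^sup>2) (b\<^sup>2) = (max a b)\<^sup>2" if "0 \<le> a" "0 \<le> b" for a b :: real
   using that by (cases "a \<le> b") (auto simp: max_def power_mono)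
  from this[of "sqrt ((N $ 1 $ 1 - N $ 2 $ 2)\<^sup>2 + (N $ 1 $ 2 + N $ 2 $ 1)\<^sup>2)" "\<bar>N $ 1 $ 2 - N $ 2 $ 1\<bar>"]
  have "(aniso_norm N)\<^sup>2 = max ((N $ 1 $ 1 - N $ 2 $ 2)\<^sup>2 + (N $ 1 $ 2 + N $ 2 $ 1)\<^sup>2) ((N $ 1 $ 2 - N $ 2 $ 1)\<^sup>2)"
   unfolding aniso_norm_def by simp
  then show ?thesis unfolding d by simp
 qed
 then have "F_star W y N = ennreal ((1/2 * sqrt (W y) * aniso_norm N)\<^sup>2)" using assms by (simp add: F_star_def power_mult_distrib power_divide)
 moreover have "((1/2 * sqrt (W y) * aniso_norm N)\<^sup>2) powr (1/2) = 1/2 * sqrt (W y) * aniso_norm N"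
  using assms aniso_norm_nonneg[of N] by (simp add: powr_half_sqrt real_sqrt_mult)
 ultimately show ?thesis by (simp add: enn_powr_def)
qed

lemma integrable_inner_bounded:
 fixes G :: "'a => 'b::euclidean_space"
 assumes "integrable M G" "\<zeta> \<in> borel_measurable M" "\<And>y. norm (\<zeta> y) \<le> C"
 shows "integrable M (\<lambda>y. \<zeta> y \<bullet> G y)"
proof (rule integrable_bound)
 show "integrable M (\<lambda>y. C * norm (G y))" using assms by simp
 show "AE y in M. norm (\<zeta> y \<bullet> G y) \<le> norm (C * norm (G y))"
 proof (rule AE_I2)
  fix y
  have "0 \<le> C" using assms(3)[of y] norm_ge_zero order_trans by blast
  then show "norm (\<zeta> y \<bullet> G y) \<le> norm (C * norm (G y))"
   using Cauchy_Schwarz_ineq2[of "\<zeta> y" "G y"] mult_right_mono[OF assms(3)[of y] norm_ge_zero[of "G y"]]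
   by (simp add: abs_mult)
 qed
qed (use assms in \<open>simp add: borel_measurable_integrable\<close>)

lemma density_current_le:
 assumes "integrable lborel G" "cont \<zeta>" "\<And>y. norm (\<zeta> y) \<le> C"
 shows "\<bar>density_current G \<zeta>\<bar> \<le> C * (LBINT y. norm (G y))"
proof -
 have "\<zeta> \<in> borel_measurable lborel" using assms(2) borel_measurable_continuous_onI by auto
 then have i: "integrable lborel (\<lambda>y. \<zeta> y \<bullet> G y)" using assms by (intro integrable_inner_bounded)
 have "\<bar>density_current G \<zeta>\<bar> \<le> (LBINT y. norm (\<zeta> y \<bullet> G y))"
  unfolding density_current_def using integral_norm_bound[of lborel "\<lambda>y. \<zeta> y \<bullet> G y"] by simp
 also have "\<dots> \<le> (LBINT y. C * norm (G y))"
  using assms i by (intro integral_mono) (auto intro!: order_trans[OF Cauchy_Schwarz_ineq2] mult_right_mono)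
 finally show ?thesis by simp
qed

text \<open>Normality needs no extra bound for the boundary: by hypothesis it is a difference of two
  point values, which gives the 2 in the constant \<open>?m + 2\<close>, while the L1 norm of
  \<open>G\<close> bounds the current itself.\<close>

lemma density_current_transition:
 assumes G: "integrable lborel G"
  and bd: "\<And>\<xi>. C1 \<xi> ==> (LBINT y. jacobian \<xi> (at y) \<bullet> G y) = \<xi> ap $ 1 - \<xi> am $ 1"
 shows "density_current G \<in> transition_currents am ap"
proof -
 let ?T = "density_current G"
 let ?m = "LBINT y. norm (G y)"
 have test_int: "integrable lborel (\<lambda>y. \<zeta> y \<bullet> G y)" if z: "\<zeta> \<in> test_functions UNIV" for \<zeta>
 proof -
  obtain K where K: "\<And>x. norm (\<zeta> x) \<le> K" and c: "cont \<zeta>" using test_function_bounded[OF z] by metis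
  from c have "\<zeta> \<in> borel_measurable lborel" using borel_measurable_continuous_onI by auto
  then show ?thesis using K by (intro integrable_inner_bounded[OF G])
 qed
 have lin: "?T (\<lambda>x. a *\<^sub>R \<zeta> x + b *\<^sub>R \<eta> x) = a * ?T \<zeta> + b * ?T \<eta>"
  if "\<zeta> \<in> test_functions UNIV" "\<eta> \<in> test_functions UNIV" for \<zeta> \<eta> a b
  using test_int that unfolding density_current_def by (simp add: inner_add_left)
 have cont: "(\<lambda>n. ?T (\<zeta> n)) \<longlonglongrightarrow> 0" if "test_null_sequence \<zeta>" for \<zeta>
 proof (rule LIMSEQ_I)
  fix e :: real assume e: "e > 0"
  \<comment> \<open>Uniform convergence of the fields themselves, the case of no derivative,
    suffices for a current with integrable density.\<close>
  have ul: "uniform_limit UNIV \<zeta> (\<lambda>_. 0) sequentially"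
  proof -
   have "\<forall>vs. uniform_limit UNIV (\<lambda>n. iterated_derivative vs (\<zeta> n)) (\<lambda>_. 0) sequentially"
    using that unfolding test_null_sequence_def by blast
   from this[rule_format, of "[]"] show ?thesis by simp
  qed
  have m: "0 \<le> ?m" by simp
  have "\<forall>\<^sub>F n in sequentially. \<forall>x. norm (\<zeta> n x) < e / (?m + 1)"
   using uniform_limitD[OF ul, of "e / (?m + 1)"] e m by (auto simp: dist_norm)
  then obtain n0 where n0: "\<And>n x. n \<ge> n0 ==> norm (\<zeta> n x) < e / (?m + 1)" unfolding eventually_sequentially by blast
  have "norm (?T (\<zeta> n) - 0) < e" if "n \<ge> n0" for n
  proof -
   have "\<zeta> n \<in> test_functions UNIV" using \<open>test_null_sequence \<zeta>\<close> by (simp add: test_null_sequence_def)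
   then have "\<bar>?T (\<zeta> n)\<bar> \<le> e / (?m + 1) * ?m"
    using n0[OF that] test_function_bounded[of "\<zeta> n"] by (intro density_current_le[OF G]) (blast intro: less_imp_le)+
   moreover have "?m / (?m + 1) < 1" using m by (subst divide_less_eq_1_pos) linarith+
   then have "e * (?m / (?m + 1)) < e" using e mult_strict_left_mono[of "?m / (?m + 1)" 1 e] by linarith
   ultimately show ?thesis by simp
  qed
  then show "\<exists>no. \<forall>n\<ge>no. norm (?T (\<zeta> n) - 0) < e" by blast
 qed
 have bdry: "current_boundary ?T \<xi> = \<xi> ap $ 1 - \<xi> am $ 1" if "\<xi> \<in> test_functions UNIV" for \<xi>
 proof -
  have "C1 \<xi>" using that by (intro smooth_C1) (simp add: test_functions_def)
  from bd[OF this] show ?thesis by (simp add: current_boundary_def density_current_def)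
 qed
 have "?T \<zeta> + current_boundary ?T \<xi> \<le> (?m + 2) * (SUP x. norm (\<zeta> x) + norm (\<xi> x))"
  if z: "\<zeta> \<in> test_functions UNIV" and x: "\<xi> \<in> test_functions UNIV" for \<zeta> \<xi>
 proof -
  let ?S = "SUP x. norm (\<zeta> x) + norm (\<xi> x)"
  obtain C1 where C1: "\<And>x. norm (\<zeta> x) \<le> C1" and cz: "cont \<zeta>" using test_function_bounded[OF z] by metis
  obtain C2 where C2: "\<And>x. norm (\<xi> x) \<le> C2" using test_function_bounded[OF x] by metis
  from C1 C2 have "bdd_above (range (\<lambda>x. norm (\<zeta> x) + norm (\<xi> x)))" by (intro bdd_aboveI[of _ "C1 + C2"]) (auto intro: add_mono)
  then have S: "norm (\<zeta> x) + norm (\<xi> x) \<le> ?S" for x by (rule cSUP_upper[OF UNIV_I])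
  have Sz: "norm (\<zeta> x) \<le> ?S" and Sx: "norm (\<xi> x) \<le> ?S" for x
   using S[of x] norm_ge_zero[of "\<zeta> x"] norm_ge_zero[of "\<xi> x"] by linarith+
  have "?T \<zeta> \<le> ?S * ?m" using density_current_le[OF G cz Sz] by simp
  moreover have "\<xi> ap $ 1 \<le> ?S" "- (\<xi> am $ 1) \<le> ?S"
   using Sx[of ap] Sx[of am] component_le_norm_cart[of "\<xi> ap" 1] component_le_norm_cart[of "\<xi> am" 1] by linarith+
  ultimately show ?thesis using bdry[OF x] by (simp add: algebra_simps)
 qed
 moreover have "0 \<le> ?m + 2" using integral_nonneg[of lborel "\<lambda>y. norm (G y)"] by simp
 ultimately show ?thesis unfolding transition_currents_def normal_current_def current_def
  using lin cont bdry by blast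
qed

lemma density_polar_decomposition_exists:
 assumes "integrable lborel G"
 shows "\<exists>\<mu> V. polar_decomposition (density_current G) \<mu> V"
proof (intro exI)
 have Gm [measurable]: "G \<in> borel_measurable borel" using borel_measurable_integrable[OF assms] by simp
 \<comment> \<open>Any unit matrix serves: it only makes \<open>V\<close> a unit field on the set
   where \<open>G\<close> vanishes, which has \<mu>-measure zero.\<close>
 define E :: "real^2^2" where "E = axis 1 (axis 1 1)"
 have E: "norm E = 1" by (simp add: E_def)
 define \<mu> where "\<mu> = density lborel (\<lambda>y. ennreal (norm (G y)))"
 define V where "V y = (if G y = 0 then E else (1 / norm (G y)) *\<^sub>R G y)" for y
 have Vm [measurable]: "V \<in> borel_measurable borel" unfolding V_def[abs_def] by measurable
 have "emeasure \<mu> K < \<infinity>" for K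
 proof -
  have "emeasure \<mu> K \<le> emeasure \<mu> (space \<mu>)" by (rule emeasure_space)
  also have "\<dots> = (\<integral>\<^sup>+y. ennreal (norm (G y)) \<partial>lborel)" unfolding \<mu>_def by (simp add: emeasure_density)
  also have "\<dots> < \<infinity>" using assms unfolding integrable_iff_bounded by blast
  finally show ?thesis .
 qed
 moreover have "density_current G \<zeta> = (LINT y|\<mu>. \<zeta> y \<bullet> V y)" if z: "\<zeta> \<in> test_functions UNIV" for \<zeta>
 proof -
  have "\<zeta> \<in> borel_measurable borel" using test_function_bounded[OF z] borel_measurable_continuous_onI by blast
  then have "(LINT y|\<mu>. \<zeta> y \<bullet> V y) = (LBINT y. norm (G y) *\<^sub>R (\<zeta> y \<bullet> V y))"
   unfolding \<mu>_def by (subst integral_density) auto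
  also have "(\<lambda>y. norm (G y) *\<^sub>R (\<zeta> y \<bullet> V y)) = (\<lambda>y. \<zeta> y \<bullet> G y)" by (auto simp: V_def)
  finally show ?thesis by (simp add: density_current_def)
 qed
 moreover have "norm (V y) = 1" for y using E by (simp add: V_def)
 ultimately show "polar_decomposition (density_current G) \<mu> V" unfolding polar_decomposition_def by (auto simp: \<mu>_def)
qed

text \<open>\<open>F_mass\<close> refers to a decomposition picked by \<open>SOME\<close>, so the
  value has to be found for an arbitrary one. Bumps, then boxes, show that the vector measures V
  d\<mu> and G dy agree on bounded Borel sets. As |V| = 1, this makes \<mu> absolutely continuous
  with a density h such that h V = G. The integrand is positively homogeneous in the matrix, so h
  can be absorbed into it.\<close>

lemma polar_decomposition_mass:
 fixes G :: "R2 => real^2^2"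
 assumes G: "integrable lborel G" and tr: "\<And>y. trace (G y) = 0"
  and W [measurable]: "W \<in> borel_measurable borel" and W0: "\<And>y. 0 \<le> W y"
  and P: "polar_decomposition (density_current G) \<mu> V"
 shows "(\<integral>\<^sup>+y. enn_powr (F_star W y (V y)) (1/2) \<partial>\<mu>) = (\<integral>\<^sup>+y. ennreal (1/2 * sqrt (W y) * aniso_norm (G y)) \<partial>lborel)"
proof -
 have Gm [measurable]: "G \<in> borel_measurable borel" using borel_measurable_integrable[OF G] by simp
 have sets_mu: "sets \<mu> = sets borel" and fin: "\<And>K. compact K ==> emeasure \<mu> K < \<infinity>"
  and Vmu: "V \<in> borel_measurable \<mu>" and V1: "AE y in \<mu>. norm (V y) = 1"
  and T: "\<And>\<zeta>. \<zeta> \<in> test_functions UNIV ==> (LBINT y. \<zeta> y \<bullet> G y) = (LINT y|\<mu>. \<zeta> y \<bullet> V y)"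
  using P by (auto simp: polar_decomposition_def density_current_def)
 have Vm [measurable]: "V \<in> borel_measurable borel" using Vmu measurable_cong_sets[OF sets_mu] by blast
 have sp: "space \<mu> = UNIV" using sets_eq_imp_space_eq[OF sets_mu] by simp
 have bmeas: "f \<in> borel_measurable \<mu>" if "f \<in> borel_measurable borel" for f :: "R2 => 'b::topological_space"
  using that measurable_cong_sets[OF sets_mu] by blast
 \<comment> \<open>The measure \<mu> is only known to be finite on compact sets, so the comparison
   with G dy is made inside each of these boxes.\<close>
 define C :: "nat => R2 set" where "C n = box (- real n *\<^sub>R One) (real n *\<^sub>R One)" for n
 have Cborel [measurable]: "C n \<in> sets borel" for n by (simp add: C_def)
 have Ccover: "\<exists>n. y \<in> C n" for y
 proof -
  obtain n :: nat where n: "norm y < real n" using reals_Archimedean2 by blast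
  then have "\<bar>y \<bullet> i\<bar> < real n" if "i \<in> Basis" for i using Basis_le_norm[OF that, of y] by linarith
  then show ?thesis unfolding C_def by (intro exI[of _ n]) (auto simp: mem_box abs_less_iff minus_less_iff)
 qed
 have int_ind: "integrable \<mu> (\<lambda>y. ind (A \<inter> cbox l u) y)" if "A \<in> sets borel" for A l u
 proof -
  have "emeasure \<mu> (A \<inter> cbox l u) \<le> emeasure \<mu> (cbox l u)" by (intro emeasure_mono) (auto simp: sets_mu)
  also have "\<dots> < \<infinity>" by (rule fin[OF compact_cbox])
  finally show ?thesis using that by (simp add: integrable_indicator_iff sets_mu)
 qed
 have int_indV: "integrable \<mu> (\<lambda>y. ind A y *\<^sub>R V y)" if A: "A \<in> sets borel" "A \<subseteq> cbox l u" for A l u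
 proof (rule integrable_bound)
  show "integrable \<mu> (ind (A \<inter> cbox l u))" using int_ind[OF A(1)] by simp
  show "AE x in \<mu>. norm (ind A x *\<^sub>R V x) \<le> norm (ind (A \<inter> cbox l u) x)"
   using V1 by eventually_elim (use A in \<open>auto simp: indicator_def\<close>)
 qed (use A in \<open>auto intro!: bmeas\<close>)
 have int_indG: "integrable lborel (\<lambda>y. ind A y *\<^sub>R G y)" if "A \<in> sets borel" for A
  using integrable_mult_indicator[OF _ G] that by simp
 \<comment> \<open>Bumps converge to the indicator of the box, dominated by the indicator of the
   closed box for \<mu> and by |G| for Lebesgue measure.\<close>
 have box_eq: "(LINT y|\<mu>. ind (box l u) y *\<^sub>R V y) = (LBINT y. ind (box l u) y *\<^sub>R G y)" for l u
 proof -
  let ?t = "\<lambda>n. box_bump (real (Suc n)) l u"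
  have tm [measurable]: "?t n \<in> borel_measurable borel" for n
   using test_function_bounded[OF box_bump_test(2)[of "real (Suc n)" l u UNIV]] borel_measurable_continuous_onI
   by (simp del: of_nat_Suc) blast
  have tle: "\<bar>?t n y\<bar> \<le> ind (UNIV \<inter> cbox l u) y" for n y
   using box_bump_bounds[of "real (Suc n)" l u y] box_bump_eq_0[of "real (Suc n)" y l u] box_subset_cbox[of l u]
   by (auto simp: indicator_def simp del: of_nat_Suc)
  have 1: "(\<lambda>n. LINT y|\<mu>. ?t n y *\<^sub>R V y) \<longlonglongrightarrow> (LINT y|\<mu>. ind (box l u) y *\<^sub>R V y)"
  proof (rule integral_dominated_convergence[where w="ind (UNIV \<inter> cbox l u)"])
   show "AE y in \<mu>. norm (?t n y *\<^sub>R V y) \<le> ind (UNIV \<inter> cbox l u) y" for n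
    using V1 by eventually_elim (use tle in simp)
  qed (use int_ind[of UNIV] in \<open>auto intro!: bmeas tendsto_intros box_bump_tendsto_indicator simp del: of_nat_Suc\<close>)
  have 2: "(\<lambda>n. LBINT y. ?t n y *\<^sub>R G y) \<longlonglongrightarrow> (LBINT y. ind (box l u) y *\<^sub>R G y)"
  proof (rule integral_dominated_convergence[where w="\<lambda>y. norm (G y)"])
   show "AE y in lborel. norm (?t n y *\<^sub>R G y) \<le> norm (G y)" for n
    using box_bump_bounds[of "real (Suc n)" l u] by (intro AE_I2) (simp add: mult_left_le_one_le del: of_nat_Suc)
  qed (use G in \<open>auto intro!: tendsto_intros box_bump_tendsto_indicator simp del: of_nat_Suc\<close>)
  have "(LINT y|\<mu>. ?t n y *\<^sub>R V y) = (LBINT y. ?t n y *\<^sub>R G y)" for n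
  proof (rule vector_eq_rdot[THEN iffD1], intro allI)
   fix E :: "real^2^2"
   have i1: "integrable \<mu> (\<lambda>y. ?t n y *\<^sub>R V y)"
   proof (rule integrable_bound[OF int_ind[of UNIV l u]])
    show "AE y in \<mu>. norm (?t n y *\<^sub>R V y) \<le> norm (ind (UNIV \<inter> cbox l u) y)" using V1 by eventually_elim (use tle[of n] in simp)
   qed (auto intro!: bmeas simp del: of_nat_Suc)
   have i2: "integrable lborel (\<lambda>y. ?t n y *\<^sub>R G y)"
   proof (rule integrable_bound[OF G])
    show "AE y in lborel. norm (?t n y *\<^sub>R G y) \<le> norm (G y)"
     using box_bump_bounds[of "real (Suc n)" l u] by (intro AE_I2) (simp add: mult_left_le_one_le del: of_nat_Suc)
   qed (simp del: of_nat_Suc)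
   have "(\<lambda>y. ?t n y *\<^sub>R E) \<in> test_functions UNIV" by (rule box_bump_test(1)) auto
   from T[OF this] show "(LINT y|\<mu>. ?t n y *\<^sub>R V y) \<bullet> E = (LBINT y. ?t n y *\<^sub>R G y) \<bullet> E"
    by (subst (1 2) integral_inner_left[symmetric]) (auto simp: i1 i2 inner_commute simp del: of_nat_Suc)
  qed
  with 1 2 show ?thesis using LIMSEQ_unique by auto
 qed
 have Csub: "C n \<subseteq> cbox (- real n *\<^sub>R One) (real n *\<^sub>R One)" for n unfolding C_def by (rule box_subset_cbox)
 \<comment> \<open>Boxes are stable under intersection and generate the Borel sets, and both sides
   are countably additive inside \<open>C n\<close>.\<close>
 have borel_eq: "(LINT y|\<mu>. ind (A \<inter> C n) y *\<^sub>R V y) = (LBINT y. ind (A \<inter> C n) y *\<^sub>R G y)"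
  if "A \<in> sets borel" for A n
 proof -
  have A: "A \<in> sigma_sets UNIV (range (\<lambda>(a, b). box a b))" using that unfolding borel_eq_box by simp
  have in_borel: "B \<in> sets borel" if "B \<in> sigma_sets UNIV (range (\<lambda>(a, b). box a b))" for B :: "R2 set"
   using that unfolding borel_eq_box by simp
  have "Int_stable (range (\<lambda>(a, b). box a b :: R2 set))" unfolding Int_stable_def
  proof (intro ballI)
   fix P Q :: "R2 set"
   assume "P \<in> range (\<lambda>(a, b). box a b)" "Q \<in> range (\<lambda>(a, b). box a b)"
   then obtain a b c d where "P = box a b" "Q = box c d" by auto
   then have "P \<inter> Q = (\<lambda>(a, b). box a b) (\<Sum>i\<in>Basis. max (a \<bullet> i) (c \<bullet> i) *\<^sub>R i, \<Sum>i\<in>Basis. min (b \<bullet> i) (d \<bullet> i) *\<^sub>R i)"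
    by (simp add: box_Int_box)
   then show "P \<inter> Q \<in> range (\<lambda>(a, b). box a b)" by (rule range_eqI)
  qed
  moreover have "range (\<lambda>(a, b). box a b :: R2 set) \<subseteq> Pow UNIV" by simp
  ultimately show ?thesis using A
  proof (induction rule: sigma_sets_induct_disjoint)
   case (basic A)
   then show ?case using box_eq by (auto simp: C_def box_Int_box)
  next
   case (compl A)
   have "ind ((UNIV - A) \<inter> C n) y = ind (UNIV \<inter> C n) y - ind (A \<inter> C n) y" for y
    by (auto simp: indicator_def)
   then have ie: "(\<lambda>y. ind ((UNIV - A) \<inter> C n) y *\<^sub>R f y)
     = (\<lambda>y. ind (C n) y *\<^sub>R f y - ind (A \<inter> C n) y *\<^sub>R f y)" for f :: "R2 => real^2^2" by (auto simp: scaleR_diff_left)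
   have Ab: "A \<in> sets borel" by (rule in_borel[OF compl(1)])
   have "(LINT y|\<mu>. ind ((UNIV - A) \<inter> C n) y *\<^sub>R V y)
    = (LINT y|\<mu>. ind (C n) y *\<^sub>R V y) - (LINT y|\<mu>. ind (A \<inter> C n) y *\<^sub>R V y)"
    unfolding ie by (intro integral_diff int_indV[of _ "- real n *\<^sub>R One" "real n *\<^sub>R One"])
     (use Ab Csub[of n] in auto)
   moreover have "(LBINT y. ind ((UNIV - A) \<inter> C n) y *\<^sub>R G y)
    = (LBINT y. ind (C n) y *\<^sub>R G y) - (LBINT y. ind (A \<inter> C n) y *\<^sub>R G y)"
    unfolding ie by (intro integral_diff int_indG) (use Ab in auto)
   moreover have "(LINT y|\<mu>. ind (C n) y *\<^sub>R V y) = (LBINT y. ind (C n) y *\<^sub>R G y)" unfolding C_def by (rule box_eq)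
   ultimately show ?case using compl(2) by simp
  next
   case (union A)
   have Ab: "A i \<in> sets borel" for i using union in_borel by blast
   have s: "(LINT y|M. ind ((\<Union>i. A i) \<inter> C n) y *\<^sub>R f y) = (\<Sum>i. LINT y|M. ind (A i \<inter> C n) y *\<^sub>R f y)"
    if f: "integrable M (\<lambda>y. ind (C n) y *\<^sub>R f y)" and M: "sets M = sets borel"
    for M and f :: "R2 => real^2^2"
   proof -
    have ei: "(\<lambda>y. ind B y *\<^sub>R (ind (C n) y *\<^sub>R f y)) = (\<lambda>y. ind (B \<inter> C n) y *\<^sub>R f y)" for B
     by (auto simp: indicator_def)
    have "set_lebesgue_integral M (\<Union>i. A i) (\<lambda>y. ind (C n) y *\<^sub>R f y)
      = (\<Sum>i. set_lebesgue_integral M (A i) (\<lambda>y. ind (C n) y *\<^sub>R f y))"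
    proof (rule lebesgue_integral_countable_add)
     show "A i \<in> sets M" for i using Ab M by simp
     show "A i \<inter> A j = {}" if "i \<noteq> j" for i j
      using union(1) that by (auto simp: disjoint_family_on_def)
     show "set_integrable M (\<Union>(range A)) (\<lambda>y. ind (C n) y *\<^sub>R f y)"
      unfolding set_integrable_def using integrable_mult_indicator[OF _ f, of "\<Union>(range A)"] Ab M by auto
    qed
    then show ?thesis unfolding set_lebesgue_integral_def ei .
   qed
   have "(LINT y|\<mu>. ind ((\<Union>i. A i) \<inter> C n) y *\<^sub>R V y) = (\<Sum>i. LINT y|\<mu>. ind (A i \<inter> C n) y *\<^sub>R V y)"
    by (rule s[OF int_indV[OF _ Csub] sets_mu]) simp
   moreover have "(LBINT y. ind ((\<Union>i. A i) \<inter> C n) y *\<^sub>R G y) = (\<Sum>i. LBINT y. ind (A i \<inter> C n) y *\<^sub>R G y)"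
    by (rule s[OF int_indG]) auto
   ultimately show ?case using union(3) by simp
  qed auto
 qed
 have sfm: "sigma_finite_measure \<mu>"
 proof
  show "\<exists>A. countable A \<and> A \<subseteq> sets \<mu> \<and> \<Union>A = space \<mu> \<and> (\<forall>a\<in>A. emeasure \<mu> a \<noteq> \<infinity>)"
  proof (intro exI[of _ "range C"] conjI ballI)
   show "countable (range C)" by simp
   show "range C \<subseteq> sets \<mu>" unfolding sets_mu by auto
   show "\<Union>(range C) = space \<mu>" using Ccover sp by blast
   fix a assume "a \<in> range C"
   then obtain n where n: "a = C n" by blast
   have "emeasure \<mu> a \<le> emeasure \<mu> (cbox (- real n *\<^sub>R One) (real n *\<^sub>R One))"
    unfolding n by (intro emeasure_mono Csub) (simp add: sets_mu)
   then show "emeasure \<mu> a \<noteq> \<infinity>" using le_less_trans[OF _ fin[OF compact_cbox[of "- real n *\<^sub>R One" "real n *\<^sub>R One"]]] by (metis infinity_ennreal_def less_irrefl)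
  qed
 qed
 interpret mu: sigma_finite_measure \<mu> by (rule sfm)
 \<comment> \<open>On a Lebesgue null set the integrals of G vanish, hence so do those of V d\<mu>
   over all Borel subsets inside \<open>C n\<close>. So V vanishes there \<mu>-almost everywhere,
   which is impossible for a unit field unless the set is \<mu>-null.\<close>
 have ac: "absolutely_continuous lborel \<mu>" unfolding absolutely_continuous_def
 proof
  fix A :: "R2 set" assume A: "A \<in> null_sets lborel"
  then have Ab [measurable]: "A \<in> sets borel" by auto
  have "AE y in \<mu>. y \<notin> A \<inter> C n" for n
  proof -
   have "AE y in \<mu>. ind (A \<inter> C n) y *\<^sub>R V y = 0"
   proof (rule mu.density_zero)
    show "integrable \<mu> (\<lambda>y. ind (A \<inter> C n) y *\<^sub>R V y)" by (rule int_indV[OF _ order_trans[OF Int_lower2 Csub]]) simp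
    fix B assume "B \<in> sets \<mu>"
    then have B [measurable]: "B \<in> sets borel" unfolding sets_mu .
    have e: "(\<lambda>y. ind B y *\<^sub>R ind (A \<inter> C n) y *\<^sub>R V y) = (\<lambda>y. ind ((B \<inter> A) \<inter> C n) y *\<^sub>R V y)"
     by (rule ext) (simp add: indicator_inter_arith)
    have "AE y in lborel. ind ((B \<inter> A) \<inter> C n) y *\<^sub>R G y = 0" using AE_not_in[OF A] by eventually_elim simp
    then have "(LBINT y. ind ((B \<inter> A) \<inter> C n) y *\<^sub>R G y) = 0" by (rule integral_eq_zero_AE)
    then show "set_lebesgue_integral \<mu> B (\<lambda>y. ind (A \<inter> C n) y *\<^sub>R V y) = 0"
     unfolding set_lebesgue_integral_def e by (subst borel_eq) auto
   qed
   with V1 show ?thesis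
   proof eventually_elim
    fix y assume "norm (V y) = 1" "ind (A \<inter> C n) y *\<^sub>R V y = 0"
    then show "y \<notin> A \<inter> C n" by (cases "y \<in> A \<inter> C n") auto
   qed
  qed
  then have "AE y in \<mu>. \<forall>n. y \<notin> A \<inter> C n" unfolding AE_all_countable by blast
  then have "AE y in \<mu>. y \<notin> A" by eventually_elim (use Ccover in blast)
  then show "A \<in> null_sets \<mu>" using AE_iff_null_sets[of A \<mu>] Ab unfolding sets_mu by blast
 qed
 have sets_eq: "sets \<mu> = sets lborel" unfolding sets_mu by simp
 \<comment> \<open>Real-valued form of the Radon-Nikodym derivative; sigma-finiteness of \<mu> makes
   the latter finite almost everywhere.\<close>
 define h where "h y = enn2real (RN_deriv lborel \<mu> y)" for y
 have h0: "0 \<le> h y" for y by (simp add: h_def)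
 have hm [measurable]: "h \<in> borel_measurable borel" unfolding h_def[abs_def] by simp
 have mu_h: "\<mu> = density lborel (\<lambda>y. ennreal (h y))"
 proof -
  have "AE y in lborel. RN_deriv lborel \<mu> y \<noteq> \<infinity>" by (rule sigma_finite_measure.RN_deriv_finite[OF sigma_finite_lborel sfm ac sets_eq])
  then have "AE y in lborel. ennreal (h y) = RN_deriv lborel \<mu> y" by eventually_elim (simp add: h_def ennreal_enn2real_if)
  then have "density lborel (\<lambda>y. ennreal (h y)) = density lborel (RN_deriv lborel \<mu>)" by (intro density_cong) auto
  then show ?thesis unfolding sigma_finite_measure.density_RN_deriv[OF sigma_finite_lborel ac sets_eq] by (rule sym)
 qed
 have hV: "AE y in lborel. h y *\<^sub>R V y = G y"
 proof -
  have "AE y in lborel. h y *\<^sub>R (ind (C n) y *\<^sub>R V y) = ind (C n) y *\<^sub>R G y" for n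
  proof (rule sigma_finite_measure.density_unique_banach[OF sigma_finite_lborel])
   have "integrable \<mu> (\<lambda>y. ind (C n) y *\<^sub>R V y)" using int_indV[of "C n"] Csub[of n] by simp
   then show "integrable lborel (\<lambda>y. h y *\<^sub>R (ind (C n) y *\<^sub>R V y))"
    unfolding mu_h by (subst (asm) integrable_density) (auto simp: h0)
   show "integrable lborel (\<lambda>y. ind (C n) y *\<^sub>R G y)" using int_indG by simp
   fix A :: "R2 set" assume "A \<in> sets lborel"
   then have A [measurable]: "A \<in> sets borel" by simp
   have "set_lebesgue_integral lborel A (\<lambda>y. h y *\<^sub>R (ind (C n) y *\<^sub>R V y))
     = (LINT y|\<mu>. ind (A \<inter> C n) y *\<^sub>R V y)" unfolding set_lebesgue_integral_def mu_h
    by (subst integral_density) (auto simp: h0 indicator_inter_arith mult_ac)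
   also have "\<dots> = set_lebesgue_integral lborel A (\<lambda>y. ind (C n) y *\<^sub>R G y)"
    unfolding set_lebesgue_integral_def borel_eq[OF A] by (simp add: indicator_inter_arith)
   finally show "set_lebesgue_integral lborel A (\<lambda>y. h y *\<^sub>R (ind (C n) y *\<^sub>R V y))
    = set_lebesgue_integral lborel A (\<lambda>y. ind (C n) y *\<^sub>R G y)" .
  qed
  then have "AE y in lborel. \<forall>n. h y *\<^sub>R (ind (C n) y *\<^sub>R V y) = ind (C n) y *\<^sub>R G y" unfolding AE_all_countable by blast
  then show ?thesis
  proof eventually_elim
   fix y assume *: "\<forall>n. h y *\<^sub>R (ind (C n) y *\<^sub>R V y) = ind (C n) y *\<^sub>R G y"
   obtain n where "y \<in> C n" using Ccover by blast
   then show "h y *\<^sub>R V y = G y" using *[rule_format, of n] by simp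
  qed
 qed
 \<comment> \<open>h times the trace of V is the trace of G, and h > 0 holds \<mu>-almost
   everywhere. This keeps the infinite branch of \<open>F_star\<close> out of the integral.\<close>
 have "AE y in \<mu>. trace (V y) = 0" unfolding mu_h
 proof (subst AE_density)
  show "AE y in lborel. 0 < ennreal (h y) \<longrightarrow> trace (V y) = 0" using hV
  proof eventually_elim
   fix y assume e: "h y *\<^sub>R V y = G y"
   have "trace (h y *\<^sub>R V y) = h y * trace (V y)" by (simp add: trace_def sum_distrib_left)
   then show "0 < ennreal (h y) \<longrightarrow> trace (V y) = 0" using tr[of y] e by auto
  qed
 qed auto
 then have "(\<integral>\<^sup>+y. enn_powr (F_star W y (V y)) (1/2) \<partial>\<mu>) = (\<integral>\<^sup>+y. ennreal (1/2 * sqrt (W y) * aniso_norm (V y)) \<partial>\<mu>)"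
  by (intro nn_integral_cong_AE, eventually_elim) (rule sqrt_F_star[OF W0])
 also have "\<dots> = (\<integral>\<^sup>+y. ennreal (h y) * ennreal (1/2 * sqrt (W y) * aniso_norm (V y)) \<partial>lborel)"
  unfolding mu_h by (subst nn_integral_density) auto
 also have "\<dots> = (\<integral>\<^sup>+y. ennreal (1/2 * sqrt (W y) * aniso_norm (G y)) \<partial>lborel)" using hV
 proof (intro nn_integral_cong_AE, eventually_elim)
  fix y assume e: "h y *\<^sub>R V y = G y"
  show "ennreal (h y) * ennreal (1/2 * sqrt (W y) * aniso_norm (V y)) = ennreal (1/2 * sqrt (W y) * aniso_norm (G y))"
  proof -
   have "ennreal (h y) * ennreal (1/2 * sqrt (W y) * aniso_norm (V y)) = ennreal (h y * (1/2 * sqrt (W y) * aniso_norm (V y)))"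
    by (rule ennreal_mult[symmetric]) (simp_all add: h0 W0 aniso_norm_nonneg)
   also have "h y * (1/2 * sqrt (W y) * aniso_norm (V y)) = 1/2 * sqrt (W y) * aniso_norm (G y)"
    using aniso_norm_scaleR[OF h0, of y "V y"] by (simp add: e)
   finally show ?thesis .
  qed
 qed
 finally show ?thesis .
qed

theorem F_mass_density_current:
 fixes G :: "R2 => real^2^2"
 assumes "integrable lborel G" "\<And>y. trace (G y) = 0" "W \<in> borel_measurable borel" "\<And>y. 0 \<le> W y"
 shows "F_mass W (density_current G) = (\<integral>\<^sup>+y. ennreal (1/2 * sqrt (W y) * aniso_norm (G y)) \<partial>lborel)"
proof -
 have "\<exists>V. polar_decomposition (density_current G) (current_measure (density_current G)) V"
  unfolding current_measure_def by (rule someI_ex[OF density_polar_decomposition_exists[OF assms(1)]])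
 then have "polar_decomposition (density_current G) (current_measure (density_current G)) (current_orientation (density_current G))"
  unfolding current_orientation_def by (rule someI_ex)
 from polar_decomposition_mass[OF assms this] show ?thesis by (simp add: F_mass_def)
qed

section \<open>Integration in the plane\<close>

definition mk2 :: "real => real => R2" where "mk2 s t = (\<chi> i. if i = 1 then s else t)"

lemma mk2_nth [simp]: "mk2 s t $ 1 = s" "mk2 s t $ 2 = t" by (auto simp: mk2_def)

lemma mk2_measurable [measurable]: "(\<lambda>p. mk2 (fst p) (snd p)) \<in> borel_measurable (borel \<Otimes>\<^sub>M borel)"
proof -
 have "mk2 s t = s *\<^sub>R axis 1 1 + t *\<^sub>R axis 2 1" for s t
  by (simp add: vec_eq_iff forall_2 axis_def)
 then show ?thesis by simp
qed

lemma Basis_vec2: "(Basis :: R2 set) = {axis 1 1, axis 2 1}" by (auto simp: Basis_vec_def UNIV_2)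

lemma prod_Basis_vec2: "(\<Prod>b\<in>(Basis :: R2 set). f b) = f (axis 1 1) * (f (axis 2 1) :: 'a::comm_monoid_mult)"
 by (simp add: Basis_vec2 axis_eq_axis)

lemma box_vec2: "box l u = {y::R2. l $ 1 < y $ 1 \<and> y $ 1 < u $ 1 \<and> l $ 2 < y $ 2 \<and> y $ 2 < u $ 2}"
 by (auto simp: box_def Basis_vec2 inner_axis)

text \<open>The plane is the type real^2 and not a product type; this identification gives access to
  Fubini for products of one-dimensional kernels.\<close>

lemma lborel_vec2: "lborel = distr (lborel \<Otimes>\<^sub>M lborel) borel (\<lambda>p. mk2 (fst p) (snd p))"
proof (rule lborel_eqI)
 fix l u :: "R2" assume le: "\<And>b. b \<in> Basis ==> l \<bullet> b \<le> u \<bullet> b"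
 have l12: "l $ 1 \<le> u $ 1" "l $ 2 \<le> u $ 2" using le[of "axis 1 1"] le[of "axis 2 1"] by (auto simp: Basis_vec2 inner_axis)
 have "(\<lambda>p. mk2 (fst p) (snd p)) -` box l u \<inter> space (lborel \<Otimes>\<^sub>M lborel) = {l$1<..<u$1} \<times> {l$2<..<u$2}"
  by (auto simp: box_vec2 space_pair_measure)
 then have "emeasure (distr (lborel \<Otimes>\<^sub>M lborel) borel (\<lambda>p. mk2 (fst p) (snd p))) (box l u)
  = emeasure lborel {l$1<..<u$1} * emeasure lborel {l$2<..<u$2}" by (subst emeasure_distr) (auto simp: lborel.emeasure_pair_measure_Times)
 also have "\<dots> = (\<Prod>b\<in>Basis. (u - l) \<bullet> b)" using l12 by (simp add: prod_Basis_vec2 inner_axis inner_diff_left ennreal_mult)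
 finally show "emeasure (distr (lborel \<Otimes>\<^sub>M lborel) borel (\<lambda>p. mk2 (fst p) (snd p))) (box l u) = (\<Prod>b\<in>Basis. (u - l) \<bullet> b)" .
qed simp

lemma integral_vec2_mult:
 fixes f g :: "real => real"
 assumes [measurable]: "f \<in> borel_measurable borel" "g \<in> borel_measurable borel"
  and "integrable lborel f" "integrable lborel g"
 shows "(LINT y|(lborel :: R2 measure). f (y $ 1) * g (y $ 2)) = (LBINT s. f s) * (LBINT t. g t)"
proof -
 have i: "integrable (lborel \<Otimes>\<^sub>M lborel) (\<lambda>p. f (fst p) * g (snd p))"
  by (rule lborel_pair.Fubini_integrable) (use assms(3,4) in \<open>auto simp: abs_mult\<close>)
 have "(LINT y|(lborel :: R2 measure). f (y $ 1) * g (y $ 2)) = (LINT p|(lborel \<Otimes>\<^sub>M lborel). f (fst p) * g (snd p))"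
  by (subst lborel_vec2, subst integral_distr) auto
 also have "\<dots> = (LBINT s. LBINT t. f s * g t)" by (subst lborel_pair.integral_fst'[OF i, symmetric]) simp
 finally show ?thesis by simp
qed

lemma integrable_bounded_support:
 fixes f :: "'a::euclidean_space => 'b::{banach,second_countable_topology}"
 assumes [measurable]: "f \<in> borel_measurable borel"
  and "bounded S" "\<And>x. x \<notin> S ==> f x = 0" "\<And>x. norm (f x) \<le> C"
 shows "integrable lborel f"
proof -
 obtain R where R: "S \<subseteq> cball 0 R" using assms(2) unfolding bounded_any_center[of S 0] by (auto simp: subset_eq)
 have "emeasure lborel (cball 0 R :: 'a set) < \<infinity>" by (rule emeasure_bounded_finite) simp
 then have i: "integrable lborel (\<lambda>x. C * ind (cball 0 R :: 'a set) x)" by (intro integrable_mult_right integrable_real_indicator) simp_all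
 have C0: "0 \<le> C" using assms(4) norm_ge_zero order_trans by blast
 show ?thesis
 proof (rule integrable_bound[OF i])
  have "norm (f x) \<le> norm (C * ind (cball 0 R) x)" for x
  proof (cases "x \<in> S")
   case True
   then have "x \<in> cball 0 R" using R by blast
   then show ?thesis using assms(4)[of x] C0 by simp
  qed (use assms(3) in simp)
  then show "AE x in lborel. norm (f x) \<le> norm (C * ind (cball 0 R) x)" by simp
 qed simp
qed

lemma continuous_bounded_support:
 fixes f :: "'a::euclidean_space => 'b::euclidean_space"
 assumes c: "cont f" and "bounded S" "\<And>x. x \<notin> S ==> f x = 0"
 obtains C where "0 \<le> C" "\<And>x. norm (f x) \<le> C"
proof -
 have "compact (f ` closure S)" using assms
  by (intro compact_continuous_image continuous_on_subset[OF c]) auto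
 then obtain C where "\<And>x. x \<in> closure S ==> norm (f x) \<le> C" using compact_imp_bounded bounded_iff by (metis image_eqI)
 then have "norm (f x) \<le> max C 0" for x
  using assms(3)[of x] closure_subset[of S] by (cases "x \<in> S") (auto intro: max.coboundedI1)
 then show ?thesis using that by (metis max.cobounded2)
qed

lemma integrable_continuous_support:
 fixes f :: "'a::euclidean_space => 'b::euclidean_space"
 assumes c: "cont f" and S: "bounded S" "\<And>x. x \<notin> S ==> f x = 0"
 shows "integrable lborel f"
proof -
 obtain C where "\<And>x. norm (f x) \<le> C" using continuous_bounded_support[OF assms] by metis
 then show ?thesis by (intro integrable_bounded_support[OF _ S]) (auto intro: borel_measurable_continuous_onI c)
qed

lemma integral_translation:
 fixes F :: "'a::euclidean_space => 'b::{banach, second_countable_topology}"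
 assumes [measurable]: "F \<in> borel_measurable borel"
 shows "(LBINT y. F (y + c)) = (LBINT y. F y)"
proof -
 have "(LBINT y. F y) = (LINT y|distr lborel borel ((+) c). F y)" by (simp add: lborel_distr_plus)
 also have "\<dots> = (LBINT y. F (c + y))" by (subst integral_distr) auto
 finally show ?thesis by (simp add: add.commute)
qed

text \<open>The difference quotients have integral zero by translation invariance, and the mean
  value theorem bounds them by \<open>C\<close> on a fixed ball. Only the derivative in the single
  direction \<open>e\<close> is involved; this is the source of every integration by parts
  below.\<close>

lemma integral_directional_derivative_zero:
 fixes F F' :: "'a::euclidean_space => real"
 assumes D: "\<And>y. ((\<lambda>h. F (y + h *\<^sub>R e)) has_real_derivative F' y) (at 0)"
  and [measurable]: "F \<in> borel_measurable borel" "F' \<in> borel_measurable borel"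
  and C: "\<And>y. \<bar>F' y\<bar> \<le> C" and S: "bounded S" "\<And>y. y \<notin> S ==> F y = 0" and FB: "\<And>y. \<bar>F y\<bar> \<le> B"
 shows "(LBINT y. F' y) = 0"
proof -
 obtain R0 where R0: "S \<subseteq> cball 0 R0" using S(1) unfolding bounded_any_center[of S 0] by (auto simp: subset_eq)
 \<comment> \<open>Outside the ball of this radius, both a point and its translates by at most
   \<open>e\<close> lie off the support.\<close>
 define R where "R = R0 + norm e"
 have D': "((\<lambda>h. F (y + h *\<^sub>R e)) has_real_derivative F' (y + s *\<^sub>R e)) (at s)" for y s
 proof -
  have "((\<lambda>h. F ((y + s *\<^sub>R e) + h *\<^sub>R e)) has_real_derivative F' (y + s *\<^sub>R e)) (at (s + (-s)))" using D by simp
  then have "((\<lambda>h. F ((y + s *\<^sub>R e) + (h + (-s)) *\<^sub>R e)) has_real_derivative F' (y + s *\<^sub>R e)) (at s)"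
   unfolding DERIV_shift[of "\<lambda>h. F ((y + s *\<^sub>R e) + h *\<^sub>R e)"] .
  then show ?thesis by (simp add: algebra_simps)
 qed
 define h where "h n = 1 / real (Suc n)" for n
 have h: "0 < h n" "h n \<le> 1" for n by (auto simp: h_def)
 have hlim: "h \<longlonglongrightarrow> 0" unfolding h_def[abs_def] using LIMSEQ_inverse_real_of_nat by (simp add: inverse_eq_divide)
 have iF: "integrable lborel F" by (rule integrable_bounded_support[where C=B, OF _ S]) (simp_all add: FB)
 have iFt: "integrable lborel (\<lambda>y. F (y + c))" for c
 proof (rule integrable_bounded_support[where S="(\<lambda>y. y - c) ` S" and C=B])
  show "bounded ((\<lambda>y. y - c) ` S)" using bounded_translation[OF S(1), of "-c"] by (simp add: add.commute)
  show "F (x + c) = 0" if "x \<notin> (\<lambda>y. y - c) ` S" for x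
   using that by (intro S(2)) (metis add_diff_cancel_right' image_eqI)
 qed (simp_all add: FB)
 let ?q = "\<lambda>n y. (F (y + h n *\<^sub>R e) - F y) / h n"
 have z: "(LBINT y. (F (y + h n *\<^sub>R e) - F y) / h n) = 0" for n
  using iF iFt integral_translation[of F "h n *\<^sub>R e"] by simp
 have bnd: "\<bar>?q n y\<bar> \<le> C * ind (cball 0 R) y" for n y
 proof (cases "y \<in> cball 0 R")
  case True
  obtain \<zeta> where "F (y + h n *\<^sub>R e) - F (y + 0 *\<^sub>R e) = (h n - 0) * F' (y + \<zeta> *\<^sub>R e)"
   using MVT2[OF h(1)[of n], of "\<lambda>h. F (y + h *\<^sub>R e)" "\<lambda>s. F' (y + s *\<^sub>R e)"] D' by blast
  then have "?q n y = F' (y + \<zeta> *\<^sub>R e)" using h(1)[of n] by simp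
  then show ?thesis using C True by simp
 next
  case False
  then have n: "norm y > R" by simp
  have "norm (h n *\<^sub>R e) \<le> norm e" using h[of n] by (simp add: mult_left_le_one_le)
  moreover have "norm y \<le> norm (y + h n *\<^sub>R e) + norm (h n *\<^sub>R e)"
   using norm_triangle_ineq4[of "y + h n *\<^sub>R e" "h n *\<^sub>R e"] by simp
  ultimately have "norm (y + h n *\<^sub>R e) > R0" "norm y > R0" using n norm_ge_zero[of e] unfolding R_def by linarith+
  then have "y + h n *\<^sub>R e \<notin> S" "y \<notin> S" using R0 by auto
  then show ?thesis using S(2) False by simp
 qed
 have "(\<lambda>n. LBINT y. ?q n y) \<longlonglongrightarrow> (LBINT y. F' y)"
 proof (rule integral_dominated_convergence[where w="\<lambda>y. C * ind (cball 0 R) y"])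
  have "emeasure lborel (cball 0 R :: 'a set) < \<infinity>" by (rule emeasure_bounded_finite) simp
  then show "integrable lborel (\<lambda>y. C * ind (cball 0 R :: 'a set) y)" by (intro integrable_mult_right integrable_real_indicator) simp_all
  show "AE y in lborel. (\<lambda>n. ?q n y) \<longlonglongrightarrow> F' y"
  proof (rule AE_I2)
   fix y
   have "((\<lambda>h. (F (y + h *\<^sub>R e) - F y) / h) \<longlongrightarrow> F' y) (at 0)" using D[of y] by (simp add: DERIV_def)
   moreover have "filterlim h (at 0) sequentially" using hlim h(1) by (auto simp: filterlim_at intro!: always_eventually less_imp_neq[symmetric])
   ultimately show "(\<lambda>n. ?q n y) \<longlonglongrightarrow> F' y" by (rule filterlim_compose)
  qed
  show "AE y in lborel. norm (?q n y) \<le> C * ind (cball 0 R) y" for n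
   using bnd by (intro AE_I2) simp
 qed auto
 from this[unfolded z] show ?thesis by (simp add: LIMSEQ_const_iff)
qed

section \<open>A mollifier\<close>

text \<open>The biweight kernel. A C1 profile is enough because no kernel is ever differentiated
  twice; 15/16 is the reciprocal of the integral of (1 - t^2)^2 over [-1, 1].\<close>

definition kb :: "real => real" where "kb t = 15/16 * (max 0 (1 - t\<^sup>2))^2"
definition kb' :: "real => real" where "kb' t = - (15/4) * t * max 0 (1 - t\<^sup>2)"

text \<open>The function \<open>kB\<close> is a compactly supported primitive of \<open>- t * kb t\<close>.\<close>

definition kB :: "real => real" where "kB t = 5/32 * (max 0 (1 - t\<^sup>2))^3"

lemma pos_part_power_deriv: "((\<lambda>x::real. (max 0 x)^(Suc (Suc n))) has_real_derivative real (Suc (Suc n)) * (max 0 x)^(Suc n)) (at x)"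
proof -
 consider "x > 0" | "x < 0" | "x = 0" by linarith
 then show ?thesis
 proof cases
  case 1
  have *: "((\<lambda>x::real. x^(Suc (Suc n))) has_real_derivative real (Suc (Suc n)) * (max 0 x)^(Suc n)) (at x)"
   using DERIV_pow[of "Suc (Suc n)" x UNIV] 1 by simp
  show ?thesis
   by (rule DERIV_cong_ev[THEN iffD1, OF refl _ refl *])
    (use 1 eventually_nhds_in_open[of "{0<..}" x] in \<open>auto elim!: eventually_mono\<close>)
 next
  case 2
  have *: "((\<lambda>x::real. 0) has_real_derivative real (Suc (Suc n)) * (max 0 x)^(Suc n)) (at x)" using 2 by simp
  show ?thesis
   by (rule DERIV_cong_ev[THEN iffD1, OF refl _ refl *])
    (use 2 eventually_nhds_in_open[of "{..<0}" x] in \<open>auto elim!: eventually_mono\<close>)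
 next
  case 3
  have "((\<lambda>h::real. max 0 h * (max 0 h)^n) \<longlongrightarrow> max 0 0 * (max 0 0)^n) (at 0)" by (intro tendsto_intros)
  moreover have "((max 0 (0 + h))^(Suc (Suc n)) - (max 0 (0::real))^(Suc (Suc n))) / h = max 0 h * (max 0 h)^n" for h :: real
   by (cases "h > 0") (auto simp: max_def)
  ultimately show ?thesis using 3 by (simp add: DERIV_def)
 qed
qed

lemma pos_part_power_deriv_chain:
 assumes "(g has_real_derivative g') (at x)"
 shows "((\<lambda>x. (max 0 (g x))^2) has_real_derivative 2 * max 0 (g x) * g') (at x)"
  and "((\<lambda>x. (max 0 (g x))^3) has_real_derivative 3 * (max 0 (g x))^2 * g') (at x)"
 using DERIV_chain2[OF pos_part_power_deriv[of 0] assms] DERIV_chain2[OF pos_part_power_deriv[of 1] assms]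
 by (simp_all add: numeral_2_eq_2 numeral_3_eq_3)

lemma one_minus_square_deriv: "((\<lambda>t::real. 1 - t\<^sup>2) has_real_derivative - 2 * t) (at t)" by (auto intro!: derivative_eq_intros)

lemma kb_deriv: "(kb has_real_derivative kb' t) (at t)" unfolding kb_def[abs_def] kb'_def
 by (rule DERIV_cong[OF DERIV_cmult[OF pos_part_power_deriv_chain(1)[OF one_minus_square_deriv]]]) simp

lemma kB_deriv: "(kB has_real_derivative - (t * kb t)) (at t)" unfolding kB_def[abs_def] kb_def
 by (rule DERIV_cong[OF DERIV_cmult[OF pos_part_power_deriv_chain(2)[OF one_minus_square_deriv]]]) simp

lemma k_cont [continuous_intros]:
 assumes "continuous_on S f"
 shows "continuous_on S (\<lambda>x. kb (f x))" "continuous_on S (\<lambda>x. kb' (f x))" "continuous_on S (\<lambda>x. kB (f x))"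
 unfolding kb_def kb'_def kB_def by (intro continuous_intros assms)+

lemma k_measurable [measurable]: "kb \<in> borel_measurable borel" "kb' \<in> borel_measurable borel" "kB \<in> borel_measurable borel"
 by (intro borel_measurable_continuous_onI k_cont continuous_on_id)+

lemma k_zero: assumes "1 \<le> \<bar>t\<bar>" shows "kb t = 0" "kb' t = 0" "kB t = 0"
proof -
 have "1 \<le> t\<^sup>2" using assms by (metis abs_le_square_iff abs_one one_power2)
 then show "kb t = 0" "kb' t = 0" "kB t = 0" by (auto simp: kb_def kb'_def kB_def)
qed

lemma k_bounds: "0 \<le> kb t" "kb t \<le> 1" "\<bar>kb' t\<bar> \<le> 4" "0 \<le> kB t" "kB t \<le> 1"
proof -
 have m: "0 \<le> max 0 (1 - t\<^sup>2)" "max 0 (1 - t\<^sup>2) \<le> 1" by auto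
 show "0 \<le> kb t" "0 \<le> kB t" by (auto simp: kb_def kB_def)
 show "kb t \<le> 1" using power_le_one[OF m, of 2] by (simp add: kb_def)
 show "kB t \<le> 1" using power_le_one[OF m, of 3] by (simp add: kB_def)
 show "\<bar>kb' t\<bar> \<le> 4"
 proof (cases "1 \<le> \<bar>t\<bar>")
  case True then show ?thesis using k_zero by simp
 next
  case False
  then have "\<bar>t\<bar> * max 0 (1 - t\<^sup>2) \<le> 1" using m by (intro mult_le_one) auto
  moreover have "\<bar>kb' t\<bar> = 15/4 * (\<bar>t\<bar> * max 0 (1 - t\<^sup>2))" unfolding kb'_def using m(1) by (simp add: abs_mult)
  ultimately show ?thesis by linarith
 qed
qed

lemma kb_integrable: "integrable lborel kb"
proof (rule integrable_continuous_support[where S="{-1..1}"])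
 show "kb x = 0" if "x \<notin> {-1..1}" for x using that by (intro k_zero) auto
qed (auto intro!: continuous_intros)

lemma kb_integral: "(LBINT t. kb t) = 1"
proof -
 have "(LBINT t. kb t) = (LBINT t=ereal (-1)..ereal 1. kb t)"
 proof -
  have "kb t = ind {-1..1} t *\<^sub>R kb t" for t
  proof (cases "t \<in> {-1..1}")
   case False
   then have "1 \<le> \<bar>t\<bar>" by auto
   then show ?thesis by (simp add: k_zero)
  qed simp
  then have "(LBINT t. kb t) = set_lebesgue_integral lborel {-1..1} kb" unfolding set_lebesgue_integral_def by presburger
  then show ?thesis by (subst interval_integral_Icc) auto
 qed
 also have "\<dots> = (15/16 * (1 - 2/3*1^3 + 1/5*1^5)) - (15/16 * ((-1) - 2/3*(-1)^3 + 1/5*(-1)^5))"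
 proof (rule interval_integral_FTC_finite)
  show "continuous_on {min (-1) 1..max (-1) (1::real)} kb" by (intro continuous_intros)
  fix x :: real assume x: "min (-1) 1 \<le> x" "x \<le> max (-1) 1"
  then have "x\<^sup>2 \<le> 1" by (auto simp: abs_square_le_1 abs_le_iff)
  then have "kb x = 15/16 * (1 - x\<^sup>2)^2" by (simp add: kb_def)
  also have "\<dots> = 15/16 * (1 - 2/3*(3*x^2) + 1/5*(5*x^4))" by (simp add: power2_eq_square power4_eq_xxxx algebra_simps)
  finally have e: "kb x = 15/16 * (1 - 2/3*(3*x^2) + 1/5*(5*x^4))" .
  show "((\<lambda>x. 15/16 * (x - 2/3*x^3 + 1/5*x^5)) has_vector_derivative kb x) (at x within {min (-1) 1..max (-1) 1})"
   unfolding e has_real_derivative_iff_has_vector_derivative[symmetric]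
   by (rule has_field_derivative_at_within) (auto intro!: derivative_eq_intros)
 qed
 finally show ?thesis by simp
qed

definition eta :: "R2 => real" where "eta y = kb (y $ 1) * kb (y $ 2)"

abbreviation unit_square :: "R2 set" where "unit_square \<equiv> cbox (\<chi> i. -1) (\<chi> i. 1)"

lemma unit_square_iff: "y \<in> unit_square \<longleftrightarrow> \<bar>y $ 1\<bar> \<le> 1 \<and> \<bar>y $ 2\<bar> \<le> 1"
 by (auto simp: mem_box_cart forall_2 abs_le_iff)

lemma norm_unit_square: "y \<in> unit_square ==> norm y \<le> 2" using norm_le_l1_cart[of y] by (auto simp: unit_square_iff sum_2)

lemma measure_unit_square: "measure lborel unit_square = 4" by (simp add: content_cbox_cart interval_ne_empty_cart(1))

lemma eta_zero: "y \<notin> unit_square ==> eta y = 0" by (auto simp: eta_def unit_square_iff k_zero)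

lemma eta_cont [continuous_intros]: "continuous_on S f ==> continuous_on S (\<lambda>x. eta (f x))" unfolding eta_def by (intro continuous_intros)

lemma eta_measurable [measurable]: "eta \<in> borel_measurable borel" by (intro borel_measurable_continuous_onI continuous_intros)

lemma eta_bounds: "0 \<le> eta y" "eta y \<le> 1" unfolding eta_def using k_bounds by (auto intro: mult_le_one)

lemma eta_integral: "(LBINT y. eta y) = 1" unfolding eta_def using integral_vec2_mult[of kb kb] kb_integrable kb_integral by simp

section \<open>Transport along trace-free matrix fields\<close>

text \<open>Coordinates on the three-dimensional space of trace-free matrices: diagonal (r, -r),
  then the entries (1, 2) and (2, 1).\<close>

definition tfm :: "real => real => real => real^2^2" where
 "tfm r p q = r *\<^sub>R (axis 1 (axis 1 1) - axis 2 (axis 2 1)) + p *\<^sub>R axis 1 (axis 2 1) + q *\<^sub>R axis 2 (axis 1 1)"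

lemma tfm_inner: "tfm r p q \<bullet> N = r * (N $ 1 $ 1 - N $ 2 $ 2) + p * N $ 1 $ 2 + q * N $ 2 $ 1"
 by (simp add: tfm_def inner_add_left inner_diff_left inner_axis')

lemma trace_tfm: "trace (tfm r p q) = 0" by (simp add: tfm_def trace_def sum_2 axis_def)

lemma norm_tfm: "norm (tfm r p q) \<le> 2 * \<bar>r\<bar> + \<bar>p\<bar> + \<bar>q\<bar>"
proof -
 have "norm (axis 1 (axis 1 1) - axis 2 (axis 2 1) :: real^2^2) \<le> 1 + 1" by (rule order_trans[OF norm_triangle_ineq4]) simp
 then have "norm (r *\<^sub>R (axis 1 (axis 1 1) - axis 2 (axis 2 1) :: real^2^2)) \<le> 2 * \<bar>r\<bar>"
  using mult_left_mono[of "norm (axis 1 (axis 1 1) - axis 2 (axis 2 1) :: real^2^2)" 2 "\<bar>r\<bar>"] by (simp add: mult.commute)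
 moreover have "norm (p *\<^sub>R axis 1 (axis 2 1) :: real^2^2) = \<bar>p\<bar>" "norm (q *\<^sub>R axis 2 (axis 1 1) :: real^2^2) = \<bar>q\<bar>"
  by simp_all
 ultimately show ?thesis unfolding tfm_def
  by (smt (verit, best) norm_triangle_ineq)
qed

lemma tfm_continuous [continuous_intros]:
 "continuous_on S r ==> continuous_on S p ==> continuous_on S q ==> continuous_on S (\<lambda>x. tfm (r x) (p x) (q x))"
 unfolding tfm_def by (intro continuous_intros)

lemma tfm_measurable [measurable]:
 "r \<in> borel_measurable M ==> p \<in> borel_measurable M ==> q \<in> borel_measurable M ==> (\<lambda>x. tfm (r x) (p x) (q x)) \<in> borel_measurable M"
 unfolding tfm_def by (intro borel_measurable_add borel_measurable_scaleR borel_measurable_const)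

section \<open>Differentiation and integration by parts along a cone of squares\<close>

lemma C1_jacobian_continuous:
 assumes "C1 \<xi>" "continuous_on S f"
 shows "continuous_on S (\<lambda>x. jacobian \<xi> (at (f x)))"
 using assms unfolding C1_def by (auto intro: continuous_on_compose2[of UNIV "\<lambda>x. jacobian \<xi> (at x)"])

lemma C1_continuous: assumes "C1 \<xi>" "continuous_on S f" shows "continuous_on S (\<lambda>x. \<xi> (f x))"
proof -
 have "cont \<xi>" using assms(1) unfolding C1_def by (meson continuous_at_imp_continuous_on differentiable_imp_continuous_within)
 then show ?thesis using assms(2) by (auto intro: continuous_on_compose2[of UNIV \<xi>])
qed

lemma C1_has_derivative:
 assumes "C1 \<xi>"
 shows "((\<lambda>x. \<xi> x $ i) has_derivative (\<lambda>h. h $ 1 * jacobian \<xi> (at x) $ i $ 1 + h $ 2 * jacobian \<xi> (at x) $ i $ 2)) (at x)"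
proof -
 have "(\<xi> has_derivative (\<lambda>h. jacobian \<xi> (at x) *v h)) (at x)" using assms by (simp add: C1_def jacobian_works)
 from bounded_linear.has_derivative[OF bounded_linear_vec_nth[of i] this]
 show ?thesis by (simp add: matrix_vector_mult_def sum_2 mult.commute)
qed

lemma C1_ray:
 assumes "C1 \<xi>"
 shows "((\<lambda>\<tau>. \<xi> (o' + \<tau> *\<^sub>R e) $ i) has_real_derivative
  (e $ 1 * jacobian \<xi> (at (o' + \<tau> *\<^sub>R e)) $ i $ 1 + e $ 2 * jacobian \<xi> (at (o' + \<tau> *\<^sub>R e)) $ i $ 2)) (at \<tau>)"
proof -
 have "((\<lambda>\<tau>. o' + \<tau> *\<^sub>R e) has_derivative (\<lambda>h. h *\<^sub>R e)) (at \<tau>)" by (auto intro!: derivative_eq_intros)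
 from has_derivative_compose[OF this C1_has_derivative[OF assms, of i]] show ?thesis
  unfolding has_field_derivative_def by (rule has_derivative_eq_rhs) (simp add: fun_eq_iff algebra_simps)
qed

text \<open>For y in the unit square these points form the square of half-width \<tau> about o' +
  \<tau> w. Radius and distance from the apex o' grow together, so the whole cone consists of
  dilations of one square, and differentiation in \<tau> yields the linear field y + w.\<close>

definition point :: "R2 => R2 => real => R2 => R2" where
 "point o' w \<tau> y = o' + \<tau> *\<^sub>R (y + w)"

lemma point_continuous [continuous_intros]:
 "continuous_on S f ==> continuous_on S g ==> continuous_on S h ==> continuous_on S k ==> continuous_on S (\<lambda>x. point (f x) (g x) (h x) (k x))"
 unfolding point_def by (intro continuous_intros)

text \<open>Parameter integrals are treated by theorems on the gauge integral over a compact box;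
  this is the passage between the two integrals.\<close>

lemma LINT_unit_square:
 fixes g :: "R2 => real"
 assumes c: "cont g" and z: "\<And>y. y \<notin> unit_square ==> g y = 0"
 shows "(LBINT y. g y) = integral unit_square g"
proof -
 have e: "g = (\<lambda>y. ind unit_square y *\<^sub>R g y)"
 proof (rule ext)
  fix y show "g y = ind unit_square y *\<^sub>R g y" by (cases "y \<in> unit_square") (simp_all add: z)
 qed
 have "(LBINT y. g y) = set_lebesgue_integral lborel unit_square g" unfolding set_lebesgue_integral_def by (rule arg_cong[OF e])
 also have "\<dots> = integral unit_square g"
 proof (rule set_borel_integral_eq_integral(2))
  show "set_integrable lborel unit_square g" unfolding set_integrable_def
   by (rule borel_integrable_compact) (auto intro: continuous_on_subset[OF c])
 qed
 finally show ?thesis .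
qed

lemma kernel_leibniz:
 fixes k :: "R2 => real" and F F' :: "real => R2 => real"
 assumes k: "cont k" "\<And>y. y \<notin> unit_square ==> k y = 0"
  and F: "\<And>\<tau> y. ((\<lambda>\<tau>. F \<tau> y) has_real_derivative F' \<tau> y) (at \<tau>)" "\<And>\<tau>. cont (F \<tau>)"
  and F': "cont (\<lambda>p. F' (fst p) (snd p))"
 shows "((\<lambda>\<tau>. LBINT y. k y * F \<tau> y) has_real_derivative (LBINT y. k y * F' \<tau> y)) (at \<tau>)"
proof -
 have kp: "cont (\<lambda>p::real \<times> R2. k (snd p))" by (rule continuous_on_compose2[OF k(1)]) (auto intro!: continuous_intros)
 have cF': "cont (F' \<tau>)" for \<tau>
 proof -
  have "cont (\<lambda>y::R2. (\<tau>, y))" by (intro continuous_intros)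
  from continuous_on_compose2[OF F' this] show ?thesis by simp
 qed
 have "((\<lambda>\<tau>. integral unit_square (\<lambda>y. k y * F \<tau> y)) has_real_derivative integral unit_square (\<lambda>y. k y * F' \<tau> y)) (at \<tau> within UNIV)"
 proof (rule leibniz_rule_field_derivative)
  show "((\<lambda>\<tau>. k y * F \<tau> y) has_real_derivative k y * F' \<tau> y) (at \<tau> within UNIV)" for \<tau> y
   using F(1) by (auto intro!: derivative_eq_intros)
  show "(\<lambda>y. k y * F \<tau> y) integrable_on unit_square" for \<tau>
   by (intro integrable_continuous continuous_intros continuous_on_subset[OF k(1)] continuous_on_subset[OF F(2)]) auto
  show "continuous_on (UNIV \<times> unit_square) (\<lambda>(\<tau>, y). k y * F' \<tau> y)" unfolding case_prod_beta
   by (intro continuous_intros continuous_on_subset[OF kp] continuous_on_subset[OF F']) auto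
 qed auto
 moreover have "(LBINT y. k y * F \<tau> y) = integral unit_square (\<lambda>y. k y * F \<tau> y)" for \<tau>
  by (rule LINT_unit_square) (use k(2) in \<open>auto intro!: continuous_intros k(1) F(2)\<close>)
 moreover have "(LBINT y. k y * F' \<tau> y) = integral unit_square (\<lambda>y. k y * F' \<tau> y)" for \<tau>
  by (rule LINT_unit_square) (use k(2) in \<open>auto intro!: continuous_intros k(1) cF'\<close>)
 ultimately show ?thesis by simp
qed

lemma kernel_continuous_param:
 fixes H :: "real \<times> R2 => real"
 assumes H: "continuous_on (U \<times> UNIV) H" and z: "\<And>\<tau> y. \<tau> \<in> U ==> y \<notin> unit_square ==> H (\<tau>, y) = 0"
 shows "continuous_on U (\<lambda>\<tau>. LBINT y. H (\<tau>, y))"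
proof -
 have "continuous_on U (\<lambda>\<tau>. integral unit_square (\<lambda>y. H (\<tau>, y)))"
  by (rule integral_continuous_on_param) (auto intro: continuous_on_subset[OF H])
 moreover have "(LBINT y. H (\<tau>, y)) = integral unit_square (\<lambda>y. H (\<tau>, y))" if "\<tau> \<in> U" for \<tau>
 proof (rule LINT_unit_square)
  show "cont (\<lambda>y. H (\<tau>, y))" by (rule continuous_on_compose2[OF H]) (use that in \<open>auto intro!: continuous_intros\<close>)
 qed (use z that in auto)
 ultimately show ?thesis by (simp cong: continuous_on_cong_simp)
qed

text \<open>The chain rule puts a factor \<tau> in front of the Jacobian. Dividing by it is the
  origin of the 1/\<tau> in the transport of divergences, and so of the logarithm.\<close>

lemma kernel_integral_by_parts:
 fixes K K' :: "R2 => real"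
 assumes K: "cont K" "cont K'"
   "\<And>y. y \<notin> unit_square ==> K y = 0" "\<And>y. y \<notin> unit_square ==> K' y = 0"
  and D: "\<And>y. ((\<lambda>h. K (y + h *\<^sub>R axis j 1)) has_real_derivative K' y) (at 0)"
  and xi: "C1 \<xi>"
 shows "has_bochner_integral lborel
  (\<lambda>y. K' y * \<xi> (point o' w \<tau> y) $ i + \<tau> * K y * jacobian \<xi> (at (point o' w \<tau> y)) $ i $ j) 0"
proof -
 let ?F = "\<lambda>y. K y * \<xi> (point o' w \<tau> y) $ i"
 let ?F' = "\<lambda>y. K' y * \<xi> (point o' w \<tau> y) $ i + \<tau> * K y * jacobian \<xi> (at (point o' w \<tau> y)) $ i $ j"
 have c: "cont ?F" "cont ?F'" by (intro continuous_intros K C1_continuous[OF xi] C1_jacobian_continuous[OF xi])+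
 have z: "?F y = 0" "?F' y = 0" if "y \<notin> unit_square" for y using K(3,4) that by auto
 obtain A where A: "\<And>y. norm (?F y) \<le> A" using continuous_bounded_support[OF c(1) _ z(1)] by (metis bounded_cbox)
 obtain B where B: "\<And>y. norm (?F' y) \<le> B" using continuous_bounded_support[OF c(2) _ z(2)] by (metis bounded_cbox)
 have "(LBINT y. ?F' y) = 0"
 proof (rule integral_directional_derivative_zero[where F="?F" and S=unit_square and C=B and B=A and e="axis j 1"])
  fix y :: "R2"
  have p: "point o' w \<tau> (y + h *\<^sub>R axis j 1) = point o' w \<tau> y + h *\<^sub>R (\<tau> *\<^sub>R axis j 1)" for h
   by (simp add: point_def algebra_simps)
  have a: "(axis j (1::real)) $ 1 * a 1 + (axis j 1) $ 2 * a 2 = a j" for a :: "2 => real" using exhaust_2[of j] by (auto simp: axis_def)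
  have "((\<lambda>h. \<xi> (point o' w \<tau> (y + h *\<^sub>R axis j 1)) $ i) has_real_derivative \<tau> * jacobian \<xi> (at (point o' w \<tau> y)) $ i $ j) (at 0)"
   unfolding p using C1_ray[OF xi, of "point o' w \<tau> y" "\<tau> *\<^sub>R axis j 1" i 0]
    a[of "\<lambda>j. jacobian \<xi> (at (point o' w \<tau> y)) $ i $ j"] by (simp add: mult.assoc flip: distrib_left)
  from DERIV_mult[OF D[of y] this]
  show "((\<lambda>h. ?F (y + h *\<^sub>R axis j 1)) has_real_derivative ?F' y) (at 0)" by (simp add: algebra_simps)
 qed (use A B z c in \<open>auto intro: borel_measurable_continuous_onI\<close>)
 moreover have "integrable lborel ?F'" by (rule integrable_continuous_support[OF c(2) _ z(2)]) auto
 ultimately show ?thesis by (simp add: has_bochner_integral_iff)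
qed

text \<open>Integrating by parts in either order moves the derivative from one variable to the other,
  without second derivatives of the vector field.\<close>

lemma kernel_swap:
 fixes \<kappa> \<kappa>' \<mu> \<mu>' :: "real => real"
 assumes d: "\<And>t. (\<kappa> has_real_derivative \<kappa>' t) (at t)" "\<And>t. (\<mu> has_real_derivative \<mu>' t) (at t)"
  and c: "cont \<kappa>'" "cont \<mu>'"
  and z: "\<And>t. 1 \<le> \<bar>t\<bar> ==> \<kappa> t = 0 \<and> \<kappa>' t = 0 \<and> \<mu> t = 0 \<and> \<mu>' t = 0"
  and xi: "C1 \<xi>" and t: "\<tau> \<noteq> 0"
 shows "has_bochner_integral lborel (\<lambda>y. \<kappa> (y $ 1) * \<mu>' (y $ 2) * jacobian \<xi> (at (point o' w \<tau> y)) $ i $ 1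
  - \<kappa>' (y $ 1) * \<mu> (y $ 2) * jacobian \<xi> (at (point o' w \<tau> y)) $ i $ 2) 0"
proof -
 have c0: "cont \<kappa>" "cont \<mu>" using d by (auto intro: DERIV_continuous_on)
 have cc: "cont (\<lambda>y::R2. f (y $ j))" if "cont f" for f :: "real => real" and j
  by (rule continuous_on_compose2[OF that]) (auto intro!: continuous_intros)
 have out: "1 \<le> \<bar>y $ 1\<bar> \<or> 1 \<le> \<bar>y $ 2\<bar>" if "y \<notin> unit_square" for y :: "R2" using that by (auto simp: unit_square_iff)
 have 1: "has_bochner_integral lborel (\<lambda>y. (\<kappa>' (y $ 1) * \<mu>' (y $ 2)) * \<xi> (point o' w \<tau> y) $ i
  + \<tau> * (\<kappa> (y $ 1) * \<mu>' (y $ 2)) * jacobian \<xi> (at (point o' w \<tau> y)) $ i $ 1) 0"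
 proof (rule kernel_integral_by_parts[OF _ _ _ _ _ xi])
  fix y :: "R2"
  have "((\<lambda>h. \<kappa> (y $ 1 + h)) has_real_derivative \<kappa>' (y $ 1)) (at 0)"
   using d(1)[of "y $ 1"] DERIV_shift[of \<kappa> "\<kappa>' (y $ 1)" 0 "y $ 1"] by (simp add: add.commute)
  from DERIV_cmult_right[OF this, of "\<mu>' (y $ 2)"]
  show "((\<lambda>h. \<kappa> ((y + h *\<^sub>R axis 1 1) $ 1) * \<mu>' ((y + h *\<^sub>R axis 1 1) $ 2)) has_real_derivative \<kappa>' (y $ 1) * \<mu>' (y $ 2)) (at 0)"
   by (simp add: axis_def)
 qed (use out z in \<open>auto intro!: continuous_intros cc c c0; blast\<close>)+
 have 2: "has_bochner_integral lborel (\<lambda>y. (\<kappa>' (y $ 1) * \<mu>' (y $ 2)) * \<xi> (point o' w \<tau> y) $ i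
  + \<tau> * (\<kappa>' (y $ 1) * \<mu> (y $ 2)) * jacobian \<xi> (at (point o' w \<tau> y)) $ i $ 2) 0"
 proof (rule kernel_integral_by_parts[OF _ _ _ _ _ xi])
  fix y :: "R2"
  have "((\<lambda>h. \<mu> (y $ 2 + h)) has_real_derivative \<mu>' (y $ 2)) (at 0)"
   using d(2)[of "y $ 2"] DERIV_shift[of \<mu> "\<mu>' (y $ 2)" 0 "y $ 2"] by (simp add: add.commute)
  from DERIV_cmult[OF this, of "\<kappa>' (y $ 1)"]
  show "((\<lambda>h. \<kappa>' ((y + h *\<^sub>R axis 2 1) $ 1) * \<mu> ((y + h *\<^sub>R axis 2 1) $ 2)) has_real_derivative \<kappa>' (y $ 1) * \<mu>' (y $ 2)) (at 0)"
   by (simp add: axis_def)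
 qed (use out z in \<open>auto intro!: continuous_intros cc c c0; blast\<close>)+
 have e: "1 / \<tau> * ((a * F + \<tau> * k * G) - (a * F + \<tau> * l * H)) = k * G - l * H" for a F k G l H
  using t by (simp add: field_simps)
 from has_bochner_integral_mult_right[OF has_bochner_integral_diff[OF 1 2], of "1 / \<tau>", unfolded e]
 show ?thesis by simp
qed

definition eta1 :: "R2 => real" where "eta1 y = kb' (y $ 1) * kb (y $ 2)"
definition eta2 :: "R2 => real" where "eta2 y = kb (y $ 1) * kb' (y $ 2)"

lemma eta12_zero: assumes "y \<notin> unit_square" shows "eta1 y = 0" "eta2 y = 0"
proof -
 have "1 \<le> \<bar>y $ 1\<bar> \<or> 1 \<le> \<bar>y $ 2\<bar>" using assms by (auto simp: unit_square_iff)
 then show "eta1 y = 0" "eta2 y = 0" using k_zero by (auto simp: eta1_def eta2_def)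
qed

lemma eta12_cont [continuous_intros]:
 "continuous_on S f ==> continuous_on S (\<lambda>x. eta1 (f x))" "continuous_on S f ==> continuous_on S (\<lambda>x. eta2 (f x))"
 unfolding eta1_def eta2_def by (intro continuous_intros; assumption)+

section \<open>Means of a field and of its divergence, and their derivatives along a ray\<close>

definition mean :: "(R2 => R2) => 2 => R2 => real => real" where
 "mean \<xi> i z t = (LBINT y. eta y * \<xi> (z + t *\<^sub>R y) $ i)"

definition mean_div :: "(R2 => R2) => R2 => real => real" where
 "mean_div \<xi> z t = (LBINT y. eta y * trace (jacobian \<xi> (at (z + t *\<^sub>R y))))"

text \<open>The derivatives of the means of \<open>\<xi>\<close> and of its divergence along the rays from a common
 origin, expressed through the trace-free part of the Jacobian matrix.\<close>

definition kernel_div :: "R2 => R2 => real^2^2" where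
 "kernel_div w y = tfm ((y $ 1 + w $ 1) * eta1 y - (y $ 2 + w $ 2) * eta2 y)
  (2 * (y $ 2 + w $ 2) * eta1 y) (2 * (y $ 1 + w $ 1) * eta2 y)"

definition kernel_val :: "2 => R2 => R2 => real^2^2" where
 "kernel_val i w y =
  (if i = 1 then tfm (eta y * (y $ 1 + w $ 1 / 2)) (eta y * (y $ 2 + w $ 2)) (- (kB (y $ 1) * kb' (y $ 2)))
  else tfm (- (eta y * (y $ 2 + w $ 2 / 2))) (- (kb' (y $ 1) * kB (y $ 2))) (eta y * (y $ 1 + w $ 1)))"

lemma kernel_zero: assumes "y \<notin> unit_square" shows "kernel_div w y = 0" "kernel_val i w y = 0"
proof -
 have "1 \<le> \<bar>y $ 1\<bar> \<or> 1 \<le> \<bar>y $ 2\<bar>" using assms by (auto simp: unit_square_iff)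
 then have "kB (y $ 1) * kb' (y $ 2) = 0" "kb' (y $ 1) * kB (y $ 2) = 0" using k_zero by auto
 then show "kernel_div w y = 0" "kernel_val i w y = 0"
  unfolding kernel_div_def kernel_val_def eta_zero[OF assms] eta12_zero[OF assms] by (simp_all add: tfm_def)
qed

lemma kernel_cont [continuous_intros]:
 assumes "continuous_on S f" "continuous_on S g"
 shows "continuous_on S (\<lambda>x. kernel_div (f x) (g x))" "continuous_on S (\<lambda>x. kernel_val i (f x) (g x))"
proof -
 show "continuous_on S (\<lambda>x. kernel_div (f x) (g x))" unfolding kernel_div_def by (intro continuous_intros assms)
 show "continuous_on S (\<lambda>x. kernel_val i (f x) (g x))" unfolding kernel_val_def
 proof (cases "i = 1")
  case True then show "continuous_on S (\<lambda>x. if i = 1 then tfm (eta (g x) * (g x $ 1 + f x $ 1 / 2)) (eta (g x) * (g x $ 2 + f x $ 2)) (- (kB (g x $ 1) * kb' (g x $ 2)))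
  else tfm (- (eta (g x) * (g x $ 2 + f x $ 2 / 2))) (- (kb' (g x $ 1) * kB (g x $ 2))) (eta (g x) * (g x $ 1 + f x $ 1)))"
   by simp (intro continuous_intros assms; simp)
 next
  case False then show "continuous_on S (\<lambda>x. if i = 1 then tfm (eta (g x) * (g x $ 1 + f x $ 1 / 2)) (eta (g x) * (g x $ 2 + f x $ 2)) (- (kB (g x $ 1) * kb' (g x $ 2)))
  else tfm (- (eta (g x) * (g x $ 2 + f x $ 2 / 2))) (- (kb' (g x $ 1) * kB (g x $ 2))) (eta (g x) * (g x $ 1 + f x $ 1)))"
   by simp (intro continuous_intros assms; simp)
 qed
qed

text \<open>The mean changes by the integral of \<open>eta\<close> times row i of the Jacobian
  applied to y + w. The diagonal entry with the constant weight \<open>w $ i\<close> leaves half of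
  the trace behind. With weight \<open>y $ i\<close> no trace remains: subtracting the other
  diagonal entry makes the term trace-free, and the entry subtracted is turned by
  \<open>kernel_swap\<close> into an off-diagonal one, since - t \<open>kb\<close> t has the
  compactly supported primitive \<open>kB\<close>.\<close>

lemma mean_deriv:
 assumes xi: "C1 \<xi>" and t: "\<tau> > 0"
 shows "((\<lambda>\<tau>. mean \<xi> i (o' + \<tau> *\<^sub>R w) \<tau>) has_real_derivative
  (w $ i / 2 * mean_div \<xi> (o' + \<tau> *\<^sub>R w) \<tau> + (LBINT y. kernel_val i w y \<bullet> jacobian \<xi> (at (point o' w \<tau> y))))) (at \<tau>)"
proof -
 let ?J = "\<lambda>y. jacobian \<xi> (at (point o' w \<tau> y))"
 have pt: "o' + \<tau> *\<^sub>R w + \<tau> *\<^sub>R y = point o' w \<tau> y" for \<tau> y by (simp add: point_def algebra_simps)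
 have m: "mean \<xi> i (o' + \<tau> *\<^sub>R w) \<tau> = (LBINT y. eta y * \<xi> (point o' w \<tau> y) $ i)" for \<tau>
  unfolding mean_def pt ..
 have d: "((\<lambda>\<tau>. LBINT y. eta y * \<xi> (point o' w \<tau> y) $ i) has_real_derivative
  (LBINT y. eta y * ((y $ 1 + w $ 1) * ?J y $ i $ 1 + (y $ 2 + w $ 2) * ?J y $ i $ 2))) (at \<tau>)"
 proof (rule kernel_leibniz[where F="\<lambda>\<tau> y. \<xi> (point o' w \<tau> y) $ i" and
   F'="\<lambda>\<tau> y. (y $ 1 + w $ 1) * jacobian \<xi> (at (point o' w \<tau> y)) $ i $ 1 + (y $ 2 + w $ 2) * jacobian \<xi> (at (point o' w \<tau> y)) $ i $ 2"])
  show "((\<lambda>\<tau>. \<xi> (point o' w \<tau> y) $ i) has_real_derivative (y $ 1 + w $ 1) * jacobian \<xi> (at (point o' w \<tau> y)) $ i $ 1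
   + (y $ 2 + w $ 2) * jacobian \<xi> (at (point o' w \<tau> y)) $ i $ 2) (at \<tau>)" for \<tau> y
   using C1_ray[OF xi, of o' "y + w" i \<tau>] by (simp add: point_def)
 qed (auto intro!: continuous_intros C1_continuous[OF xi] C1_jacobian_continuous[OF xi] eta_zero)
 let ?A = "\<lambda>y. eta y * ((y $ 1 + w $ 1) * ?J y $ i $ 1 + (y $ 2 + w $ 2) * ?J y $ i $ 2)"
 let ?B = "\<lambda>y. w $ i / 2 * (eta y * trace (?J y))" and ?C = "\<lambda>y. kernel_val i w y \<bullet> ?J y"
 have iB: "integrable lborel ?B" by (rule integrable_continuous_support[where S=unit_square])
  (auto intro!: continuous_intros C1_jacobian_continuous[OF xi] simp: eta_zero trace_def)
 have iC: "integrable lborel ?C" by (rule integrable_continuous_support[where S=unit_square])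
  (auto intro!: continuous_intros C1_jacobian_continuous[OF xi] simp: kernel_zero)
 have "has_bochner_integral lborel (\<lambda>y. ?A y - (?B y + ?C y)) 0"
 proof (cases "i = 1")
  case True
  have "has_bochner_integral lborel (\<lambda>y. kB (y $ 1) * kb' (y $ 2) * ?J y $ 2 $ 1 - (- (y $ 1 * kb (y $ 1))) * kb (y $ 2) * ?J y $ 2 $ 2) 0"
   by (rule kernel_swap[OF kB_deriv kb_deriv _ _ _ xi]) (use t in \<open>auto intro!: continuous_intros simp: k_zero\<close>)
  moreover have "?A y - (?B y + ?C y) = kB (y $ 1) * kb' (y $ 2) * ?J y $ 2 $ 1 - (- (y $ 1 * kb (y $ 1))) * kb (y $ 2) * ?J y $ 2 $ 2" for y
   unfolding True by (simp add: kernel_val_def tfm_inner trace_def sum_2 eta_def field_simps)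
  ultimately show ?thesis by simp
 next
  case False
  then have i: "i = 2" using exhaust_2 by blast
  have "has_bochner_integral lborel (\<lambda>y. kb (y $ 1) * (- (y $ 2 * kb (y $ 2))) * ?J y $ 1 $ 1 - kb' (y $ 1) * kB (y $ 2) * ?J y $ 1 $ 2) 0"
   by (rule kernel_swap[OF kb_deriv kB_deriv _ _ _ xi]) (use t in \<open>auto intro!: continuous_intros simp: k_zero\<close>)
  from has_bochner_integral_minus[OF this]
  have "has_bochner_integral lborel (\<lambda>y. - (kb (y $ 1) * (- (y $ 2 * kb (y $ 2))) * ?J y $ 1 $ 1 - kb' (y $ 1) * kB (y $ 2) * ?J y $ 1 $ 2)) 0" by simp
  moreover have "?A y - (?B y + ?C y) = - (kb (y $ 1) * (- (y $ 2 * kb (y $ 2))) * ?J y $ 1 $ 1 - kb' (y $ 1) * kB (y $ 2) * ?J y $ 1 $ 2)" for y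
   unfolding i by (simp add: kernel_val_def tfm_inner trace_def sum_2 eta_def field_simps)
  ultimately show ?thesis by simp
 qed
 from has_bochner_integral_add[OF this has_bochner_integral_add[OF has_bochner_integral_integrable[OF iB] has_bochner_integral_integrable[OF iC]]]
 have "(LBINT y. ?A y) = (LBINT y. ?B y) + (LBINT y. ?C y)" by (simp add: has_bochner_integral_iff)
 also have "(LBINT y. ?B y) = w $ i / 2 * mean_div \<xi> (o' + \<tau> *\<^sub>R w) \<tau>" unfolding mean_div_def pt by simp
 finally show ?thesis using d unfolding m by simp
qed

text \<open>Second derivatives of \<xi> are avoided: integration by parts gives
  \<open>mean_div\<close> = - E / \<tau>, where E contains \<xi> but no derivative of it, and E is
  differentiated in \<tau>. Two applications of \<open>kernel_swap\<close> make the result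
  trace-free up to a multiple of \<open>mean_div\<close>, and this multiple is cancelled by the
  quotient rule.\<close>

lemma mean_div_deriv:
 assumes xi: "C1 \<xi>" and t: "\<tau> > 0"
 shows "((\<lambda>\<tau>. mean_div \<xi> (o' + \<tau> *\<^sub>R w) \<tau>) has_real_derivative
  - (1 / \<tau>) * (LBINT y. kernel_div w y \<bullet> jacobian \<xi> (at (point o' w \<tau> y)))) (at \<tau>)"
proof -
 let ?J = "\<lambda>\<tau> y. jacobian \<xi> (at (point o' w \<tau> y))"
 have pt: "o' + \<tau> *\<^sub>R w + \<tau> *\<^sub>R y = point o' w \<tau> y" for \<tau> y by (simp add: point_def algebra_simps)
 have m: "mean_div \<xi> (o' + \<tau> *\<^sub>R w) \<tau> = (LBINT y. eta y * trace (?J \<tau> y))" for \<tau>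
  unfolding mean_div_def pt ..
 define E where "E \<tau> = (LBINT y. eta1 y * \<xi> (point o' w \<tau> y) $ 1) + (LBINT y. eta2 y * \<xi> (point o' w \<tau> y) $ 2)" for \<tau>
 have i0: "integrable lborel (\<lambda>y. k y * \<xi> (point o' w \<tau> y) $ i)" if "cont k" "\<And>y. y \<notin> unit_square ==> k y = 0" for k \<tau> i
  by (rule integrable_continuous_support[where S=unit_square])
   (use that in \<open>auto intro!: continuous_intros C1_continuous[OF xi]\<close>)
 have i1: "integrable lborel (\<lambda>y. k y * trace (?J \<tau> y))" if "cont k" "\<And>y. y \<notin> unit_square ==> k y = 0" for k \<tau>
  by (rule integrable_continuous_support[where S=unit_square])
   (use that in \<open>auto intro!: continuous_intros C1_jacobian_continuous[OF xi] simp: trace_def\<close>)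
 have E_eq: "E \<tau> = - \<tau> * mean_div \<xi> (o' + \<tau> *\<^sub>R w) \<tau>" for \<tau>
 proof -
  have sh: "((\<lambda>h. kb (a + h)) has_real_derivative kb' a) (at 0)" for a
   using kb_deriv[of a] DERIV_shift[of kb "kb' a" 0 a] by (simp add: add.commute)
  have 1: "has_bochner_integral lborel (\<lambda>y. eta1 y * \<xi> (point o' w \<tau> y) $ 1 + \<tau> * eta y * ?J \<tau> y $ 1 $ 1) 0"
  proof (rule kernel_integral_by_parts[OF _ _ _ _ _ xi])
   fix y :: "R2"
   from DERIV_cmult_right[OF sh[of "y $ 1"], of "kb (y $ 2)"]
   show "((\<lambda>h. eta (y + h *\<^sub>R axis 1 1)) has_real_derivative eta1 y) (at 0)" by (simp add: axis_def eta_def eta1_def)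
  qed (auto intro!: continuous_intros eta_zero eta12_zero)
  have 2: "has_bochner_integral lborel (\<lambda>y. eta2 y * \<xi> (point o' w \<tau> y) $ 2 + \<tau> * eta y * ?J \<tau> y $ 2 $ 2) 0"
  proof (rule kernel_integral_by_parts[OF _ _ _ _ _ xi])
   fix y :: "R2"
   from DERIV_cmult[OF sh[of "y $ 2"], of "kb (y $ 1)"]
   show "((\<lambda>h. eta (y + h *\<^sub>R axis 2 1)) has_real_derivative eta2 y) (at 0)" by (simp add: axis_def eta_def eta2_def)
  qed (auto intro!: continuous_intros eta_zero eta12_zero)
  have 3: "has_bochner_integral lborel (\<lambda>y. (eta1 y * \<xi> (point o' w \<tau> y) $ 1 + eta2 y * \<xi> (point o' w \<tau> y) $ 2) + \<tau> * (eta y * trace (?J \<tau> y))) 0"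
   using has_bochner_integral_add[OF 1 2] by (simp add: trace_def sum_2 algebra_simps)
  have 4: "has_bochner_integral lborel (\<lambda>y. (eta1 y * \<xi> (point o' w \<tau> y) $ 1 + eta2 y * \<xi> (point o' w \<tau> y) $ 2) + \<tau> * (eta y * trace (?J \<tau> y)))
   (E \<tau> + \<tau> * (LBINT y. eta y * trace (?J \<tau> y)))" unfolding E_def
   by (intro has_bochner_integral_add has_bochner_integral_mult_right has_bochner_integral_integrable i0 i1)
    (auto intro!: continuous_intros eta_zero eta12_zero)
  from has_bochner_integral_eq[OF 3 4] show ?thesis unfolding m by simp
 qed
 let ?A1 = "\<lambda>y. eta1 y * ((y $ 1 + w $ 1) * ?J \<tau> y $ 1 $ 1 + (y $ 2 + w $ 2) * ?J \<tau> y $ 1 $ 2)"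
 let ?A2 = "\<lambda>y. eta2 y * ((y $ 1 + w $ 1) * ?J \<tau> y $ 2 $ 1 + (y $ 2 + w $ 2) * ?J \<tau> y $ 2 $ 2)"
 have dk: "((\<lambda>\<tau>. LBINT y. k y * \<xi> (point o' w \<tau> y) $ i) has_real_derivative
  (LBINT y. k y * ((y $ 1 + w $ 1) * ?J \<tau> y $ i $ 1 + (y $ 2 + w $ 2) * ?J \<tau> y $ i $ 2))) (at \<tau>)"
  if "cont k" "\<And>y. y \<notin> unit_square ==> k y = 0" for k i
 proof (rule kernel_leibniz[where F="\<lambda>\<tau> y. \<xi> (point o' w \<tau> y) $ i" and
   F'="\<lambda>\<tau> y. (y $ 1 + w $ 1) * ?J \<tau> y $ i $ 1 + (y $ 2 + w $ 2) * ?J \<tau> y $ i $ 2"])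
  show "((\<lambda>\<tau>. \<xi> (point o' w \<tau> y) $ i) has_real_derivative (y $ 1 + w $ 1) * ?J \<tau> y $ i $ 1
   + (y $ 2 + w $ 2) * ?J \<tau> y $ i $ 2) (at \<tau>)" for \<tau> y
   using C1_ray[OF xi, of o' "y + w" i \<tau>] by (simp add: point_def)
 qed (use that in \<open>auto intro!: continuous_intros C1_continuous[OF xi] C1_jacobian_continuous[OF xi]\<close>)
 have dE: "(E has_real_derivative (LBINT y. ?A1 y) + (LBINT y. ?A2 y)) (at \<tau>)"
  unfolding E_def[abs_def] by (intro DERIV_add dk) (auto intro!: continuous_intros eta12_zero)
 have iA: "integrable lborel ?A1" "integrable lborel ?A2" by (rule integrable_continuous_support[where S=unit_square];
    auto intro!: continuous_intros C1_jacobian_continuous[OF xi] simp: eta12_zero)+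
 have iC: "integrable lborel (\<lambda>y. kernel_div w y \<bullet> ?J \<tau> y)" by (rule integrable_continuous_support[where S=unit_square])
  (auto intro!: continuous_intros C1_jacobian_continuous[OF xi] simp: kernel_zero)
 have iB: "integrable lborel (\<lambda>y. eta y * trace (?J \<tau> y))" by (intro i1 continuous_intros eta_zero)
 \<comment> \<open>The product rule for (t + a) \<open>kb\<close> t yields an additional
   \<open>kb\<close> t. In the two swaps below, one for each coordinate, these additional terms add
   up to \<open>eta\<close> times the trace.\<close>
 have dl: "((\<lambda>t. (t + a) * kb t) has_real_derivative (kb t + (t + a) * kb' t)) (at t)" for a t
  using kb_deriv[of t] by (auto intro!: derivative_eq_intros)
 have s1: "has_bochner_integral lborel (\<lambda>y. kb (y $ 1) * (kb (y $ 2) + (y $ 2 + w $ 2) * kb' (y $ 2)) * ?J \<tau> y $ 1 $ 1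
  - kb' (y $ 1) * ((y $ 2 + w $ 2) * kb (y $ 2)) * ?J \<tau> y $ 1 $ 2) 0"
  by (rule kernel_swap[OF kb_deriv dl _ _ _ xi]) (use t in \<open>auto intro!: continuous_intros simp: k_zero\<close>)
 have s2: "has_bochner_integral lborel (\<lambda>y. (y $ 1 + w $ 1) * kb (y $ 1) * kb' (y $ 2) * ?J \<tau> y $ 2 $ 1
  - (kb (y $ 1) + (y $ 1 + w $ 1) * kb' (y $ 1)) * kb (y $ 2) * ?J \<tau> y $ 2 $ 2) 0"
  by (rule kernel_swap[OF dl kb_deriv _ _ _ xi]) (use t in \<open>auto intro!: continuous_intros simp: k_zero\<close>)
 have e: "- (?A1 y + ?A2 y) - eta y * trace (?J \<tau> y) + kernel_div w y \<bullet> ?J \<tau> y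
  = ((y $ 1 + w $ 1) * kb (y $ 1) * kb' (y $ 2) * ?J \<tau> y $ 2 $ 1
  - (kb (y $ 1) + (y $ 1 + w $ 1) * kb' (y $ 1)) * kb (y $ 2) * ?J \<tau> y $ 2 $ 2)
  - (kb (y $ 1) * (kb (y $ 2) + (y $ 2 + w $ 2) * kb' (y $ 2)) * ?J \<tau> y $ 1 $ 1
  - kb' (y $ 1) * ((y $ 2 + w $ 2) * kb (y $ 2)) * ?J \<tau> y $ 1 $ 2)" for y
  by (simp add: kernel_div_def tfm_inner trace_def sum_2 eta_def eta1_def eta2_def algebra_simps)
 have "has_bochner_integral lborel (\<lambda>y. - (?A1 y + ?A2 y) - eta y * trace (?J \<tau> y) + kernel_div w y \<bullet> ?J \<tau> y) 0"
  unfolding e using has_bochner_integral_diff[OF s2 s1] by simp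
 moreover have "has_bochner_integral lborel (\<lambda>y. - (?A1 y + ?A2 y) - eta y * trace (?J \<tau> y) + kernel_div w y \<bullet> ?J \<tau> y)
  (- ((LBINT y. ?A1 y) + (LBINT y. ?A2 y)) - (LBINT y. eta y * trace (?J \<tau> y)) + (LBINT y. kernel_div w y \<bullet> ?J \<tau> y))"
  by (intro has_bochner_integral_add has_bochner_integral_diff has_bochner_integral_minus has_bochner_integral_integrable iA iB iC)
 ultimately have eq: "(LBINT y. ?A1 y) + (LBINT y. ?A2 y)
   = (LBINT y. kernel_div w y \<bullet> ?J \<tau> y) - mean_div \<xi> (o' + \<tau> *\<^sub>R w) \<tau>"
  unfolding m using has_bochner_integral_eq by fastforce
 \<comment> \<open>The derivative of E contains - \<open>mean_div\<close>, and E itself is - \<tau>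
   \<open>mean_div\<close>; the two contributions to the quotient cancel.\<close>
 have dq: "((\<lambda>\<tau>. - E \<tau> / \<tau>) has_real_derivative
  (- ((LBINT y. kernel_div w y \<bullet> ?J \<tau> y) - mean_div \<xi> (o' + \<tau> *\<^sub>R w) \<tau>) * \<tau> - (- E \<tau>) * 1) / (\<tau> * \<tau>)) (at \<tau>)"
  using t by (intro DERIV_divide DERIV_minus dE[unfolded eq] DERIV_ident) auto
 have "(- ((LBINT y. kernel_div w y \<bullet> ?J \<tau> y) - mean_div \<xi> (o' + \<tau> *\<^sub>R w) \<tau>) * \<tau> - (- E \<tau>) * 1) / (\<tau> * \<tau>)
  = - (1 / \<tau>) * (LBINT y. kernel_div w y \<bullet> ?J \<tau> y)" using t by (simp add: E_eq field_simps)
 with dq have *: "((\<lambda>\<tau>. - E \<tau> / \<tau>) has_real_derivative - (1 / \<tau>) * (LBINT y. kernel_div w y \<bullet> ?J \<tau> y)) (at \<tau>)" by simp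
 show ?thesis
 proof (rule DERIV_cong_ev[THEN iffD1, OF refl _ refl *])
  have "\<forall>\<^sub>F x in nhds \<tau>. x \<in> {0<..}" by (rule eventually_nhds_in_open) (use t in auto)
  then show "\<forall>\<^sub>F x in nhds \<tau>. - E x / x = mean_div \<xi> (o' + x *\<^sub>R w) x" by eventually_elim (simp add: E_eq)
 qed
qed


text \<open>The numerator arises from integrating the divergence term of \<open>mean_deriv\<close>
  by parts, the denominator from \<open>mean_div_deriv\<close>. The quotient stays bounded, so
  transporting values costs no logarithm and may start at radius 0. For t = 0 it is 1 at every
  \<tau> > 0; the case distinction keeps this value at \<tau> = 0, where the division would give
  0.\<close>

definition ramp :: "real => real => real" where "ramp t \<tau> = (if t = 0 then 1 else (\<tau> - t) / \<tau>)"

lemma ramp_bounds: "0 \<le> t ==> t \<le> \<tau> ==> \<bar>ramp t \<tau>\<bar> \<le> 1" by (auto simp: ramp_def field_simps)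

lemma ramp_measurable [measurable]: "(\<lambda>\<tau>. ramp t \<tau>) \<in> borel_measurable borel" unfolding ramp_def by measurable

definition transport_val :: "2 => real => R2 => real => R2 => real^2^2" where
 "transport_val i t w \<tau> y = kernel_val i w y + (w $ i / 2 * ramp t \<tau>) *\<^sub>R kernel_div w y"

lemma point_segment:
 "point (c - L *\<^sub>R w) w \<tau> y = (c - (L - \<tau>) *\<^sub>R w) + \<tau> *\<^sub>R y" by (simp add: point_def algebra_simps)

lemma set_LINT_of_has_integral:
 fixes f :: "real => real"
 assumes "(f has_integral I) {a..b}" "continuous_on {a..b} f"
 shows "(LBINT \<tau>. ind {a..b} \<tau> * f \<tau>) = I"
proof -
 have "set_integrable lborel {a..b} f" using assms(2) borel_integrable_atLeastAtMost' by blast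
 from set_borel_integral_eq_integral(2)[OF this] assms(1) show ?thesis
  by (simp add: set_lebesgue_integral_def integral_unique)
qed

text \<open>The correction by \<open>mean_div\<close> is forced: the trace-free integral vanishes on
  the identity field, for which the difference of the means is z - c. With the apex c - L w the
  parameter is the radius, equal to t at z and to L at c.\<close>

theorem mean_transport:
 assumes xi: "C1 \<xi>" and t: "0 \<le> t" "t < L" and z: "z = c - (L - t) *\<^sub>R w"
 shows "mean \<xi> i z t = mean \<xi> i c L + (z $ i - c $ i) / 2 * mean_div \<xi> c L
  - (LBINT \<tau>. ind {t..L} \<tau> *
    (LBINT y. transport_val i t w \<tau> y \<bullet> jacobian \<xi> (at (point (c - L *\<^sub>R w) w \<tau> y))))"
proof -
 define o' where "o' = c - L *\<^sub>R w"
 let ?J = "\<lambda>\<tau> y. jacobian \<xi> (at (point o' w \<tau> y))"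
 let ?m = "\<lambda>\<tau>. mean \<xi> i (o' + \<tau> *\<^sub>R w) \<tau>" and ?D = "\<lambda>\<tau>. mean_div \<xi> (o' + \<tau> *\<^sub>R w) \<tau>"
 \<comment> \<open>The subtracted term trades \<open>mean_div\<close>, which is not trace-free, for
   its derivative, which is. Its weight vanishes at \<tau> = t, so that nothing is subtracted at
   z.\<close>
 define \<Phi> where "\<Phi> \<tau> = ?m \<tau> - w $ i / 2 * (\<tau> - t) * ?D \<tau>" for \<tau>
 let ?h = "\<lambda>\<tau>. LBINT y. transport_val i t w \<tau> y \<bullet> ?J \<tau> y"
 have pt: "o' + \<tau> *\<^sub>R w + \<tau> *\<^sub>R y = point o' w \<tau> y" for \<tau> y by (simp add: point_def algebra_simps)
 have cp: "cont (\<lambda>p::real \<times> R2. point o' w (fst p) (snd p))" by (intro continuous_intros)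
 have cm: "cont ?m" unfolding mean_def pt
 proof -
  have "cont (\<lambda>\<tau>. LBINT y. (\<lambda>p. eta (snd p) * \<xi> (point o' w (fst p) (snd p)) $ i) (\<tau>, y))"
   by (rule kernel_continuous_param) (auto intro!: continuous_intros C1_continuous[OF xi] simp: eta_zero)
  then show "cont (\<lambda>\<tau>. LBINT y. eta y * \<xi> (point o' w \<tau> y) $ i)" by simp
 qed
 have cD: "cont ?D" unfolding mean_div_def pt
 proof -
  have "cont (\<lambda>\<tau>. LBINT y. (\<lambda>p. eta (snd p) * trace (jacobian \<xi> (at (point o' w (fst p) (snd p))))) (\<tau>, y))"
   by (rule kernel_continuous_param) (auto intro!: continuous_intros C1_jacobian_continuous[OF xi] simp: eta_zero trace_def)
  then show "cont (\<lambda>\<tau>. LBINT y. eta y * trace (?J \<tau> y))" by simp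
 qed
 have cr: "continuous_on {t..L} (\<lambda>\<tau>. ramp t \<tau>)" using t by (cases "t = 0") (auto simp: ramp_def intro!: continuous_intros)
 have ch: "continuous_on {t..L} ?h"
 proof -
  have "continuous_on ({t..L} \<times> UNIV) (\<lambda>p::real \<times> R2. ramp t (fst p))"
   by (rule continuous_on_compose2[OF cr]) (auto intro!: continuous_intros)
  then have "continuous_on ({t..L} \<times> UNIV) (\<lambda>p. transport_val i t w (fst p) (snd p) \<bullet> ?J (fst p) (snd p))"
   unfolding transport_val_def by (intro continuous_intros C1_jacobian_continuous[OF xi])
  from kernel_continuous_param[OF this] show ?thesis by (simp add: transport_val_def kernel_zero)
 qed
 have iK: "integrable lborel (\<lambda>y. kernel_val i w y \<bullet> ?J \<tau> y)" "integrable lborel (\<lambda>y. kernel_div w y \<bullet> ?J \<tau> y)" for \<tau>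
  by (rule integrable_continuous_support[where S=unit_square];
    auto intro!: continuous_intros C1_jacobian_continuous[OF xi] simp: kernel_zero)+
 have d: "(\<Phi> has_vector_derivative ?h \<tau>) (at \<tau>)" if "\<tau> \<in> {t<..<L}" for \<tau>
 proof -
  have tp: "\<tau> > 0" "\<tau> > t" using that t by auto
  have r: "ramp t \<tau> = (\<tau> - t) / \<tau>" using tp by (simp add: ramp_def)
  have "?h \<tau> = (LBINT y. kernel_val i w y \<bullet> ?J \<tau> y) + w $ i / 2 * ramp t \<tau> * (LBINT y. kernel_div w y \<bullet> ?J \<tau> y)"
   unfolding transport_val_def inner_add_left inner_scaleR_left
   by (subst integral_add[OF iK(1) integrable_mult_right[OF iK(2)]]) simp
  moreover have "(\<Phi> has_real_derivative (w $ i / 2 * ?D \<tau> + (LBINT y. kernel_val i w y \<bullet> ?J \<tau> y))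
    - (w $ i / 2 * (\<tau> - t) * (- (1 / \<tau>) * (LBINT y. kernel_div w y \<bullet> ?J \<tau> y)) + w $ i / 2 * ?D \<tau>)) (at \<tau>)"
   unfolding \<Phi>_def[abs_def]
  proof (intro DERIV_diff mean_deriv[OF xi tp(1)])
   have "((\<lambda>\<tau>. w $ i / 2 * (\<tau> - t)) has_real_derivative w $ i / 2) (at \<tau>)" by (auto intro!: derivative_eq_intros)
   from DERIV_mult[OF this mean_div_deriv[OF xi tp(1), of o' w]]
   show "((\<lambda>\<tau>. w $ i / 2 * (\<tau> - t) * ?D \<tau>) has_real_derivative
    w $ i / 2 * (\<tau> - t) * (- (1 / \<tau>) * (LBINT y. kernel_div w y \<bullet> ?J \<tau> y)) + w $ i / 2 * ?D \<tau>) (at \<tau>)"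
    by (simp add: algebra_simps)
  qed
  ultimately show ?thesis
   unfolding has_real_derivative_iff_has_vector_derivative[symmetric] by (simp add: r)
 qed
 have "(?h has_integral (\<Phi> L - \<Phi> t)) {t..L}"
 \<comment> \<open>The derivative is only known for \<tau> > 0, while t = 0 is allowed; continuity
   up to the end points is enough.\<close>
 proof (rule fundamental_theorem_of_calculus_interior)
  show "continuous_on {t..L} \<Phi>" unfolding \<Phi>_def[abs_def]
   by (intro continuous_intros continuous_on_subset[OF cm] continuous_on_subset[OF cD]) auto
 qed (use t d in auto)
 from set_LINT_of_has_integral[OF this ch]
 have "(LBINT \<tau>. ind {t..L} \<tau> * ?h \<tau>) = \<Phi> L - \<Phi> t" .
 moreover have "o' + L *\<^sub>R w = c" "o' + t *\<^sub>R w = z" by (simp_all add: o'_def z algebra_simps)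
 moreover have "z $ i - c $ i = - (L - t) * w $ i" by (simp add: z algebra_simps)
 then have zi: "z $ i - c $ i = - ((L - t) * w $ i)" by linarith
 have "(z $ i - c $ i) / 2 * mean_div \<xi> c L = - (w $ i / 2 * (L - t) * mean_div \<xi> c L)"
 proof -
  have "- (A * B) / 2 * D = - (B / 2 * A * D)" for A B D :: real by simp
  then show ?thesis unfolding zi .
 qed
 ultimately show ?thesis unfolding \<Phi>_def o'_def[symmetric] by simp
qed

text \<open>Here the factor 1/\<tau> is not compensated, so the initial radius must be positive and
  the cost will be the integral of 1/\<tau>.\<close>

theorem mean_div_transport:
 assumes xi: "C1 \<xi>" and t: "0 < t" "t < L" and z: "z = c - (L - t) *\<^sub>R w"
 shows "mean_div \<xi> z t = mean_div \<xi> c L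
  + (LBINT \<tau>. ind {t..L} \<tau> *
    (LBINT y. ((1 / \<tau>) *\<^sub>R kernel_div w y) \<bullet> jacobian \<xi> (at (point (c - L *\<^sub>R w) w \<tau> y))))"
proof -
 define o' where "o' = c - L *\<^sub>R w"
 let ?J = "\<lambda>\<tau> y. jacobian \<xi> (at (point o' w \<tau> y))"
 let ?D = "\<lambda>\<tau>. mean_div \<xi> (o' + \<tau> *\<^sub>R w) \<tau>"
 let ?h = "\<lambda>\<tau>. LBINT y. ((1 / \<tau>) *\<^sub>R kernel_div w y) \<bullet> ?J \<tau> y"
 have pos: "\<tau> > 0" if "\<tau> \<in> {t..L}" for \<tau> using that t by auto
 have ch: "continuous_on {t..L} ?h"
 proof -
  have c1: "continuous_on ({t..L} \<times> UNIV) (\<lambda>p::real \<times> R2. 1 / fst p)"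
  proof (intro continuous_intros ballI)
   fix x :: "real \<times> R2" assume "x \<in> {t..L} \<times> UNIV"
   then show "fst x \<noteq> 0" using t by auto
  qed
  have c2: "continuous_on ({t..L} \<times> UNIV) (\<lambda>p::real \<times> R2. kernel_div w (snd p))" by (intro continuous_intros)
  have c3: "continuous_on ({t..L} \<times> UNIV) (\<lambda>p. ?J (fst p) (snd p))" by (intro continuous_intros C1_jacobian_continuous[OF xi])
  have "continuous_on ({t..L} \<times> UNIV) (\<lambda>p. ((1 / fst p) *\<^sub>R kernel_div w (snd p)) \<bullet> ?J (fst p) (snd p))"
   by (rule continuous_on_inner[OF continuous_on_scaleR[OF c1 c2] c3])
  from kernel_continuous_param[OF this] show ?thesis by (simp add: kernel_zero)
 qed
 have d: "(?D has_vector_derivative - ?h \<tau>) (at \<tau> within {t..L})" if "\<tau> \<in> {t..L}" for \<tau>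
 proof -
  have "(?D has_real_derivative - (1 / \<tau>) * (LBINT y. kernel_div w y \<bullet> ?J \<tau> y)) (at \<tau>)"
   by (rule mean_div_deriv[OF xi pos[OF that]])
  moreover have "- (1 / \<tau>) * (LBINT y. kernel_div w y \<bullet> ?J \<tau> y) = - ?h \<tau>" unfolding inner_scaleR_left by simp
  ultimately have "(?D has_real_derivative - ?h \<tau>) (at \<tau>)" by (simp only:)
  from has_field_derivative_at_within[OF this] show ?thesis
   unfolding has_real_derivative_iff_has_vector_derivative .
 qed
 have "((\<lambda>\<tau>. - ?h \<tau>) has_integral (?D L - ?D t)) {t..L}" by (rule fundamental_theorem_of_calculus) (use t in simp, rule d)
 from has_integral_neg[OF this] have "(?h has_integral - (?D L - ?D t)) {t..L}" by simp
 from set_LINT_of_has_integral[OF this ch]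
 have "(LBINT \<tau>. ind {t..L} \<tau> * ?h \<tau>) = - (?D L - ?D t)" .
 moreover have "o' + L *\<^sub>R w = c" "o' + t *\<^sub>R w = z" by (simp_all add: o'_def z algebra_simps)
 ultimately show ?thesis unfolding o'_def[symmetric] by simp
qed

section \<open>Bounds for the transport kernels\<close>

lemma norm_kernel_div: "norm (kernel_div w y) \<le> 40 * (1 + norm w) * ind unit_square y"
proof (cases "y \<in> unit_square")
 case True
 then have y: "\<bar>y $ 1\<bar> \<le> 1" "\<bar>y $ 2\<bar> \<le> 1" by (auto simp: unit_square_iff)
 have e: "\<bar>y $ 1 + w $ 1\<bar> \<le> 1 + norm w" "\<bar>y $ 2 + w $ 2\<bar> \<le> 1 + norm w"
  using y component_le_norm_cart[of w 1] component_le_norm_cart[of w 2] by linarith+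
 have h: "\<bar>eta1 y\<bar> \<le> 4" "\<bar>eta2 y\<bar> \<le> 4"
  using mult_mono[OF k_bounds(3)[of "y $ 1"] k_bounds(2)[of "y $ 2"]] mult_mono[OF k_bounds(2)[of "y $ 1"] k_bounds(3)[of "y $ 2"]]
   k_bounds(1) by (auto simp: eta1_def eta2_def abs_mult)
 have p: "\<bar>a * b\<bar> \<le> 4 * (1 + norm w)" if "\<bar>a\<bar> \<le> 1 + norm w" "\<bar>b\<bar> \<le> 4" for a b :: real
  using mult_mono[OF that] norm_ge_zero[of w] by (simp add: abs_mult algebra_simps)
 have k: "kernel_div w y = tfm ((y $ 1 + w $ 1) * eta1 y - (y $ 2 + w $ 2) * eta2 y)
  (2 * ((y $ 2 + w $ 2) * eta1 y)) (2 * ((y $ 1 + w $ 1) * eta2 y))" by (simp only: kernel_div_def mult.assoc)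
 have lin: "n \<le> 40 * (1 + m)" if "n \<le> 2 * d + \<bar>2 * a\<bar> + \<bar>2 * b\<bar>" "d \<le> e + f" "\<bar>a\<bar> \<le> 4 * (1 + m)"
  "\<bar>b\<bar> \<le> 4 * (1 + m)" "e \<le> 4 * (1 + m)" "f \<le> 4 * (1 + m)" "0 \<le> m" for n m d a b e f :: real
  using that by linarith
 have "norm (kernel_div w y) \<le> 40 * (1 + norm w)" unfolding k
  by (rule lin[OF norm_tfm abs_triangle_ineq4 p[OF e(2) h(1)] p[OF e(1) h(2)] p[OF e(1) h(1)] p[OF e(2) h(2)] norm_ge_zero])
 then show ?thesis using True by simp
qed (simp add: kernel_zero)

lemma norm_transport_val:
 assumes "0 \<le> t" "t \<le> \<tau>"
 shows "norm (transport_val i t w \<tau> y) \<le> 40 * (1 + norm w)\<^sup>2 * ind unit_square y"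
proof (cases "y \<in> unit_square")
 case True
 then have y: "\<bar>y $ 1\<bar> \<le> 1" "\<bar>y $ 2\<bar> \<le> 1" by (auto simp: unit_square_iff)
 have w: "\<bar>w $ i\<bar> \<le> norm w" for i by (rule component_le_norm_cart)
 have p: "\<bar>eta y * a\<bar> \<le> 1 + norm w" if "\<bar>a\<bar> \<le> 1 + norm w" for a
  using mult_mono[OF eta_bounds(2)[of y] that] eta_bounds(1)[of y] by (simp add: abs_mult)
 have q: "\<bar>kB (y $ 1) * kb' (y $ 2)\<bar> \<le> 4" "\<bar>kb' (y $ 1) * kB (y $ 2)\<bar> \<le> 4"
  using mult_mono[OF k_bounds(5)[of "y $ 1"] k_bounds(3)[of "y $ 2"]] mult_mono[OF k_bounds(3)[of "y $ 1"] k_bounds(5)[of "y $ 2"]]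
   k_bounds(4) by (auto simp: abs_mult)
 have e: "\<bar>y $ 1 + w $ 1 / 2\<bar> \<le> 1 + norm w" "\<bar>y $ 2 + w $ 2 / 2\<bar> \<le> 1 + norm w"
  "\<bar>y $ 1 + w $ 1\<bar> \<le> 1 + norm w" "\<bar>y $ 2 + w $ 2\<bar> \<le> 1 + norm w" using y w[of 1] w[of 2] by linarith+
 have lin: "n \<le> 7 * (1 + m)" if "n \<le> 2 * a + b + c" "a \<le> 1 + m" "b + c \<le> (1 + m) + 4" "0 \<le> m"
  for n m a b c :: real using that by (simp add: algebra_simps)
 have v: "norm (kernel_val i w y) \<le> 7 * (1 + norm w)"
 proof (cases "i = 1")
  case True
  have "\<bar>eta y * (y $ 2 + w $ 2)\<bar> + \<bar>- (kB (y $ 1) * kb' (y $ 2))\<bar> \<le> (1 + norm w) + 4"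
   unfolding abs_minus_cancel by (rule add_mono[OF p[OF e(4)] q(1)])
  from lin[OF norm_tfm p[OF e(1)] this norm_ge_zero] show ?thesis unfolding kernel_val_def if_P[OF True] .
 next
  case False
  have "\<bar>- (kb' (y $ 1) * kB (y $ 2))\<bar> + \<bar>eta y * (y $ 1 + w $ 1)\<bar> \<le> (1 + norm w) + 4"
   unfolding abs_minus_cancel using add_mono[OF p[OF e(3)] q(2)] by simp
  moreover have "\<bar>- (eta y * (y $ 2 + w $ 2 / 2))\<bar> \<le> 1 + norm w" unfolding abs_minus_cancel by (rule p[OF e(2)])
  ultimately show ?thesis unfolding kernel_val_def if_not_P[OF False] using lin[OF norm_tfm _ _ norm_ge_zero] by blast
 qed
 have "\<bar>w $ i / 2 * ramp t \<tau>\<bar> \<le> norm w / 2 * 1" unfolding abs_mult by (intro mult_mono ramp_bounds assms) (use w[of i] in auto)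
 then have "norm ((w $ i / 2 * ramp t \<tau>) *\<^sub>R kernel_div w y) \<le> norm w / 2 * (40 * (1 + norm w))"
  using norm_kernel_div[of w y] True unfolding norm_scaleR by (intro mult_mono) auto
 then have "norm (transport_val i t w \<tau> y) \<le> 7 * (1 + norm w) + norm w / 2 * (40 * (1 + norm w))"
  unfolding transport_val_def using v norm_triangle_ineq[of "kernel_val i w y" "(w $ i / 2 * ramp t \<tau>) *\<^sub>R kernel_div w y"] by linarith
 also have "\<dots> \<le> 40 * (1 + norm w)\<^sup>2" by (simp add: power2_eq_square algebra_simps)
 finally show ?thesis using True by simp
qed (simp add: kernel_zero transport_val_def)

section \<open>Trace-free densities\<close>

text \<open>A calculus of fillings: a functional of \<xi> is filled by a trace-free density inside
  \<open>S\<close>, and \<kappa> bounds the L1 norm of that density. Fillings add and scale together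
  with their costs, so a correction can be assembled piece by piece.\<close>

definition tfrep :: "R2 set => real => ((R2 => R2) => real) => bool" where
 "tfrep S \<kappa> \<Lambda> \<longleftrightarrow> (\<exists>G. integrable lborel G \<and> (\<forall>y. trace (G y) = 0) \<and> (\<forall>y. y \<notin> S \<longrightarrow> G y = 0) \<and>
  (LBINT y. norm (G y)) \<le> \<kappa> \<and> (\<forall>\<xi>. C1 \<xi> \<longrightarrow> \<Lambda> \<xi> = (LBINT y. G y \<bullet> jacobian \<xi> (at y))))"

lemma C1_jacobian_bounded:
 assumes "C1 \<xi>" "bounded S"
 obtains C where "0 \<le> C" "\<And>y. y \<in> S ==> norm (jacobian \<xi> (at y)) \<le> C"
proof -
 have "compact ((\<lambda>y. jacobian \<xi> (at y)) ` closure S)"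
  using assms by (intro compact_continuous_image C1_jacobian_continuous continuous_on_id) auto
 then have "bounded ((\<lambda>y. jacobian \<xi> (at y)) ` closure S)" by (rule compact_imp_bounded)
 then obtain C where C: "\<forall>x\<in>(\<lambda>y. jacobian \<xi> (at y)) ` closure S. norm x \<le> C" unfolding bounded_iff by blast
 have "norm (jacobian \<xi> (at y)) \<le> max 0 C" if "y \<in> S" for y
  using C that closure_subset[of S] by (intro max.coboundedI2) auto
 then show ?thesis using that[of "max 0 C"] by simp
qed

lemma C1_jacobian_measurable: "C1 \<xi> ==> (\<lambda>y. jacobian \<xi> (at y)) \<in> borel_measurable borel"
 by (intro borel_measurable_continuous_onI C1_jacobian_continuous continuous_on_id)

lemma integrable_inner_support:
 fixes G H :: "'a::euclidean_space => 'b::euclidean_space"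
 assumes G: "integrable lborel G" and z: "\<And>y. y \<notin> S ==> G y = 0"
  and H: "H \<in> borel_measurable borel" "\<And>y. y \<in> S ==> norm (H y) \<le> C"
 shows "integrable lborel (\<lambda>y. G y \<bullet> H y)"
proof (rule integrable_bound)
 show "integrable lborel (\<lambda>y. C * norm (G y))" using G by simp
 show "AE y in lborel. norm (G y \<bullet> H y) \<le> norm (C * norm (G y))"
 proof (rule AE_I2)
  fix y show "norm (G y \<bullet> H y) \<le> norm (C * norm (G y))"
  proof (cases "y \<in> S")
   case True
   have "norm (G y \<bullet> H y) \<le> norm (G y) * norm (H y)" using Cauchy_Schwarz_ineq2[of "G y" "H y"] by simp
   also have "\<dots> \<le> norm (G y) * C" using H(2)[OF True] by (intro mult_left_mono) auto
   also have "\<dots> \<le> norm (C * norm (G y))" by (simp add: mult.commute abs_le_iff)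
   finally show ?thesis .
  qed (simp add: z)
 qed
qed (use G H in auto)

lemma integrable_inner_jacobian:
 assumes "integrable lborel G" "\<And>y. y \<notin> S ==> G y = 0" "bounded S" "C1 \<xi>"
 shows "integrable lborel (\<lambda>y. G y \<bullet> jacobian \<xi> (at y))"
proof -
 obtain C where C: "0 \<le> C" "\<And>y. y \<in> S ==> norm (jacobian \<xi> (at y)) \<le> C" using C1_jacobian_bounded[OF assms(4,3)] by blast
 show ?thesis by (rule integrable_inner_support[OF assms(1,2) C1_jacobian_measurable[OF assms(4)] C(2)])
qed

lemma tfrep_add:
 assumes "tfrep S \<kappa> \<Lambda>" "tfrep S \<kappa>' \<Lambda>'" "bounded S"
 shows "tfrep S (\<kappa> + \<kappa>') (\<lambda>\<xi>. \<Lambda> \<xi> + \<Lambda>' \<xi>)"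
proof -
 obtain G where G: "integrable lborel G" "\<And>y. trace (G y) = 0" "\<And>y. y \<notin> S ==> G y = 0"
  "(LBINT y. norm (G y)) \<le> \<kappa>" "\<And>\<xi>. C1 \<xi> ==> \<Lambda> \<xi> = (LBINT y. G y \<bullet> jacobian \<xi> (at y))"
  using assms(1) unfolding tfrep_def by blast
 obtain G' where G': "integrable lborel G'" "\<And>y. trace (G' y) = 0" "\<And>y. y \<notin> S ==> G' y = 0"
  "(LBINT y. norm (G' y)) \<le> \<kappa>'" "\<And>\<xi>. C1 \<xi> ==> \<Lambda>' \<xi> = (LBINT y. G' y \<bullet> jacobian \<xi> (at y))"
  using assms(2) unfolding tfrep_def by blast
 have "(LBINT y. norm (G y + G' y)) \<le> (LBINT y. norm (G y) + norm (G' y))" using G(1) G'(1) by (intro integral_mono norm_triangle_ineq) auto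
 also have "\<dots> \<le> \<kappa> + \<kappa>'" using G G' by simp
 finally have n: "(LBINT y. norm (G y + G' y)) \<le> \<kappa> + \<kappa>'" .
 have e: "\<Lambda> \<xi> + \<Lambda>' \<xi> = (LBINT y. (G y + G' y) \<bullet> jacobian \<xi> (at y))" if xi: "C1 \<xi>" for \<xi>
  unfolding inner_add_left G(5)[OF xi] G'(5)[OF xi]
  by (rule integral_add[symmetric, OF integrable_inner_jacobian[OF G(1,3) assms(3) xi]
    integrable_inner_jacobian[OF G'(1,3) assms(3) xi]])
 show ?thesis unfolding tfrep_def
 proof (intro exI[of _ "\<lambda>y. G y + G' y"] conjI allI impI)
  show "trace (G y + G' y) = 0" for y using G(2)[of y] G'(2)[of y] by (simp add: trace_def sum.distrib)
 qed (use G(1,3) G'(1,3) n e in auto)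
qed

lemma tfrep_scale:
 assumes "tfrep S \<kappa> \<Lambda>"
 shows "tfrep S (\<bar>a\<bar> * \<kappa>) (\<lambda>\<xi>. a * \<Lambda> \<xi>)"
proof -
 obtain G where G: "integrable lborel G" "\<And>y. trace (G y) = 0" "\<And>y. y \<notin> S ==> G y = 0"
  "(LBINT y. norm (G y)) \<le> \<kappa>" "\<And>\<xi>. C1 \<xi> ==> \<Lambda> \<xi> = (LBINT y. G y \<bullet> jacobian \<xi> (at y))"
  using assms(1) unfolding tfrep_def by blast
 show ?thesis unfolding tfrep_def
 proof (intro exI[of _ "\<lambda>y. a *\<^sub>R G y"] conjI allI impI)
  show "trace (a *\<^sub>R G y) = 0" for y using G(2)[of y] by (simp add: trace_def flip: sum_distrib_left)
  show "(LBINT y. norm (a *\<^sub>R G y)) \<le> \<bar>a\<bar> * \<kappa>" using G(4) by (simp add: mult_left_mono)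
 qed (use G in auto)
qed

lemma tfrep_cong:
 assumes "tfrep S \<kappa> \<Lambda>" "\<And>\<xi>. C1 \<xi> ==> \<Lambda>' \<xi> = \<Lambda> \<xi>" "\<kappa> \<le> \<kappa>'"
 shows "tfrep S \<kappa>' \<Lambda>'" using assms unfolding tfrep_def by (smt (verit, best))

section \<open>Push-forward of densities under families of affine maps\<close>

lemma lborel_affine_plane:
 fixes f :: "R2 => 'b::{banach, second_countable_topology}"
 assumes [measurable]: "f \<in> borel_measurable borel" and s: "0 < s"
 shows "(LBINT Y. f Y) = s\<^sup>2 *\<^sub>R (LBINT y. f (a + s *\<^sub>R y))"
proof -
 have "(LBINT Y. f Y) = (LINT Y|density (distr lborel borel (\<lambda>x. a + s *\<^sub>R x)) (\<lambda>_. ennreal (s\<^sup>2)). f Y)"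
  using s by (subst lborel_affine[of s a]) auto
 also have "\<dots> = s\<^sup>2 *\<^sub>R (LBINT y. f (a + s *\<^sub>R y))" by (subst integral_density) (auto simp: integral_distr)
 finally show ?thesis .
qed

lemma lborel_affine_plane_nn:
 fixes f :: "R2 => ennreal"
 assumes [measurable]: "f \<in> borel_measurable borel" and s: "0 < s"
 shows "(\<integral>\<^sup>+Y. f Y \<partial>lborel) = ennreal (s\<^sup>2) * (\<integral>\<^sup>+y. f (a + s *\<^sub>R y) \<partial>lborel)"
proof -
 have "(\<integral>\<^sup>+Y. f Y \<partial>lborel) = (\<integral>\<^sup>+Y. f Y \<partial>density (distr lborel borel (\<lambda>x. a + s *\<^sub>R x)) (\<lambda>_. ennreal (s\<^sup>2)))"
  using s by (subst lborel_affine[of s a]) auto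
 also have "\<dots> = ennreal (s\<^sup>2) * (\<integral>\<^sup>+y. f (a + s *\<^sub>R y) \<partial>lborel)"
  by (subst nn_integral_density) (auto simp: nn_integral_distr nn_integral_cmult)
 finally show ?thesis .
qed

text \<open>For fixed \<omega> the map from y to a + s y is a change of variables, so the
  push-forward of K has an explicit density with the factor 1 / s^2; integrating these densities
  over \<omega> gives \<open>G\<close>. The parameter \<omega> is abstract because it will be a pair
  of a point of the domain and a transport parameter.\<close>

lemma push_density:
 fixes K :: "'w::euclidean_space => R2 => real^2^2" and a :: "'w => R2" and s :: "'w => real"
 assumes Kint: "integrable lborel (\<lambda>p. K (fst p) (snd p))"
  and a [measurable]: "a \<in> borel_measurable borel" and s [measurable]: "s \<in> borel_measurable borel"
  and s0: "\<And>\<omega> y. s \<omega> \<le> 0 ==> K \<omega> y = 0" and tr: "\<And>\<omega> y. trace (K \<omega> y) = 0"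
  and S: "\<And>\<omega> y. K \<omega> y \<noteq> 0 ==> a \<omega> + s \<omega> *\<^sub>R y \<in> S"
 shows "\<exists>G. integrable lborel G \<and> (\<forall>y. trace (G y) = 0) \<and> (\<forall>y. y \<notin> S \<longrightarrow> G y = 0) \<and>
  (LBINT y. norm (G y)) \<le> (LBINT p. norm (K (fst p) (snd p))) \<and>
  (\<forall>H C. H \<in> borel_measurable borel \<longrightarrow> (\<forall>y\<in>S. norm (H y) \<le> C) \<longrightarrow>
   (LBINT y. G y \<bullet> H y) = (LBINT p. K (fst p) (snd p) \<bullet> H (a (fst p) + s (fst p) *\<^sub>R snd p)))"
proof -
 have Km [measurable]: "(\<lambda>p. K (fst p) (snd p)) \<in> borel_measurable borel" using borel_measurable_integrable[OF Kint] by simp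
 have Km2 [measurable (raw)]: "(\<lambda>x. K (f x) (g x)) \<in> borel_measurable M"
  if "f \<in> borel_measurable M" "g \<in> borel_measurable M" for f g and M :: "'c measure"
 proof -
  have "(\<lambda>x. (f x, g x)) \<in> borel_measurable M" using that by (rule borel_measurable_Pair)
  from measurable_compose[OF this Km] show ?thesis by simp
 qed
 define Q where "Q \<omega> Y = (if s \<omega> > 0 then (1 / (s \<omega>)\<^sup>2) *\<^sub>R K \<omega> ((1 / s \<omega>) *\<^sub>R (Y - a \<omega>)) else 0)" for \<omega> Y
 have Qm [measurable]: "(\<lambda>p. Q (fst p) (snd p)) \<in> borel_measurable (lborel \<Otimes>\<^sub>M lborel)" unfolding Q_def by measurable
 have Q0: "Q \<omega> Y = 0" if "Y \<notin> S" for \<omega> Y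
 proof (cases "s \<omega> > 0")
  case True
  have "a \<omega> + s \<omega> *\<^sub>R ((1 / s \<omega>) *\<^sub>R (Y - a \<omega>)) = Y" using True by simp
  then show ?thesis using S[of \<omega> "(1 / s \<omega>) *\<^sub>R (Y - a \<omega>)"] that by (auto simp: Q_def)
 qed (simp add: Q_def)
 have Qpt: "Q \<omega> (a \<omega> + s \<omega> *\<^sub>R y) = (1 / (s \<omega>)\<^sup>2) *\<^sub>R K \<omega> y" if "s \<omega> > 0" for \<omega> y using that by (simp add: Q_def)
 have nnQ: "(\<integral>\<^sup>+Y. ennreal (norm (Q \<omega> Y)) \<partial>lborel) = (\<integral>\<^sup>+y. ennreal (norm (K \<omega> y)) \<partial>lborel)" for \<omega>
 proof (cases "s \<omega> > 0")
  case True
  have [measurable]: "Q \<omega> \<in> borel_measurable borel" unfolding Q_def[abs_def] by measurable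
  have "(\<integral>\<^sup>+Y. ennreal (norm (Q \<omega> Y)) \<partial>lborel) = ennreal ((s \<omega>)\<^sup>2) * (\<integral>\<^sup>+y. ennreal (norm ((1 / (s \<omega>)\<^sup>2) *\<^sub>R K \<omega> y)) \<partial>lborel)"
   by (subst lborel_affine_plane_nn[OF _ True, of _ "a \<omega>"]) (simp_all add: Qpt[OF True])
  also have "\<dots> = (\<integral>\<^sup>+y. ennreal ((s \<omega>)\<^sup>2) * ennreal (norm ((1 / (s \<omega>)\<^sup>2) *\<^sub>R K \<omega> y)) \<partial>lborel)"
   by (rule nn_integral_cmult[symmetric]) simp
  also have "\<dots> = (\<integral>\<^sup>+y. ennreal (norm (K \<omega> y)) \<partial>lborel)"
   using True by (intro nn_integral_cong) (simp add: ennreal_mult[symmetric])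
  finally show ?thesis .
 qed (simp add: Q_def s0)
 have KintP: "integrable (lborel \<Otimes>\<^sub>M lborel) (\<lambda>p. K (fst p) (snd p))" using Kint by (simp add: lborel_prod)
 have nnK: "(\<integral>\<^sup>+p. ennreal (norm (Q (fst p) (snd p))) \<partial>(lborel \<Otimes>\<^sub>M lborel)) = (\<integral>\<^sup>+p. ennreal (norm (K (fst p) (snd p))) \<partial>(lborel \<Otimes>\<^sub>M lborel))"
  using lborel.nn_integral_fst[of "\<lambda>p. ennreal (norm (Q (fst p) (snd p)))" lborel, symmetric]
   lborel.nn_integral_fst[of "\<lambda>p. ennreal (norm (K (fst p) (snd p)))" lborel] nnQ by simp
 have Qint: "integrable (lborel \<Otimes>\<^sub>M lborel) (\<lambda>p. Q (fst p) (snd p))"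
  unfolding integrable_iff_bounded nnK using KintP unfolding integrable_iff_bounded by auto
 then have Qint': "integrable (lborel \<Otimes>\<^sub>M lborel) (\<lambda>(\<omega>, Y). Q \<omega> Y)" by (simp add: case_prod_unfold)
 define G where "G Y = (LBINT \<omega>. Q \<omega> Y)" for Y
 have Gint: "integrable lborel G" unfolding G_def[abs_def] by (rule lborel_pair.integrable_snd[OF Qint'])
 have AEi: "AE Y in lborel. integrable lborel (\<lambda>\<omega>. Q \<omega> Y)" by (rule lborel_pair.AE_integrable_snd[OF Qint'])
 have trQ: "trace (Q \<omega> Y) = 0" for \<omega> Y
 proof -
  have "trace (c *\<^sub>R M) = c * trace M" for c and M :: "real^2^2" by (simp add: trace_def sum_distrib_left)
  moreover have "trace (0 :: real^2^2) = 0" by (simp add: trace_def)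
  ultimately show ?thesis by (simp add: Q_def tr)
 qed
 have trG: "trace (G Y) = 0" for Y
 proof (cases "integrable lborel (\<lambda>\<omega>. Q \<omega> Y)")
  case True
  have bl: "bounded_linear (trace :: real^2^2 => real)"
   unfolding trace_def sum_2 by (intro bounded_linear_add bounded_linear_compose[OF bounded_linear_vec_nth bounded_linear_vec_nth])
  have "(LBINT \<omega>. trace (Q \<omega> Y)) = trace (G Y)" unfolding G_def by (rule integral_bounded_linear[OF bl True])
  then show ?thesis by (simp add: trQ)
 next
  \<comment> \<open>Where the integral over \<omega> does not exist, \<open>G\<close> has the
    default value 0, which is trace-free as well.\<close>
  case False
  then show ?thesis by (simp add: G_def not_integrable_integral_eq trace_def)
 qed
 have nG: "(LBINT Y. norm (G Y)) \<le> (LBINT p. norm (K (fst p) (snd p)))"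
 proof -
  have Qn: "integrable (lborel \<Otimes>\<^sub>M lborel) (\<lambda>(\<omega>, Y). norm (Q \<omega> Y))" using integrable_norm[OF Qint'] by (simp add: case_prod_unfold)
  have "(LBINT Y. norm (G Y)) \<le> (LBINT Y. LBINT \<omega>. norm (Q \<omega> Y))"
   unfolding G_def using integrable_norm[OF Gint[unfolded G_def[abs_def]]] lborel_pair.integrable_snd[OF Qn]
   by (intro integral_mono integral_norm_bound) auto
  also have "\<dots> = (LINT p|(lborel \<Otimes>\<^sub>M lborel). norm (Q (fst p) (snd p)))"
   using lborel_pair.integral_snd[OF Qn] by (simp add: case_prod_unfold)
  also have "\<dots> = (LINT p|(lborel \<Otimes>\<^sub>M lborel). norm (K (fst p) (snd p)))" using nnK by (subst (1 2) integral_eq_nn_integral) auto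
  finally show ?thesis by (simp add: lborel_prod)
 qed
 have fin: "(LBINT y. G y \<bullet> H y) = (LBINT p. K (fst p) (snd p) \<bullet> H (a (fst p) + s (fst p) *\<^sub>R snd p))"
  if H [measurable]: "H \<in> borel_measurable borel" and C: "\<forall>y\<in>S. norm (H y) \<le> C" for H C
 proof -
  define C' where "C' = \<bar>C\<bar>"
  have CS: "norm (H y) \<le> C'" if "y \<in> S" for y using C that by (force simp: C'_def)
  have QH: "integrable (lborel \<Otimes>\<^sub>M lborel) (\<lambda>p. Q (fst p) (snd p) \<bullet> H (snd p))"
  proof (rule integrable_bound[OF integrable_mult_right[OF integrable_norm[OF Qint], of C']])
   show "AE p in lborel \<Otimes>\<^sub>M lborel. norm (Q (fst p) (snd p) \<bullet> H (snd p)) \<le> norm (C' * norm (Q (fst p) (snd p)))"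
   proof (rule AE_I2)
    fix p :: "'w \<times> R2"
    have "\<bar>Q (fst p) (snd p) \<bullet> H (snd p)\<bar> \<le> norm (Q (fst p) (snd p)) * norm (H (snd p))" by (rule Cauchy_Schwarz_ineq2)
    also have "\<dots> \<le> norm (Q (fst p) (snd p)) * C'"
     using CS[of "snd p"] Q0[of "snd p" "fst p"] by (cases "snd p \<in> S") (auto intro: mult_left_mono)
    finally show "norm (Q (fst p) (snd p) \<bullet> H (snd p)) \<le> norm (C' * norm (Q (fst p) (snd p)))" by (simp add: C'_def mult.commute abs_mult)
   qed
  qed measurable
  have KH: "integrable (lborel \<Otimes>\<^sub>M lborel) (\<lambda>p. K (fst p) (snd p) \<bullet> H (a (fst p) + s (fst p) *\<^sub>R snd p))"
  proof (rule integrable_bound[OF integrable_mult_right[OF integrable_norm[OF KintP], of C']])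
   show "AE p in lborel \<Otimes>\<^sub>M lborel. norm (K (fst p) (snd p) \<bullet> H (a (fst p) + s (fst p) *\<^sub>R snd p)) \<le> norm (C' * norm (K (fst p) (snd p)))"
   proof (rule AE_I2)
    fix p :: "'w \<times> R2"
    let ?z = "a (fst p) + s (fst p) *\<^sub>R snd p"
    have "\<bar>K (fst p) (snd p) \<bullet> H ?z\<bar> \<le> norm (K (fst p) (snd p)) * norm (H ?z)" by (rule Cauchy_Schwarz_ineq2)
    also have "\<dots> \<le> norm (K (fst p) (snd p)) * C'"
     using CS[of ?z] S[of "fst p" "snd p"] by (cases "K (fst p) (snd p) = 0") (auto intro: mult_left_mono)
    finally show "norm (K (fst p) (snd p) \<bullet> H ?z) \<le> norm (C' * norm (K (fst p) (snd p)))" by (simp add: C'_def mult.commute abs_mult)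
   qed
  qed (intro borel_measurable_inner; measurable)
  have QH': "integrable (lborel \<Otimes>\<^sub>M lborel) (\<lambda>(\<omega>, Y). Q \<omega> Y \<bullet> H Y)" using QH by (simp add: case_prod_unfold)
  have "(LBINT Y. G Y \<bullet> H Y) = (LBINT Y. LBINT \<omega>. Q \<omega> Y \<bullet> H Y)"
  proof (rule integral_cong_AE)
   show "AE Y in lborel. G Y \<bullet> H Y = (LBINT \<omega>. Q \<omega> Y \<bullet> H Y)" using AEi by eventually_elim (simp add: G_def)
   show "(\<lambda>Y. G Y \<bullet> H Y) \<in> borel_measurable lborel" using borel_measurable_integrable[OF Gint] H by simp
   show "(\<lambda>Y. LBINT \<omega>. Q \<omega> Y \<bullet> H Y) \<in> borel_measurable lborel"
    using borel_measurable_integrable[OF lborel_pair.integrable_snd[OF QH']] .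
  qed
  also have "\<dots> = (LBINT \<omega>. LBINT Y. Q \<omega> Y \<bullet> H Y)" by (rule lborel_pair.Fubini_integral[OF QH'])
  also have "\<dots> = (LBINT \<omega>. LBINT y. K \<omega> y \<bullet> H (a \<omega> + s \<omega> *\<^sub>R y))"
  proof (rule integral_cong[OF refl])
   fix \<omega> :: 'w
   show "(LBINT Y. Q \<omega> Y \<bullet> H Y) = (LBINT y. K \<omega> y \<bullet> H (a \<omega> + s \<omega> *\<^sub>R y))"
   proof (cases "s \<omega> > 0")
    case True
    have [measurable]: "Q \<omega> \<in> borel_measurable borel" unfolding Q_def[abs_def] by measurable
    show ?thesis using True
     by (subst lborel_affine_plane[OF _ True, of _ "a \<omega>"]) (simp_all add: Qpt[OF True])
   qed (simp add: Q_def s0)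
  qed
  also have "\<dots> = (LINT p|(lborel \<Otimes>\<^sub>M lborel). K (fst p) (snd p) \<bullet> H (a (fst p) + s (fst p) *\<^sub>R snd p))"
   using lborel_pair.integral_fst'[OF KH] by simp
  finally show ?thesis by (simp add: lborel_prod)
 qed
 have G0: "\<forall>y. y \<notin> S \<longrightarrow> G y = 0" by (simp add: G_def Q0)
 show ?thesis using Gint trG G0 nG fin by (intro exI[of _ G]) blast
qed


text \<open>Superposition of the transports of all points x with coefficient c x, through
  \<open>push_density\<close> with \<omega> = (x, \<tau>). The 4 is the area of the unit square. The
  kernel bound is a product of a function of x and one of \<tau>, which makes the cost
  factorise.\<close>

lemma tfrep_transport:
 fixes c B :: "R2 => real" and o' w :: "R2 => R2" and V :: "R2 => real => R2 => real^2^2" and g :: "real => real"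
 assumes [measurable]: "c \<in> borel_measurable borel" "o' \<in> borel_measurable borel" "w \<in> borel_measurable borel"
   "B \<in> borel_measurable borel" "g \<in> borel_measurable borel"
  and V [measurable]: "(\<lambda>p. V (fst (fst p)) (snd (fst p)) (snd p)) \<in> borel_measurable borel"
  and X: "bounded X" "\<And>x. x \<notin> X ==> c x = 0" and c0: "\<And>x. \<bar>c x\<bar> \<le> c0" and t: "0 \<le> t" "t < L"
  and Vb: "\<And>x \<tau> y. x \<in> X ==> t \<le> \<tau> ==> \<tau> \<le> L ==> norm (V x \<tau> y) \<le> B x * g \<tau> * ind unit_square y"
  and B: "\<And>x. x \<in> X ==> 0 \<le> B x \<and> B x \<le> B0" and g: "\<And>\<tau>. t \<le> \<tau> ==> \<tau> \<le> L ==> 0 \<le> g \<tau> \<and> g \<tau> \<le> g0"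
  and tr: "\<And>x \<tau> y. trace (V x \<tau> y) = 0"
  and S: "\<And>x \<tau> y. x \<in> X ==> t \<le> \<tau> ==> \<tau> \<le> L ==> y \<in> unit_square ==> point (o' x) (w x) \<tau> y \<in> S" and bS: "bounded S"
 shows "tfrep S (4 * (LBINT \<tau>. ind {t..L} \<tau> * g \<tau>) * (LBINT x. \<bar>c x\<bar> * B x))
  (\<lambda>\<xi>. LBINT x. c x * (LBINT \<tau>. ind {t..L} \<tau> * (LBINT y. V x \<tau> y \<bullet> jacobian \<xi> (at (point (o' x) (w x) \<tau> y)))))"
proof -
 \<comment> \<open>The parameter \<tau> = 0 is removed because \<open>push_density\<close> works
   with positive scales only; it is a null set.\<close>
 define T where "T = {t..L} \<inter> {0<..}"
 have Tm [measurable]: "T \<in> sets borel" by (simp add: T_def)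
 define K where "K \<omega> y = (c (fst \<omega>) * ind T (snd \<omega>)) *\<^sub>R V (fst \<omega>) (snd \<omega>) y" for \<omega> y
 have TT: "AE \<tau> in lborel. ind T \<tau> = ind {t..L} \<tau>"
  using AE_lborel_singleton[of "0::real"] by eventually_elim (use t in \<open>auto simp: T_def indicator_def\<close>)
 have B0: "norm (K \<omega> y) \<le> \<bar>c (fst \<omega>)\<bar> * B (fst \<omega>) * (ind T (snd \<omega>) * g (snd \<omega>)) * ind unit_square y" for \<omega> y
 proof (cases "fst \<omega> \<in> X \<and> snd \<omega> \<in> T")
  case True
  then have "norm (V (fst \<omega>) (snd \<omega>) y) \<le> B (fst \<omega>) * g (snd \<omega>) * ind unit_square y" by (intro Vb) (auto simp: T_def)
  from mult_left_mono[OF this, of "\<bar>c (fst \<omega>)\<bar>"] show ?thesis using True by (simp add: K_def abs_mult mult_ac)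
 next
  case False
  then show ?thesis using X(2)[of "fst \<omega>"] by (auto simp: K_def)
 qed
 have f1: "(\<lambda>p. fst (fst p)) \<in> borel_measurable (borel :: ((R2 \<times> real) \<times> R2) measure)"
  and f2: "(\<lambda>p. snd (fst p)) \<in> borel_measurable (borel :: ((R2 \<times> real) \<times> R2) measure)"
  and f3: "snd \<in> borel_measurable (borel :: ((R2 \<times> real) \<times> R2) measure)"
  and f4: "fst \<in> borel_measurable (borel :: (R2 \<times> real) measure)"
  and f5: "snd \<in> borel_measurable (borel :: (R2 \<times> real) measure)" by (intro borel_measurable_continuous_onI continuous_intros)+
 note cm = measurable_compose[OF f1 assms(1)] and om = measurable_compose[OF f1 assms(2)] and wm = measurable_compose[OF f1 assms(3)]
  and Bm = measurable_compose[OF f1 assms(4)] and gm = measurable_compose[OF f2 assms(5)]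
 have Ti: "(\<lambda>p. ind T (snd (fst p))) \<in> borel_measurable (borel :: ((R2 \<times> real) \<times> R2) measure)"
  by (rule measurable_compose[OF f2]) simp
 have Km: "(\<lambda>p. K (fst p) (snd p)) \<in> borel_measurable borel" unfolding K_def
  by (intro borel_measurable_scaleR borel_measurable_times cm Ti V)
 define Z where "Z = (X \<times> {t..L}) \<times> unit_square"
 have bZ: "bounded Z" unfolding Z_def using X(1) by (intro bounded_Times) auto
 have K0: "K \<omega> y = 0" if "(\<omega>, y) \<notin> Z" for \<omega> y
 proof -
  have "fst \<omega> \<notin> X \<or> snd \<omega> \<notin> T \<or> y \<notin> unit_square" using that by (cases \<omega>) (auto simp: Z_def T_def)
  then show ?thesis
  proof (elim disjE)
   assume "y \<notin> unit_square" then show ?thesis using B0[of \<omega> y] by simp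
  qed (use X(2) in \<open>auto simp: K_def\<close>)
 qed
 have Kb: "norm (K \<omega> y) \<le> \<bar>c0\<bar> * \<bar>B0\<bar> * \<bar>g0\<bar>" for \<omega> y
 proof (cases "(\<omega>, y) \<in> Z \<and> snd \<omega> \<in> T")
  case True
  then have 1: "0 \<le> B (fst \<omega>)" "B (fst \<omega>) \<le> \<bar>B0\<bar>" "0 \<le> g (snd \<omega>)" "g (snd \<omega>) \<le> \<bar>g0\<bar>" "\<bar>c (fst \<omega>)\<bar> \<le> \<bar>c0\<bar>"
   using B[of "fst \<omega>"] g[of "snd \<omega>"] c0[of "fst \<omega>"] by (auto simp: Z_def mem_Times_iff)
  have "norm (K \<omega> y) \<le> \<bar>c (fst \<omega>)\<bar> * B (fst \<omega>) * g (snd \<omega>)" using B0[of \<omega> y] True by (simp add: Z_def)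
  also have "\<dots> \<le> \<bar>c0\<bar> * \<bar>B0\<bar> * \<bar>g0\<bar>" using 1 by (intro mult_mono mult_nonneg_nonneg) auto
  finally show ?thesis .
 next
  case False
  then have "K \<omega> y = 0" using K0[of \<omega> y] by (auto simp: K_def)
  then show ?thesis by simp
 qed
 have Kint: "integrable lborel (\<lambda>p. K (fst p) (snd p))"
  by (rule integrable_bounded_support[OF Km bZ, of "\<bar>c0\<bar> * \<bar>B0\<bar> * \<bar>g0\<bar>"]) (use K0 Kb in auto)
 let ?a = "\<lambda>\<omega>. o' (fst \<omega>) + snd \<omega> *\<^sub>R w (fst \<omega>)"
 have pt: "?a \<omega> + snd \<omega> *\<^sub>R y = point (o' (fst \<omega>)) (w (fst \<omega>)) (snd \<omega>) y" for \<omega> y by (simp add: point_def algebra_simps)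
 have KS: "?a \<omega> + snd \<omega> *\<^sub>R y \<in> S" if "K \<omega> y \<noteq> 0" for \<omega> y
  using K0[of \<omega> y] that unfolding pt by (cases \<omega>) (auto simp: Z_def intro: S)
 have trs: "trace (r *\<^sub>R M) = r * trace M" for r and M :: "real^2^2" by (simp add: trace_def sum_distrib_left)
 have "\<exists>G. integrable lborel G \<and> (\<forall>y. trace (G y) = 0) \<and> (\<forall>y. y \<notin> S \<longrightarrow> G y = 0) \<and>
  (LBINT y. norm (G y)) \<le> (LBINT p. norm (K (fst p) (snd p))) \<and>
  (\<forall>H C. H \<in> borel_measurable borel \<longrightarrow> (\<forall>y\<in>S. norm (H y) \<le> C) \<longrightarrow>
   (LBINT y. G y \<bullet> H y) = (LBINT p. K (fst p) (snd p) \<bullet> H (?a (fst p) + snd (fst p) *\<^sub>R snd p)))"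
 proof (rule push_density[OF Kint])
  show "K \<omega> y = 0" if "snd \<omega> \<le> 0" for \<omega> y using that by (simp add: K_def T_def)
  show "trace (K \<omega> y) = 0" for \<omega> y unfolding K_def trs tr by simp
  show "(\<lambda>\<omega>. o' (fst \<omega>) + snd \<omega> *\<^sub>R w (fst \<omega>)) \<in> borel_measurable borel"
   by (intro borel_measurable_add borel_measurable_scaleR f5 measurable_compose[OF f4] assms(2,3))
  show "snd \<in> borel_measurable (borel :: (R2 \<times> real) measure)" by (rule f5)
 qed (use KS in auto)
 then obtain G where G: "integrable lborel G" "\<And>y. trace (G y) = 0" "\<And>y. y \<notin> S ==> G y = 0"
  "(LBINT y. norm (G y)) \<le> (LBINT p. norm (K (fst p) (snd p)))"
  "\<And>H C. H \<in> borel_measurable borel ==> \<forall>y\<in>S. norm (H y) \<le> C ==>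
   (LBINT y. G y \<bullet> H y) = (LBINT p. K (fst p) (snd p) \<bullet> H (?a (fst p) + snd (fst p) *\<^sub>R snd p))" by blast
 have it: "(LBINT p. f (fst p) (snd p)) = (LBINT x. LBINT \<tau>. LBINT y. f (x, \<tau>) y)"
  if f: "(\<lambda>p. f (fst p) (snd p)) \<in> borel_measurable borel" "\<And>\<omega> y. (\<omega>, y) \<notin> Z ==> f \<omega> y = 0" "\<And>\<omega> y. \<bar>f \<omega> y\<bar> \<le> D"
  for f :: "(R2 \<times> real) => R2 => real" and D
 proof -
  have i: "integrable lborel (\<lambda>p. f (fst p) (snd p))" by (rule integrable_bounded_support[OF f(1) bZ, of D]) (use f in auto)
  then have i': "integrable (lborel \<Otimes>\<^sub>M lborel) (\<lambda>p. f (fst p) (snd p))" by (simp add: lborel_prod)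
  have "(LBINT p. f (fst p) (snd p)) = (LBINT \<omega>. LBINT y. f \<omega> y)" using lborel_pair.integral_fst'[OF i'] by (simp add: lborel_prod)
  moreover have "integrable (lborel \<Otimes>\<^sub>M lborel) (\<lambda>\<omega>. LBINT y. f \<omega> y)"
   using lborel_pair.integrable_fst'[OF i'] by (simp add: lborel_prod)
  from lborel_pair.integral_fst'[OF this]
  have "(LBINT \<omega>. LBINT y. f \<omega> y) = (LBINT x. LBINT \<tau>. LBINT y. f (x, \<tau>) y)" by (simp add: lborel_prod)
  ultimately show ?thesis by simp
 qed
 have cost: "(LBINT p. norm (K (fst p) (snd p))) \<le> 4 * (LBINT \<tau>. ind {t..L} \<tau> * g \<tau>) * (LBINT x. \<bar>c x\<bar> * B x)"
 proof -
  let ?f = "\<lambda>\<omega> y. \<bar>c (fst \<omega>)\<bar> * B (fst \<omega>) * (ind T (snd \<omega>) * g (snd \<omega>)) * ind unit_square y"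
  have fm: "(\<lambda>p. ?f (fst p) (snd p)) \<in> borel_measurable borel"
   by (intro borel_measurable_times borel_measurable_abs cm Bm Ti gm measurable_compose[OF f3]) simp
  have f0: "?f \<omega> y = 0" if "(\<omega>, y) \<notin> Z" for \<omega> y using that X(2)[of "fst \<omega>"]
   by (cases \<omega>) (auto simp: Z_def T_def indicator_def)
  have fb: "\<bar>?f \<omega> y\<bar> \<le> \<bar>c0\<bar> * \<bar>B0\<bar> * \<bar>g0\<bar>" for \<omega> y
  proof (cases "(\<omega>, y) \<in> Z \<and> snd \<omega> \<in> T")
   case True
   then have 1: "0 \<le> B (fst \<omega>)" "B (fst \<omega>) \<le> \<bar>B0\<bar>" "0 \<le> g (snd \<omega>)" "g (snd \<omega>) \<le> \<bar>g0\<bar>" "\<bar>c (fst \<omega>)\<bar> \<le> \<bar>c0\<bar>"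
    using B[of "fst \<omega>"] g[of "snd \<omega>"] c0[of "fst \<omega>"] by (auto simp: Z_def mem_Times_iff)
   have "\<bar>?f \<omega> y\<bar> = \<bar>c (fst \<omega>)\<bar> * B (fst \<omega>) * g (snd \<omega>)" using True 1 by (simp add: Z_def mem_Times_iff abs_mult)
   also have "\<dots> \<le> \<bar>c0\<bar> * \<bar>B0\<bar> * \<bar>g0\<bar>" using 1 by (intro mult_mono mult_nonneg_nonneg) auto
   finally show ?thesis .
  next
   case False
   then have fz: "?f \<omega> y = 0" using f0[of \<omega> y] by auto
   show ?thesis unfolding fz by simp
  qed
  have fint: "integrable lborel (\<lambda>p. ?f (fst p) (snd p))"
   by (rule integrable_bounded_support[OF fm bZ, of "\<bar>c0\<bar> * \<bar>B0\<bar> * \<bar>g0\<bar>"]) (use f0 fb in auto)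
  have "(LBINT p. norm (K (fst p) (snd p))) \<le> (LBINT p. ?f (fst p) (snd p))" by (intro integral_mono integrable_norm[OF Kint] fint B0)
  also have "\<dots> = (LBINT x. LBINT \<tau>. LBINT y. ?f (x, \<tau>) y)" by (rule it[OF fm f0 fb])
  also have "\<dots> = (LBINT x. \<bar>c x\<bar> * B x) * (LBINT \<tau>. ind T \<tau> * g \<tau>) * 4" by (simp add: measure_unit_square)
  also have "(LBINT \<tau>. ind T \<tau> * g \<tau>) = (LBINT \<tau>. ind {t..L} \<tau> * g \<tau>)"
   by (rule integral_cong_AE) (use TT in \<open>auto elim!: eventually_mono\<close>)
  finally show ?thesis by (simp add: mult_ac)
 qed
 have rep: "(LBINT x. c x * (LBINT \<tau>. ind {t..L} \<tau> * (LBINT y. V x \<tau> y \<bullet> jacobian \<xi> (at (point (o' x) (w x) \<tau> y)))))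
   = (LBINT y. G y \<bullet> jacobian \<xi> (at y))" if xi: "C1 \<xi>" for \<xi>
 proof -
  have Jm [measurable]: "(\<lambda>y. jacobian \<xi> (at y)) \<in> borel_measurable borel" by (rule C1_jacobian_measurable[OF xi])
  obtain C where C: "0 \<le> C" "\<And>y. y \<in> S ==> norm (jacobian \<xi> (at y)) \<le> C" using C1_jacobian_bounded[OF xi bS] by blast
  let ?f = "\<lambda>\<omega> y. K \<omega> y \<bullet> jacobian \<xi> (at (?a \<omega> + snd \<omega> *\<^sub>R y))"
  have am: "(\<lambda>p. ?a (fst p) + snd (fst p) *\<^sub>R snd p) \<in> borel_measurable (borel :: ((R2 \<times> real) \<times> R2) measure)"
   by (intro borel_measurable_add borel_measurable_scaleR f2 f3 om wm)
  have fm: "(\<lambda>p. ?f (fst p) (snd p)) \<in> borel_measurable borel" by (intro borel_measurable_inner Km measurable_compose[OF am Jm])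
  have f0: "?f \<omega> y = 0" if "(\<omega>, y) \<notin> Z" for \<omega> y using K0[OF that] by simp
  have fb: "\<bar>?f \<omega> y\<bar> \<le> \<bar>c0\<bar> * \<bar>B0\<bar> * \<bar>g0\<bar> * C" for \<omega> y
  proof (cases "K \<omega> y = 0")
   case False
   have "\<bar>?f \<omega> y\<bar> \<le> norm (K \<omega> y) * norm (jacobian \<xi> (at (?a \<omega> + snd \<omega> *\<^sub>R y)))" by (rule Cauchy_Schwarz_ineq2)
   also have "\<dots> \<le> \<bar>c0\<bar> * \<bar>B0\<bar> * \<bar>g0\<bar> * C" using Kb[of \<omega> y] C(2)[OF KS[OF False]] by (intro mult_mono) auto
   finally show ?thesis .
  qed (use C in simp)
  have "(LBINT y. G y \<bullet> jacobian \<xi> (at y)) = (LBINT p. ?f (fst p) (snd p))" by (rule G(5)[OF Jm, of C]) (use C in blast)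
  also have "\<dots> = (LBINT x. LBINT \<tau>. LBINT y. ?f (x, \<tau>) y)" by (rule it[OF fm f0 fb])
  also have "\<dots> = (LBINT x. c x * (LBINT \<tau>. ind T \<tau> * (LBINT y. V x \<tau> y \<bullet> jacobian \<xi> (at (point (o' x) (w x) \<tau> y)))))"
   unfolding pt by (simp add: K_def mult.assoc)
  also have "\<dots> = (LBINT x. c x * (LBINT \<tau>. ind {t..L} \<tau> * (LBINT y. V x \<tau> y \<bullet> jacobian \<xi> (at (point (o' x) (w x) \<tau> y)))))"
  proof (rule integral_cong[OF refl], rule arg_cong[of _ _ "\<lambda>z. c _ * z"])
   fix x
   have pm: "(\<lambda>p. point (o' x) (w x) (fst p) (snd p)) \<in> borel_measurable (borel :: (real \<times> R2) measure)"
    unfolding point_def by (intro borel_measurable_continuous_onI continuous_intros)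
   have "(\<lambda>p. ((x, fst p), snd p)) \<in> borel_measurable (borel :: (real \<times> R2) measure)"
    by (intro borel_measurable_continuous_onI continuous_intros)
   from measurable_compose[OF this V]
   have vm: "(\<lambda>p. V x (fst p) (snd p)) \<in> borel_measurable (borel :: (real \<times> R2) measure)" by simp
   have "(\<lambda>p. V x (fst p) (snd p) \<bullet> jacobian \<xi> (at (point (o' x) (w x) (fst p) (snd p)))) \<in> borel_measurable (lborel \<Otimes>\<^sub>M lborel)"
    using borel_measurable_inner[OF vm measurable_compose[OF pm Jm]] by (simp add: lborel_prod)
   then have m: "(\<lambda>\<tau>. LBINT y. V x \<tau> y \<bullet> jacobian \<xi> (at (point (o' x) (w x) \<tau> y))) \<in> borel_measurable lborel"
    using lborel.borel_measurable_lebesgue_integral[of "\<lambda>\<tau> y. V x \<tau> y \<bullet> jacobian \<xi> (at (point (o' x) (w x) \<tau> y))" lborel]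
    by (simp add: case_prod_unfold)
   show "(LBINT \<tau>. ind T \<tau> * (LBINT y. V x \<tau> y \<bullet> jacobian \<xi> (at (point (o' x) (w x) \<tau> y))))
    = (LBINT \<tau>. ind {t..L} \<tau> * (LBINT y. V x \<tau> y \<bullet> jacobian \<xi> (at (point (o' x) (w x) \<tau> y))))"
    by (rule integral_cong_AE) (use TT m in \<open>auto elim!: eventually_mono\<close>)
  qed
  finally show ?thesis by simp
 qed
 show ?thesis unfolding tfrep_def using G(1-4) cost rep by (intro exI[of _ G]) auto
qed


lemma kernel_measurable:
 "(\<lambda>p. kernel_div (fst p) (snd p)) \<in> borel_measurable borel" "(\<lambda>p. kernel_val i (fst p) (snd p)) \<in> borel_measurable borel"
 by (intro borel_measurable_continuous_onI kernel_cont continuous_intros)+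

text \<open>The centres run along the segment between z and b, which convexity keeps in the ball of
  radius R, and the squares about them have half-width at most L.\<close>

lemma segment_point:
 assumes w: "w = (1 / (L - t)) *\<^sub>R (b - z)" and t: "0 \<le> t" "t < L" "t \<le> \<tau>" "\<tau> \<le> L"
  and n: "norm b \<le> R" "norm z \<le> R" and y: "y \<in> unit_square"
 shows "norm (point (b - L *\<^sub>R w) w \<tau> y) \<le> R + 2 * L"
proof -
 define r where "r = (L - \<tau>) / (L - t)"
 have r: "0 \<le> r" "r \<le> 1" using t by (auto simp: r_def)
 have "point (b - L *\<^sub>R w) w \<tau> y = ((1 - r) *\<^sub>R b + r *\<^sub>R z) + \<tau> *\<^sub>R y"
  unfolding point_segment w r_def using t by (simp add: algebra_simps)
 also have "norm \<dots> \<le> norm ((1 - r) *\<^sub>R b + r *\<^sub>R z) + norm (\<tau> *\<^sub>R y)" by (rule norm_triangle_ineq)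
 also have "norm ((1 - r) *\<^sub>R b + r *\<^sub>R z) \<le> (1 - r) * R + r * R"
  using r n by (intro order_trans[OF norm_triangle_ineq] add_mono) (auto intro: mult_left_mono)
 also have "norm (\<tau> *\<^sub>R y) \<le> L * 2" using t norm_unit_square[OF y] by (auto intro!: mult_mono)
 finally show ?thesis by (simp add: algebra_simps)
qed

text \<open>160 is the area 4 times the kernel bound 40. The direction of the ray is the
  displacement divided by L - t, so with a final radius comparable to the displacement the cost is
  linear in the displacement.\<close>

lemma tfrep_mean:
 fixes c :: "R2 => real" and z b :: "R2 => R2"
 assumes [measurable]: "c \<in> borel_measurable borel" "z \<in> borel_measurable borel" "b \<in> borel_measurable borel"
  and X: "bounded X" "\<And>x. x \<notin> X ==> c x = 0" and c0: "\<And>x. \<bar>c x\<bar> \<le> c0"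
  and t: "0 \<le> t" "t < L" and n: "\<And>x. x \<in> X ==> norm (b x) \<le> R \<and> norm (z x) \<le> R"
 shows "tfrep (cball 0 (R + 2 * L)) (160 * L * (LBINT x. \<bar>c x\<bar> * (1 + norm (z x - b x) / (L - t))\<^sup>2))
  (\<lambda>\<xi>. LBINT x. c x * (mean \<xi> i (z x) t - mean \<xi> i (b x) L - (z x $ i - b x $ i) / 2 * mean_div \<xi> (b x) L))"
proof -
 define w where "w x = (1 / (L - t)) *\<^sub>R (b x - z x)" for x
 have wm [measurable]: "w \<in> borel_measurable borel" unfolding w_def[abs_def] by measurable
 have nw: "norm (w x) = norm (z x - b x) / (L - t)" for x using t by (simp add: w_def norm_minus_commute)
 have R: "0 \<le> R" if "x \<in> X" for x using n[OF that] norm_ge_zero[of "b x"] by linarith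
 have nwb: "norm (w x) \<le> 2 * R / (L - t)" if "x \<in> X" for x
  unfolding nw using n[OF that] norm_triangle_ineq4[of "z x" "b x"] t by (intro divide_right_mono) auto
 let ?B = "\<lambda>x. 40 * (1 + norm (w x))\<^sup>2"
 have "tfrep (cball 0 (R + 2 * L)) (4 * (LBINT \<tau>. ind {t..L} \<tau> * 1) * (LBINT x. \<bar>c x\<bar> * ?B x))
  (\<lambda>\<xi>. LBINT x. c x * (LBINT \<tau>. ind {t..L} \<tau> *
   (LBINT y. transport_val i t (w x) \<tau> y \<bullet> jacobian \<xi> (at (point (b x - L *\<^sub>R w x) (w x) \<tau> y)))))"
 proof (rule tfrep_transport[where X=X and ?c0.0=c0 and ?B0.0="40 * (1 + 2 * \<bar>R\<bar> / (L - t))\<^sup>2" and ?g0.0=1])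
  have f1: "(\<lambda>p. fst (fst p)) \<in> borel_measurable (borel :: ((R2 \<times> real) \<times> R2) measure)"
   and f2: "(\<lambda>p. snd (fst p)) \<in> borel_measurable (borel :: ((R2 \<times> real) \<times> R2) measure)"
   and f3: "snd \<in> borel_measurable (borel :: ((R2 \<times> real) \<times> R2) measure)"
   by (intro borel_measurable_continuous_onI continuous_intros)+
  have wf: "(\<lambda>p. w (fst (fst p))) \<in> borel_measurable (borel :: ((R2 \<times> real) \<times> R2) measure)"
   by (rule measurable_compose[OF f1 wm])
  have wi: "(\<lambda>p. w (fst (fst p)) $ i / 2) \<in> borel_measurable (borel :: ((R2 \<times> real) \<times> R2) measure)"
   by (rule measurable_compose[OF wf]) measurable
  have pr: "(\<lambda>p. (w (fst (fst p)), snd p)) \<in> borel_measurable (borel :: ((R2 \<times> real) \<times> R2) measure)"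
   by (intro borel_measurable_Pair wf f3)
  show "(\<lambda>p. transport_val i t (w (fst (fst p))) (snd (fst p)) (snd p)) \<in> borel_measurable (borel :: ((R2 \<times> real) \<times> R2) measure)"
   unfolding transport_val_def
   using measurable_compose[OF pr kernel_measurable(1)] measurable_compose[OF pr kernel_measurable(2)]
   by (intro borel_measurable_add borel_measurable_scaleR borel_measurable_times wi measurable_compose[OF f2 ramp_measurable]) auto
  show "norm (transport_val i t (w x) \<tau> y) \<le> 40 * (1 + norm (w x))\<^sup>2 * 1 * ind unit_square y" if "t \<le> \<tau>" for x \<tau> y
   using norm_transport_val[OF t(1) that] by simp
  show "0 \<le> 40 * (1 + norm (w x))\<^sup>2 \<and> 40 * (1 + norm (w x))\<^sup>2 \<le> 40 * (1 + 2 * \<bar>R\<bar> / (L - t))\<^sup>2" if "x \<in> X" for x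
   using nwb[OF that] R[OF that] by (auto intro!: power_mono)
  show "trace (transport_val i t (w x) \<tau> y) = 0" for x \<tau> y
  proof -
   have tk: "trace (kernel_val i (w x) y) = 0" "trace (kernel_div (w x) y) = 0" by (auto simp: kernel_val_def kernel_div_def trace_tfm)
   have "trace (A + r *\<^sub>R B) = trace A + r * trace B" for A B :: "real^2^2" and r
    by (simp add: trace_def sum.distrib sum_distrib_left)
   then show ?thesis using tk unfolding transport_val_def by simp
  qed
  show "point (b x - L *\<^sub>R w x) (w x) \<tau> y \<in> cball 0 (R + 2 * L)" if "x \<in> X" "t \<le> \<tau>" "\<tau> \<le> L" "y \<in> unit_square" for x \<tau> y
   using segment_point[OF w_def t(1,2) that(2,3) _ _ that(4)] n[OF that(1)] by simp
 qed (use X c0 t in \<open>auto\<close>)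
 from tfrep_scale[OF this, of "-1"] show ?thesis
 proof (rule tfrep_cong)
  have e1: "(LBINT \<tau>. ind {t..L} \<tau> * 1) = L - t" using t by simp
  have I0: "0 \<le> (LBINT x. \<bar>c x\<bar> * (1 + norm (z x - b x) / (L - t))\<^sup>2)" by (intro integral_nonneg) auto
  have e2: "(LBINT x. \<bar>c x\<bar> * ?B x) = 40 * (LBINT x. \<bar>c x\<bar> * (1 + norm (z x - b x) / (L - t))\<^sup>2)"
   unfolding nw by (subst integral_mult_right_zero[symmetric]) (simp add: mult_ac)
  have e3: "\<bar>-1\<bar> * (4 * a * (40 * I)) \<le> 160 * L * I" if "a \<le> L" "0 \<le> I" for a I :: real
   using mult_right_mono[OF that] by simp
  show "\<bar>-1\<bar> * (4 * (LBINT \<tau>. ind {t..L} \<tau> * 1) * (LBINT x. \<bar>c x\<bar> * ?B x))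
    \<le> 160 * L * (LBINT x. \<bar>c x\<bar> * (1 + norm (z x - b x) / (L - t))\<^sup>2)" unfolding e1 e2 by (rule e3[OF _ I0]) (use t in simp)
  fix \<xi> assume xi: "C1 \<xi>"
  have zz: "z x = b x - (L - t) *\<^sub>R w x" for x using t by (simp add: w_def)
  show "(LBINT x. c x * (mean \<xi> i (z x) t - mean \<xi> i (b x) L - (z x $ i - b x $ i) / 2 * mean_div \<xi> (b x) L))
   = - 1 * (LBINT x. c x * (LBINT \<tau>. ind {t..L} \<tau> *
   (LBINT y. transport_val i t (w x) \<tau> y \<bullet> jacobian \<xi> (at (point (b x - L *\<^sub>R w x) (w x) \<tau> y)))))"
   unfolding mean_transport[OF xi t zz] by simp
 qed
qed

lemma integral_inverse_Icc: assumes "0 < t" "t < L" shows "(LBINT \<tau>. ind {t..L} \<tau> * (1 / \<tau>)) = ln (L / t)"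
proof -
 have "((\<lambda>\<tau>. 1 / \<tau>) has_integral (ln L - ln t)) {t..L}" using assms by (intro fundamental_theorem_of_calculus)
   (auto simp: has_real_derivative_iff_has_vector_derivative[symmetric] intro!: derivative_eq_intros)
 moreover have "continuous_on {t..L} (\<lambda>\<tau>. 1 / \<tau>)" using assms by (intro continuous_on_divide continuous_intros) auto
 ultimately have "(LBINT \<tau>. ind {t..L} \<tau> * (1 / \<tau>)) = ln L - ln t" by (rule set_LINT_of_has_integral)
 then show ?thesis using assms by (simp add: ln_div)
qed

text \<open>The same superposition with the weight 1/\<tau>, whose integral over [t, L] is the
  logarithm in the cost.\<close>

lemma tfrep_mean_div:
 fixes c :: "R2 => real" and z b :: "R2 => R2"
 assumes [measurable]: "c \<in> borel_measurable borel" "z \<in> borel_measurable borel" "b \<in> borel_measurable borel"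
  and X: "bounded X" "\<And>x. x \<notin> X ==> c x = 0" and c0: "\<And>x. \<bar>c x\<bar> \<le> c0"
  and t: "0 < t" "t < L" and n: "\<And>x. x \<in> X ==> norm (b x) \<le> R \<and> norm (z x) \<le> R"
 shows "tfrep (cball 0 (R + 2 * L)) (160 * ln (L / t) * (LBINT x. \<bar>c x\<bar> * (1 + norm (z x - b x) / (L - t))))
  (\<lambda>\<xi>. LBINT x. c x * (mean_div \<xi> (z x) t - mean_div \<xi> (b x) L))"
proof -
 define w where "w x = (1 / (L - t)) *\<^sub>R (b x - z x)" for x
 have wm [measurable]: "w \<in> borel_measurable borel" unfolding w_def[abs_def] by measurable
 have nw: "norm (w x) = norm (z x - b x) / (L - t)" for x using t by (simp add: w_def norm_minus_commute)
 have R: "0 \<le> R" if "x \<in> X" for x using n[OF that] norm_ge_zero[of "b x"] by linarith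
 have nwb: "norm (w x) \<le> 2 * R / (L - t)" if "x \<in> X" for x
  unfolding nw using n[OF that] norm_triangle_ineq4[of "z x" "b x"] t by (intro divide_right_mono) auto
 let ?B = "\<lambda>x. 40 * (1 + norm (w x))"
 have "tfrep (cball 0 (R + 2 * L)) (4 * (LBINT \<tau>. ind {t..L} \<tau> * (1 / \<tau>)) * (LBINT x. \<bar>c x\<bar> * ?B x))
  (\<lambda>\<xi>. LBINT x. c x * (LBINT \<tau>. ind {t..L} \<tau> *
   (LBINT y. ((1 / \<tau>) *\<^sub>R kernel_div (w x) y) \<bullet> jacobian \<xi> (at (point (b x - L *\<^sub>R w x) (w x) \<tau> y)))))"
 proof (rule tfrep_transport[where X=X and ?c0.0=c0 and ?B0.0="40 * (1 + 2 * \<bar>R\<bar> / (L - t))" and ?g0.0="1 / t"])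
  have f1: "(\<lambda>p. fst (fst p)) \<in> borel_measurable (borel :: ((R2 \<times> real) \<times> R2) measure)"
   and f2: "(\<lambda>p. snd (fst p)) \<in> borel_measurable (borel :: ((R2 \<times> real) \<times> R2) measure)"
   and f3: "snd \<in> borel_measurable (borel :: ((R2 \<times> real) \<times> R2) measure)"
   by (intro borel_measurable_continuous_onI continuous_intros)+
  have wf: "(\<lambda>p. w (fst (fst p))) \<in> borel_measurable (borel :: ((R2 \<times> real) \<times> R2) measure)"
   by (rule measurable_compose[OF f1 wm])
  have pr: "(\<lambda>p. (w (fst (fst p)), snd p)) \<in> borel_measurable (borel :: ((R2 \<times> real) \<times> R2) measure)"
   by (intro borel_measurable_Pair wf f3)
  have "(\<lambda>p. 1 / snd (fst p)) \<in> borel_measurable (borel :: ((R2 \<times> real) \<times> R2) measure)"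
   by (rule measurable_compose[OF f2]) measurable
  then show "(\<lambda>p. (1 / snd (fst p)) *\<^sub>R kernel_div (w (fst (fst p))) (snd p)) \<in> borel_measurable (borel :: ((R2 \<times> real) \<times> R2) measure)"
   using measurable_compose[OF pr kernel_measurable(1)] by (intro borel_measurable_scaleR) auto
  show "norm ((1 / \<tau>) *\<^sub>R kernel_div (w x) y) \<le> 40 * (1 + norm (w x)) * (1 / \<tau>) * ind unit_square y" if "t \<le> \<tau>" for x \<tau> y
   using mult_left_mono[OF norm_kernel_div[of "w x" y], of "1 / \<tau>"] that t by (simp add: mult_ac)
  show "0 \<le> 40 * (1 + norm (w x)) \<and> 40 * (1 + norm (w x)) \<le> 40 * (1 + 2 * \<bar>R\<bar> / (L - t))" if "x \<in> X" for x
   using nwb[OF that] R[OF that] by auto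
  show "0 \<le> 1 / \<tau> \<and> 1 / \<tau> \<le> 1 / t" if "t \<le> \<tau>" for \<tau> using that t by (auto intro!: divide_left_mono)
  show "trace ((1 / \<tau>) *\<^sub>R kernel_div (w x) y) = 0" for x \<tau> y
  proof -
   have tk: "trace (kernel_div (w x) y) = 0" by (auto simp: kernel_div_def trace_tfm)
   show ?thesis using tk by (simp add: trace_def flip: sum_divide_distrib)
  qed
  show "point (b x - L *\<^sub>R w x) (w x) \<tau> y \<in> cball 0 (R + 2 * L)" if "x \<in> X" "t \<le> \<tau>" "\<tau> \<le> L" "y \<in> unit_square" for x \<tau> y
   using segment_point[OF w_def _ t(2) that(2,3) _ _ that(4)] n[OF that(1)] t by simp
 qed (use X c0 t in \<open>auto\<close>)
 then show ?thesis
 proof (rule tfrep_cong)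
  have "(LBINT x. \<bar>c x\<bar> * ?B x) = 40 * (LBINT x. \<bar>c x\<bar> * (1 + norm (z x - b x) / (L - t)))"
   unfolding nw by (subst integral_mult_right_zero[symmetric]) (simp add: mult_ac)
  then show "4 * (LBINT \<tau>. ind {t..L} \<tau> * (1 / \<tau>)) * (LBINT x. \<bar>c x\<bar> * ?B x)
    \<le> 160 * ln (L / t) * (LBINT x. \<bar>c x\<bar> * (1 + norm (z x - b x) / (L - t)))" unfolding integral_inverse_Icc[OF t] by simp
  fix \<xi> assume xi: "C1 \<xi>"
  have zz: "z x = b x - (L - t) *\<^sub>R w x" for x using t by (simp add: w_def)
  show "(LBINT x. c x * (mean_div \<xi> (z x) t - mean_div \<xi> (b x) L))
   = (LBINT x. c x * (LBINT \<tau>. ind {t..L} \<tau> *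
   (LBINT y. ((1 / \<tau>) *\<^sub>R kernel_div (w x) y) \<bullet> jacobian \<xi> (at (point (b x - L *\<^sub>R w x) (w x) \<tau> y)))))"
   unfolding mean_div_transport[OF xi t zz] by simp
 qed
qed

section \<open>The push-forward of a smooth map\<close>

lemma integrable_vec2_mult:
 fixes f g :: "real => real"
 assumes f: "integrable lborel f" and g: "integrable lborel g"
 shows "integrable lborel (\<lambda>y::R2. f (y $ 1) * g (y $ 2))"
proof -
 have [measurable]: "f \<in> borel_measurable borel" "g \<in> borel_measurable borel"
  using borel_measurable_integrable[OF f] borel_measurable_integrable[OF g] by simp_all
 have i: "integrable (lborel \<Otimes>\<^sub>M lborel) (\<lambda>p. f (fst p) * g (snd p))"
  by (rule lborel_pair.Fubini_integrable) (use f g in \<open>auto simp: abs_mult\<close>)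
 then show ?thesis by (subst lborel_vec2, subst integrable_distr_eq) auto
qed

section \<open>Cutoff functions in the target\<close>

definition cut0 :: "real => real" where
 "cut0 s = (max 0 (1 - (max 0 (s - 1))\<^sup>2 - (max 0 (- s - 1))\<^sup>2))\<^sup>2"
definition cut0' :: "real => real" where
 "cut0' s = 2 * max 0 (1 - (max 0 (s - 1))\<^sup>2 - (max 0 (- s - 1))\<^sup>2) * (- (2 * max 0 (s - 1)) + 2 * max 0 (- s - 1))"

lemma cut0_deriv: "(cut0 has_real_derivative cut0' s) (at s)"
proof -
 have a: "((\<lambda>s::real. s - 1) has_real_derivative 1) (at s)" "((\<lambda>s::real. - s - 1) has_real_derivative -1) (at s)"
  by (auto intro!: derivative_eq_intros)
 have "((\<lambda>s. 1 - (max 0 (s - 1))\<^sup>2 - (max 0 (- s - 1))\<^sup>2) has_real_derivative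
  (0 - 2 * max 0 (s - 1) * 1 - 2 * max 0 (- s - 1) * -1)) (at s)" by (intro DERIV_diff DERIV_const pos_part_power_deriv_chain(1) a)
 from pos_part_power_deriv_chain(1)[OF this] show ?thesis
  unfolding cut0_def[abs_def] cut0'_def by simp
qed

lemma cut0_bounds: "0 \<le> cut0 s" "cut0 s \<le> 1" "\<bar>cut0' s\<bar> \<le> 4"
proof -
 define a where "a = max 0 (s - 1)"
 define b where "b = max 0 (- s - 1)"
 define m where "m = max 0 (1 - a\<^sup>2 - b\<^sup>2)"
 have ab: "0 \<le> a" "0 \<le> b" "0 \<le> a\<^sup>2" "0 \<le> b\<^sup>2" by (auto simp: a_def b_def)
 have m: "0 \<le> m" "m \<le> 1" using ab(3,4) by (auto simp: m_def)
 have c: "cut0 s = m\<^sup>2" "cut0' s = 2 * m * (- (2 * a) + 2 * b)" by (simp_all add: cut0_def cut0'_def m_def a_def b_def)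
 show "0 \<le> cut0 s" by (simp add: c)
 show "cut0 s \<le> 1" unfolding c by (rule power_le_one[OF m])
 show "\<bar>cut0' s\<bar> \<le> 4"
 proof (cases "1 - a\<^sup>2 - b\<^sup>2 \<le> 0")
  case False
  then have "a\<^sup>2 \<le> 1" "b\<^sup>2 \<le> 1" using ab(3,4) by linarith+
  then have "a \<le> 1" "b \<le> 1" using abs_square_le_1[of a] abs_square_le_1[of b] ab(1,2) by simp_all
  then have "\<bar>- (2 * a) + 2 * b\<bar> \<le> 2" using ab(1,2) by linarith
  then have "\<bar>2 * m\<bar> * \<bar>- (2 * a) + 2 * b\<bar> \<le> 2 * 2" using m by (intro mult_mono) simp_all
  then show ?thesis unfolding c abs_mult[symmetric] by simp
 qed (simp add: c m_def)
qed

lemma cut0_eq: "\<bar>s\<bar> \<le> 1 ==> cut0 s = 1" "\<bar>s\<bar> \<le> 1 ==> cut0' s = 0" "2 \<le> \<bar>s\<bar> ==> cut0 s = 0" "2 \<le> \<bar>s\<bar> ==> cut0' s = 0"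
proof -
 assume "\<bar>s\<bar> \<le> 1"
 then have "max 0 (s - 1) = 0" "max 0 (- s - 1) = 0" by (auto simp: max_def)
 then show "cut0 s = 1" "cut0' s = 0" by (simp_all add: cut0_def cut0'_def)
next
 assume s: "2 \<le> \<bar>s\<bar>"
 have "1 \<le> (max 0 (s - 1))\<^sup>2 + (max 0 (- s - 1))\<^sup>2"
 proof (cases "s \<ge> 0")
  case True
  then have "1 \<le> max 0 (s - 1)" using s by auto
  then have "1 \<le> (max 0 (s - 1))\<^sup>2" by (rule one_le_power)
  then show ?thesis using zero_le_power2[of "max 0 (- s - 1)"] by linarith
 next
  case False
  then have "1 \<le> max 0 (- s - 1)" using s by auto
  then have "1 \<le> (max 0 (- s - 1))\<^sup>2" by (rule one_le_power)
  then show ?thesis using zero_le_power2[of "max 0 (s - 1)"] by linarith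
 qed
 then have "max 0 (1 - (max 0 (s - 1))\<^sup>2 - (max 0 (- s - 1))\<^sup>2) = 0" by simp
 then show "cut0 s = 0" "cut0' s = 0" by (simp_all only: cut0_def cut0'_def) auto
qed

lemma cut0_cont [continuous_intros]:
 "continuous_on S f ==> continuous_on S (\<lambda>x. cut0 (f x))" "continuous_on S f ==> continuous_on S (\<lambda>x. cut0' (f x))"
 unfolding cut0_def cut0'_def by (intro continuous_intros; assumption)+

definition chi :: "real => R2 => real" where "chi M y = cut0 (y $ 1 / M) * cut0 (y $ 2 / M)"
text \<open>The derivative of \<open>chi M\<close> at y in the direction e, the form needed for the
  chain rule along coordinate lines of the domain (\<open>chi_chain\<close>).\<close>

definition chi' :: "real => R2 => R2 => real" where
 "chi' M y e = cut0' (y $ 1 / M) * cut0 (y $ 2 / M) * e $ 1 / M + cut0 (y $ 1 / M) * cut0' (y $ 2 / M) * e $ 2 / M"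

lemma chi_bounds: "0 \<le> chi M y" "chi M y \<le> 1" unfolding chi_def using cut0_bounds by (auto intro!: mult_nonneg_nonneg mult_le_one)

lemma chi_cont [continuous_intros]: "continuous_on S f ==> M \<noteq> 0 ==> continuous_on S (\<lambda>x. chi M (f x))"
 unfolding chi_def by (auto intro!: continuous_intros)

lemma chi'_cont [continuous_intros]:
 "continuous_on S f ==> continuous_on S g ==> M \<noteq> 0 ==> continuous_on S (\<lambda>x. chi' M (f x) (g x))"
 unfolding chi'_def by (auto intro!: continuous_intros)

text \<open>A product cutoff is adapted to squares, hence the maximum norm: its derivative lives in
  the ring between M and 2 M, and for scales growing by factors of 4 such rings are
  disjoint.\<close>

lemma chi_eq:
 assumes "M > 0"
 shows "infnorm y \<le> M ==> chi M y = 1 \<and> chi' M y e = 0" "2 * M \<le> infnorm y ==> chi M y = 0 \<and> chi' M y e = 0"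
proof -
 have inf: "infnorm y = max \<bar>y $ 1\<bar> \<bar>y $ 2\<bar>" by (simp add: infnorm_2)
 { assume "infnorm y \<le> M"
  then have "\<bar>y $ 1 / M\<bar> \<le> 1" "\<bar>y $ 2 / M\<bar> \<le> 1" using assms by (auto simp: inf)
  then show "chi M y = 1 \<and> chi' M y e = 0" by (simp add: chi_def chi'_def cut0_eq) }
 { assume "2 * M \<le> infnorm y"
  then have "2 \<le> \<bar>y $ 1 / M\<bar> \<or> 2 \<le> \<bar>y $ 2 / M\<bar>" using assms by (auto simp: inf field_simps le_max_iff_disj)
  then show "chi M y = 0 \<and> chi' M y e = 0" by (auto simp: chi_def chi'_def cut0_eq) }
qed

lemma chi'_bound:
 assumes "M > 0" shows "\<bar>chi' M y e\<bar> \<le> 8 / M * norm e"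
proof -
 have b: "\<bar>a * c * e $ j / M\<bar> \<le> 4 / M * norm e" if "\<bar>a\<bar> * \<bar>c\<bar> \<le> 4" for a c j
 proof -
  have "\<bar>a * c * e $ j / M\<bar> = (\<bar>a\<bar> * \<bar>c\<bar>) * \<bar>e $ j\<bar> / M" using assms by (simp add: abs_mult)
  also have "\<dots> \<le> 4 * norm e / M" using that component_le_norm_cart[of e j] assms
   by (intro divide_right_mono mult_mono) auto
  finally show ?thesis by simp
 qed
 have "\<bar>cut0' s\<bar> * \<bar>cut0 t\<bar> \<le> 4" "\<bar>cut0 t\<bar> * \<bar>cut0' s\<bar> \<le> 4" for s t
  using mult_mono[OF cut0_bounds(3)[of s] cut0_bounds(2)[of t]] cut0_bounds(1)[of t] by (simp_all add: mult.commute)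
 then have "\<bar>cut0' (y $ 1 / M) * cut0 (y $ 2 / M) * e $ 1 / M\<bar> \<le> 4 / M * norm e"
  "\<bar>cut0 (y $ 1 / M) * cut0' (y $ 2 / M) * e $ 2 / M\<bar> \<le> 4 / M * norm e" by (blast intro: b)+
 moreover have "4 / M * norm e + 4 / M * norm e = 8 / M * norm e" by (simp add: field_simps)
 ultimately show ?thesis unfolding chi'_def using abs_triangle_ineq[of "cut0' (y $ 1 / M) * cut0 (y $ 2 / M) * e $ 1 / M" "cut0 (y $ 1 / M) * cut0' (y $ 2 / M) * e $ 2 / M"]
  by linarith
qed

lemma chi_chain:
 fixes v :: "R2 => R2"
 assumes "((\<lambda>h. v (x + h *\<^sub>R a)) has_vector_derivative e) (at 0)"
 shows "((\<lambda>h. chi M (v (x + h *\<^sub>R a))) has_real_derivative chi' M (v x) e) (at 0)"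
proof -
 have c: "((\<lambda>h. v (x + h *\<^sub>R a) $ j) has_real_derivative e $ j) (at 0)" for j
  using bounded_linear.has_vector_derivative[OF bounded_linear_vec_nth assms]
  by (simp add: has_real_derivative_iff_has_vector_derivative)
 have d: "((\<lambda>h. cut0 (v (x + h *\<^sub>R a) $ j / M)) has_real_derivative cut0' (v x $ j / M) * (e $ j / M)) (at 0)" for j
  by (rule DERIV_cong[OF DERIV_chain2[OF cut0_deriv DERIV_cdivide[OF c[of j], of M]]]) simp
 from DERIV_mult[OF d[of 1] d[of 2]] show ?thesis by (simp add: chi_def chi'_def algebra_simps)
qed

lemma infnorm_norm: "norm (y :: R2) \<le> 3/2 * infnorm y"
proof -
 have "sqrt 2 \<le> 3/2" by (rule real_le_lsqrt) (auto simp: power2_eq_square)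
 then have "sqrt (DIM(R2)) * infnorm y \<le> 3/2 * infnorm y" by (intro mult_right_mono) (auto simp: infnorm_pos_le)
 with norm_le_infnorm[of y] show ?thesis by linarith
qed

text \<open>A cutoff \<phi> in the domain, a map v, a target scale M and a smearing radius \<rho>.
  The only second derivative in play is the mixed one of the second component, which the null
  Lagrangian identity consumes; it enters no estimate, so mollification may make it as large as it
  likes.\<close>

locale smooth_map =
 fixes \<phi> :: "R2 => real" and d\<phi> :: "2 => R2 => real" and X :: "R2 set"
  and v :: "R2 => R2" and dv :: "2 => R2 => R2" and d12 :: "R2 => real"
  and M \<rho> :: real
 assumes phi_deriv: "((\<lambda>h. \<phi> (x + h *\<^sub>R axis j 1)) has_real_derivative d\<phi> j x) (at 0)"
  and phi_cont: "cont \<phi>" "cont (d\<phi> j)"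
  and phi_bounds: "0 \<le> \<phi> x" "\<phi> x \<le> 1"
  and phi_supp: "bounded X" "x \<notin> X ==> \<phi> x = 0" "x \<notin> X ==> d\<phi> j x = 0"
  and v_deriv: "((\<lambda>h. v (x + h *\<^sub>R axis j 1)) has_vector_derivative dv j x) (at 0)"
  and v_cont: "cont v" "cont (dv j)"
  and v_mixed: "((\<lambda>h. dv 2 (x + h *\<^sub>R axis 1 1) $ 2) has_real_derivative d12 x) (at 0)"
   "((\<lambda>h. dv 1 (x + h *\<^sub>R axis 2 1) $ 2) has_real_derivative d12 x) (at 0)"
  and d12_cont: "cont d12"
  and M: "0 < M" and \<rho>: "0 < \<rho>" "\<rho> \<le> M / 2"
begin

section \<open>The smeared push-forward and its mass\<close>

definition wt :: "R2 => real" where "wt x = \<phi> x * chi M (v x)"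
definition detv :: "R2 => real" where "detv x = dv 1 x $ 1 * dv 2 x $ 2 - dv 1 x $ 2 * dv 2 x $ 1"
definition divv :: "R2 => real" where "divv x = dv 1 x $ 1 + dv 2 x $ 2"
definition sqv :: "R2 => real" where "sqv x = (norm (dv 1 x))\<^sup>2 + (norm (dv 2 x))\<^sup>2"
text \<open>The trace-free part of the transposed Jacobian of v. The transpose appears because the
  i-th derivative of \<xi>_i(v) pairs the i-th derivative of v_k with entry (i, k) of the Jacobian
  of \<xi>.\<close>

definition Nv :: "R2 => real^2^2" where
 "Nv x = tfm ((dv 1 x $ 1 - dv 2 x $ 2) / 2) (dv 1 x $ 2) (dv 2 x $ 1)"
text \<open>As a function of Y this has integral \<open>wt x\<close>. Hence \<open>G1\<close> is the
  push-forward of \<open>wt\<close> times \<open>Nv\<close> under v, averaged over squares of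
  half-width \<rho> to obtain a density.\<close>

definition ker :: "R2 => R2 => real" where
 "ker x Y = wt x * (eta ((1 / \<rho>) *\<^sub>R (Y - v x)) / \<rho>\<^sup>2)"
definition G1 :: "R2 => real^2^2" where "G1 Y = (LBINT x. ker x Y *\<^sub>R Nv x)"

lemma wt_cont: "cont wt" unfolding wt_def using M by (intro continuous_intros phi_cont v_cont) auto
lemma wt_bounds: "0 \<le> wt x" "wt x \<le> 1"
 unfolding wt_def using phi_bounds[of x] chi_bounds[of M "v x"] by (auto intro!: mult_nonneg_nonneg mult_le_one)
lemma wt_supp: "x \<notin> X ==> wt x = 0" "2 * M \<le> infnorm (v x) ==> wt x = 0" using phi_supp(2) chi_eq(2)[OF M] by (auto simp: wt_def)

lemma Nv_cont: "cont Nv" unfolding Nv_def by (intro continuous_intros v_cont) auto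
lemma detv_cont: "cont detv" unfolding detv_def by (intro continuous_intros v_cont)
lemma sqv_cont: "cont sqv" unfolding sqv_def by (intro continuous_intros v_cont)
lemma divv_cont: "cont divv" unfolding divv_def by (intro continuous_intros v_cont)

lemma ker_supp: assumes "ker x Y \<noteq> 0" shows "x \<in> X" "norm (v x) \<le> 3 * M" "norm (Y - v x) \<le> 2 * \<rho>" "norm Y \<le> 4 * M"
proof -
 have w: "wt x \<noteq> 0" and e: "eta ((1 / \<rho>) *\<^sub>R (Y - v x)) \<noteq> 0" using assms by (auto simp: ker_def)
 show "x \<in> X" using w wt_supp(1) by blast
 have "infnorm (v x) \<le> 2 * M" using w wt_supp(2)[of x] by linarith
 then show v: "norm (v x) \<le> 3 * M" using infnorm_norm[of "v x"] by linarith
 have le2: "norm ((1 / \<rho>) *\<^sub>R (Y - v x)) \<le> 2" using e eta_zero norm_unit_square by blast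
 have "norm (Y - v x) = \<rho> * norm ((1 / \<rho>) *\<^sub>R (Y - v x))" unfolding norm_scaleR using \<rho> by simp
 also have "\<dots> \<le> \<rho> * 2" by (rule mult_left_mono[OF le2]) (use \<rho> in simp)
 finally show n: "norm (Y - v x) \<le> 2 * \<rho>" by simp
 show "norm Y \<le> 4 * M" using n v \<rho> norm_triangle_sub[of Y "v x"] by linarith
qed

lemma ker_nonneg: "0 \<le> ker x Y" unfolding ker_def using wt_bounds eta_bounds by auto

lemma ker_cont: "cont (\<lambda>p. ker (fst p) (snd p))"
proof -
 have "cont (\<lambda>p::R2 \<times> R2. wt (fst p))" "cont (\<lambda>p::R2 \<times> R2. v (fst p))"
  by (rule continuous_on_compose2[OF wt_cont] continuous_on_compose2[OF v_cont(1)]; auto intro!: continuous_intros)+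
 then show ?thesis unfolding ker_def using \<rho> by (intro continuous_intros) auto
qed

abbreviation "XY \<equiv> X \<times> (cball 0 (4 * M) :: R2 set)"

lemma ker_XY: "p \<notin> XY ==> ker (fst p) (snd p) = 0" using ker_supp(1,4)[of "fst p" "snd p"] by (auto simp: mem_Times_iff)

lemma bounded_XY: "bounded XY" using phi_supp(1) by (intro bounded_Times) auto

lemma fst_comp_cont: "cont f ==> cont (\<lambda>p::R2 \<times> R2. f (fst p))"
 by (rule continuous_on_compose2[of UNIV f]) (auto intro!: continuous_intros)
lemma snd_comp_cont: "cont f ==> cont (\<lambda>p::R2 \<times> R2. f (snd p))"
 by (rule continuous_on_compose2[of UNIV f]) (auto intro!: continuous_intros)

lemma ker_integrable:
 fixes f :: "R2 \<times> R2 => 'b::euclidean_space"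
 assumes "cont f"
 shows "integrable (lborel \<Otimes>\<^sub>M lborel) (\<lambda>(x, Y). ker x Y *\<^sub>R f (x, Y))"
proof -
 have "integrable lborel (\<lambda>p. ker (fst p) (snd p) *\<^sub>R f p)"
  by (rule integrable_continuous_support[OF _ bounded_XY]) (auto intro!: continuous_intros ker_cont assms simp: ker_XY)
 then show ?thesis by (simp add: lborel_prod case_prod_unfold)
qed

lemma ker_Y_integral: "(LBINT Y. ker x Y * f Y) = wt x * (LBINT y. eta y * f (v x + \<rho> *\<^sub>R y))"
 if "f \<in> borel_measurable borel" for f
proof -
 have m: "(\<lambda>Y. ker x Y * f Y) \<in> borel_measurable borel" unfolding ker_def using that by measurable
 have "(LBINT Y. ker x Y * f Y) = \<rho>\<^sup>2 *\<^sub>R (LBINT y. ker x (v x + \<rho> *\<^sub>R y) * f (v x + \<rho> *\<^sub>R y))"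
  by (rule lborel_affine_plane[OF m \<rho>(1)])
 also have "\<dots> = (LBINT y. \<rho>\<^sup>2 * (ker x (v x + \<rho> *\<^sub>R y) * f (v x + \<rho> *\<^sub>R y)))" by simp
 also have "\<dots> = (LBINT y. wt x * (eta y * f (v x + \<rho> *\<^sub>R y)))" using \<rho> by (intro integral_cong) (auto simp: ker_def)
 finally show ?thesis by simp
qed

lemma G1_integrable: "integrable lborel G1"
proof -
 have "integrable (lborel \<Otimes>\<^sub>M lborel) (\<lambda>(x, Y). ker x Y *\<^sub>R Nv x)"
  using ker_integrable[OF fst_comp_cont[OF Nv_cont]] by simp
 from lborel_pair.integrable_snd[OF this] show ?thesis unfolding G1_def[abs_def] .
qed

lemma ker_x_integrable:
 fixes f :: "R2 => 'b::euclidean_space"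
 assumes f: "cont f" shows "integrable lborel (\<lambda>x. ker x Y *\<^sub>R f x)"
proof -
 have "cont (\<lambda>x. ker x Y)"
 proof -
  have "cont (\<lambda>x::R2. (x, Y))" by (intro continuous_intros)
  from continuous_on_compose2[OF ker_cont this] show ?thesis by simp
 qed
 then show ?thesis
  by (intro integrable_continuous_support[OF _ phi_supp(1)] continuous_intros f) (auto dest: ker_supp(1))
qed

lemma G1_zero: "Y \<notin> cball 0 (5 * M) ==> G1 Y = 0"
proof -
 assume "Y \<notin> cball 0 (5 * M)"
 then have "ker x Y = 0" for x using ker_supp(4)[of x Y] M by fastforce
 then show ?thesis by (simp add: G1_def)
qed

lemma G1_linear:
 assumes f: "bounded_linear f"
 shows "f (G1 Y) = (LBINT x. ker x Y *\<^sub>R f (Nv x))"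
proof -
 have "(LBINT x. f (ker x Y *\<^sub>R Nv x)) = f (G1 Y)" unfolding G1_def by (rule integral_bounded_linear[OF f ker_x_integrable[OF Nv_cont]])
 then show ?thesis by (simp add: linear_simps[OF f])
qed

lemma bounded_linear_entry: "bounded_linear (\<lambda>N::real^2^2. N $ i $ j)"
 by (rule bounded_linear_compose[OF bounded_linear_vec_nth bounded_linear_vec_nth])

lemma trace_G1: "trace (G1 Y) = 0"
proof -
 have bl: "bounded_linear (trace :: real^2^2 => real)" unfolding trace_def sum_2 by (intro bounded_linear_add bounded_linear_entry)
 show ?thesis unfolding G1_linear[OF bl] by (simp add: Nv_def trace_tfm)
qed

lemma G1_functional:
 assumes xi: "C1 \<xi>"
 shows "(LBINT Y. G1 Y \<bullet> jacobian \<xi> (at Y))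
  = (LBINT x. wt x * (LBINT y. eta y * (Nv x \<bullet> jacobian \<xi> (at (v x + \<rho> *\<^sub>R y)))))"
proof -
 let ?J = "\<lambda>Y. jacobian \<xi> (at Y)"
 have i: "integrable (lborel \<Otimes>\<^sub>M lborel) (\<lambda>(x, Y). ker x Y * (Nv x \<bullet> ?J Y))"
  using ker_integrable[of "\<lambda>p. Nv (fst p) \<bullet> ?J (snd p)"]
   continuous_on_inner[OF fst_comp_cont[OF Nv_cont] snd_comp_cont[OF C1_jacobian_continuous[OF xi continuous_on_id]]] by simp
 have "(LBINT Y. G1 Y \<bullet> ?J Y) = (LBINT Y. LBINT x. ker x Y * (Nv x \<bullet> ?J Y))" by (simp add: G1_linear[OF bounded_linear_inner_left])
 also have "\<dots> = (LBINT x. LBINT Y. ker x Y * (Nv x \<bullet> ?J Y))" by (rule lborel_pair.Fubini_integral[OF i])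
 also have "\<dots> = (LBINT x. wt x * (LBINT y. eta y * (Nv x \<bullet> ?J (v x + \<rho> *\<^sub>R y))))"
  using C1_jacobian_measurable[OF xi] by (intro integral_cong refl ker_Y_integral) auto
 finally show ?thesis .
qed

text \<open>The kernel is \<phi> times a function p of v_1 times the same kind of function of v_2.
  If P is a primitive of the first factor, then p(v_1) p(v_2) det Dv is the curl of P(v_1) p(v_2)
  times the gradient of v_2, and integration by parts leaves only derivatives of \<phi>. The bound
  is free of \<rho> because p has integral at most 1 in its first argument; 4 M is the length of the
  interval [-2M, 2M] that supports it in the second.\<close>

lemma G1_null_lagrangian:
 "(LBINT Y. \<bar>LBINT x. ker x Y * detv x\<bar>)
  \<le> 4 * M * (LBINT x. \<bar>d\<phi> 1 x\<bar> * \<bar>dv 2 x $ 2\<bar> + \<bar>d\<phi> 2 x\<bar> * \<bar>dv 1 x $ 2\<bar>)"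
proof -
 define p where "p a r = cut0 (r / M) * (kb ((a - r) / \<rho>) / \<rho>)" for a r
 define p' where "p' a r = cut0 (r / M) * (kb' ((a - r) / \<rho>) * (- 1 / \<rho>) / \<rho>) + cut0' (r / M) / M * (kb ((a - r) / \<rho>) / \<rho>)" for a r
 have p0: "0 \<le> p a r" for a r unfolding p_def using cut0_bounds k_bounds \<rho> by auto
 have pc: "cont (p a)" "cont (p' a)" for a
  unfolding p_def[abs_def] p'_def[abs_def] using M \<rho> by (intro continuous_intros; simp)+
 have pd: "(p a has_real_derivative p' a r) (at r)" for a r
 proof -
  have 1: "((\<lambda>r. cut0 (r / M)) has_real_derivative cut0' (r / M) * (1 / M)) (at r)"
   by (rule DERIV_chain2[OF cut0_deriv DERIV_cdivide[OF DERIV_ident]])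
  have 2: "((\<lambda>r. (a - r) / \<rho>) has_real_derivative (- 1 / \<rho>)) (at r)" using \<rho>(1) by (auto intro!: derivative_eq_intros)
  from DERIV_mult[OF 1 DERIV_cdivide[OF DERIV_chain2[OF kb_deriv 2], of \<rho>]]
  show ?thesis unfolding p_def[abs_def] p'_def by (simp add: algebra_simps)
 qed
 have pz: "p a r = 0" if "2 * M \<le> \<bar>r\<bar>" for a r
  using that M by (simp add: p_def cut0_eq(3) field_simps abs_if split: if_splits)
 have kereq: "ker x Y = \<phi> x * p (Y $ 1) (v x $ 1) * p (Y $ 2) (v x $ 2)" for x Y
  by (simp add: ker_def wt_def chi_def p_def eta_def power2_eq_square)
 \<comment> \<open>The total increase of a primitive of p. It bounds the primitive that vanishes at
   -2M, uniformly in the second argument.\<close>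
 define Pb where "Pb a = (LBINT r. ind {-2*M..2*M} r * p a r)" for a
 have "\<exists>P. (\<forall>s. (P has_real_derivative p a s) (at s)) \<and> (\<forall>s. \<bar>P s\<bar> \<le> Pb a)" for a
 proof -
  have "\<exists>F. \<forall>x::real. -\<infinity> < ereal x \<longrightarrow> ereal x < \<infinity> \<longrightarrow> (F has_vector_derivative p a x) (at x)"
   by (rule einterval_antiderivative) (use pc(1) in \<open>auto simp: continuous_on_eq_continuous_at\<close>)
  then obtain F where F: "\<And>s. (F has_real_derivative p a s) (at s)" unfolding has_real_derivative_iff_has_vector_derivative by auto
  have mono: "F s \<le> F t" if "s \<le> t" for s t
   using DERIV_nonneg_imp_nondecreasing[OF that, of F] F p0 by blast
  have "((\<lambda>r. p a r) has_integral (F (2*M) - F (-2*M))) {-2*M..2*M}" using M F by (intro fundamental_theorem_of_calculus)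
    (auto simp: has_real_derivative_iff_has_vector_derivative[symmetric] intro: has_field_derivative_at_within)
  then have PbF: "Pb a = F (2*M) - F (-2*M)" unfolding Pb_def by (rule set_LINT_of_has_integral) (rule continuous_on_subset[OF pc(1)], simp)
  have const: "F s = F t" if "\<And>r. s \<le> r ==> r \<le> t ==> p a r = 0" "s \<le> t" for s t
  proof -
   have "F t \<le> F s"
   proof (rule DERIV_nonpos_imp_nonincreasing[OF that(2)])
    fix x assume "s \<le> x" "x \<le> t"
    then show "\<exists>y. DERIV F x :> y \<and> y \<le> 0" using F[of x] that(1)[of x] by auto
   qed
   with mono[OF that(2)] show ?thesis by simp
  qed
  have "F (-2*M) \<le> F s \<and> F s \<le> F (2*M)" for s
  proof -
   consider "s \<le> -2*M" | "-2*M \<le> s" "s \<le> 2*M" | "2*M \<le> s" by linarith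
   then show ?thesis
   proof cases
    case 1
    then have "F s = F (-2*M)" by (intro const pz) auto
    then show ?thesis using mono[of "-2*M" "2*M"] M by simp
   next
    case 3
    then have "F (2*M) = F s" by (intro const pz) auto
    then show ?thesis using mono[of "-2*M" "2*M"] M by simp
   qed (use mono in auto)
  qed
  then have "\<bar>F s - F (-2*M)\<bar> \<le> Pb a" for s unfolding PbF by (simp add: abs_le_iff)
  moreover have "((\<lambda>s. F s - F (-2*M)) has_real_derivative p a s) (at s)" for s
   using DERIV_diff[OF F DERIV_const] by simp
  ultimately show ?thesis by (intro exI[of _ "\<lambda>s. F s - F (-2*M)"]) auto
 qed
 then obtain P where P: "\<And>a s. (P a has_real_derivative p a s) (at s)" "\<And>a s. \<bar>P a s\<bar> \<le> Pb a" by metis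
 have Pc: "cont (P a)" for a using P(1) by (auto intro: DERIV_continuous_on)
 define D where "D x = \<bar>d\<phi> 1 x\<bar> * \<bar>dv 2 x $ 2\<bar> + \<bar>d\<phi> 2 x\<bar> * \<bar>dv 1 x $ 2\<bar>" for x
 have Dc: "cont D" unfolding D_def by (intro continuous_intros v_cont phi_cont)
 have D0: "0 \<le> D x" for x by (simp add: D_def)
 have Ds: "D x = 0" if "x \<notin> X" for x using phi_supp(3)[OF that] by (simp add: D_def)
 have comp: "cont (\<lambda>x. g (v x $ j))" if "cont g" for g :: "real => real" and j
  by (rule continuous_on_compose2[OF that]) (auto intro!: continuous_intros v_cont)
 have J: "\<bar>LBINT x. ker x Y * detv x\<bar> \<le> (LBINT x. D x * (Pb (Y $ 1) * p (Y $ 2) (v x $ 2)))" for Y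
 proof -
  let ?a = "Y $ 1" and ?b = "Y $ 2"
  let ?P = "\<lambda>x. P ?a (v x $ 1)" and ?f = "\<lambda>x. p ?b (v x $ 2)" and ?f' = "\<lambda>x. p' ?b (v x $ 2)" and ?q = "\<lambda>x. p ?a (v x $ 1)"
  have vd: "((\<lambda>h. v (x + h *\<^sub>R axis j 1) $ i) has_real_derivative dv j x $ i) (at 0)" for x i j
   using bounded_linear.has_vector_derivative[OF bounded_linear_vec_nth v_deriv]
   by (simp add: has_real_derivative_iff_has_vector_derivative)
  have dP: "((\<lambda>h. ?P (x + h *\<^sub>R axis j 1)) has_real_derivative ?q x * dv j x $ 1) (at 0)" for x j
   using DERIV_chain2[OF P(1) vd[of x j 1]] by simp
  have df: "((\<lambda>h. ?f (x + h *\<^sub>R axis j 1)) has_real_derivative ?f' x * dv j x $ 2) (at 0)" for x j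
   using DERIV_chain2[OF pd vd[of x j 2]] by simp
  let ?F1 = "\<lambda>x. \<phi> x * (?P x * (?f x * dv 2 x $ 2))" and ?F2 = "\<lambda>x. \<phi> x * (?P x * (?f x * dv 1 x $ 2))"
  \<comment> \<open>The derivative of \<open>?F1\<close> in direction 1 and that of
    \<open>?F2\<close> in direction 2; in their difference the terms with \<open>d12\<close> and
    those with \<open>p'\<close> cancel.\<close>
  let ?R1 = "\<lambda>x. \<phi> x * (?P x * (?f x * d12 x + ?f' x * dv 1 x $ 2 * dv 2 x $ 2) + ?q x * dv 1 x $ 1 * (?f x * dv 2 x $ 2)) + d\<phi> 1 x * (?P x * (?f x * dv 2 x $ 2))"
  let ?R2 = "\<lambda>x. \<phi> x * (?P x * (?f x * d12 x + ?f' x * dv 2 x $ 2 * dv 1 x $ 2) + ?q x * dv 2 x $ 1 * (?f x * dv 1 x $ 2)) + d\<phi> 2 x * (?P x * (?f x * dv 1 x $ 2))"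
  have cR: "cont ?F1" "cont ?F2" "cont ?R1" "cont ?R2"
   by (intro continuous_intros v_cont phi_cont d12_cont comp[OF Pc] comp[OF pc(1)] comp[OF pc(2)])+
  have z: "?F1 x = 0" "?F2 x = 0" "?R1 x = 0" "?R2 x = 0" if "x \<notin> X" for x using phi_supp(2,3)[OF that] by auto
  have iR: "integrable lborel ?R1" "integrable lborel ?R2"
   using integrable_continuous_support[OF cR(3) phi_supp(1) z(3)] integrable_continuous_support[OF cR(4) phi_supp(1) z(4)] by blast+
  have m: "?F1 \<in> borel_measurable borel" "?F2 \<in> borel_measurable borel" "?R1 \<in> borel_measurable borel" "?R2 \<in> borel_measurable borel"
   by (intro borel_measurable_continuous_onI cR)+
  obtain b1 where b1: "\<And>x. norm (?F1 x) \<le> b1" using continuous_bounded_support[OF cR(1) phi_supp(1) z(1)] by metis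
  obtain b2 where b2: "\<And>x. norm (?F2 x) \<le> b2" using continuous_bounded_support[OF cR(2) phi_supp(1) z(2)] by metis
  obtain b3 where b3: "\<And>x. norm (?R1 x) \<le> b3" using continuous_bounded_support[OF cR(3) phi_supp(1) z(3)] by metis
  obtain b4 where b4: "\<And>x. norm (?R2 x) \<le> b4" using continuous_bounded_support[OF cR(4) phi_supp(1) z(4)] by metis
  have i1: "(LBINT x. ?R1 x) = 0"
  proof (rule integral_directional_derivative_zero[OF _ m(1) m(3) b3[unfolded real_norm_def] phi_supp(1) z(1) b1[unfolded real_norm_def]])
   fix x
   have "((\<lambda>h. ?f (x + h *\<^sub>R axis 1 1) * dv 2 (x + h *\<^sub>R axis 1 1) $ 2) has_real_derivative ?f x * d12 x + ?f' x * dv 1 x $ 2 * dv 2 x $ 2) (at 0)"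
    using DERIV_mult[OF df[of x 1] v_mixed(1)[of x]] by (simp add: algebra_simps)
   from DERIV_mult[OF phi_deriv[of x 1] DERIV_mult[OF dP[of x 1] this]]
   show "((\<lambda>h. ?F1 (x + h *\<^sub>R axis 1 1)) has_real_derivative ?R1 x) (at 0)" by (simp add: algebra_simps)
  qed
  have i2: "(LBINT x. ?R2 x) = 0"
  proof (rule integral_directional_derivative_zero[OF _ m(2) m(4) b4[unfolded real_norm_def] phi_supp(1) z(2) b2[unfolded real_norm_def]])
   fix x
   have "((\<lambda>h. ?f (x + h *\<^sub>R axis 2 1) * dv 1 (x + h *\<^sub>R axis 2 1) $ 2) has_real_derivative ?f x * d12 x + ?f' x * dv 2 x $ 2 * dv 1 x $ 2) (at 0)"
    using DERIV_mult[OF df[of x 2] v_mixed(2)[of x]] by (simp add: algebra_simps)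
   from DERIV_mult[OF phi_deriv[of x 2] DERIV_mult[OF dP[of x 2] this]]
   show "((\<lambda>h. ?F2 (x + h *\<^sub>R axis 2 1)) has_real_derivative ?R2 x) (at 0)" by (simp add: algebra_simps)
  qed
  let ?E = "\<lambda>x. (d\<phi> 1 x * dv 2 x $ 2 - d\<phi> 2 x * dv 1 x $ 2) * (?P x * ?f x)"
  have E: "ker x Y * detv x = (?R1 x - ?R2 x) - ?E x" for x
   unfolding kereq detv_def by (simp add: algebra_simps)
  have iE: "integrable lborel ?E" by (rule integrable_continuous_support[OF _ phi_supp(1)])
    (auto intro!: continuous_intros v_cont phi_cont comp[OF Pc] comp[OF pc(1)] simp: phi_supp(3))
  have "(LBINT x. ker x Y * detv x) = - (LBINT x. ?E x)" unfolding E using iR iE i1 i2 by (subst integral_diff) (auto simp: integral_diff[OF iR])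
  then have "\<bar>LBINT x. ker x Y * detv x\<bar> \<le> (LBINT x. norm (?E x))" using integral_norm_bound[of lborel ?E] by simp
  also have "\<dots> \<le> (LBINT x. D x * (Pb ?a * ?f x))"
  proof (rule integral_mono)
   show "integrable lborel (\<lambda>x. norm (?E x))" using iE by simp
   show "integrable lborel (\<lambda>x. D x * (Pb ?a * ?f x))"
    by (rule integrable_continuous_support[OF _ phi_supp(1)]) (auto intro!: continuous_intros Dc comp[OF pc(1)] simp: Ds)
   fix x
   have "\<bar>d\<phi> 1 x * dv 2 x $ 2 - d\<phi> 2 x * dv 1 x $ 2\<bar> \<le> D x" unfolding D_def abs_mult[symmetric] by (rule abs_triangle_ineq4)
   then have "\<bar>d\<phi> 1 x * dv 2 x $ 2 - d\<phi> 2 x * dv 1 x $ 2\<bar> * (\<bar>?P x\<bar> * ?f x) \<le> D x * (Pb ?a * ?f x)"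
    using P(2)[of ?a "v x $ 1"] p0 D0 by (intro mult_mono mult_right_mono mult_nonneg_nonneg) auto
   then show "norm (?E x) \<le> D x * (Pb ?a * ?f x)" using p0 by (simp add: abs_mult)
  qed
  finally show ?thesis .
 qed
 have pm: "(\<lambda>q. p (fst q) (snd q)) \<in> borel_measurable (borel :: (real \<times> real) measure)"
  unfolding p_def using M \<rho> by (intro borel_measurable_continuous_onI continuous_intros) auto
 have kint: "integrable lborel (\<lambda>a. kb ((a - r) / \<rho>) / \<rho>)" "(LBINT a. kb ((a - r) / \<rho>) / \<rho>) = 1" for r
 proof -
  have "integrable lborel (\<lambda>a. kb (- r / \<rho> + (1 / \<rho>) * a))" using \<rho> kb_integrable by (intro lborel_integrable_real_affine) auto
  then show "integrable lborel (\<lambda>a. kb ((a - r) / \<rho>) / \<rho>)" by (simp add: diff_divide_distrib add.commute)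
  have "(LBINT a. kb a) = \<bar>1 / \<rho>\<bar> *\<^sub>R (LBINT a. kb (- r / \<rho> + (1 / \<rho>) * a))"
   using \<rho> by (intro lborel_integral_real_affine) auto
  then show "(LBINT a. kb ((a - r) / \<rho>) / \<rho>) = 1" using \<rho> kb_integral by (simp add: diff_divide_distrib add.commute)
 qed
 have pint: "(LBINT a. p a r) \<le> 1" "integrable lborel (\<lambda>a. p a r)" for r
 proof -
  show "integrable lborel (\<lambda>a. p a r)" unfolding p_def by (rule integrable_mult_right[OF kint(1)])
  have "(LBINT a. p a r) = cut0 (r / M) * (LBINT a. kb ((a - r) / \<rho>) / \<rho>)" unfolding p_def by (rule integral_mult_right_zero)
  then show "(LBINT a. p a r) \<le> 1" unfolding kint(2) using cut0_bounds(2)[of "r / M"] by simp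
 qed
 have Pbm: "Pb \<in> borel_measurable borel" and Pbi: "integrable lborel Pb" and Pbl: "(LBINT a. Pb a) \<le> 4 * M" and Pb0: "\<And>a. 0 \<le> Pb a"
 proof -
  have c: "cont (\<lambda>q. p (fst q) (snd q))" unfolding p_def using M \<rho> by (intro continuous_intros) auto
  define S where "S = {-(2*M+\<rho>)..2*M+\<rho>} \<times> {-2*M..2*M}"
  have bS: "bounded S" unfolding S_def by (intro bounded_Times) auto
  let ?h = "\<lambda>q. ind {-2*M..2*M} (snd q) * p (fst q) (snd q)"
  have pz2: "p a r = 0" if "\<rho> \<le> \<bar>a - r\<bar>" for a r
   using that \<rho> by (simp add: p_def k_zero(1) field_simps abs_if split: if_splits)
  have hz: "?h q = 0" if "q \<notin> S" for q
  proof (cases "snd q \<in> {-2*M..2*M}")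
   case True
   then have "fst q \<notin> {-(2*M+\<rho>)..2*M+\<rho>}" using that by (cases q) (auto simp: S_def)
   then have "\<rho> \<le> \<bar>fst q - snd q\<bar>" using True by (auto simp: abs_if)
   then show ?thesis by (simp add: pz2)
  qed simp
  obtain C where C: "\<And>q. q \<in> S ==> \<bar>p (fst q) (snd q)\<bar> \<le> C"
  proof -
   have "compact ((\<lambda>q. p (fst q) (snd q)) ` S)" unfolding S_def
    by (intro compact_continuous_image continuous_on_subset[OF c] compact_Times) auto
   then have "bounded ((\<lambda>q. p (fst q) (snd q)) ` S)" by (rule compact_imp_bounded)
   then show ?thesis using that unfolding bounded_iff by auto
  qed
  have "snd \<in> borel_measurable (borel :: (real \<times> real) measure)" by (intro borel_measurable_continuous_onI continuous_intros)
  then have hm: "?h \<in> borel_measurable borel" by (intro borel_measurable_times pm measurable_compose[of snd _ borel "ind {-2*M..2*M}"]) auto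
  have "integrable lborel ?h"
  proof (rule integrable_bounded_support[OF hm bS hz])
   show "norm (?h q) \<le> \<bar>C\<bar>" for q using C[of q] hz[of q] by (cases "q \<in> S") (auto simp: indicator_def)
  qed
  then have hi: "integrable (lborel \<Otimes>\<^sub>M lborel) (\<lambda>(a, r). ind {-2*M..2*M} r * p a r)" by (simp add: lborel_prod case_prod_unfold)
  show Pbi: "integrable lborel Pb" unfolding Pb_def[abs_def] by (rule lborel_pair.integrable_fst[OF hi])
  then show "Pb \<in> borel_measurable borel" by (auto dest: borel_measurable_integrable)
  show "0 \<le> Pb a" for a unfolding Pb_def using p0 by (intro integral_nonneg) auto
  have "(LBINT a. Pb a) = (LBINT r. LBINT a. ind {-2*M..2*M} r * p a r)" unfolding Pb_def by (rule lborel_pair.Fubini_integral[OF hi, symmetric])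
  also have "\<dots> \<le> (LBINT r. ind {-2*M..2*M} r * 1)"
  proof (rule integral_mono)
   show "integrable lborel (\<lambda>r. LBINT a. ind {-2*M..2*M} r * p a r)" by (rule lborel_pair.integrable_snd[OF hi])
   show "(LBINT a. ind {-2*M..2*M} r * p a r) \<le> ind {-2*M..2*M} r * 1" for r
    using pint(1)[of r] by (cases "r \<in> {-2*M..2*M}") simp_all
   show "integrable lborel (\<lambda>r. ind {-2*M..2*M} r * 1)" using M by (auto intro!: integrable_real_indicator)
  qed
  also have "\<dots> = 4 * M" using M by simp
  finally show "(LBINT a. Pb a) \<le> 4 * M" .
 qed
 let ?K = "\<lambda>x (Y::R2). D x * (Pb (Y $ 1) * p (Y $ 2) (v x $ 2))"
 have pint': "(LBINT a. p a r) = cut0 (r / M)" for r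
  unfolding p_def integral_mult_right_zero kint(2) by simp
 have inner: "integrable lborel (\<lambda>Y::R2. Pb (Y $ 1) * p (Y $ 2) s)"
   "(LBINT Y. Pb ((Y::R2) $ 1) * p (Y $ 2) s) = (LBINT a. Pb a) * cut0 (s / M)" for s
  using integrable_vec2_mult[OF Pbi pint(2)[of s]] integral_vec2_mult[OF Pbm _ Pbi pint(2)[of s]]
   borel_measurable_integrable[OF pint(2)[of s]] pint'[of s] by auto
 have KY: "(LBINT Y. ?K x Y) = D x * ((LBINT a. Pb a) * cut0 (v x $ 2 / M))" for x
  by (simp add: inner(2))
 have cKY: "cont (\<lambda>x. D x * ((LBINT a. Pb a) * cut0 (v x $ 2 / M)))" using M by (intro continuous_intros Dc v_cont) auto
 have iKY: "integrable lborel (\<lambda>x. D x * ((LBINT a. Pb a) * cut0 (v x $ 2 / M)))"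
  by (rule integrable_continuous_support[OF cKY phi_supp(1)]) (simp add: Ds)
 have K0: "0 \<le> ?K x Y" for x Y using D0 Pb0 p0 by simp
 have Kint: "integrable (lborel \<Otimes>\<^sub>M lborel) (\<lambda>(x, Y). ?K x Y)"
 proof (rule lborel_pair.Fubini_integrable)
  have f1: "fst \<in> borel_measurable (borel :: (R2 \<times> R2) measure)"
   and f2: "(\<lambda>q. snd q $ 1) \<in> borel_measurable (borel :: (R2 \<times> R2) measure)"
   and f3: "(\<lambda>q. snd q $ 2) \<in> borel_measurable (borel :: (R2 \<times> R2) measure)"
   by (intro borel_measurable_continuous_onI continuous_intros)+
  have "cont (\<lambda>x. v x $ 2)" by (intro continuous_intros v_cont)
  then have v2: "(\<lambda>x. v x $ 2) \<in> borel_measurable borel" by (rule borel_measurable_continuous_onI)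
  have "(\<lambda>q. (snd q $ 2, v (fst q) $ 2)) \<in> borel_measurable (borel :: (R2 \<times> R2) measure)"
   by (intro borel_measurable_Pair f3 measurable_compose[OF f1 v2])
  from measurable_compose[OF this pm]
  have "(\<lambda>q. p (snd q $ 2) (v (fst q) $ 2)) \<in> borel_measurable (borel :: (R2 \<times> R2) measure)" by simp
  then have "(\<lambda>q. ?K (fst q) (snd q)) \<in> borel_measurable borel"
   by (intro borel_measurable_times measurable_compose[OF f1 borel_measurable_continuous_onI[OF Dc]] measurable_compose[OF f2 Pbm])
  then show "(\<lambda>(x, Y). ?K x Y) \<in> borel_measurable (lborel \<Otimes>\<^sub>M lborel)" by (simp add: lborel_prod case_prod_unfold)
  have e: "(LBINT Y. norm (case (x, Y) of (x, Y) => ?K x Y)) = D x * ((LBINT a. Pb a) * cut0 (v x $ 2 / M))" for x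
   using KY[of x] K0[of x] by (simp only: prod.case real_norm_def abs_of_nonneg)
  show "integrable lborel (\<lambda>x. LBINT Y. norm (case (x, Y) of (x, Y) => ?K x Y))" unfolding e by (rule iKY)
  show "AE x in lborel. integrable lborel (\<lambda>Y. case (x, Y) of (x, Y) => ?K x Y)" using inner(1) by simp
 qed
 have "(LBINT Y. \<bar>LBINT x. ker x Y * detv x\<bar>) \<le> (LBINT Y. LBINT x. ?K x Y)"
 proof (rule integral_mono[OF _ lborel_pair.integrable_snd[OF Kint] J])
  have "integrable (lborel \<Otimes>\<^sub>M lborel) (\<lambda>(x, Y). ker x Y * detv x)" using ker_integrable[OF fst_comp_cont[OF detv_cont]] by simp
  from lborel_pair.integrable_snd[OF this] show "integrable lborel (\<lambda>Y. \<bar>LBINT x. ker x Y * detv x\<bar>)" by (rule integrable_abs)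
 qed
 also have "\<dots> = (LBINT x. LBINT Y. ?K x Y)" by (rule lborel_pair.Fubini_integral[OF Kint])
 also have "\<dots> \<le> (LBINT x. 4 * M * D x)" unfolding KY
 proof (rule integral_mono[OF iKY])
  show "integrable lborel (\<lambda>x. 4 * M * D x)" using integrable_continuous_support[OF Dc phi_supp(1) Ds] by simp
  fix x
  have "(LBINT a. Pb a) * cut0 (v x $ 2 / M) \<le> 4 * M * 1" using Pbl cut0_bounds[of "v x $ 2 / M"] M by (intro mult_mono) auto
  from mult_left_mono[OF this D0[of x]] show "D x * ((LBINT a. Pb a) * cut0 (v x $ 2 / M)) \<le> 4 * M * D x" by (simp add: mult_ac)
 qed
 finally show ?thesis by (simp add: D_def)
qed

text \<open>Off the null Lagrangian, the conformal and the rotational part of the derivative both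
  have half of the Dirichlet energy.\<close>

lemma G1_mass:
 assumes W: "cont W" "\<And>y. 0 \<le> W y" and e: "0 < \<epsilon>" "0 \<le> e0"
  and near: "\<And>x Y. infnorm (v x) \<le> 2 * M ==> norm (Y - v x) \<le> 2 * \<rho> ==> W Y \<le> W (v x) + e0"
 shows "integrable lborel (\<lambda>Y. sqrt (W Y) * aniso_norm (G1 Y))"
  and "(LBINT Y. sqrt (W Y) * aniso_norm (G1 Y))
   \<le> (LBINT x. wt x * ((W (v x) + e0) / (2 * \<epsilon>) + \<epsilon> / 2 * sqv x))
    + \<epsilon> * (4 * M * (LBINT x. \<bar>d\<phi> 1 x\<bar> * \<bar>dv 2 x $ 2\<bar> + \<bar>d\<phi> 2 x\<bar> * \<bar>dv 1 x $ 2\<bar>))"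
proof -
 define en where "en x = (W (v x) + e0) / (2 * \<epsilon>) + \<epsilon> / 2 * sqv x" for x
 have Wv: "cont (\<lambda>x. W (v x))" by (rule continuous_on_compose2[OF W(1) v_cont(1)]) simp
 have enc: "cont en" unfolding en_def using e by (intro continuous_intros Wv sqv_cont) auto
 have en0: "0 \<le> en x" for x unfolding en_def sqv_def using e W(2) by simp
 define J where "J Y = (LBINT x. ker x Y * detv x)" for Y
 define LA where "LA N = mk2 (N $ 1 $ 1 - N $ 2 $ 2) (N $ 1 $ 2 + N $ 2 $ 1)" for N :: "real^2^2"
 define LB where "LB N = N $ 1 $ 2 - N $ 2 $ 1" for N :: "real^2^2"
 have nmk: "norm (mk2 s t) = sqrt (s\<^sup>2 + t\<^sup>2)" for s t by (simp add: norm_vec_def L2_set_def sum_2)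
 have blA: "bounded_linear LA"
 proof -
  have LAe: "LA = (\<lambda>N. (N $ 1 $ 1 - N $ 2 $ 2) *\<^sub>R axis 1 1 + (N $ 1 $ 2 + N $ 2 $ 1) *\<^sub>R axis 2 1)"
   by (rule ext) (simp add: LA_def vec_eq_iff forall_2 axis_def)
  show ?thesis unfolding LAe
   by (intro bounded_linear_add bounded_linear_compose[OF bounded_linear_scaleR_left] bounded_linear_sub bounded_linear_entry)
 qed
 have blB: "bounded_linear LB" unfolding LB_def[abs_def] by (intro bounded_linear_sub bounded_linear_entry)
 have an: "aniso_norm N = max (norm (LA N)) (norm (LB N))" for N
  by (simp add: aniso_norm_def LA_def LB_def nmk)
 have A2: "(norm (LA (Nv x)))\<^sup>2 = sqv x - 2 * detv x" for x
 proof -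
  have "(norm (LA (Nv x)))\<^sup>2 = (dv 1 x $ 1 - dv 2 x $ 2)\<^sup>2 + (dv 1 x $ 2 + dv 2 x $ 1)\<^sup>2"
  proof -
   have "Nv x $ 1 $ 1 - Nv x $ 2 $ 2 = dv 1 x $ 1 - dv 2 x $ 2" "Nv x $ 1 $ 2 = dv 1 x $ 2" "Nv x $ 2 $ 1 = dv 2 x $ 1"
    by (simp_all add: Nv_def tfm_def axis_def)
   then show ?thesis unfolding LA_def nmk by simp
  qed
  then show ?thesis unfolding sqv_def detv_def power2_norm_eq_inner
   by (simp add: inner_vec_def sum_2 power2_eq_square algebra_simps)
 qed
 \<comment> \<open>The gap in this inequality is the square of the divergence of v.\<close>
 have B2: "(norm (LB (Nv x)))\<^sup>2 \<le> sqv x + 2 * detv x" for x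
 proof -
  have "(norm (LB (Nv x)))\<^sup>2 = (dv 1 x $ 2 - dv 2 x $ 1)\<^sup>2" by (simp add: LB_def Nv_def tfm_def axis_def)
  also have "\<dots> \<le> (dv 1 x $ 2 - dv 2 x $ 1)\<^sup>2 + (dv 1 x $ 1 + dv 2 x $ 2)\<^sup>2" by simp
  also have "\<dots> = sqv x + 2 * detv x" unfolding sqv_def detv_def power2_norm_eq_inner
   by (simp add: inner_vec_def sum_2 power2_eq_square algebra_simps)
  finally show ?thesis .
 qed
 have iw: "integrable lborel (\<lambda>x. ker x Y * f x)" if "cont f" for f :: "R2 => real" and Y
  using ker_x_integrable[OF that, of Y] by simp
 \<comment> \<open>Young's inequality with weight \<epsilon> for both linear parts at once, \<sigma>
   = -1 for \<open>LA\<close> and \<sigma> = 1 for \<open>LB\<close>. It is applied before the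
   maximum of the two is taken, so the determinant occurs only in its smeared integral
   \<open>J\<close>, to which \<open>G1_null_lagrangian\<close> applies.\<close>
 have key: "sqrt (W Y) * norm (L (G1 Y)) \<le> (LBINT x. ker x Y * en x) + \<sigma> * \<epsilon> * J Y"
  if L: "bounded_linear L" and L2: "\<And>x. (norm (L (Nv x)))\<^sup>2 \<le> sqv x + \<sigma> * (2 * detv x)"
  for L :: "real^2^2 => 'b::euclidean_space" and \<sigma> Y
 proof -
  have Lc: "cont (\<lambda>x. L (Nv x))" using continuous_on_compose2[OF linear_continuous_on[OF L] Nv_cont] by auto
  have "norm (L (G1 Y)) \<le> (LBINT x. norm (ker x Y *\<^sub>R L (Nv x)))" unfolding G1_linear[OF L] by (rule integral_norm_bound)
  also have "\<dots> = (LBINT x. ker x Y * norm (L (Nv x)))" using ker_nonneg by simp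
  finally have "sqrt (W Y) * norm (L (G1 Y)) \<le> (LBINT x. sqrt (W Y) * (ker x Y * norm (L (Nv x))))" using W(2) by (simp add: mult_left_mono)
  also have "\<dots> \<le> (LBINT x. ker x Y * en x + \<sigma> * \<epsilon> * (ker x Y * detv x))"
  proof (rule integral_mono)
   show "integrable lborel (\<lambda>x. sqrt (W Y) * (ker x Y * norm (L (Nv x))))" by (intro integrable_mult_right iw continuous_intros Lc)
   show "integrable lborel (\<lambda>x. ker x Y * en x + \<sigma> * \<epsilon> * (ker x Y * detv x))"
    by (intro integrable_add integrable_mult_right iw enc detv_cont)
   fix x
   show "sqrt (W Y) * (ker x Y * norm (L (Nv x))) \<le> ker x Y * en x + \<sigma> * \<epsilon> * (ker x Y * detv x)"
   proof (cases "ker x Y = 0")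
    case False
    have "wt x \<noteq> 0" using False by (auto simp: ker_def)
    then have "infnorm (v x) \<le> 2 * M" using wt_supp(2)[of x] by linarith
    then have WY: "W Y \<le> W (v x) + e0" using near ker_supp(3)[OF False] by blast
    let ?a = "sqrt (W Y)" and ?b = "norm (L (Nv x))"
    have "0 \<le> (?a - \<epsilon> * ?b)\<^sup>2" by simp
    then have "2 * \<epsilon> * (?a * ?b) \<le> W Y + \<epsilon>\<^sup>2 * ?b\<^sup>2" using W(2)[of Y] by (simp add: power2_eq_square algebra_simps)
    also have "\<dots> \<le> (W (v x) + e0) + \<epsilon>\<^sup>2 * (sqv x + \<sigma> * (2 * detv x))"
     using WY L2[of x] by (intro add_mono mult_left_mono) auto
    finally have "?a * ?b \<le> ((W (v x) + e0) + \<epsilon>\<^sup>2 * (sqv x + \<sigma> * (2 * detv x))) / (2 * \<epsilon>)"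
     using e by (simp add: field_simps)
    also have "\<dots> = en x + \<sigma> * \<epsilon> * detv x" using e by (simp add: en_def power2_eq_square field_simps)
    finally have "ker x Y * (?a * ?b) \<le> ker x Y * (en x + \<sigma> * \<epsilon> * detv x)" by (rule mult_left_mono[OF _ ker_nonneg])
    then show ?thesis by (simp add: algebra_simps)
   qed simp
  qed
  also have "\<dots> = (LBINT x. ker x Y * en x) + \<sigma> * \<epsilon> * J Y"
   unfolding J_def by (subst integral_add) (auto intro!: integrable_mult_right iw enc detv_cont)
  finally show ?thesis .
 qed
 have pt: "sqrt (W Y) * aniso_norm (G1 Y) \<le> (LBINT x. ker x Y * en x) + \<epsilon> * \<bar>J Y\<bar>" for Y
 proof -
  have a: "sqrt (W Y) * norm (LA (G1 Y)) \<le> (LBINT x. ker x Y * en x) + (-1) * \<epsilon> * J Y" by (rule key[OF blA]) (simp add: A2)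
  have b: "sqrt (W Y) * norm (LB (G1 Y)) \<le> (LBINT x. ker x Y * en x) + 1 * \<epsilon> * J Y" by (rule key[OF blB]) (use B2 in simp)
  have "(-1) * \<epsilon> * J Y \<le> \<epsilon> * \<bar>J Y\<bar>" "1 * \<epsilon> * J Y \<le> \<epsilon> * \<bar>J Y\<bar>"
   using mult_left_mono[of "- J Y" "\<bar>J Y\<bar>" \<epsilon>] mult_left_mono[of "J Y" "\<bar>J Y\<bar>" \<epsilon>] e by simp_all
  then show ?thesis unfolding an using a b by (cases "norm (LA (G1 Y)) \<le> norm (LB (G1 Y))") (auto simp: max_def simp del: real_norm_def)
 qed
 have iE: "integrable (lborel \<Otimes>\<^sub>M lborel) (\<lambda>(x, Y). ker x Y * en x)" using ker_integrable[OF fst_comp_cont[OF enc]] by simp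
 have iJ: "integrable lborel J"
 proof -
  have "integrable (lborel \<Otimes>\<^sub>M lborel) (\<lambda>(x, Y). ker x Y * detv x)" using ker_integrable[OF fst_comp_cont[OF detv_cont]] by simp
  from lborel_pair.integrable_snd[OF this] show ?thesis unfolding J_def[abs_def] .
 qed
 have ib: "integrable lborel (\<lambda>Y. (LBINT x. ker x Y * en x) + \<epsilon> * \<bar>J Y\<bar>)"
  using lborel_pair.integrable_snd[OF iE] iJ by auto
 have Wm: "W \<in> borel_measurable borel" by (rule borel_measurable_continuous_onI[OF W(1)])
 show int: "integrable lborel (\<lambda>Y. sqrt (W Y) * aniso_norm (G1 Y))"
 proof (rule integrable_bound[OF ib])
  show "(\<lambda>Y. sqrt (W Y) * aniso_norm (G1 Y)) \<in> borel_measurable lborel"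
   using borel_measurable_integrable[OF G1_integrable] Wm by measurable
  show "AE Y in lborel. norm (sqrt (W Y) * aniso_norm (G1 Y)) \<le> norm ((LBINT x. ker x Y * en x) + \<epsilon> * \<bar>J Y\<bar>)"
  proof (rule AE_I2)
   fix Y
   have "0 \<le> sqrt (W Y) * aniso_norm (G1 Y)" using W(2) aniso_norm_nonneg by simp
   then show "norm (sqrt (W Y) * aniso_norm (G1 Y)) \<le> norm ((LBINT x. ker x Y * en x) + \<epsilon> * \<bar>J Y\<bar>)"
    using pt[of Y] unfolding real_norm_def by linarith
  qed
 qed
 have "(LBINT Y. sqrt (W Y) * aniso_norm (G1 Y)) \<le> (LBINT Y. (LBINT x. ker x Y * en x) + \<epsilon> * \<bar>J Y\<bar>)"
  by (rule integral_mono[OF int ib pt])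
 also have "\<dots> = (LBINT Y. LBINT x. ker x Y * en x) + \<epsilon> * (LBINT Y. \<bar>J Y\<bar>)" using lborel_pair.integrable_snd[OF iE] iJ by simp
 also have "(LBINT Y. LBINT x. ker x Y * en x) = (LBINT x. LBINT Y. ker x Y * en x)" by (rule lborel_pair.Fubini_integral[OF iE])
 also have "\<dots> = (LBINT x. wt x * en x)" by (intro integral_cong refl) (subst ker_Y_integral, simp_all add: eta_integral)
 also have "\<epsilon> * (LBINT Y. \<bar>J Y\<bar>) \<le> \<epsilon> * (4 * M * (LBINT x. \<bar>d\<phi> 1 x\<bar> * \<bar>dv 2 x $ 2\<bar> + \<bar>d\<phi> 2 x\<bar> * \<bar>dv 1 x $ 2\<bar>))"
  unfolding J_def using G1_null_lagrangian e by (intro mult_left_mono) auto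
 finally show "(LBINT Y. sqrt (W Y) * aniso_norm (G1 Y))
   \<le> (LBINT x. wt x * ((W (v x) + e0) / (2 * \<epsilon>) + \<epsilon> / 2 * sqv x))
    + \<epsilon> * (4 * M * (LBINT x. \<bar>d\<phi> 1 x\<bar> * \<bar>dv 2 x $ 2\<bar> + \<bar>d\<phi> 2 x\<bar> * \<bar>dv 1 x $ 2\<bar>))"
  unfolding en_def by simp
qed

end

section \<open>Correcting the boundary\<close>

lemma kernel_continuous_map:
 fixes H :: "R2 \<times> R2 => real"
 assumes H: "cont H" and z: "\<And>x y. y \<notin> unit_square ==> H (x, y) = 0"
 shows "cont (\<lambda>x. LBINT y. H (x, y))"
proof -
 have "cont (\<lambda>x. integral unit_square (\<lambda>y. H (x, y)))" by (rule integral_continuous_on_param) (auto intro: continuous_on_subset[OF H])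
 moreover have "(LBINT y. H (x, y)) = integral unit_square (\<lambda>y. H (x, y))" for x
 proof (rule LINT_unit_square)
  have "cont (\<lambda>y::R2. (x, y))" by (intro continuous_intros)
  from continuous_on_compose2[OF H this] show "cont (\<lambda>y. H (x, y))" by simp
 qed (use z in auto)
 ultimately show ?thesis by simp
qed

lemma mean_zero: "mean \<xi> i z 0 = \<xi> z $ i" by (simp add: mean_def eta_integral)

text \<open>The number l is the integral of \<phi> along the jump line, expressed as a flux through
  a half-plane. The scale h is intermediate: v is close to the jump function only in the mean, so
  the two are compared over squares of half-width h, which can be fixed before that closeness is.
  Since |am| and |ap| are at most M - 1, the distance from v to the jump function is at least 1
  wherever v leaves the square of size M.\<close>

locale transition_map = smooth_map \<phi> d\<phi> X v dv d12 M \<rho>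
 for \<phi> :: "R2 => real" and d\<phi> X v dv d12 M \<rho> +
 fixes am ap :: "R2" and l h C\<phi> :: real
 assumes Xm: "X \<in> sets borel"
  and flux: "(LBINT x. d\<phi> 1 x * ind {x. x $ 1 > 0} x) = - l"
   "(LBINT x. d\<phi> 2 x * ind {x. x $ 1 > 0} x) = 0"
  and h: "2 * \<rho> \<le> h" "2 * h \<le> M" and a: "norm am \<le> M - 1" "norm ap \<le> M - 1" and a1: "am $ 1 = ap $ 1"
  and C\<phi>: "\<bar>d\<phi> j x\<bar> \<le> C\<phi>"
begin

abbreviation "u0 \<equiv> jump_function am ap"
abbreviation "gap x \<equiv> norm (v x - u0 x)"

lemma h0: "0 < h" using h \<rho> by linarith
lemma C0: "0 \<le> C\<phi>" using C\<phi>[of 1 0] abs_ge_zero order_trans by blast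

lemma u0_comp: "f (u0 x) = ind {x. x $ 1 > 0} x * f ap + (1 - ind {x. x $ 1 > 0} x) * f am" for f :: "R2 => real" by (simp add: jump_function_def)

lemma half_measurable: "{x::R2. x $ 1 > 0} \<in> sets borel" by (intro borel_open open_Collect_less continuous_intros)

lemma u0_measurable: "(\<lambda>x. f (u0 x)) \<in> borel_measurable borel" for f :: "R2 => 'b::topological_space"
 unfolding jump_function_def using half_measurable by measurable

lemma u0_meas [measurable]: "u0 \<in> borel_measurable borel" using u0_measurable[of "\<lambda>x. x"] by simp

lemma norm_u0: "norm (u0 x) \<le> M - 1" using a by (simp add: jump_function_def)

text \<open>By the product rule \<open>\<alpha> i + \<gamma> i\<close> is the i-th derivative of
  \<open>wt\<close>, and \<open>\<alpha> i + \<beta> i\<close> is \<open>d\<phi> i\<close>. So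
  \<beta> sees only points where v is large, \<gamma> only points where v lies in the ring of the
  cutoff, and \<delta> is the coefficient of the divergence that \<open>Nv\<close> omits.\<close>

definition \<alpha> :: "2 => R2 => real" where "\<alpha> i x = d\<phi> i x * chi M (v x)"
definition \<beta> :: "2 => R2 => real" where "\<beta> i x = d\<phi> i x * (1 - chi M (v x))"
definition \<gamma> :: "2 => R2 => real" where "\<gamma> i x = \<phi> x * chi' M (v x) (dv i x)"
definition \<delta> :: "R2 => real" where "\<delta> x = wt x * divv x / 2"

lemma coeff_cont: "cont (\<alpha> i)" "cont (\<beta> i)" "cont (\<gamma> i)" "cont \<delta>"
 unfolding \<alpha>_def[abs_def] \<beta>_def[abs_def] \<gamma>_def[abs_def] \<delta>_def[abs_def] using M
 by (intro continuous_intros phi_cont v_cont wt_cont divv_cont; simp)+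

lemma coeff_supp: "x \<notin> X ==> \<alpha> i x = 0" "x \<notin> X ==> \<beta> i x = 0" "x \<notin> X ==> \<gamma> i x = 0" "x \<notin> X ==> \<delta> x = 0"
 using phi_supp(2,3) by (auto simp: \<alpha>_def \<beta>_def \<gamma>_def \<delta>_def wt_def)

lemma coeff_meas [measurable]: "\<alpha> i \<in> borel_measurable borel" "\<beta> i \<in> borel_measurable borel" "\<gamma> i \<in> borel_measurable borel" "\<delta> \<in> borel_measurable borel"
 by (intro borel_measurable_continuous_onI coeff_cont)+

lemma v_meas [measurable]: "v \<in> borel_measurable borel" by (intro borel_measurable_continuous_onI v_cont)

lemma coeff_bounded: obtains c where "\<And>x. \<bar>\<alpha> i x\<bar> \<le> c" "\<And>x. \<bar>\<beta> i x\<bar> \<le> c" "\<And>x. \<bar>\<gamma> i x\<bar> \<le> c" "\<And>x. \<bar>\<delta> x\<bar> \<le> c" "0 \<le> c"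
proof -
 obtain c1 where 1: "0 \<le> c1" "\<And>x. norm (\<alpha> i x) \<le> c1" using continuous_bounded_support[OF coeff_cont(1) phi_supp(1) coeff_supp(1)] by metis
 obtain c2 where 2: "0 \<le> c2" "\<And>x. norm (\<beta> i x) \<le> c2" using continuous_bounded_support[OF coeff_cont(2) phi_supp(1) coeff_supp(2)] by metis
 obtain c3 where 3: "0 \<le> c3" "\<And>x. norm (\<gamma> i x) \<le> c3" using continuous_bounded_support[OF coeff_cont(3) phi_supp(1) coeff_supp(3)] by metis
 obtain c4 where 4: "0 \<le> c4" "\<And>x. norm (\<delta> x) \<le> c4" using continuous_bounded_support[OF coeff_cont(4) phi_supp(1) coeff_supp(4)] by metis
 show ?thesis
 proof (rule that[of "c1 + c2 + c3 + c4"])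
  show "\<bar>\<alpha> i x\<bar> \<le> c1 + c2 + c3 + c4" for x using 1(2)[of x] 1 2 3 4 unfolding real_norm_def by linarith
  show "\<bar>\<beta> i x\<bar> \<le> c1 + c2 + c3 + c4" for x using 2(2)[of x] 1 2 3 4 unfolding real_norm_def by linarith
  show "\<bar>\<gamma> i x\<bar> \<le> c1 + c2 + c3 + c4" for x using 3(2)[of x] 1 2 3 4 unfolding real_norm_def by linarith
  show "\<bar>\<delta> x\<bar> \<le> c1 + c2 + c3 + c4" for x using 4(2)[of x] 1 2 3 4 unfolding real_norm_def by linarith
 qed (use 1 2 3 4 in simp)
qed

text \<open>Stated for measurable factors because the jump function is not continuous; the
  continuous case follows separately.\<close>

lemma integrable_coeff:
 assumes k: "cont k" "\<And>x. x \<notin> X ==> k x = 0" and f: "f \<in> borel_measurable borel" "\<And>x. x \<in> X ==> \<bar>f x\<bar> \<le> B"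
 shows "integrable lborel (\<lambda>x. k x * (f x :: real))"
proof -
 obtain c where c: "0 \<le> c" "\<And>x. norm (k x) \<le> c" using continuous_bounded_support[OF k(1) phi_supp(1) k(2)] by metis
 show ?thesis
 proof (rule integrable_bounded_support[OF _ phi_supp(1)])
  show "(\<lambda>x. k x * f x) \<in> borel_measurable borel" using borel_measurable_continuous_onI[OF k(1)] f(1) by measurable
  show "norm (k x * f x) \<le> c * \<bar>B\<bar>" for x
  proof (cases "x \<in> X")
   case True
   then have "\<bar>f x\<bar> \<le> \<bar>B\<bar>" using f(2)[of x] by linarith
   then show ?thesis using c(2)[of x] c(1) by (simp add: abs_mult mult_mono)
  qed (use k(2) c in simp)
 qed (use k(2) in simp)
qed

lemma integrable_coeff_cont:
 assumes "cont k" "\<And>x. x \<notin> X ==> k x = 0" "cont f"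
 shows "integrable lborel (\<lambda>x. k x * (f x :: real))"
 by (rule integrable_continuous_support[OF _ phi_supp(1)]) (auto intro!: continuous_intros assms simp: assms(2))

lemma u0_bounded: "\<bar>f (u0 x)\<bar> \<le> \<bar>f ap\<bar> + \<bar>f am\<bar>" for f :: "R2 => real" by (simp add: jump_function_def)

section \<open>The boundary of the push-forward\<close>

lemma mean_v_cont:
 assumes xi: "C1 \<xi>"
 shows "cont (\<lambda>x. mean \<xi> i (v x) \<rho>)" "cont (\<lambda>x. mean_div \<xi> (v x) \<rho>)"
proof -
 have vf: "cont (\<lambda>p::R2 \<times> R2. v (fst p))" by (rule fst_comp_cont[OF v_cont(1)])
 have "cont (\<lambda>x. LBINT y. (\<lambda>p. eta (snd p) * \<xi> (v (fst p) + \<rho> *\<^sub>R snd p) $ i) (x, y))"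
  by (rule kernel_continuous_map) (auto intro!: continuous_intros C1_continuous[OF xi] vf simp: eta_zero)
 then show "cont (\<lambda>x. mean \<xi> i (v x) \<rho>)" unfolding mean_def by simp
 have "cont (\<lambda>x. LBINT y. (\<lambda>p. eta (snd p) * trace (jacobian \<xi> (at (v (fst p) + \<rho> *\<^sub>R snd p)))) (x, y))"
  by (rule kernel_continuous_map) (auto intro!: continuous_intros C1_jacobian_continuous[OF xi] vf simp: eta_zero trace_def)
 then show "cont (\<lambda>x. mean_div \<xi> (v x) \<rho>)" unfolding mean_div_def by simp
qed

lemma v_line: "((\<lambda>\<tau>. v (x + \<tau> *\<^sub>R axis j 1)) has_vector_derivative dv j (x + s *\<^sub>R axis j 1)) (at s)"
proof -
 have "((\<lambda>\<tau>. v ((x + s *\<^sub>R axis j 1) + \<tau> *\<^sub>R axis j 1)) has_vector_derivative dv j (x + s *\<^sub>R axis j 1)) (at (s - s))"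
  using v_deriv[where x="x + s *\<^sub>R axis j 1" and j=j] by simp
 moreover have "((\<lambda>\<tau>. \<tau> - s) has_vector_derivative 1) (at s)" by (auto intro!: derivative_eq_intros)
 ultimately have "((\<lambda>\<tau>. v ((x + s *\<^sub>R axis j 1) + (\<tau> - s) *\<^sub>R axis j 1)) has_vector_derivative 1 *\<^sub>R dv j (x + s *\<^sub>R axis j 1)) (at s)"
  using vector_diff_chain_at[of "\<lambda>\<tau>. \<tau> - s" 1 s] by (simp add: o_def)
 then show ?thesis by (simp add: algebra_simps)
qed

definition dmean :: "(R2 => R2) => 2 => 2 => R2 => real" where
 "dmean \<xi> i j x = (LBINT y. eta y * (dv j x $ 1 * jacobian \<xi> (at (v x + \<rho> *\<^sub>R y)) $ i $ 1 + dv j x $ 2 * jacobian \<xi> (at (v x + \<rho> *\<^sub>R y)) $ i $ 2))"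

lemma mean_v_deriv:
 assumes xi: "C1 \<xi>"
 shows "((\<lambda>h. mean \<xi> i (v (x + h *\<^sub>R axis j 1)) \<rho>) has_real_derivative dmean \<xi> i j x) (at 0)"
proof -
 let ?v = "\<lambda>\<tau>. v (x + \<tau> *\<^sub>R axis j 1)" and ?dv = "\<lambda>\<tau>. dv j (x + \<tau> *\<^sub>R axis j 1)"
 have vc: "cont (\<lambda>p::real \<times> R2. ?v (fst p))" "cont (\<lambda>p::real \<times> R2. ?dv (fst p))"
  by (rule continuous_on_compose2[OF v_cont(1)] continuous_on_compose2[OF v_cont(2)]; auto intro!: continuous_intros)+
 have "((\<lambda>\<tau>. LBINT y. eta y * \<xi> (?v \<tau> + \<rho> *\<^sub>R y) $ i) has_real_derivative
  (LBINT y. eta y * (?dv 0 $ 1 * jacobian \<xi> (at (?v 0 + \<rho> *\<^sub>R y)) $ i $ 1 + ?dv 0 $ 2 * jacobian \<xi> (at (?v 0 + \<rho> *\<^sub>R y)) $ i $ 2))) (at 0)"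
 proof (rule kernel_leibniz[where F="\<lambda>\<tau> y. \<xi> (?v \<tau> + \<rho> *\<^sub>R y) $ i" and
  F'="\<lambda>\<tau> y. ?dv \<tau> $ 1 * jacobian \<xi> (at (?v \<tau> + \<rho> *\<^sub>R y)) $ i $ 1 + ?dv \<tau> $ 2 * jacobian \<xi> (at (?v \<tau> + \<rho> *\<^sub>R y)) $ i $ 2"])
  fix \<tau> y
  have "((\<lambda>\<tau>. ?v \<tau> + \<rho> *\<^sub>R y) has_derivative (\<lambda>h. h *\<^sub>R ?dv \<tau>)) (at \<tau>)"
   using v_line[of x j \<tau>] unfolding has_vector_derivative_def by (auto intro!: derivative_eq_intros)
  from has_derivative_compose[OF this C1_has_derivative[OF xi, of i]]
  show "((\<lambda>\<tau>. \<xi> (?v \<tau> + \<rho> *\<^sub>R y) $ i) has_real_derivative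
   ?dv \<tau> $ 1 * jacobian \<xi> (at (?v \<tau> + \<rho> *\<^sub>R y)) $ i $ 1 + ?dv \<tau> $ 2 * jacobian \<xi> (at (?v \<tau> + \<rho> *\<^sub>R y)) $ i $ 2) (at \<tau>)"
   unfolding has_field_derivative_def by (rule has_derivative_eq_rhs) (simp add: fun_eq_iff algebra_simps)
 qed (auto intro!: continuous_intros C1_continuous[OF xi] C1_jacobian_continuous[OF xi] vc eta_zero)
 then show ?thesis unfolding mean_def dmean_def by simp
qed

lemma dmean_cont:
 assumes xi: "C1 \<xi>" shows "cont (dmean \<xi> i j)"
proof -
 have vf: "cont (\<lambda>p::R2 \<times> R2. v (fst p))" "cont (\<lambda>p::R2 \<times> R2. dv j (fst p))"
  by (rule fst_comp_cont[OF v_cont(1)] fst_comp_cont[OF v_cont(2)])+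
 have "cont (\<lambda>x. LBINT y. (\<lambda>p. eta (snd p) * (dv j (fst p) $ 1 * jacobian \<xi> (at (v (fst p) + \<rho> *\<^sub>R snd p)) $ i $ 1 + dv j (fst p) $ 2 * jacobian \<xi> (at (v (fst p) + \<rho> *\<^sub>R snd p)) $ i $ 2)) (x, y))"
  by (rule kernel_continuous_map) (auto intro!: continuous_intros C1_jacobian_continuous[OF xi] vf simp: eta_zero)
 then show ?thesis unfolding dmean_def[abs_def] by simp
qed

lemma divergence_identity:
 assumes xi: "C1 \<xi>"
 shows "(LBINT x. (\<alpha> i x + \<gamma> i x) * mean \<xi> i (v x) \<rho> + wt x * dmean \<xi> i i x) = 0"
proof -
 let ?F = "\<lambda>x. wt x * mean \<xi> i (v x) \<rho>" and ?F' = "\<lambda>x. (\<alpha> i x + \<gamma> i x) * mean \<xi> i (v x) \<rho> + wt x * dmean \<xi> i i x"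
 have c: "cont ?F" "cont ?F'" by (intro continuous_intros wt_cont coeff_cont mean_v_cont[OF xi] dmean_cont[OF xi])+
 have z: "?F x = 0" "?F' x = 0" if "x \<notin> X" for x using wt_supp(1)[OF that] coeff_supp[OF that] by auto
 obtain A where A: "\<And>x. norm (?F x) \<le> A" using continuous_bounded_support[OF c(1) phi_supp(1) z(1)] by metis
 obtain B where B: "\<And>x. norm (?F' x) \<le> B" using continuous_bounded_support[OF c(2) phi_supp(1) z(2)] by metis
 show ?thesis
 proof (rule integral_directional_derivative_zero[where F="?F" and S=X and C=B and B=A and e="axis i 1"])
  fix x
  have "((\<lambda>h. wt (x + h *\<^sub>R axis i 1)) has_real_derivative \<alpha> i x + \<gamma> i x) (at 0)"
   using DERIV_mult[OF phi_deriv[of x i] chi_chain[OF v_deriv[of x i], of M]] unfolding wt_def \<alpha>_def \<gamma>_def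
   by (simp add: algebra_simps)
  from DERIV_mult[OF this mean_v_deriv[OF xi, of i x i]]
  show "((\<lambda>h. ?F (x + h *\<^sub>R axis i 1)) has_real_derivative ?F' x) (at 0)" by (simp add: algebra_simps)
 qed (use A B z c phi_supp(1) in \<open>auto intro: borel_measurable_continuous_onI\<close>)
qed

text \<open>Splits the derivative of v into \<open>Nv\<close>, whose pairing gives
  \<open>G1\<close>, and half of its divergence, which has to be compensated by transport.\<close>

lemma dmean_sum:
 assumes xi: "C1 \<xi>"
 shows "dmean \<xi> 1 1 x + dmean \<xi> 2 2 x = (LBINT y. eta y * (Nv x \<bullet> jacobian \<xi> (at (v x + \<rho> *\<^sub>R y)))) + divv x / 2 * mean_div \<xi> (v x) \<rho>"
proof -
 let ?J = "\<lambda>y. jacobian \<xi> (at (v x + \<rho> *\<^sub>R y))"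
 have i: "integrable lborel (\<lambda>y. eta y * f y)" if "cont f" for f :: "R2 => real"
  by (rule integrable_continuous_support[where S=unit_square]) (auto intro!: continuous_intros that simp: eta_zero)
 have cJ: "cont ?J" by (intro continuous_intros C1_jacobian_continuous[OF xi])
 have "dmean \<xi> 1 1 x + dmean \<xi> 2 2 x = (LBINT y. eta y * (dv 1 x $ 1 * ?J y $ 1 $ 1 + dv 1 x $ 2 * ?J y $ 1 $ 2)
   + eta y * (dv 2 x $ 1 * ?J y $ 2 $ 1 + dv 2 x $ 2 * ?J y $ 2 $ 2))"
  unfolding dmean_def by (rule integral_add[symmetric]) (intro i continuous_intros cJ)+
 also have "\<dots> = (LBINT y. eta y * (Nv x \<bullet> ?J y) + divv x / 2 * (eta y * trace (?J y)))"
  by (intro integral_cong refl) (simp add: Nv_def tfm_inner divv_def trace_def sum_2 field_simps)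
 also have "\<dots> = (LBINT y. eta y * (Nv x \<bullet> ?J y)) + (LBINT y. divv x / 2 * (eta y * trace (?J y)))"
  by (rule integral_add) (auto intro!: i integrable_mult_right continuous_intros cJ simp: trace_def)
 also have "(LBINT y. divv x / 2 * (eta y * trace (?J y))) = divv x / 2 * mean_div \<xi> (v x) \<rho>" unfolding mean_div_def by simp
 finally show ?thesis .
qed

text \<open>The required boundary arises by putting the jump function in place of v: the integral of
  \<open>d\<phi> i\<close> is zero, so only the flux through the jump line contributes, and it has
  no second component.\<close>

lemma target_identity:
 fixes \<xi> :: "R2 => R2"
 shows
 "(LBINT x. d\<phi> 1 x * \<xi> (u0 x) $ 1) + (LBINT x. d\<phi> 2 x * \<xi> (u0 x) $ 2) = - (l * (\<xi> ap $ 1 - \<xi> am $ 1))"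
proof -
 have z: "(LBINT x. d\<phi> i x) = 0" for i
 proof -
  obtain A where A: "\<And>x. norm (\<phi> x) \<le> A" using continuous_bounded_support[OF phi_cont(1) phi_supp(1,2)] by metis
  show ?thesis
   by (rule integral_directional_derivative_zero[OF phi_deriv _ _ C\<phi> phi_supp(1,2) A[unfolded real_norm_def]])
    (intro borel_measurable_continuous_onI phi_cont)+
 qed
 have i1: "integrable lborel (d\<phi> i)" for i by (rule integrable_continuous_support[OF phi_cont(2) phi_supp(1,3)])
 have i2: "integrable lborel (\<lambda>x. d\<phi> i x * ind {x. x $ 1 > 0} x)" for i
  by (rule integrable_coeff[OF phi_cont(2) phi_supp(3), where B=1]) (use half_measurable in \<open>auto simp: indicator_def\<close>)
 have T: "(LBINT x. d\<phi> i x * \<xi> (u0 x) $ i) = (\<xi> ap $ i - \<xi> am $ i) * (LBINT x. d\<phi> i x * ind {x. x $ 1 > 0} x)" for i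
 proof -
  have "(LBINT x. d\<phi> i x * \<xi> (u0 x) $ i)
   = (LBINT x. (\<xi> ap $ i - \<xi> am $ i) * (d\<phi> i x * ind {x. x $ 1 > 0} x) + \<xi> am $ i * d\<phi> i x)"
   by (intro integral_cong refl) (simp add: u0_comp[of "\<lambda>y. \<xi> y $ i"] algebra_simps)
  also have "\<dots> = (\<xi> ap $ i - \<xi> am $ i) * (LBINT x. d\<phi> i x * ind {x. x $ 1 > 0} x) + \<xi> am $ i * (LBINT x. d\<phi> i x)"
   using i1 i2 by (subst integral_add) auto
  finally show ?thesis by (simp add: z)
 qed
 show ?thesis unfolding T flux by (simp add: algebra_simps)
qed

lemma G1_boundary:
 assumes xi: "C1 \<xi>"
 shows "(LBINT Y. G1 Y \<bullet> jacobian \<xi> (at Y)) = - (LBINT x. (\<alpha> 1 x + \<gamma> 1 x) * mean \<xi> 1 (v x) \<rho>)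
  - (LBINT x. (\<alpha> 2 x + \<gamma> 2 x) * mean \<xi> 2 (v x) \<rho>) - (LBINT x. \<delta> x * mean_div \<xi> (v x) \<rho>)"
proof -
 let ?N = "\<lambda>x. LBINT y. eta y * (Nv x \<bullet> jacobian \<xi> (at (v x + \<rho> *\<^sub>R y)))"
 have iag: "integrable lborel (\<lambda>x. (\<alpha> i x + \<gamma> i x) * mean \<xi> i (v x) \<rho>)" for i
  by (intro integrable_coeff_cont continuous_intros coeff_cont mean_v_cont[OF xi]) (simp add: coeff_supp)
 have iw: "integrable lborel (\<lambda>x. wt x * dmean \<xi> i i x)" for i
  by (intro integrable_coeff_cont wt_cont dmean_cont[OF xi] wt_supp(1))
 have id: "integrable lborel (\<lambda>x. \<delta> x * mean_div \<xi> (v x) \<rho>)"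
  by (intro integrable_coeff_cont coeff_cont coeff_supp mean_v_cont[OF xi])
 have w: "(LBINT x. wt x * dmean \<xi> i i x) = - (LBINT x. (\<alpha> i x + \<gamma> i x) * mean \<xi> i (v x) \<rho>)" for i
  using divergence_identity[OF xi, of i] integral_add[OF iag iw, of i i] by linarith
 have e: "wt x * ?N x = (wt x * dmean \<xi> 1 1 x + wt x * dmean \<xi> 2 2 x) - \<delta> x * mean_div \<xi> (v x) \<rho>" for x
  using arg_cong[OF dmean_sum[OF xi, of x], of "\<lambda>z. wt x * z"] unfolding \<delta>_def by (simp add: algebra_simps)
 have "(LBINT Y. G1 Y \<bullet> jacobian \<xi> (at Y)) = (LBINT x. (wt x * dmean \<xi> 1 1 x + wt x * dmean \<xi> 2 2 x) - \<delta> x * mean_div \<xi> (v x) \<rho>)"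
  unfolding G1_functional[OF xi] e ..
 also have "\<dots> = (LBINT x. wt x * dmean \<xi> 1 1 x) + (LBINT x. wt x * dmean \<xi> 2 2 x) - (LBINT x. \<delta> x * mean_div \<xi> (v x) \<rho>)"
  by (subst integral_diff[OF integrable_add[OF iw iw] id],
    subst integral_add[OF iw iw]) simp
 finally show ?thesis unfolding w by simp
qed

text \<open>Each piece moves means along one route. With weight \<alpha>, the mean at v (A) and the
  point value at the jump function (B) are both compared with the mean of radius h about the latter;
  C sends the divergence left over there to the fixed square about 0. With the weights \<beta> (D)
  and \<gamma> (E) the means go to the fixed square directly, as does the divergence at v (F). The
  vanishing displacement in B and the subtracted zeros keep every piece in the form of
  \<open>tfrep_mean\<close>.\<close>

definition piece_A :: "2 => (R2 => R2) => real" where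
 "piece_A i \<xi> = (LBINT x. \<alpha> i x * (mean \<xi> i (v x) \<rho> - mean \<xi> i (u0 x) h - (v x $ i - u0 x $ i) / 2 * mean_div \<xi> (u0 x) h))"
definition piece_B :: "2 => (R2 => R2) => real" where
 "piece_B i \<xi> = (LBINT x. \<alpha> i x * (mean \<xi> i (u0 x) 0 - mean \<xi> i (u0 x) h - (u0 x $ i - u0 x $ i) / 2 * mean_div \<xi> (u0 x) h))"
definition piece_C :: "2 => (R2 => R2) => real" where
 "piece_C i \<xi> = (LBINT x. (\<alpha> i x * ((v x $ i - u0 x $ i) / 2)) * (mean_div \<xi> (u0 x) h - mean_div \<xi> 0 M))"
definition piece_D :: "2 => (R2 => R2) => real" where
 "piece_D i \<xi> = (LBINT x. \<beta> i x * (mean \<xi> i (u0 x) 0 - mean \<xi> i 0 M - (u0 x $ i - 0 $ i) / 2 * mean_div \<xi> 0 M))"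
definition piece_E :: "2 => (R2 => R2) => real" where
 "piece_E i \<xi> = (LBINT x. \<gamma> i x * (mean \<xi> i (v x) \<rho> - mean \<xi> i 0 M - (v x $ i - 0 $ i) / 2 * mean_div \<xi> 0 M))"
definition piece_F :: "(R2 => R2) => real" where
 "piece_F \<xi> = (LBINT x. \<delta> x * (mean_div \<xi> (v x) \<rho> - mean_div \<xi> 0 M))"
text \<open>The coefficient with which \<open>mean_div \<xi> 0 M\<close> is left over after the
  transports of component i.\<close>

definition rest :: "2 => R2 => real" where
 "rest i x = \<alpha> i x * ((v x $ i - u0 x $ i) / 2) - \<beta> i x * (u0 x $ i / 2) + \<gamma> i x * (v x $ i / 2)"

lemma pieces_sum:
 assumes xi: "C1 \<xi>"
 shows "(LBINT x. (\<alpha> i x + \<gamma> i x) * mean \<xi> i (v x) \<rho>) - (LBINT x. d\<phi> i x * \<xi> (u0 x) $ i)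
  = piece_A i \<xi> - piece_B i \<xi> + piece_C i \<xi> - piece_D i \<xi> + piece_E i \<xi>
   + (LBINT x. \<gamma> i x - \<beta> i x) * mean \<xi> i 0 M + (LBINT x. rest i x) * mean_div \<xi> 0 M"
proof -
 note ic = integrable_coeff_cont[OF coeff_cont(1) coeff_supp(1)] integrable_coeff_cont[OF coeff_cont(2) coeff_supp(2)]
  integrable_coeff_cont[OF coeff_cont(3) coeff_supp(3)]
 have iu: "integrable lborel (\<lambda>x. k x * f (u0 x))" if "cont k" "\<And>x. x \<notin> X ==> k x = 0"
  for k and f :: "R2 => real" by (rule integrable_coeff[OF that u0_measurable u0_bounded])
 have vi: "cont (\<lambda>x. v x $ i)" by (intro continuous_intros v_cont)
 have kv: "cont (\<lambda>x. \<alpha> i x * v x $ i)" by (intro continuous_intros v_cont coeff_cont)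
 let ?m = "\<lambda>x. mean \<xi> i (v x) \<rho>" and ?L = "mean \<xi> i 0 M" and ?D = "mean_div \<xi> 0 M"
 let ?mh = "\<lambda>y. mean \<xi> i y h" and ?Dh = "\<lambda>y. mean_div \<xi> y h"
 have iA: "integrable lborel (\<lambda>x. \<alpha> i x * (?m x - ?mh (u0 x) - (v x $ i - u0 x $ i) / 2 * ?Dh (u0 x)))"
 proof -
  have e: "\<alpha> i x * (?m x - ?mh (u0 x) - (v x $ i - u0 x $ i) / 2 * ?Dh (u0 x))
   = \<alpha> i x * ?m x - \<alpha> i x * ?mh (u0 x) - (\<alpha> i x * v x $ i) * (?Dh (u0 x) / 2) + \<alpha> i x * (u0 x $ i / 2 * ?Dh (u0 x))" for x
   by (simp add: field_simps)
  show ?thesis unfolding e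
   by (intro integrable_add integrable_diff ic mean_v_cont[OF xi]
     iu[of "\<alpha> i" ?mh] iu[OF kv, of "\<lambda>y. ?Dh y / 2"] iu[of "\<alpha> i" "\<lambda>y. y $ i / 2 * ?Dh y"] coeff_cont)
    (simp_all add: coeff_supp)
 qed
 have iB: "integrable lborel (\<lambda>x. \<alpha> i x * (mean \<xi> i (u0 x) 0 - ?mh (u0 x) - (u0 x $ i - u0 x $ i) / 2 * ?Dh (u0 x)))"
  using iu[OF coeff_cont(1) coeff_supp(1), where f="\<lambda>y. mean \<xi> i y 0 - ?mh y - (y $ i - y $ i) / 2 * ?Dh y"] .
 have iC: "integrable lborel (\<lambda>x. (\<alpha> i x * ((v x $ i - u0 x $ i) / 2)) * (?Dh (u0 x) - ?D))"
 proof -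
  have e: "(\<alpha> i x * ((v x $ i - u0 x $ i) / 2)) * (?Dh (u0 x) - ?D)
   = (\<alpha> i x * v x $ i) * ((?Dh (u0 x) - ?D) / 2) - \<alpha> i x * (u0 x $ i / 2 * (?Dh (u0 x) - ?D))" for x
   by (simp add: field_simps)
  show ?thesis unfolding e
   by (intro integrable_diff iu[OF kv, of "\<lambda>y. (?Dh y - ?D) / 2"]
     iu[of "\<alpha> i" "\<lambda>y. y $ i / 2 * (?Dh y - ?D)"] coeff_cont) (simp_all add: coeff_supp)
 qed
 have iD: "integrable lborel (\<lambda>x. \<beta> i x * (mean \<xi> i (u0 x) 0 - ?L - (u0 x $ i - 0 $ i) / 2 * ?D))"
  using iu[OF coeff_cont(2) coeff_supp(2), where f="\<lambda>y. mean \<xi> i y 0 - ?L - (y $ i - 0 $ i) / 2 * ?D"] .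
 have iE: "integrable lborel (\<lambda>x. \<gamma> i x * (?m x - ?L - (v x $ i - 0 $ i) / 2 * ?D))"
  by (intro ic continuous_intros mean_v_cont[OF xi] v_cont) auto
 have ig: "integrable lborel (\<lambda>x. \<gamma> i x - \<beta> i x)"
  by (rule integrable_continuous_support[OF _ phi_supp(1)]) (auto intro!: continuous_intros coeff_cont simp: coeff_supp)
 have ir: "integrable lborel (rest i)"
 proof -
  have e: "rest i = (\<lambda>x. (\<alpha> i x * v x $ i) * (1 / 2) - \<alpha> i x * (u0 x $ i / 2) - \<beta> i x * (u0 x $ i / 2) + \<gamma> i x * (v x $ i / 2))"
   by (rule ext) (simp add: rest_def field_simps)
  show ?thesis unfolding e
   by (intro integrable_add integrable_diff iu[OF kv, of "\<lambda>y. 1 / 2"] ic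
     iu[of "\<alpha> i" "\<lambda>y. y $ i / 2"] iu[of "\<beta> i" "\<lambda>y. y $ i / 2"] coeff_cont continuous_intros v_cont) (auto simp: coeff_supp)
 qed
 have i1: "integrable lborel (\<lambda>x. (\<alpha> i x + \<gamma> i x) * ?m x)"
  by (intro integrable_coeff_cont continuous_intros coeff_cont mean_v_cont[OF xi]) (simp add: coeff_supp)
 have i2: "integrable lborel (\<lambda>x. d\<phi> i x * \<xi> (u0 x) $ i)" using iu[OF phi_cont(2) phi_supp(3), where f="\<lambda>y. \<xi> y $ i"] .
 have e: "(\<alpha> i x + \<gamma> i x) * ?m x - d\<phi> i x * \<xi> (u0 x) $ i
  = \<alpha> i x * (?m x - ?mh (u0 x) - (v x $ i - u0 x $ i) / 2 * ?Dh (u0 x))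
   - \<alpha> i x * (mean \<xi> i (u0 x) 0 - ?mh (u0 x) - (u0 x $ i - u0 x $ i) / 2 * ?Dh (u0 x))
   + (\<alpha> i x * ((v x $ i - u0 x $ i) / 2)) * (?Dh (u0 x) - ?D)
   - \<beta> i x * (mean \<xi> i (u0 x) 0 - ?L - (u0 x $ i - 0 $ i) / 2 * ?D)
   + \<gamma> i x * (?m x - ?L - (v x $ i - 0 $ i) / 2 * ?D)
   + (\<gamma> i x - \<beta> i x) * ?L + rest i x * ?D" for x
 proof -
  have d: "d\<phi> i x = \<alpha> i x + \<beta> i x" by (simp add: \<alpha>_def \<beta>_def algebra_simps)
  show ?thesis unfolding d rest_def mean_zero by (simp add: field_simps)
 qed
 have "(LBINT x. (\<alpha> i x + \<gamma> i x) * ?m x) - (LBINT x. d\<phi> i x * \<xi> (u0 x) $ i)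
   = (LBINT x. (\<alpha> i x + \<gamma> i x) * ?m x - d\<phi> i x * \<xi> (u0 x) $ i)" by (rule integral_diff[symmetric, OF i1 i2])
 also have "\<dots> = piece_A i \<xi> - piece_B i \<xi> + piece_C i \<xi> - piece_D i \<xi> + piece_E i \<xi>
   + (LBINT x. (\<gamma> i x - \<beta> i x) * ?L) + (LBINT x. rest i x * ?D)"
 proof -
  have hb: "has_bochner_integral lborel (\<lambda>x. (\<alpha> i x + \<gamma> i x) * ?m x - d\<phi> i x * \<xi> (u0 x) $ i)
   (piece_A i \<xi> - piece_B i \<xi> + piece_C i \<xi> - piece_D i \<xi> + piece_E i \<xi>
   + (LBINT x. (\<gamma> i x - \<beta> i x) * ?L) + (LBINT x. rest i x * ?D))" unfolding e piece_A_def piece_B_def piece_C_def piece_D_def piece_E_def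
   by (intro has_bochner_integral_add has_bochner_integral_diff has_bochner_integral_integrable iA iB iC iD iE
     integrable_mult_left ig ir)
  then show ?thesis by (rule has_bochner_integral_integral_eq)
 qed
 finally show ?thesis by simp
qed

text \<open>Recorded exactly as \<open>tfrep_mean\<close> and \<open>tfrep_mean_div\<close> deliver
  it, vanishing distances included; \<open>transport_cost_le\<close> does the
  simplification.\<close>

definition transport_cost :: real where
 "transport_cost = (\<Sum>i\<in>UNIV. 160 * h * (LBINT x. \<bar>\<alpha> i x\<bar> * (1 + norm (v x - u0 x) / (h - \<rho>))\<^sup>2)
   + 160 * h * (LBINT x. \<bar>\<alpha> i x\<bar> * (1 + norm (u0 x - u0 x) / (h - 0))\<^sup>2)
   + 160 * ln (M / h) * (LBINT x. \<bar>\<alpha> i x * ((v x $ i - u0 x $ i) / 2)\<bar> * (1 + norm (u0 x - 0) / (M - h)))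
   + 160 * M * (LBINT x. \<bar>\<beta> i x\<bar> * (1 + norm (u0 x - 0) / (M - 0))\<^sup>2)
   + 160 * M * (LBINT x. \<bar>\<gamma> i x\<bar> * (1 + norm (v x - 0) / (M - \<rho>))\<^sup>2))
  + 160 * ln (M / \<rho>) * (LBINT x. \<bar>\<delta> x\<bar> * (1 + norm (v x - 0) / (M - \<rho>)))"

lemma pieces_tfrep:
 "tfrep (cball 0 (5 * M)) transport_cost
  (\<lambda>\<xi>. (\<Sum>i\<in>UNIV. piece_A i \<xi> - piece_B i \<xi> + piece_C i \<xi> - piece_D i \<xi> + piece_E i \<xi>) + piece_F \<xi>)"
proof -
 \<comment> \<open>The map v is bounded only where the target cutoff can be nonzero. Outside this
   set \<alpha>, \<gamma> and \<delta> vanish, and \<beta> is paired with the jump function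
   alone.\<close>
 let ?Y = "X \<inter> {x. infnorm (v x) \<le> 2 * M}"
 have bY: "bounded ?Y" using phi_supp(1) by blast
 have vb: "norm (v x) \<le> 3 * M" if "x \<in> ?Y" for x using infnorm_norm[of "v x"] that by auto
 have Y0: "\<alpha> i x = 0" "\<gamma> i x = 0" "\<delta> x = 0" if "x \<notin> ?Y" for i x
 proof -
  have "x \<notin> X \<or> chi M (v x) = 0 \<and> chi' M (v x) (dv i x) = 0"
  proof (cases "x \<in> X")
   case True
   then have "2 * M \<le> infnorm (v x)" using that by auto
   then show ?thesis using chi_eq(2)[OF M, of "v x" "dv i x"] by blast
  qed simp
  then show "\<alpha> i x = 0" "\<gamma> i x = 0" "\<delta> x = 0" using phi_supp(2,3)[of x] by (auto simp: \<alpha>_def \<gamma>_def \<delta>_def wt_def)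
 qed
 have M1: "1 \<le> M" using a norm_ge_zero[of am] by linarith
 \<comment> \<open>The bounds for the centres are chosen so that both final radii, h and M, lead to
   the same ball of radius 5 M.\<close>
 have r5: "5 * M - 2 * h + 2 * h = 5 * M" "3 * M + 2 * M = 5 * M" by simp_all
 have i: "tfrep (cball 0 (5 * M)) (160 * h * (LBINT x. \<bar>\<alpha> i x\<bar> * (1 + norm (v x - u0 x) / (h - \<rho>))\<^sup>2)
   + 160 * h * (LBINT x. \<bar>\<alpha> i x\<bar> * (1 + norm (u0 x - u0 x) / (h - 0))\<^sup>2)
   + 160 * ln (M / h) * (LBINT x. \<bar>\<alpha> i x * ((v x $ i - u0 x $ i) / 2)\<bar> * (1 + norm (u0 x - 0) / (M - h)))
   + 160 * M * (LBINT x. \<bar>\<beta> i x\<bar> * (1 + norm (u0 x - 0) / (M - 0))\<^sup>2)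
   + 160 * M * (LBINT x. \<bar>\<gamma> i x\<bar> * (1 + norm (v x - 0) / (M - \<rho>))\<^sup>2))
  (\<lambda>\<xi>. piece_A i \<xi> - piece_B i \<xi> + piece_C i \<xi> - piece_D i \<xi> + piece_E i \<xi>)" for i
 proof -
  obtain c where c: "\<And>x. \<bar>\<alpha> i x\<bar> \<le> c" "\<And>x. \<bar>\<beta> i x\<bar> \<le> c" "\<And>x. \<bar>\<gamma> i x\<bar> \<le> c" "\<And>x. \<bar>\<delta> x\<bar> \<le> c" "0 \<le> c" using coeff_bounded by blast
  have nu: "norm (u0 x) \<le> 3 * M" "norm (u0 x) \<le> 5 * M - 2 * h" for x using norm_u0[of x] M1 h h0 by linarith+
  have nv: "norm (v x) \<le> 5 * M - 2 * h" if "x \<in> ?Y" for x using vb[OF that] h M1 by linarith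
  have A: "tfrep (cball 0 (5 * M)) (160 * h * (LBINT x. \<bar>\<alpha> i x\<bar> * (1 + norm (v x - u0 x) / (h - \<rho>))\<^sup>2)) (piece_A i)"
   unfolding piece_A_def[abs_def]
   by (rule tfrep_mean[where X="?Y" and R="5 * M - 2 * h" and t=\<rho> and L=h, unfolded r5])
    (use bY Y0 c h \<rho> nu nv in auto)
  have B: "tfrep (cball 0 (5 * M)) (160 * h * (LBINT x. \<bar>\<alpha> i x\<bar> * (1 + norm (u0 x - u0 x) / (h - 0))\<^sup>2)) (piece_B i)"
   unfolding piece_B_def[abs_def]
   by (rule tfrep_mean[where X="?Y" and R="5 * M - 2 * h" and t=0 and L=h, unfolded r5])
    (use bY Y0 c h0 nu in auto)
  have ckb: "\<bar>\<alpha> i x * ((v x $ i - u0 x $ i) / 2)\<bar> \<le> c * (3 * M)" for x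
  proof (cases "x \<in> ?Y")
   case True
   have "\<bar>v x $ i\<bar> \<le> 3 * M" "\<bar>u0 x $ i\<bar> \<le> 3 * M"
    using vb[OF True] nu(1)[of x] component_le_norm_cart[of "v x" i] component_le_norm_cart[of "u0 x" i] by linarith+
   then have "\<bar>(v x $ i - u0 x $ i) / 2\<bar> \<le> 3 * M" by (simp add: abs_le_iff)
   then show ?thesis unfolding abs_mult[of "\<alpha> i x"] using c(1)[of x] c(5) by (intro mult_mono) auto
  next
   case False
   then show ?thesis using Y0(1)[OF False] c(5) M by simp
  qed
  have C: "tfrep (cball 0 (5 * M)) (160 * ln (M / h) * (LBINT x. \<bar>\<alpha> i x * ((v x $ i - u0 x $ i) / 2)\<bar> * (1 + norm (u0 x - 0) / (M - h)))) (piece_C i)"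
   unfolding piece_C_def[abs_def]
  proof (rule tfrep_mean_div[where X="?Y" and R="3 * M" and t=h and L=M, unfolded r5, OF _ _ _ bY _ ckb])
   show "(\<lambda>x. \<alpha> i x * ((v x $ i - u0 x $ i) / 2)) \<in> borel_measurable borel"
    by (intro borel_measurable_times borel_measurable_divide borel_measurable_diff borel_measurable_const coeff_meas u0_measurable[of "\<lambda>y. y $ i"] borel_measurable_continuous_onI continuous_on_component v_cont)
  qed (use Y0 h h0 nu M1 in auto)
  have D: "tfrep (cball 0 (5 * M)) (160 * M * (LBINT x. \<bar>\<beta> i x\<bar> * (1 + norm (u0 x - 0) / (M - 0))\<^sup>2)) (piece_D i)"
   unfolding piece_D_def[abs_def]
   by (rule tfrep_mean[where X=X and R="3 * M" and t=0 and L=M, unfolded r5])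
    (use phi_supp(1) coeff_supp(2) c nu M1 in auto)
  have E: "tfrep (cball 0 (5 * M)) (160 * M * (LBINT x. \<bar>\<gamma> i x\<bar> * (1 + norm (v x - 0) / (M - \<rho>))\<^sup>2)) (piece_E i)"
   unfolding piece_E_def[abs_def]
   by (rule tfrep_mean[where X="?Y" and R="3 * M" and t=\<rho> and L=M, unfolded r5])
    (use bY Y0 c vb \<rho> M1 in auto)
  have bS: "bounded (cball 0 (5 * M) :: R2 set)" by simp
  from tfrep_add[OF tfrep_add[OF tfrep_add[OF tfrep_add[OF A tfrep_scale[OF B, of "-1"] bS] C bS] tfrep_scale[OF D, of "-1"] bS] E bS]
  show ?thesis by (rule tfrep_cong) simp_all
 qed
 obtain c where c: "\<And>x. \<bar>\<alpha> 1 x\<bar> \<le> c" "\<And>x. \<bar>\<beta> 1 x\<bar> \<le> c" "\<And>x. \<bar>\<gamma> 1 x\<bar> \<le> c" "\<And>x. \<bar>\<delta> x\<bar> \<le> c" "0 \<le> c" using coeff_bounded by blast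
 have F: "tfrep (cball 0 (5 * M)) (160 * ln (M / \<rho>) * (LBINT x. \<bar>\<delta> x\<bar> * (1 + norm (v x - 0) / (M - \<rho>)))) piece_F"
  unfolding piece_F_def[abs_def]
  by (rule tfrep_mean_div[where X="?Y" and R="3 * M" and t=\<rho> and L=M, unfolded r5])
   (use bY Y0 c vb \<rho> M1 in auto)
 have bS: "bounded (cball 0 (5 * M) :: R2 set)" by simp
 show ?thesis unfolding transport_cost_def sum_2 by (intro tfrep_add i F bS)
qed

text \<open>After all transports, the required boundary minus that of \<open>G1\<close> is the
  filled functional plus a combination of two means and one mean of the divergence over the fixed
  square. Constant fields annihilate everything except the means, so their coefficients vanish. The
  identity annihilates both trace-free densities and also the required boundary, because am and ap
  have the same first component, so the coefficient of the divergence vanishes too.\<close>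

theorem corrected_density:
 "\<exists>G. integrable lborel G \<and> (\<forall>y. trace (G y) = 0) \<and> (\<forall>y. y \<notin> cball 0 (5 * M) \<longrightarrow> G y = 0) \<and>
  (LBINT y. norm (G y)) \<le> transport_cost \<and>
  (\<forall>\<xi>. C1 \<xi> \<longrightarrow> (LBINT y. (G1 y + G y) \<bullet> jacobian \<xi> (at y)) = l * (\<xi> ap $ 1 - \<xi> am $ 1))"
proof -
 define \<Lambda> where "\<Lambda> = (\<lambda>\<xi>. (\<Sum>i\<in>UNIV. piece_A i \<xi> - piece_B i \<xi> + piece_C i \<xi> - piece_D i \<xi> + piece_E i \<xi>) + piece_F \<xi>)"
 obtain G where G: "integrable lborel G" "\<And>y. trace (G y) = 0" "\<And>y. y \<notin> cball 0 (5 * M) ==> G y = 0"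
  "(LBINT y. norm (G y)) \<le> transport_cost" "\<And>\<xi>. C1 \<xi> ==> \<Lambda> \<xi> = (LBINT y. G y \<bullet> jacobian \<xi> (at y))"
  using pieces_tfrep unfolding tfrep_def \<Lambda>_def by blast
 define d where "d i = (LBINT x. \<gamma> i x - \<beta> i x)" for i
 define c where "c = (LBINT x. rest 1 x) + (LBINT x. rest 2 x) + (LBINT x. \<delta> x)"
 have main: "l * (\<xi> ap $ 1 - \<xi> am $ 1) - (LBINT y. G1 y \<bullet> jacobian \<xi> (at y))
  = \<Lambda> \<xi> + d 1 * mean \<xi> 1 0 M + d 2 * mean \<xi> 2 0 M + c * mean_div \<xi> 0 M" if xi: "C1 \<xi>" for \<xi>
 proof -
  have id: "integrable lborel (\<lambda>x. \<delta> x * mean_div \<xi> (v x) \<rho>)" "integrable lborel \<delta>"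
   using integrable_coeff_cont[OF coeff_cont(4) coeff_supp(4) mean_v_cont(2)[OF xi]]
    integrable_continuous_support[OF coeff_cont(4) phi_supp(1) coeff_supp(4)] by blast+
  have "piece_F \<xi> = (LBINT x. \<delta> x * mean_div \<xi> (v x) \<rho> - \<delta> x * mean_div \<xi> 0 M)"
   unfolding piece_F_def right_diff_distrib ..
  also have "\<dots> = (LBINT x. \<delta> x * mean_div \<xi> (v x) \<rho>) - (LBINT x. \<delta> x) * mean_div \<xi> 0 M"
   by (subst integral_diff[OF id(1) integrable_mult_left[OF id(2)]]) simp
  finally have F: "(LBINT x. \<delta> x * mean_div \<xi> (v x) \<rho>) = piece_F \<xi> + (LBINT x. \<delta> x) * mean_div \<xi> 0 M" by simp
  show ?thesis
   using pieces_sum[OF xi, of 1] pieces_sum[OF xi, of 2] target_identity[of \<xi>]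
   unfolding G1_boundary[OF xi] F \<Lambda>_def sum_2 d_def c_def by (simp add: algebra_simps)
 qed
 have const: "C1 (\<lambda>x. axis k 1)" and jc: "jacobian (\<lambda>x. axis k 1 :: R2) (at (y :: R2)) = 0" for k :: 2 and y
 proof -
  have "((\<lambda>x. axis k 1 :: R2) has_derivative (\<lambda>h. 0)) (at y)" for y :: "R2" by (rule has_derivative_const)
  then have "jacobian (\<lambda>x. axis k 1 :: R2) (at y) = 0" for y :: "R2"
   unfolding jacobian_def by (simp add: frechet_derivative_const matrix_def vec_eq_iff)
  then show "C1 (\<lambda>x. axis k 1)" "jacobian (\<lambda>x. axis k 1 :: R2) (at y) = 0" by (auto simp: C1_def)
 qed
 have ident: "C1 (\<lambda>x. x)" and ji: "jacobian (\<lambda>x. x :: R2) (at y) = mat 1" for y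
 proof -
  have "jacobian (\<lambda>x. x :: R2) (at y) = mat 1" for y
   unfolding jacobian_def by (simp add: frechet_derivative_ident matrix_def mat_def vec_eq_iff axis_def)
  then show "C1 (\<lambda>x. x)" "jacobian (\<lambda>x. x :: R2) (at y) = mat 1" by (auto simp: C1_def)
 qed
 have ip: "N \<bullet> mat 1 = trace N" for N :: "real^2^2" by (simp add: inner_vec_def trace_def sum_2 mat_def)
 have dz: "d k = 0" for k
 proof -
  have m: "mean (\<lambda>x. axis k 1) j 0 M = (if j = k then 1 else 0)" for j
   unfolding mean_def by (simp add: axis_def eta_integral)
  have md: "mean_div (\<lambda>x. axis k 1) 0 M = 0" unfolding mean_div_def jc by (simp add: trace_def)
  have "\<Lambda> (\<lambda>x. axis k 1) = 0" unfolding G(5)[OF const] jc by simp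
  then have "d 1 * (if 1 = k then 1 else 0) + d 2 * (if 2 = k then 1 else 0) = 0" using main[OF const, of k] unfolding m md jc by simp
  then show ?thesis using exhaust_2[of k] by auto
 qed
 have cz: "c = 0"
 proof -
  have md: "mean_div (\<lambda>x. x) 0 M = 2" unfolding mean_div_def ji by (simp add: trace_def sum_2 mat_def eta_integral)
  have "\<Lambda> (\<lambda>x. x) = 0" unfolding G(5)[OF ident] ji ip G(2) by simp
  then show ?thesis using main[OF ident] a1 unfolding md ji ip trace_G1 dz by simp
 qed
 have "(LBINT y. (G1 y + G y) \<bullet> jacobian \<xi> (at y)) = l * (\<xi> ap $ 1 - \<xi> am $ 1)" if xi: "C1 \<xi>" for \<xi>
 proof -
  have bS: "bounded (cball 0 (5 * M) :: R2 set)" by simp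
  have "(LBINT y. (G1 y + G y) \<bullet> jacobian \<xi> (at y)) = (LBINT y. G1 y \<bullet> jacobian \<xi> (at y)) + (LBINT y. G y \<bullet> jacobian \<xi> (at y))"
   unfolding inner_add_left
   by (rule integral_add[OF integrable_inner_jacobian[OF G1_integrable G1_zero bS xi]
    integrable_inner_jacobian[OF G(1,3) bS xi]])
  then show ?thesis using main[OF xi] G(5)[OF xi] unfolding dz cz by simp
 qed
 then show ?thesis using G(1-4) by (intro exI[of _ G]) blast
qed

end

section \<open>Mollification\<close>

lemma integrable_kernel_mult:
 fixes F q :: "R2 => real"
 assumes F: "integrable lborel F" and q: "cont q" "bounded S" "\<And>w. w \<notin> S ==> q w = 0"
 shows "integrable lborel (\<lambda>z. q (x - z) * F z)"
proof -
 obtain C where C: "0 \<le> C" "\<And>x. norm (q x) \<le> C" using continuous_bounded_support[OF q] by metis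
 have [measurable]: "F \<in> borel_measurable borel" using F by auto
 have [measurable]: "q \<in> borel_measurable borel" by (intro borel_measurable_continuous_onI q)
 show ?thesis
 proof (rule integrable_bound[of _ "\<lambda>z. C * F z"])
  show "AE z in lborel. norm (q (x - z) * F z) \<le> norm (C * F z)" using C by (auto simp: abs_mult intro!: mult_right_mono)
 qed (use F in auto)
qed

lemma convolution_continuous:
 fixes F q :: "R2 => real"
 assumes F: "integrable lborel F" and q: "cont q" "bounded S" "\<And>w. w \<notin> S ==> q w = 0"
 shows "cont (\<lambda>x. LBINT z. q (x - z) * F z)"
proof -
 obtain C where C: "0 \<le> C" "\<And>x. norm (q x) \<le> C" using continuous_bounded_support[OF q] by metis
 have [measurable]: "F \<in> borel_measurable borel" using F by auto
 have [measurable]: "q \<in> borel_measurable borel" by (intro borel_measurable_continuous_onI q)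
 show ?thesis
  unfolding continuous_on_sequentially o_def
 proof (intro ballI allI impI, elim conjE)
  fix y and x :: "nat => R2" assume x: "x \<longlonglongrightarrow> y"
  show "(\<lambda>n. LBINT z. q (x n - z) * F z) \<longlonglongrightarrow> (LBINT z. q (y - z) * F z)"
  proof (rule integral_dominated_convergence[where w="\<lambda>z. C * \<bar>F z\<bar>"])
   have "(\<lambda>n. q (x n - z)) \<longlonglongrightarrow> q (y - z)" for z
    by (rule continuous_on_tendsto_compose[OF q(1)]) (auto intro!: tendsto_intros x)
   then show "AE z in lborel. (\<lambda>n. q (x n - z) * F z) \<longlonglongrightarrow> q (y - z) * F z" by (intro AE_I2 tendsto_mult tendsto_const)
   show "AE z in lborel. norm (q (x n - z) * F z) \<le> C * \<bar>F z\<bar>" for n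
    using C by (auto simp: abs_mult intro!: mult_right_mono)
  qed (use F in auto)
 qed
qed

text \<open>The derivative falls on the kernel, so integrability of F is enough; the bounded
  derivative of q makes it Lipschitz along the direction and dominates the difference
  quotients.\<close>

lemma convolution_deriv:
 fixes F q q' :: "R2 => real"
 assumes F: "integrable lborel F" and q: "cont q" "bounded S" "\<And>w. w \<notin> S ==> q w = 0"
  and q': "cont q'" "\<And>w. w \<notin> S ==> q' w = 0"
  and d: "\<And>w. ((\<lambda>h. q (w + h *\<^sub>R e)) has_real_derivative q' w) (at 0)"
 shows "((\<lambda>h. LBINT z. q ((x + h *\<^sub>R e) - z) * F z) has_real_derivative (LBINT z. q' (x - z) * F z)) (at 0)"
proof -
 obtain C where C: "0 \<le> C" "\<And>x. norm (q' x) \<le> C" using continuous_bounded_support[OF q'(1) q(2) q'(2)] by metis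
 have [measurable]: "F \<in> borel_measurable borel" using F by auto
 have [measurable]: "q \<in> borel_measurable borel" "q' \<in> borel_measurable borel" by (intro borel_measurable_continuous_onI q q')+
 have d': "((\<lambda>h. q (w + h *\<^sub>R e)) has_real_derivative q' (w + s *\<^sub>R e)) (at s)" for w s
  using d[of "w + s *\<^sub>R e"] DERIV_shift[of "\<lambda>h. q (w + h *\<^sub>R e)" "q' (w + s *\<^sub>R e)" 0 s] by (simp add: algebra_simps)
 have lip: "\<bar>q (w + h *\<^sub>R e) - q w\<bar> \<le> C * \<bar>h\<bar>" for w h
  using field_differentiable_bound[of UNIV "\<lambda>h. q (w + h *\<^sub>R e)" "\<lambda>s. q' (w + s *\<^sub>R e)" C h 0] d' C by simp
 show ?thesis unfolding DERIV_def tendsto_at_iff_sequentially o_def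
 proof (intro allI impI)
  fix h :: "nat => real" assume hn: "\<forall>i. h i \<in> UNIV - {0}" and h0: "h \<longlonglongrightarrow> 0"
  have eq: "((LBINT z. q (x + (0 + h n) *\<^sub>R e - z) * F z) - (LBINT z. q (x + 0 *\<^sub>R e - z) * F z)) / h n
   = (LBINT z. (q ((x - z) + h n *\<^sub>R e) - q (x - z)) / h n * F z)" for n
  proof -
   have *: "(q ((x - z) + h n *\<^sub>R e) - q (x - z)) / h n * F z = (q (x + h n *\<^sub>R e - z) * F z - q (x - z) * F z) / h n" for z
    by (simp add: left_diff_distrib add_diff_eq diff_add_eq)
   show ?thesis unfolding *
    using integral_diff[OF integrable_kernel_mult[OF F q, of "x + h n *\<^sub>R e"] integrable_kernel_mult[OF F q, of x]]
    by simp
  qed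
  have "(\<lambda>n. LBINT z. (q ((x - z) + h n *\<^sub>R e) - q (x - z)) / h n * F z) \<longlonglongrightarrow> (LBINT z. q' (x - z) * F z)"
  proof (rule integral_dominated_convergence[where w="\<lambda>z. C * \<bar>F z\<bar>"])
   have "(\<lambda>n. (q ((x - z) + h n *\<^sub>R e) - q (x - z)) / h n) \<longlonglongrightarrow> q' (x - z)" for z
    using d[of "x - z"] hn h0 unfolding DERIV_def tendsto_at_iff_sequentially o_def by simp
   then show "AE z in lborel. (\<lambda>n. (q ((x - z) + h n *\<^sub>R e) - q (x - z)) / h n * F z) \<longlonglongrightarrow> q' (x - z) * F z"
    by (intro AE_I2 tendsto_mult tendsto_const)
   have "\<bar>(q ((x - z) + h n *\<^sub>R e) - q (x - z)) / h n\<bar> \<le> C" for z n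
    using lip[of "x - z" "h n"] hn by (simp add: abs_divide divide_le_eq)
   then show "AE z in lborel. norm ((q ((x - z) + h n *\<^sub>R e) - q (x - z)) / h n * F z) \<le> C * \<bar>F z\<bar>" for n
    unfolding real_norm_def abs_mult by (intro AE_I2 mult_right_mono) auto
  qed (use F in auto)
  then show "(\<lambda>n. ((LBINT z. q (x + (0 + h n) *\<^sub>R e - z) * F z) - (LBINT z. q (x + 0 *\<^sub>R e - z) * F z)) / h n)
   \<longlonglongrightarrow> (LBINT z. q' (x - z) * F z)" unfolding eq .
 qed
qed

text \<open>Exchange of integrals for a kernel of unit mass. Restricting to a bounded set
  \<open>X\<close> makes integrability immediate from continuity of the convolution.\<close>

lemma convolution_L1_le:
 fixes F q :: "R2 => real"
 assumes F: "integrable lborel F" "\<And>z. 0 \<le> F z" and q: "cont q" "bounded S" "\<And>w. w \<notin> S ==> q w = 0"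
  and q1: "\<And>w. 0 \<le> q w" "(LBINT w. q w) = 1" and X: "bounded X" "X \<in> sets borel"
 shows "(LBINT x. ind X x * (LBINT z. q (x - z) * F z)) \<le> (LBINT z. F z)"
  "integrable lborel (\<lambda>x. ind X x * (LBINT z. q (x - z) * F z))"
proof -
 define P where "P x = (LBINT z. q (x - z) * F z)" for x
 have Pc: "cont P" unfolding P_def using convolution_continuous[OF F(1) q] .
 have [measurable]: "P \<in> borel_measurable borel" by (intro borel_measurable_continuous_onI Pc)
 have P0: "0 \<le> P x" for x unfolding P_def by (intro integral_nonneg) (auto simp: F q1)
 have [measurable]: "F \<in> borel_measurable borel" using F by auto
 have [measurable]: "q \<in> borel_measurable borel" by (intro borel_measurable_continuous_onI q)
 have "compact (P ` closure X)" using X(1) Pc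
  by (intro compact_continuous_image) (auto intro: continuous_on_subset simp: compact_closure)
 then obtain C where C: "\<And>x. x \<in> X ==> norm (P x) \<le> C"
  using compact_imp_bounded[of "P ` closure X"] closure_subset[of X] unfolding bounded_iff by (metis image_eqI subsetD)
 have int: "integrable lborel (\<lambda>x. ind X x * P x)"
 proof (rule integrable_bounded_support[OF _ X(1), of _ "max 0 C"])
  show "norm (ind X x * P x) \<le> max 0 C" for x using C[of x] by (auto simp: indicator_def)
 qed (use X(2) in auto)
 have "ennreal (LBINT x. ind X x * P x) = (\<integral>\<^sup>+x. ennreal (ind X x * P x) \<partial>lborel)"
  by (rule nn_integral_eq_integral[OF int, symmetric]) (auto simp: P0)
 also have "\<dots> \<le> (\<integral>\<^sup>+x. ennreal (P x) \<partial>lborel)"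
  by (intro nn_integral_mono ennreal_leI) (auto simp: P0 indicator_def)
 also have "\<dots> = (\<integral>\<^sup>+x. \<integral>\<^sup>+z. ennreal (q (x - z) * F z) \<partial>lborel \<partial>lborel)"
  unfolding P_def by (intro nn_integral_cong nn_integral_eq_integral[symmetric] integrable_kernel_mult[OF F(1) q]) (auto simp: F q1)
 also have "\<dots> = (\<integral>\<^sup>+z. \<integral>\<^sup>+x. ennreal (q (x - z) * F z) \<partial>lborel \<partial>lborel)"
 proof -
  have "(\<lambda>p. ennreal (q (fst p - snd p) * F (snd p))) \<in> borel_measurable (lborel \<Otimes>\<^sub>M (lborel :: R2 measure))" by measurable
  from lborel_pair.Fubini'[of "\<lambda>x z. ennreal (q (x - z) * F z)"] this show ?thesis by (simp add: case_prod_unfold)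
 qed
 also have "\<dots> = (\<integral>\<^sup>+z. ennreal (F z) \<partial>lborel)"
 proof (intro nn_integral_cong)
  fix z
  have "bounded ((+) z ` S)" using q(2) by (rule bounded_translation)
  then have iq: "integrable lborel (\<lambda>x. q (x - z))"
  proof (rule integrable_continuous_support[rotated])
   show "q (x - z) = 0" if "x \<notin> (+) z ` S" for x using that q(3)[of "x - z"] by (force simp: image_iff)
  qed (intro continuous_intros continuous_on_compose2[OF q(1)]; simp)
  have "(\<integral>\<^sup>+x. ennreal (q (x - z) * F z) \<partial>lborel) = ennreal (LBINT x. q (x - z) * F z)"
   by (intro nn_integral_eq_integral integrable_mult_left iq) (auto simp: F q1)
  also have "(LBINT x. q (x - z) * F z) = F z" using integral_translation[of q "-z"] q1(2) by simp
  finally show "(\<integral>\<^sup>+x. ennreal (q (x - z) * F z) \<partial>lborel) = ennreal (F z)" .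
 qed
 also have "\<dots> = ennreal (LBINT z. F z)" by (intro nn_integral_eq_integral F) (auto simp: F)
 finally show "(LBINT x. ind X x * (LBINT z. q (x - z) * F z)) \<le> (LBINT z. F z)" unfolding P_def using F(2) by (simp add: ennreal_le_iff)
 show "integrable lborel (\<lambda>x. ind X x * (LBINT z. q (x - z) * F z))" using int unfolding P_def .
qed

text \<open>An indicator is approximated by that of an open superset, and the latter by multiples of
  the distance to the complement, truncated at 1; sums and dominated limits follow by
  induction.\<close>

lemma continuous_dense_L1:
 fixes F :: "R2 => real"
 assumes "integrable lborel F" "0 < e"
 shows "\<exists>g. cont g \<and> integrable lborel g \<and> (LBINT x. \<bar>F x - g x\<bar>) < e" using assms
proof (induction arbitrary: e rule: integrable_induct)
 case (base A c)
 obtain U where U: "open U" "A \<subseteq> U" "emeasure lborel (U - A) < ennreal (e / (2 * (\<bar>c\<bar> + 1)))"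
  using outer_regular_lborel[of A "e / (2 * (\<bar>c\<bar> + 1))"] base by auto
 have A: "A \<in> sets borel" using base by simp
 have "emeasure lborel U = emeasure lborel A + emeasure lborel (U - A)" using U(1,2) A by (subst plus_emeasure) (auto simp: Un_absorb1)
 then have fU: "emeasure lborel U < \<infinity>"
  using U(3) base(2) by (simp add: less_top ennreal_add_eq_top) (metis ennreal_less_top order_less_trans)
 \<comment> \<open>\<open>infdist\<close> to the empty set is 0 by convention, so the complement of
   U has to be nonempty.\<close>
 have "U \<noteq> UNIV" using fU by auto
 then have ne: "- U \<noteq> {}" by auto
 have cl: "closed (- U)" using U(1) by (rule closed_Compl)
 define g where "g n x = min 1 (real n * infdist x (- U))" for n :: nat and x
 have gc: "cont (g n)" for n unfolding g_def by (intro continuous_intros)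
 have [measurable]: "g n \<in> borel_measurable borel" for n by (intro borel_measurable_continuous_onI gc)
 have [measurable]: "U \<in> sets borel" "A \<in> sets borel" using U A by auto
 have g01: "0 \<le> g n x" "g n x \<le> ind U x" for n x
  using infdist_nonneg[of x "-U"] in_closed_iff_infdist_zero[OF cl ne, of x] by (auto simp: g_def indicator_def)
 have iU: "integrable lborel (ind U)" "integrable lborel (ind A)" using fU base by (auto intro!: integrable_real_indicator)
 have ig: "integrable lborel (g n)" for n
  by (rule integrable_bound[OF iU(1)]) (use g01 in \<open>auto simp: abs_of_nonneg\<close>)
 have lim: "(\<lambda>n. LBINT x. \<bar>ind U x - g n x\<bar>) \<longlonglongrightarrow> (LINT x|(lborel :: R2 measure). 0)"
 proof (rule integral_dominated_convergence[where w="ind U"])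
  have "(\<lambda>n. \<bar>ind U x - g n x\<bar>) \<longlonglongrightarrow> 0" for x
  proof (cases "x \<in> U")
   case True
   then have p: "0 < infdist x (- U)" using infdist_nonneg[of x "-U"] in_closed_iff_infdist_zero[OF cl ne, of x] by auto
   obtain N where N: "1 \<le> real N * infdist x (- U)" using spec[OF reals_Archimedean3[OF p], of 1] by (auto intro: less_imp_le)
   have "\<bar>ind U x - g n x\<bar> = 0" if "n \<ge> N" for n
   proof -
    have "1 \<le> real n * infdist x (- U)" using N that p by (smt (verit) mult_right_mono of_nat_le_iff)
    then show ?thesis using True by (simp add: g_def)
   qed
   then show ?thesis by (intro tendsto_eventually) (auto simp: eventually_sequentially)
  next
   case False
   then have "g n x = 0" for n using g01[of n x] by simp
   then show ?thesis using False by simp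
  qed
  then show "AE x in lborel. (\<lambda>n. \<bar>ind U x - g n x\<bar>) \<longlonglongrightarrow> 0" by simp
  show "AE x in lborel. norm \<bar>ind U x - g n x\<bar> \<le> ind U x" for n
  proof (rule AE_I2)
   fix x show "norm \<bar>ind U x - g n x\<bar> \<le> ind U x" using g01[of n x] by simp
  qed
 qed (use iU in auto)
 have pos: "0 < e / (2 * (\<bar>c\<bar> + 1))" using base by auto
 from order_tendstoD(2)[OF lim, of "e / (2 * (\<bar>c\<bar> + 1))"] pos obtain n
  where n: "(LBINT x. \<bar>ind U x - g n x\<bar>) < e / (2 * (\<bar>c\<bar> + 1))" by (auto simp: eventually_sequentially)
 have iUA: "integrable lborel (\<lambda>x. \<bar>ind U x - ind A x\<bar>)" "integrable lborel (\<lambda>x. \<bar>ind U x - g n x\<bar>)"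
  "integrable lborel (\<lambda>x. \<bar>ind A x - g n x\<bar>)" using iU ig by auto
 have "(LBINT x. \<bar>ind U x - ind A x\<bar>) = measure lborel (U - A)"
 proof -
  have "\<bar>ind U x - ind A x\<bar> = ind (U - A) x" for x using U(2) by (auto simp: indicator_def)
  then show ?thesis by simp
 qed
 also have "\<dots> < e / (2 * (\<bar>c\<bar> + 1))" using U(3) order_less_trans[OF U(3) ennreal_less_top] pos by (simp add: measure_def enn2real_less_iff)
 finally have m: "(LBINT x. \<bar>ind U x - ind A x\<bar>) < e / (2 * (\<bar>c\<bar> + 1))" .
 have "(LBINT x. \<bar>ind A x - g n x\<bar>) \<le> (LBINT x. \<bar>ind U x - ind A x\<bar> + \<bar>ind U x - g n x\<bar>)"
  by (intro integral_mono integrable_add iUA) linarith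
 also have "\<dots> < e / (\<bar>c\<bar> + 1)" using n m by (simp add: integral_add[OF iUA(1,2)] field_simps)
 finally have "(LBINT x. \<bar>ind A x - g n x\<bar>) < e / (\<bar>c\<bar> + 1)" .
 then have "(LBINT x. \<bar>ind A x - g n x\<bar>) * (\<bar>c\<bar> + 1) < e" by (simp add: less_divide_eq add_nonneg_pos)
 moreover have "0 \<le> (LBINT x. \<bar>ind A x - g n x\<bar>)" by (intro integral_nonneg) auto
 ultimately have fin: "(LBINT x. \<bar>ind A x - g n x\<bar>) * \<bar>c\<bar> < e" unfolding distrib_left by linarith
 have "\<bar>ind A x *\<^sub>R c - c * g n x\<bar> = \<bar>ind A x - g n x\<bar> * \<bar>c\<bar>" for x
  by (simp add: abs_mult[symmetric] algebra_simps)
 then show ?case using fin gc[of n] ig[of n] by (intro exI[of _ "\<lambda>x. c * g n x"]) (auto intro!: continuous_intros)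
next
 case (add f g)
 obtain a where a: "cont a" "integrable lborel a" "(LBINT x. \<bar>f x - a x\<bar>) < e / 2" using add.IH(1)[of "e / 2"] add.prems by auto
 obtain b where b: "cont b" "integrable lborel b" "(LBINT x. \<bar>g x - b x\<bar>) < e / 2" using add.IH(2)[of "e / 2"] add.prems by auto
 have i: "integrable lborel (\<lambda>x. \<bar>f x - a x\<bar>)" "integrable lborel (\<lambda>x. \<bar>g x - b x\<bar>)" "integrable lborel (\<lambda>x. \<bar>f x + g x - (a x + b x)\<bar>)"
  using add.hyps a b by (auto intro!: integrable_diff integrable_add integrable_abs)
 have "(LBINT x. \<bar>f x + g x - (a x + b x)\<bar>) \<le> (LBINT x. \<bar>f x - a x\<bar> + \<bar>g x - b x\<bar>)"
  by (intro integral_mono integrable_add i) linarith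
 also have "\<dots> < e" using a b by (simp add: integral_add[OF i(1,2)])
 finally show ?case using a b by (intro exI[of _ "\<lambda>x. a x + b x"]) (auto intro!: continuous_intros)
next
 case (lim f s)
 have "(\<lambda>i. LBINT x. \<bar>f x - s i x\<bar>) \<longlonglongrightarrow> (LINT x|(lborel :: R2 measure). 0)"
 proof (rule integral_dominated_convergence[where w="\<lambda>x. 3 * norm (f x)"])
  show "AE x in lborel. (\<lambda>i. \<bar>f x - s i x\<bar>) \<longlonglongrightarrow> 0"
  proof (rule AE_I2)
   fix x :: "R2"
   have "(\<lambda>i. s i x) \<longlonglongrightarrow> f x" by (rule lim.hyps(2)) simp
   then have "(\<lambda>i. \<bar>f x - s i x\<bar>) \<longlonglongrightarrow> \<bar>f x - f x\<bar>" by (intro tendsto_intros)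
   then show "(\<lambda>i. \<bar>f x - s i x\<bar>) \<longlonglongrightarrow> 0" by simp
  qed
  show "AE x in lborel. norm \<bar>f x - s i x\<bar> \<le> 3 * norm (f x)" for i
  proof (rule AE_I2)
   fix x :: "R2"
   have "norm (s i x) \<le> 2 * norm (f x)" by (rule lim.hyps(3)) simp
   then show "norm \<bar>f x - s i x\<bar> \<le> 3 * norm (f x)" unfolding real_norm_def by linarith
  qed
 qed (use lim.hyps in auto)
 from order_tendstoD(2)[OF this, of "e / 2"] lim.prems obtain n where n: "(LBINT x. \<bar>f x - s n x\<bar>) < e / 2"
  by (auto simp: eventually_sequentially)
 obtain g where g: "cont g" "integrable lborel g" "(LBINT x. \<bar>s n x - g x\<bar>) < e / 2" using lim.IH[of "e / 2" n] lim.prems by auto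
 have i: "integrable lborel (\<lambda>x. \<bar>f x - s n x\<bar>)" "integrable lborel (\<lambda>x. \<bar>s n x - g x\<bar>)" "integrable lborel (\<lambda>x. \<bar>f x - g x\<bar>)"
  using lim.hyps g by (auto intro!: integrable_diff integrable_abs)
 have "(LBINT x. \<bar>f x - g x\<bar>) \<le> (LBINT x. \<bar>f x - s n x\<bar> + \<bar>s n x - g x\<bar>)"
  by (intro integral_mono integrable_add i) linarith
 also have "\<dots> < e" using n g by (simp add: integral_add[OF i(1,2)])
 finally show ?case using g by blast
qed

text \<open>The radius d serves all admissible kernels, so that one kernel can be used for both
  components of a map. F is split into a continuous function, handled by uniform continuity, and a
  small remainder, whose convolution stays small because the kernel has unit mass.\<close>

lemma convolution_L1_limit:
 fixes F :: "R2 => real"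
 assumes F: "integrable lborel F" and X: "bounded X" "X \<in> sets borel" and \<kappa>: "0 < \<kappa>"
 shows "\<exists>d>0. \<forall>q. cont q \<and> (\<forall>w. 0 \<le> q w) \<and> (LBINT w. q w) = 1 \<and> (\<forall>w. d \<le> norm w \<longrightarrow> q w = 0) \<and> (\<forall>w. q (- w) = q w)
   \<longrightarrow> (LBINT x. ind X x * \<bar>(LBINT z. q (x - z) * F z) - F x\<bar>) < \<kappa>"
proof -
 obtain g where g: "cont g" "integrable lborel g" "(LBINT x. \<bar>F x - g x\<bar>) < \<kappa> / 4"
  using continuous_dense_L1[OF F, of "\<kappa> / 4"] \<kappa> by auto
 define m where "m = measure lborel X"
 have fX: "emeasure lborel X < \<infinity>" using X emeasure_bounded_finite by simp
 have iX: "integrable lborel (ind X)" using X(2) fX by (auto intro!: integrable_real_indicator)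
 obtain R where R: "X \<subseteq> cball 0 R" using X(1) unfolding bounded_iff by (auto simp: subset_iff)
 have "uniformly_continuous_on (cball 0 (R + 1)) g" by (intro compact_uniformly_continuous continuous_on_subset[OF g(1)]) auto
 moreover have mp: "0 < \<kappa> / (4 * (m + 1))" using \<kappa> by (simp add: m_def add_nonneg_pos)
 ultimately obtain d' where d': "0 < d'" "\<And>x z. x \<in> cball 0 (R + 1) ==> z \<in> cball 0 (R + 1) ==> dist z x < d' ==> dist (g z) (g x) < \<kappa> / (4 * (m + 1))"
  unfolding uniformly_continuous_on_def by meson
 show ?thesis
 proof (intro exI[of _ "min d' 1"] conjI allI impI)
  show "0 < min d' 1" using d' by simp
  fix q :: "R2 => real"
  assume "cont q \<and> (\<forall>w. 0 \<le> q w) \<and> (LBINT w. q w) = 1 \<and> (\<forall>w. min d' 1 \<le> norm w \<longrightarrow> q w = 0) \<and> (\<forall>w. q (- w) = q w)"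
  then have q: "cont q" "\<And>w. 0 \<le> q w" "(LBINT w. q w) = 1" "\<And>w. min d' 1 \<le> norm w ==> q w = 0" "\<And>w. q (- w) = q w" by blast+
  have S: "bounded (ball (0::R2) (min d' 1))" "w \<notin> ball 0 (min d' 1) ==> q w = 0" for w using q(4)[of w] by auto
  define D where "D z = \<bar>F z - g z\<bar>" for z
  have D: "integrable lborel D" "0 \<le> D z" for z unfolding D_def[abs_def] using F g by auto
  define P where "P x = (LBINT z. q (x - z) * D z)" for x
  note young = convolution_L1_le[OF D q(1) S q(2,3) X, folded P_def]
  have iq: "integrable lborel (\<lambda>z. q (x - z))" "(LBINT z. q (x - z)) = 1" for x
  proof -
   have iq0: "integrable lborel q" by (rule integrable_continuous_support[OF q(1) S])
   have qm: "q \<in> borel_measurable borel" by (intro borel_measurable_continuous_onI q)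
   show "integrable lborel (\<lambda>z. q (x - z))" 
    by (intro integrable_continuous_support[of _ "cball x (min d' 1)"] continuous_intros continuous_on_compose2[OF q(1)] q(4))
     (auto simp: dist_norm)
   have "q (x - z) = q (z + (- x))" for z using q(5)[of "x - z"] by simp
    then show "(LBINT z. q (x - z)) = 1" using integral_translation[OF qm, of "- x"] q(3) by simp
  qed
  have pw: "ind X x * \<bar>(LBINT z. q (x - z) * F z) - F x\<bar> \<le> ind X x * P x + ind X x * (\<kappa> / (4 * (m + 1))) + D x" for x
  proof (cases "x \<in> X")
   case True
   have i1: "integrable lborel (\<lambda>z. q (x - z) * F z)" "integrable lborel (\<lambda>z. q (x - z) * D z)" "integrable lborel (\<lambda>z. q (x - z) * g z)"
    "integrable lborel (\<lambda>z. q (x - z) * (F z - g z))" using F g(2) D(1) by (auto intro!: integrable_kernel_mult[OF _ q(1) S])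
   have i2: "integrable lborel (\<lambda>z. q (x - z) * (g z - g x))" unfolding right_diff_distrib using i1 iq by auto
   have "(LBINT z. q (x - z) * F z) - F x = (LBINT z. q (x - z) * (F z - g z)) + (LBINT z. q (x - z) * (g z - g x)) + (g x - F x)"
    using i1 iq unfolding right_diff_distrib by simp
   moreover have "\<bar>LBINT z. q (x - z) * (F z - g z)\<bar> \<le> P x"
    unfolding P_def using integral_norm_bound[of lborel "\<lambda>z. q (x - z) * (F z - g z)"] by (simp add: abs_mult D_def q)
   moreover have "\<bar>LBINT z. q (x - z) * (g z - g x)\<bar> \<le> \<kappa> / (4 * (m + 1))"
   proof -
    have "\<bar>LBINT z. q (x - z) * (g z - g x)\<bar> \<le> (LBINT z. \<bar>q (x - z) * (g z - g x)\<bar>)"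
     using integral_norm_bound[of lborel "\<lambda>z. q (x - z) * (g z - g x)"] by simp
    also have "\<dots> \<le> (LBINT z. q (x - z) * (\<kappa> / (4 * (m + 1))))"
    proof (intro integral_mono integrable_abs i2 integrable_mult_left iq)
     fix z
     show "\<bar>q (x - z) * (g z - g x)\<bar> \<le> q (x - z) * (\<kappa> / (4 * (m + 1)))"
     proof (cases "norm (x - z) < min d' 1")
      case True
      have "norm z \<le> norm x + norm (x - z)" by (metis norm_triangle_sub norm_minus_commute add.commute)
      then have "z \<in> cball 0 (R + 1)" "x \<in> cball 0 (R + 1)" using True R \<open>x \<in> X\<close> by (auto dest!: subsetD)
      from d'(2)[OF this(2,1)] have "\<bar>g z - g x\<bar> \<le> \<kappa> / (4 * (m + 1))" using True by (simp add: dist_norm norm_minus_commute)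
      from mult_left_mono[OF this q(2)[of "x - z"]] show ?thesis using q(2)[of "x - z"] by (simp only: abs_mult abs_of_nonneg)
     next
      case False
      then have "q (x - z) = 0" by (intro q(4)) linarith
      then show ?thesis by simp
     qed
    qed
    finally show ?thesis using iq(2)[of x] by simp
   qed
   ultimately show ?thesis using True unfolding D_def by simp
  next
   case False then show ?thesis by (simp add: D)
  qed
  have "(LBINT x. ind X x * \<bar>(LBINT z. q (x - z) * F z) - F x\<bar>)
   \<le> (LBINT x. ind X x * P x + ind X x * (\<kappa> / (4 * (m + 1))) + D x)"
  proof (rule integral_mono'[OF _ pw])
   show "integrable lborel (\<lambda>x. ind X x * P x + ind X x * (\<kappa> / (4 * (m + 1))) + D x)"
    by (intro integrable_add D young(2) integrable_mult_left iX)
   have "0 \<le> P x" for x unfolding P_def by (intro integral_nonneg) (auto simp: D q)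
   then show "0 \<le> ind X x * P x + ind X x * (\<kappa> / (4 * (m + 1))) + D x" for x
    using D(2)[of x] mp by (intro add_nonneg_nonneg mult_nonneg_nonneg) auto
  qed
  also have "\<dots> = (LBINT x. ind X x * P x) + m * (\<kappa> / (4 * (m + 1))) + (LBINT x. D x)" using young(2) iX D(1) by (simp add: m_def)
  also have "\<dots> < \<kappa>"
  proof -
   have "0 \<le> m" by (simp add: m_def)
   then have "m / (m + 1) \<le> 1" by simp
   from mult_left_mono[OF this, of "\<kappa> / 4"] have "m * (\<kappa> / (4 * (m + 1))) \<le> \<kappa> / 4" using \<kappa> by (simp add: mult.commute)
   then show ?thesis using young(1) g(3) \<kappa> unfolding D_def[abs_def] by linarith
  qed
  finally show "(LBINT x. ind X x * \<bar>(LBINT z. q (x - z) * F z) - F x\<bar>) < \<kappa>" .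
 qed
qed

lemma frechet_derivative_line:
 fixes f :: "R2 => real"
 assumes "f differentiable (at z)" "((\<lambda>h. f (z + h *\<^sub>R e)) has_real_derivative D) (at 0)"
 shows "frechet_derivative f (at z) e = D"
proof -
 define f' where "f' = frechet_derivative f (at z)"
 have f': "(f has_derivative f') (at z)" using assms(1) unfolding f'_def frechet_derivative_works .
 then interpret linear f' by (rule has_derivative_linear)
 have "((\<lambda>h::real. z + h *\<^sub>R e) has_derivative (\<lambda>h. h *\<^sub>R e)) (at 0)" by (auto intro!: derivative_eq_intros)
 from has_derivative_compose[OF this, of f f'] f' have "((\<lambda>h. f (z + h *\<^sub>R e)) has_derivative (\<lambda>h. f' (h *\<^sub>R e))) (at 0)" by simp
 moreover have "(\<lambda>h. f' (h *\<^sub>R e)) = (*) (f' e)" by (auto simp: scaleR)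
 ultimately have "((\<lambda>h. f (z + h *\<^sub>R e)) has_real_derivative f' e) (at 0)" by (simp add: has_field_derivative_def)
 from DERIV_unique[OF this assms(2)] show ?thesis unfolding f'_def .
qed

lemma flat0_mono: "0 < s ==> s \<le> t ==> flat 0 s \<le> flat 0 t" by (simp add: flat_def frac_le)

lemma flat_continuous: "cont (flat n)" by (intro continuous_at_imp_continuous_on ballI DERIV_isCont[OF flat_deriv])

text \<open>Unlike \<open>eta\<close>, this kernel must be smooth, because weak derivatives are
  defined by test functions and \<open>mollified\<close> uses z to q (x - z) as one. The half-width
  d / 2 puts the supporting square inside the ball of radius d.\<close>

lemma mollifier:
 assumes d: "0 < d"
 obtains q :: "R2 => real" and q1 :: "2 => R2 => real" and q12 :: "R2 => real"
 where "cont q" "\<And>j. cont (q1 j)" "cont q12"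
  "\<And>w. d \<le> norm w ==> q w = 0" "\<And>j w. d \<le> norm w ==> q1 j w = 0" "\<And>w. d \<le> norm w ==> q12 w = 0"
  "\<And>w. 0 \<le> q w" "(LBINT w. q w) = 1" "\<And>w. q (- w) = q w"
  "\<And>j w. ((\<lambda>h. q (w + h *\<^sub>R axis j 1)) has_real_derivative q1 j w) (at 0)"
  "\<And>w. ((\<lambda>h. q1 2 (w + h *\<^sub>R axis 1 1)) has_real_derivative q12 w) (at 0)"
  "\<And>w. ((\<lambda>h. q1 1 (w + h *\<^sub>R axis 2 1)) has_real_derivative q12 w) (at 0)"
  "\<And>x \<Omega>. cball x d \<subseteq> \<Omega> ==> (\<lambda>z. q (x - z)) \<in> test_functions \<Omega>"
proof -
 define e where "e = d / 2"
 have e: "0 < e" using d by (simp add: e_def)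
 define B where "B t = flat 0 (e + t) * flat 0 (e - t)" for t
 define B' where "B' t = flat 2 (e + t) * flat 0 (e - t) - flat 0 (e + t) * flat 2 (e - t)" for t
 have dB: "(B has_real_derivative B' t) (at t)" for t
 proof -
  have f: "(flat 0 has_real_derivative flat 2 s) (at s)" for s using flat_deriv[of 0 s] by (simp add: numeral_2_eq_2)
  show ?thesis unfolding B_def[abs_def] B'_def
   by (auto intro!: derivative_eq_intros DERIV_chain2[OF f])
 qed
 have cB: "cont B" "cont B'" unfolding B_def[abs_def] B'_def[abs_def] by (intro continuous_intros continuous_on_compose2[OF flat_continuous]; simp)+
 have zB: "B t = 0" "B' t = 0" if "e \<le> \<bar>t\<bar>" for t
  using that e flat_nonpos[of "e + t"] flat_nonpos[of "e - t"] by (auto simp: B_def B'_def abs_if split: if_splits)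
 have B0: "0 \<le> B t" "B (- t) = B t" for t by (simp_all add: B_def flat_nonneg)
 have iB: "integrable lborel B" by (rule integrable_continuous_support[OF cB(1), of "cball 0 e"]) (auto intro!: zB simp: dist_norm)
 have c_pos: "0 < (LBINT t. B t)"
 proof -
  define c0 where "c0 = flat 0 (e / 2) * flat 0 (e / 2)"
  have c0: "0 < c0" using e flat0_pos[of "e / 2"] by (simp add: c0_def)
  have "0 < c0 * e" using c0 e by simp
  also have "c0 * e = (LBINT t. ind {-e/2..e/2} t * c0)" using e by simp
  also have "\<dots> \<le> (LBINT t. B t)"
  proof (rule integral_mono)
   show "ind {-e/2..e/2} t * c0 \<le> B t" for t
   proof (cases "t \<in> {-e/2..e/2}")
    case True
    then have "c0 \<le> B t" unfolding c0_def B_def using e flat_nonneg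
     by (intro mult_mono flat0_mono) auto
    then show ?thesis using True by simp
   qed (simp add: B0)
  qed (use iB e in \<open>auto intro!: integrable_mult_left integrable_real_indicator\<close>)
  finally show ?thesis .
 qed
 define c where "c = (LBINT t. B t)"
 have c: "0 < c" using c_pos by (simp add: c_def)
 define q where "q w = B (w $ 1) * B (w $ 2) / c\<^sup>2" for w :: "R2"
 define q1 where "q1 j w = (if j = 1 then B' (w $ 1) * B (w $ 2) else B (w $ 1) * B' (w $ 2)) / c\<^sup>2" for j :: 2 and w :: "R2"
 define q12 where "q12 w = B' (w $ 1) * B' (w $ 2) / c\<^sup>2" for w :: "R2"
 have far: "e \<le> \<bar>w $ 1\<bar> \<or> e \<le> \<bar>w $ 2\<bar>" if "d \<le> norm w" for w :: "R2"
  using norm_le_l1_cart[of w] that by (simp add: sum_2 e_def) linarith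
 have dB0: "((\<lambda>h. B (s + h)) has_real_derivative B' s) (at 0)" for s
  using DERIV_shift[of B "B' s" 0 s] dB[of s] by (simp add: add.commute)
 have dB0': "((\<lambda>h. B' (s + h)) has_real_derivative D) (at 0)" if "(B' has_real_derivative D) (at s)" for s D
  using DERIV_shift[of B' D 0 s] that by (simp add: add.commute)
 have ax: "axis 1 (1::real) $ (2::2) = 0" "axis 2 (1::real) $ (1::2) = 0" "axis 1 (1::real) $ (1::2) = 1" "axis 2 (1::real) $ (2::2) = 1"
  by (simp_all add: axis_def)
 show ?thesis
 proof (rule that[of q q1 q12])
  have cc: "cont (\<lambda>w::R2. B (w $ i))" "cont (\<lambda>w::R2. B' (w $ i))" for i
   by (intro continuous_on_compose2[OF cB(1)] continuous_on_compose2[OF cB(2)] continuous_intros; simp)+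
  show "cont q" "cont q12" unfolding q_def[abs_def] q12_def[abs_def]
   using c by (intro continuous_intros cc; simp)+
  show "cont (q1 j)" for j unfolding q1_def[abs_def]
   using c by (cases "j = 1") (auto intro!: continuous_intros cc)
  show "q w = 0" "q1 j w = 0" "q12 w = 0" if "d \<le> norm w" for w j
   using far[OF that] zB by (auto simp: q_def q1_def q12_def)
  show "0 \<le> q w" "q (- w) = q w" for w by (simp_all add: q_def B0)
  have "(LBINT w. q w) = c * c / c\<^sup>2" unfolding q_def using iB cB by (simp add: integral_vec2_mult c_def borel_measurable_continuous_onI)
  then show "(LBINT w. q w) = 1" using c by (simp add: power2_eq_square)
  show "((\<lambda>h. q (w + h *\<^sub>R axis j 1)) has_real_derivative q1 j w) (at 0)" for j w
  proof -
   have "((\<lambda>h. B (w $ 1 + h) * B (w $ 2) / c\<^sup>2) has_real_derivative B' (w $ 1) * B (w $ 2) / c\<^sup>2) (at 0)"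
    "((\<lambda>h. B (w $ 1) * B (w $ 2 + h) / c\<^sup>2) has_real_derivative B (w $ 1) * B' (w $ 2) / c\<^sup>2) (at 0)"
    using c by (auto intro!: derivative_eq_intros dB0 simp: power2_eq_square)
   then show ?thesis using exhaust_2[of j] by (auto simp: q_def q1_def ax)
  qed
  show "((\<lambda>h. q1 2 (w + h *\<^sub>R axis 1 1)) has_real_derivative q12 w) (at 0)" "((\<lambda>h. q1 1 (w + h *\<^sub>R axis 2 1)) has_real_derivative q12 w) (at 0)" for w
   using c by (auto intro!: derivative_eq_intros dB0 simp: q12_def q1_def ax power2_eq_square)
  show "(\<lambda>z. q (x - z)) \<in> test_functions \<Omega>" if "cball x d \<subseteq> \<Omega>" for x \<Omega>
  proof -
   have "(\<lambda>z. box_bump 1 (x - mk2 e e) (x + mk2 e e) z *\<^sub>R (1 / c\<^sup>2)) = (\<lambda>z. q (x - z))"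
    by (rule ext) (simp add: box_bump_def prod_Basis_vec2 inner_axis q_def B_def algebra_simps)
   moreover have "cbox (x - mk2 e e) (x + mk2 e e) \<subseteq> \<Omega>"
   proof
    fix z assume "z \<in> cbox (x - mk2 e e) (x + mk2 e e)"
    then have "\<bar>(x - z) $ 1\<bar> \<le> e" "\<bar>(x - z) $ 2\<bar> \<le> e" by (auto simp: mem_box_cart forall_2 abs_le_iff algebra_simps)
    then have "norm (x - z) \<le> d" using norm_le_l1_cart[of "x - z"] by (simp add: sum_2 e_def)
    then show "z \<in> \<Omega>" using that by (auto simp: dist_norm)
   qed
   ultimately show ?thesis using box_bump_test(1)[of 1 "x - mk2 e e" "x + mk2 e e" \<Omega> "1 / c\<^sup>2"] by simp
  qed
 qed
qed

text \<open>Borel functions on the whole plane in place of classes on the disc. The weak derivative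
  is tested only inside the disc, so extending by zero requires no regularity across the
  circle.\<close>

locale weak_map =
 fixes U :: "R2 => R2" and Gm :: "R2 => real^2^2"
 assumes U: "integrable lborel U" and Gm_meas: "Gm \<in> borel_measurable borel"
  and Gm2: "integrable lborel (\<lambda>x. (norm (Gm x))\<^sup>2)"
  and Gm0: "x \<notin> unit_disc ==> Gm x = 0"
  and weak: "\<phi> \<in> test_functions unit_disc ==>
   (LBINT x. U x $ i * frechet_derivative \<phi> (at x) (axis j 1)) = - (LBINT x. Gm x $ i $ j * \<phi> x)"
begin

lemma entry_measurable: "(\<lambda>x. Gm x $ i $ j) \<in> borel_measurable borel"
 by (rule borel_measurable_continuous_on[OF _ Gm_meas]) (intro continuous_intros)

lemma integrable_U: "integrable lborel (\<lambda>x. U x $ i)" using integrable_inner_left[OF U, of "axis i 1"] by (simp add: inner_axis)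

lemma entry_le: "\<bar>Gm x $ i $ j\<bar> \<le> norm (Gm x)"
 using component_le_norm_cart[of "Gm x $ i" j] Finite_Cartesian_Product.norm_nth_le[of "Gm x" i] by linarith

lemma integrable_Gm: "integrable lborel (\<lambda>x. Gm x $ i $ j)" "integrable lborel (\<lambda>x. (Gm x $ i $ j)\<^sup>2)"
proof -
 note [measurable] = entry_measurable
 show "integrable lborel (\<lambda>x. (Gm x $ i $ j)\<^sup>2)"
  by (rule integrable_bound[OF Gm2]) (use entry_le in \<open>auto intro!: power_mono simp: abs_le_square_iff[symmetric]\<close>)
 have i1: "integrable lborel (\<lambda>x::R2. ind unit_disc x + (norm (Gm x))\<^sup>2)"
  by (intro integrable_add Gm2 integrable_real_indicator) (use emeasure_bounded_finite[OF bounded_ball, of "0::R2" 1] in auto)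
 show "integrable lborel (\<lambda>x. Gm x $ i $ j)"
 proof (rule integrable_bound[OF i1])
  have "\<bar>Gm x $ i $ j\<bar> \<le> ind unit_disc x + (norm (Gm x))\<^sup>2" for x
  proof (cases "x \<in> unit_disc")
   case True
   have "norm (Gm x) \<le> 1 + (norm (Gm x))\<^sup>2" using sum_squares_bound[of "norm (Gm x)" 1] by (simp add: power2_eq_square) (smt (verit) norm_ge_zero)
   then show ?thesis using True entry_le[of x i j] by simp
  qed (simp add: Gm0)
  then show "AE x in lborel. norm (Gm x $ i $ j) \<le> norm (ind unit_disc x + (norm (Gm x))\<^sup>2)" by (intro AE_I2) simp
 qed (use entry_measurable in measurable)
qed

text \<open>On X, which stays away from the circle, the derivative of the mollified map is the
  mollified weak derivative. So Jensen's inequality bounds its Dirichlet energy, and the unit mass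
  of the kernel the L1 norm of its divergence, both without loss. Existence of the mixed derivative
  is all that is claimed about second order.\<close>

theorem mollified:
 assumes X: "X \<in> sets borel" "X \<subseteq> cball 0 r" "r < 1" and \<kappa>: "0 < \<kappa>"
 obtains v :: "R2 => R2" and dv :: "2 => R2 => R2" and d12 :: "R2 => real"
 where "\<And>x j. ((\<lambda>h. v (x + h *\<^sub>R axis j 1)) has_vector_derivative dv j x) (at 0)"
  "cont v" "\<And>j. cont (dv j)"
  "\<And>x. ((\<lambda>h. dv 2 (x + h *\<^sub>R axis 1 1) $ 2) has_real_derivative d12 x) (at 0)"
  "\<And>x. ((\<lambda>h. dv 1 (x + h *\<^sub>R axis 2 1) $ 2) has_real_derivative d12 x) (at 0)"
  "cont d12"
  "(LBINT x. ind X x * norm (v x - U x)) < \<kappa>"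
  "(LBINT x. ind X x * ((norm (dv 1 x))\<^sup>2 + (norm (dv 2 x))\<^sup>2)) \<le> (LBINT x. (norm (Gm x))\<^sup>2)"
  "(LBINT x. ind X x * \<bar>dv 1 x $ 1 + dv 2 x $ 2\<bar>) \<le> (LBINT x. \<bar>trace (Gm x)\<bar>)"
proof -
 have bX: "bounded X" using X(2) bounded_subset bounded_cball by blast
 obtain da where da: "0 < da" "\<forall>q. cont q \<and> (\<forall>w. 0 \<le> q w) \<and> (LBINT w. q w) = 1 \<and> (\<forall>w. da \<le> norm w \<longrightarrow> q w = 0) \<and> (\<forall>w. q (- w) = q w)
   \<longrightarrow> (LBINT x. ind X x * \<bar>(LBINT z. q (x - z) * U z $ 1) - U x $ 1\<bar>) < \<kappa> / 2"
  using convolution_L1_limit[OF integrable_U[of 1] bX X(1) half_gt_zero[OF \<kappa>]] by - (elim exE conjE, rule that)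
 obtain db where db: "0 < db" "\<forall>q. cont q \<and> (\<forall>w. 0 \<le> q w) \<and> (LBINT w. q w) = 1 \<and> (\<forall>w. db \<le> norm w \<longrightarrow> q w = 0) \<and> (\<forall>w. q (- w) = q w)
   \<longrightarrow> (LBINT x. ind X x * \<bar>(LBINT z. q (x - z) * U z $ 2) - U x $ 2\<bar>) < \<kappa> / 2"
  using convolution_L1_limit[OF integrable_U[of 2] bX X(1) half_gt_zero[OF \<kappa>]] by - (elim exE conjE, rule that)
 define d where "d = min (min da db) ((1 - r) / 2)"
 have d: "0 < d" "d \<le> da" "d \<le> db" "r + d < 1" using da(1) db(1) X(3) min.cobounded2[of "min da db" "(1 - r) / 2"] by (auto simp: d_def simp del: min.cobounded2)
 obtain q :: "R2 => real" and q1 :: "2 => R2 => real" and q12 :: "R2 => real" where q: "cont q" "\<And>j. cont (q1 j)" "cont q12"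
  "\<And>w. d \<le> norm w ==> q w = 0" "\<And>j w. d \<le> norm w ==> q1 j w = 0" "\<And>w. d \<le> norm w ==> q12 w = 0"
  and q': "\<And>w. 0 \<le> q w" "(LBINT w. q w) = 1" "\<And>w. q (- w) = q w"
  and dq: "\<And>j w. ((\<lambda>h. q (w + h *\<^sub>R axis j 1)) has_real_derivative q1 j w) (at 0)"
  "\<And>w. ((\<lambda>h. q1 2 (w + h *\<^sub>R axis 1 1)) has_real_derivative q12 w) (at 0)"
  "\<And>w. ((\<lambda>h. q1 1 (w + h *\<^sub>R axis 2 1)) has_real_derivative q12 w) (at 0)"
  and tq: "\<And>x \<Omega>. cball x d \<subseteq> \<Omega> ==> (\<lambda>z. q (x - z)) \<in> test_functions \<Omega>"
  by (rule mollifier[OF d(1)]) (rule that)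
 have S: "bounded (ball 0 d :: R2 set)" "w \<notin> ball 0 d ==> q w = 0" "w \<notin> ball 0 d ==> q1 j w = 0" "w \<notin> ball 0 d ==> q12 w = 0" for w j
  using q(4-6) by auto
 define va where "va i x = (LBINT z. q (x - z) * U z $ i)" for i x
 define vb where "vb j i x = (LBINT z. q1 j (x - z) * U z $ i)" for i j x
 define v where "v x = (va 1 x *\<^sub>R axis 1 1 + va 2 x *\<^sub>R axis 2 (1::real) :: R2)" for x
 define dv where "dv j x = (vb j 1 x *\<^sub>R axis 1 1 + vb j 2 x *\<^sub>R axis 2 (1::real) :: R2)" for j x
 define d12 where "d12 x = (LBINT z. q12 (x - z) * U z $ 2)" for x
 have comp: "v x $ i = va i x" "dv j x $ i = vb j i x" for x and i j :: 2
  using exhaust_2[of i] by (auto simp: v_def dv_def axis_def)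
 have d1: "((\<lambda>h. va i (x + h *\<^sub>R axis j 1)) has_real_derivative vb j i x) (at 0)" for i j x
  unfolding va_def vb_def by (rule convolution_deriv[OF integrable_U q(1) S(1,2) q(2) S(3) dq(1)])
 have ca: "cont (va i)" for i unfolding va_def by (rule convolution_continuous[OF integrable_U q(1) S(1,2)])
 have cb: "cont (vb j i)" for i j unfolding vb_def by (rule convolution_continuous[OF integrable_U q(2) S(1,3)])
 \<comment> \<open>For x in X the ball of radius d about x lies in the disc, so q (x - z) is
   admissible as a test function of z.\<close>
 have entries: "vb j i x = (LBINT z. q (x - z) * Gm z $ i $ j)" if x: "x \<in> X" for i j x
 proof -
  have "cball x d \<subseteq> unit_disc"
  proof
   fix z assume "z \<in> cball x d"
   moreover have "norm x \<le> r" using x X(2) by auto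
   moreover have "norm z \<le> norm x + dist x z" by (metis dist_norm norm_triangle_sub norm_minus_commute)
   ultimately show "z \<in> unit_disc" using d(4) by auto
  qed
  from tq[OF this] have t: "(\<lambda>z. q (x - z)) \<in> test_functions unit_disc" .
  have fd: "frechet_derivative (\<lambda>z. q (x - z)) (at z) (axis j 1) = - q1 j (x - z)" for z
  proof (rule frechet_derivative_line)
   have "iterated_derivative [] (\<lambda>z. q (x - z)) differentiable (at z)" using t unfolding test_functions_def smooth_def by blast
   then show "(\<lambda>z. q (x - z)) differentiable at z" by simp
   have "((\<lambda>h. q ((x - z) + (- h) *\<^sub>R axis j 1)) has_real_derivative q1 j (x - z) * - 1) (at 0)"
    by (rule DERIV_chain2[of "\<lambda>h. q ((x - z) + h *\<^sub>R axis j 1)"]) (use dq(1)[where w="x - z" and j=j] in \<open>auto intro!: derivative_eq_intros\<close>)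
   then show "((\<lambda>h. q (x - (z + h *\<^sub>R axis j 1))) has_real_derivative - q1 j (x - z)) (at 0)" by (simp add: algebra_simps)
  qed
  from weak[OF t, of i j] show ?thesis unfolding fd vb_def by (simp add: mult.commute)
 qed
 show ?thesis
 proof (rule that[of v dv d12])
  show "((\<lambda>h. v (x + h *\<^sub>R axis j 1)) has_vector_derivative dv j x) (at 0)" for x j
  proof -
   have "((\<lambda>h. va 1 (x + h *\<^sub>R axis j 1) *\<^sub>R axis 1 (1::real) + va 2 (x + h *\<^sub>R axis j 1) *\<^sub>R axis 2 (1::real)) has_vector_derivative
     (va 1 (x + 0 *\<^sub>R axis j 1) *\<^sub>R 0 + vb j 1 x *\<^sub>R axis 1 1) + (va 2 (x + 0 *\<^sub>R axis j 1) *\<^sub>R 0 + vb j 2 x *\<^sub>R axis 2 (1::real)::R2)) (at 0)"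
    by (intro has_vector_derivative_add has_vector_derivative_scaleR has_vector_derivative_const d1)
   then show ?thesis by (simp add: v_def dv_def)
  qed
  show "cont v" "cont (dv j)" for j unfolding v_def[abs_def] dv_def[abs_def] by (intro continuous_intros ca cb)+
  show "((\<lambda>h. dv 2 (x + h *\<^sub>R axis 1 1) $ 2) has_real_derivative d12 x) (at 0)" for x
   unfolding comp vb_def d12_def by (rule convolution_deriv[OF integrable_U q(2) S(1,3) q(3) S(4) dq(2)])
  show "((\<lambda>h. dv 1 (x + h *\<^sub>R axis 2 1) $ 2) has_real_derivative d12 x) (at 0)" for x
   unfolding comp vb_def d12_def by (rule convolution_deriv[OF integrable_U q(2) S(1,3) q(3) S(4) dq(3)])
  show "cont d12" unfolding d12_def by (rule convolution_continuous[OF integrable_U q(3) S(1,4)])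
  note [measurable] = X(1)
  have Um: "(\<lambda>x. U x $ i) \<in> borel_measurable borel" for i using integrable_U[of i] by auto
  have vam: "va i \<in> borel_measurable borel" "vb j i \<in> borel_measurable borel" for i j by (intro borel_measurable_continuous_onI ca cb)+
  have iXc: "integrable lborel (\<lambda>x. ind X x * f x)" if f: "cont f" for f :: "R2 => real"
  proof -
   obtain C where C: "\<And>x. x \<in> cball 0 r ==> norm (f x) \<le> C"
    using compact_imp_bounded[OF compact_continuous_image[OF continuous_on_subset[OF f subset_UNIV] compact_cball[of 0 r]]]
    unfolding bounded_iff by (metis imageI)
   have [measurable]: "f \<in> borel_measurable borel" by (intro borel_measurable_continuous_onI f)
   show ?thesis
   proof (rule integrable_bounded_support[OF _ bX, of _ "max 0 C"])
    show "norm (ind X x * f x) \<le> max 0 C" for x using C[of x] X(2) by (auto simp: indicator_def)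
   qed auto
  qed
  have iXU: "integrable lborel (\<lambda>x. ind X x * \<bar>va i x - U x $ i\<bar>)" for i
  proof (rule integrable_bound[OF integrable_add[OF iXc[OF continuous_on_rabs[OF ca[of i]]] integrable_abs[OF integrable_U[of i]]]])
   show "AE x in lborel. norm (ind X x * \<bar>va i x - U x $ i\<bar>) \<le> norm (ind X x * \<bar>va i x\<bar> + \<bar>U x $ i\<bar>)"
    by (intro AE_I2) (auto simp: indicator_def)
  qed (use Um vam in measurable)
  have "(LBINT x. ind X x * norm (v x - U x)) \<le> (LBINT x. ind X x * \<bar>va 1 x - U x $ 1\<bar> + ind X x * \<bar>va 2 x - U x $ 2\<bar>)"
  proof (rule integral_mono')
   show "ind X x * norm (v x - U x) \<le> ind X x * \<bar>va 1 x - U x $ 1\<bar> + ind X x * \<bar>va 2 x - U x $ 2\<bar>" for x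
    using norm_le_l1_cart[of "v x - U x"] by (auto simp: sum_2 comp indicator_def)
   show "0 \<le> ind X x * \<bar>va 1 x - U x $ 1\<bar> + ind X x * \<bar>va 2 x - U x $ 2\<bar>" for x by simp
  qed (intro integrable_add iXU)
  also have "\<dots> < \<kappa>"
  proof -
   have z: "\<forall>w. da \<le> norm w \<longrightarrow> q w = 0" "\<forall>w. db \<le> norm w \<longrightarrow> q w = 0" using q(4) d(2,3) by auto
   have "(LBINT x. ind X x * \<bar>va 1 x - U x $ 1\<bar>) < \<kappa> / 2"
    unfolding va_def by (rule da(2)[rule_format], intro conjI q(1) allI q' z(1))
   moreover have "(LBINT x. ind X x * \<bar>va 2 x - U x $ 2\<bar>) < \<kappa> / 2"
    unfolding va_def by (rule db(2)[rule_format], intro conjI q(1) allI q' z(2))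
   ultimately show ?thesis by (subst integral_add[OF iXU iXU]) linarith
  qed
  finally show "(LBINT x. ind X x * norm (v x - U x)) < \<kappa>" .
  have ik: "integrable lborel (\<lambda>z. q (x - z) * f z)" if "integrable lborel f" for f x
   by (rule integrable_kernel_mult[OF that q(1) S(1,2)])
  have iq: "integrable lborel (\<lambda>z. q (x - z))" "(LBINT z. q (x - z)) = 1" for x
  proof -
   show "integrable lborel (\<lambda>z. q (x - z))"
    by (intro integrable_continuous_support[of _ "cball x d"] continuous_intros continuous_on_compose2[OF q(1)] q(4)) (auto simp: dist_norm)
   have "q (x - z) = q (z + (- x))" for z using q'(3)[of "x - z"] by simp
   then show "(LBINT z. q (x - z)) = 1" using integral_translation[OF borel_measurable_continuous_onI[OF q(1)], of "- x"] q'(2) by simp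
  qed
  \<comment> \<open>The variance of f under the probability density q (x - z) is
    nonnegative.\<close>
  have jensen: "(LBINT z. q (x - z) * f z)\<^sup>2 \<le> (LBINT z. q (x - z) * (f z)\<^sup>2)" if f: "integrable lborel f" "integrable lborel (\<lambda>z. (f z)\<^sup>2)" for f x
  proof -
   define m where "m = (LBINT z. q (x - z) * f z)"
   have eq: "q (x - z) * (f z - m)\<^sup>2 = q (x - z) * (f z)\<^sup>2 - (2 * m) * (q (x - z) * f z) + m\<^sup>2 * q (x - z)" for z
    by (simp add: power2_eq_square algebra_simps)
   have "0 \<le> (LBINT z. q (x - z) * (f z - m)\<^sup>2)" by (intro integral_nonneg) (auto simp: q')
   also have "\<dots> = (LBINT z. q (x - z) * (f z)\<^sup>2) - (2 * m) * m + m\<^sup>2 * 1"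
    unfolding eq using ik[OF f(1), of x] ik[OF f(2), of x] iq[of x] by (simp add: m_def)
   finally show ?thesis unfolding m_def[symmetric] by (simp add: power2_eq_square)
  qed
  have sq: "(norm (Gm z))\<^sup>2 = (Gm z $ 1 $ 1)\<^sup>2 + (Gm z $ 1 $ 2)\<^sup>2 + (Gm z $ 2 $ 1)\<^sup>2 + (Gm z $ 2 $ 2)\<^sup>2" for z
   by (rule norm_matrix_2)
  show "(LBINT x. ind X x * ((norm (dv 1 x))\<^sup>2 + (norm (dv 2 x))\<^sup>2)) \<le> (LBINT x. (norm (Gm x))\<^sup>2)"
  proof (rule order_trans[OF integral_mono' convolution_L1_le(1)[OF Gm2 _ q(1) S(1,2) q'(1,2) bX X(1)]])
   show "ind X x * ((norm (dv 1 x))\<^sup>2 + (norm (dv 2 x))\<^sup>2) \<le> ind X x * (LBINT z. q (x - z) * (norm (Gm z))\<^sup>2)" for x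
   proof (cases "x \<in> X")
    case True
    have "(norm (dv 1 x))\<^sup>2 + (norm (dv 2 x))\<^sup>2 = (vb 1 1 x)\<^sup>2 + (vb 2 1 x)\<^sup>2 + (vb 1 2 x)\<^sup>2 + (vb 2 2 x)\<^sup>2"
     unfolding power2_norm_eq_inner by (simp add: inner_vec_def sum_2 comp power2_eq_square)
    also have "\<dots> \<le> (LBINT z. q (x - z) * (Gm z $ 1 $ 1)\<^sup>2) + (LBINT z. q (x - z) * (Gm z $ 1 $ 2)\<^sup>2)
      + (LBINT z. q (x - z) * (Gm z $ 2 $ 1)\<^sup>2) + (LBINT z. q (x - z) * (Gm z $ 2 $ 2)\<^sup>2)"
     unfolding entries[OF True] by (intro add_mono jensen integrable_Gm)
    also have "\<dots> = (LBINT z. q (x - z) * (norm (Gm z))\<^sup>2)" unfolding sq distrib_left using ik[OF integrable_Gm(2)] by simp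
    finally show ?thesis using True by simp
   qed simp
  qed (use convolution_L1_le(2)[OF Gm2 _ q(1) S(1,2) q'(1,2) bX X(1)] in \<open>auto intro!: mult_nonneg_nonneg integral_nonneg simp: q'\<close>)
  have itr: "integrable lborel (\<lambda>x. \<bar>trace (Gm x)\<bar>)"
   unfolding trace_def sum_2 by (intro integrable_abs integrable_add integrable_Gm)
  show "(LBINT x. ind X x * \<bar>dv 1 x $ 1 + dv 2 x $ 2\<bar>) \<le> (LBINT x. \<bar>trace (Gm x)\<bar>)"
  proof (rule order_trans[OF integral_mono' convolution_L1_le(1)[OF itr _ q(1) S(1,2) q'(1,2) bX X(1)]])
   show "ind X x * \<bar>dv 1 x $ 1 + dv 2 x $ 2\<bar> \<le> ind X x * (LBINT z. q (x - z) * \<bar>trace (Gm z)\<bar>)" for x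
   proof (cases "x \<in> X")
    case True
    have "dv 1 x $ 1 + dv 2 x $ 2 = (LBINT z. q (x - z) * trace (Gm z))"
     unfolding comp entries[OF True] trace_def sum_2 distrib_left using ik[OF integrable_Gm(1)] by simp
    then show ?thesis using True integral_norm_bound[of lborel "\<lambda>z. q (x - z) * trace (Gm z)"] by (simp add: abs_mult q')
   qed simp
  qed (use convolution_L1_le(2)[OF itr _ q(1) S(1,2) q'(1,2) bX X(1)] in \<open>auto intro!: mult_nonneg_nonneg integral_nonneg simp: q'\<close>)
 qed
qed

end

section \<open>The mass at a fixed scale\<close>

text \<open>\<open>aniso_norm\<close> is the maximum of two seminorms, each bounded by twice the
  norm; the correction needs to be known in norm only.\<close>

lemma aniso_norm_add_le: "aniso_norm (A + B) \<le> aniso_norm A + 2 * norm B"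
proof -
 have sq: "(B $ 1 $ 1)\<^sup>2 + (B $ 1 $ 2)\<^sup>2 + (B $ 2 $ 1)\<^sup>2 + (B $ 2 $ 2)\<^sup>2 = (norm B)\<^sup>2" by (simp add: norm_matrix_2)
 have p: "(a - d)\<^sup>2 + (b + c)\<^sup>2 \<le> 4 * (a\<^sup>2 + b\<^sup>2 + c\<^sup>2 + d\<^sup>2)" for a b c d :: real
  using zero_le_power2[of "a + d"] zero_le_power2[of "b - c"] zero_le_power2[of a] zero_le_power2[of b] zero_le_power2[of c] zero_le_power2[of d]
  unfolding power2_diff power2_sum by argo
 have p': "(b - c)\<^sup>2 \<le> 4 * (a\<^sup>2 + b\<^sup>2 + c\<^sup>2 + d\<^sup>2)" for a b c d :: real
  using zero_le_power2[of "b + c"] zero_le_power2[of a] zero_le_power2[of b] zero_le_power2[of c] zero_le_power2[of d]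
  unfolding power2_diff power2_sum by argo
 have 1: "sqrt ((B $ 1 $ 1 - B $ 2 $ 2)\<^sup>2 + (B $ 1 $ 2 + B $ 2 $ 1)\<^sup>2) \<le> 2 * norm B"
  by (rule real_le_lsqrt) (use p[of "B $ 1 $ 1" "B $ 2 $ 2" "B $ 1 $ 2" "B $ 2 $ 1"] sq in \<open>auto simp: power_mult_distrib\<close>)
 have 2: "\<bar>B $ 1 $ 2 - B $ 2 $ 1\<bar> \<le> 2 * norm B"
  by (rule abs_le_square_iff[THEN iffD2, of _ "2 * norm B", unfolded abs_of_nonneg[OF mult_nonneg_nonneg[OF zero_le_numeral norm_ge_zero]]])
    (use p'[of "B $ 1 $ 2" "B $ 2 $ 1" "B $ 1 $ 1" "B $ 2 $ 2"] sq in \<open>auto simp: power_mult_distrib\<close>)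
 have 3: "sqrt (((A + B) $ 1 $ 1 - (A + B) $ 2 $ 2)\<^sup>2 + ((A + B) $ 1 $ 2 + (A + B) $ 2 $ 1)\<^sup>2)
   \<le> sqrt ((A $ 1 $ 1 - A $ 2 $ 2)\<^sup>2 + (A $ 1 $ 2 + A $ 2 $ 1)\<^sup>2) + sqrt ((B $ 1 $ 1 - B $ 2 $ 2)\<^sup>2 + (B $ 1 $ 2 + B $ 2 $ 1)\<^sup>2)"
  using real_sqrt_sum_squares_triangle_ineq[of "A $ 1 $ 1 - A $ 2 $ 2" "B $ 1 $ 1 - B $ 2 $ 2" "A $ 1 $ 2 + A $ 2 $ 1" "B $ 1 $ 2 + B $ 2 $ 1"]
  by (simp add: algebra_simps)
 have 4: "\<bar>(A + B) $ 1 $ 2 - (A + B) $ 2 $ 1\<bar> \<le> \<bar>A $ 1 $ 2 - A $ 2 $ 1\<bar> + \<bar>B $ 1 $ 2 - B $ 2 $ 1\<bar>" by simp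
 show ?thesis
  using 1 2 order_trans[OF 3 add_mono[OF max.cobounded1 1]] order_trans[OF 4 add_mono[OF max.cobounded2 2]]
  unfolding aniso_norm_def by (intro max.boundedI)
qed

text \<open>With a and b the norms of the two partial derivatives, the first inequality turns the
  cost of the target cutoff into energy. The second shows that the remainder of the null Lagrangian
  is of order sqrt \<epsilon> for maps of bounded energy.\<close>

lemma am_gm_energy:
 fixes W a b e :: real
 assumes "0 < e" "0 \<le> W" "0 \<le> a" "0 \<le> b"
 shows "sqrt W * (a + b) \<le> W / (2 * e) + e * (a\<^sup>2 + b\<^sup>2)"
  "e * a + e * b \<le> sqrt e * (1 + e * (a\<^sup>2 + b\<^sup>2))"
proof -
 have "0 \<le> (sqrt W - e * (a + b))\<^sup>2 + (e * (a - b))\<^sup>2" by simp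
 also have "\<dots> = (sqrt W)\<^sup>2 - 2 * e * (sqrt W * (a + b)) + 2 * e\<^sup>2 * (a\<^sup>2 + b\<^sup>2)" by algebra
 also have "(sqrt W)\<^sup>2 = W" using assms by simp
 finally have "2 * e * (sqrt W * (a + b)) \<le> W + 2 * e\<^sup>2 * (a\<^sup>2 + b\<^sup>2)" by linarith
 then show "sqrt W * (a + b) \<le> W / (2 * e) + e * (a\<^sup>2 + b\<^sup>2)" using assms(1) by (simp add: field_simps power2_eq_square)
 have s: "sqrt e * sqrt e = e" "0 < sqrt e" using assms by auto
 have "0 \<le> (1 - sqrt e * a)\<^sup>2 + (1 - sqrt e * b)\<^sup>2" by simp
 also have "\<dots> = 2 - 2 * (sqrt e * a + sqrt e * b) + (sqrt e * sqrt e) * (a\<^sup>2 + b\<^sup>2)" by algebra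
 finally have "sqrt e * a + sqrt e * b \<le> 1 + e * (a\<^sup>2 + b\<^sup>2) / 2" unfolding s by argo
 also have "\<dots> \<le> 1 + e * (a\<^sup>2 + b\<^sup>2)" using assms by simp
 finally have "sqrt e * (sqrt e * a + sqrt e * b) \<le> sqrt e * (1 + e * (a\<^sup>2 + b\<^sup>2))" using s by (intro mult_left_mono) auto
 then show "e * a + e * b \<le> sqrt e * (1 + e * (a\<^sup>2 + b\<^sup>2))" using assms(1) by (simp add: distrib_left mult.assoc[symmetric] s abs_of_pos)
qed

context transition_map
begin

lemma integrable_cutoff:
 fixes f :: "R2 => real"
 assumes f: "f \<in> borel_measurable borel" and b: "\<And>x. x \<in> X ==> \<bar>f x\<bar> \<le> C"
 shows "integrable lborel (\<lambda>x. ind X x * f x)"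
proof (rule integrable_bounded_support[OF _ phi_supp(1), of _ "max 0 C"])
 show "norm (ind X x * f x) \<le> max 0 C" for x using b[of x] by (auto simp: indicator_def)
 show "(\<lambda>x. ind X x * f x) \<in> borel_measurable borel" using Xm f by measurable
qed auto

lemma continuous_bounded_on_X:
 fixes f :: "R2 => 'b::real_normed_vector"
 assumes f: "cont f"
 shows "\<exists>C. \<forall>x\<in>X. norm (f x) \<le> C"
proof -
 have "compact (f ` closure X)" using phi_supp(1) f
  by (intro compact_continuous_image) (auto intro: continuous_on_subset simp: compact_closure)
 from compact_imp_bounded[OF this] obtain C where "\<forall>y\<in>f ` closure X. norm y \<le> C" unfolding bounded_iff by auto
 then have "norm (f x) \<le> C" if "x \<in> X" for x using closure_subset[of X] that by auto
 then show ?thesis by auto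
qed

lemma integrable_cutoff_cont:
 fixes f :: "R2 => real"
 assumes f: "cont f" shows "integrable lborel (\<lambda>x. ind X x * f x)"
proof -
 obtain C where C: "\<forall>x\<in>X. norm (f x) \<le> C" using continuous_bounded_on_X[OF f] by (elim exE)
 show ?thesis by (rule integrable_cutoff[OF borel_measurable_continuous_onI[OF f], of C]) (use C in auto)
qed

lemma gap_measurable [measurable]: "gap \<in> borel_measurable borel" by measurable

lemma integrable_gap: "integrable lborel (\<lambda>x. ind X x * gap x)"
proof -
 obtain C where C: "\<forall>x\<in>X. norm (v x) \<le> C" using continuous_bounded_on_X[OF v_cont(1)] by (elim exE)
 show ?thesis
 proof (rule integrable_cutoff[OF gap_measurable, of "C + M"])
  show "\<bar>gap x\<bar> \<le> C + M" if "x \<in> X" for x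
   using C that norm_triangle_ineq4[of "v x" "u0 x"] norm_u0[of x] by fastforce
 qed
qed

lemma integrable_indicator_X: "integrable lborel (ind X)" using integrable_cutoff_cont[of "\<lambda>_. 1"] by simp

lemma LINT_indicator_X: "(LBINT x. ind X x) = measure lborel X" by simp

lemma chi_nonzero_norm: "chi M (v x) \<noteq> 0 ==> norm (v x) \<le> 3 * M"
 using chi_eq(2)[OF M, of "v x" 0] infnorm_norm[of "v x"] by (cases "2 * M \<le> infnorm (v x)") auto

text \<open>For \<beta>: where \<open>chi M (v x)\<close> is below 1, v has left the square of size
  M, whereas the jump function has norm at most M - 1; so the gap is at least 1 there.\<close>

lemma coeff_le: "\<bar>\<alpha> i x\<bar> \<le> C\<phi> * ind X x" "\<bar>\<beta> i x\<bar> \<le> C\<phi> * (ind X x * gap x)"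
proof -
 have c: "0 \<le> chi M (v x)" "chi M (v x) \<le> 1" using chi_bounds by auto
 show "\<bar>\<alpha> i x\<bar> \<le> C\<phi> * ind X x"
 proof (cases "x \<in> X")
  case True
  have "\<bar>d\<phi> i x\<bar> * chi M (v x) \<le> C\<phi> * 1" using C\<phi>[of i x] c C0 by (intro mult_mono) auto
  then show ?thesis using True c by (simp add: \<alpha>_def abs_mult)
 qed (simp add: coeff_supp)
 show "\<bar>\<beta> i x\<bar> \<le> C\<phi> * (ind X x * gap x)"
 proof (cases "x \<in> X")
  case True
  have "1 - chi M (v x) \<le> gap x"
  proof (cases "infnorm (v x) \<le> M")
   case True then show ?thesis using chi_eq(1)[OF M True, of 0] by simp
  next
   case False
   then have "M < norm (v x)" using infnorm_le_norm[of "v x"] by linarith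
   then have "1 \<le> gap x" using norm_u0[of x] norm_triangle_ineq2[of "v x" "u0 x"] by linarith
   then show ?thesis using c by linarith
  qed
  then have "\<bar>d\<phi> i x\<bar> * (1 - chi M (v x)) \<le> C\<phi> * gap x" using C\<phi>[of i x] c C0 by (intro mult_mono) auto
  then show ?thesis using True c by (simp add: \<beta>_def abs_mult)
 qed (simp add: coeff_supp)
qed

text \<open>The derivative of the cutoff has size 1 / M, which just compensates a transport distance
  of order M. The cost of a ring is thus a constant times the integral of |Dv| over it, whatever the
  size of the ring.\<close>

lemma gamma_le: "M * \<bar>\<gamma> i x\<bar> \<le> 8 * (\<phi> x * ind {M..2 * M} (infnorm (v x)) * norm (dv i x))"
proof (cases "infnorm (v x) \<in> {M..2 * M}")
 case True
 have "M * (\<phi> x * \<bar>chi' M (v x) (dv i x)\<bar>) \<le> M * (\<phi> x * (8 / M * norm (dv i x)))"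
  using M phi_bounds chi'_bound[OF M] by (intro mult_left_mono) auto
 then show ?thesis using True M phi_bounds(1)[of x] by (simp add: \<gamma>_def abs_mult ac_simps)
next
 case False
 then have "chi' M (v x) (dv i x) = 0" using chi_eq[OF M, of "v x" "dv i x"] by auto
 then show ?thesis using False by (simp add: \<gamma>_def)
qed

text \<open>The terms are grouped by what will make them small: the first by the choice of h, those
  with the gap by the L1 distance of v from the jump function once h is fixed, those with \<gamma>
  by the choice of the ring, the last by the decay of the divergence.\<close>

lemma transport_cost_le:
 "transport_cost \<le> C\<phi> * (640 * h * measure lborel X + (1280 + 5120 * M / h + 480 * ln (M / h) + 1280 * M) * (LBINT x. ind X x * gap x))
  + 7840 * (M * (LBINT x. \<bar>\<gamma> 1 x\<bar>) + M * (LBINT x. \<bar>\<gamma> 2 x\<bar>)) + 560 * (ln (M / \<rho>) * (LBINT x. ind X x * \<bar>divv x\<bar>))"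
proof -
 define m g D where "m = measure lborel X" and "g = (LBINT x. ind X x * gap x)" and "D = (LBINT x. ind X x * \<bar>divv x\<bar>)"
 note iX = integrable_indicator_X and ig = integrable_gap
 have h': "0 < h" "h / 2 \<le> h - \<rho>" "M / 2 \<le> M - h" "M / 2 \<le> M - \<rho>" "0 < M" using h \<rho> M by auto
 have lnh: "0 \<le> ln (M / h)" "0 \<le> ln (M / \<rho>)" using h \<rho> M h' by (auto intro!: ln_ge_zero)
 have gapM: "gap x \<le> 4 * M" if "chi M (v x) \<noteq> 0" for x
  using chi_nonzero_norm[OF that] norm_triangle_ineq4[of "v x" "u0 x"] norm_u0[of x] by linarith
 define TA TB TC TD TE where "TA i = 160 * h * (LBINT x. \<bar>\<alpha> i x\<bar> * (1 + norm (v x - u0 x) / (h - \<rho>))\<^sup>2)"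
  and "TB i = 160 * h * (LBINT x. \<bar>\<alpha> i x\<bar> * (1 + norm (u0 x - u0 x) / (h - 0))\<^sup>2)"
  and "TC i = 160 * ln (M / h) * (LBINT x. \<bar>\<alpha> i x * ((v x $ i - u0 x $ i) / 2)\<bar> * (1 + norm (u0 x - 0) / (M - h)))"
  and "TD i = 160 * M * (LBINT x. \<bar>\<beta> i x\<bar> * (1 + norm (u0 x - 0) / (M - 0))\<^sup>2)"
  and "TE i = 160 * M * (LBINT x. \<bar>\<gamma> i x\<bar> * (1 + norm (v x - 0) / (M - \<rho>))\<^sup>2)" for i
 define TF where "TF = 160 * ln (M / \<rho>) * (LBINT x. \<bar>\<delta> x\<bar> * (1 + norm (v x - 0) / (M - \<rho>)))"
 have A: "TA i \<le> C\<phi> * (160 * h * m + (640 + 2560 * M / h) * g)" for i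
 proof -
  have pw: "\<bar>\<alpha> i x\<bar> * (1 + norm (v x - u0 x) / (h - \<rho>))\<^sup>2 \<le> C\<phi> * ind X x + C\<phi> * (4 / h + 16 * M / h\<^sup>2) * (ind X x * gap x)" for x
  proof (cases "x \<in> X \<and> chi M (v x) \<noteq> 0")
   case True
   have "gap x / (h - \<rho>) \<le> gap x / (h / 2)" using h' by (intro divide_left_mono) auto
   then have "(1 + gap x / (h - \<rho>))\<^sup>2 \<le> (1 + gap x / (h / 2))\<^sup>2" using h' by (intro power_mono) auto
   also have "\<dots> = 1 + 4 / h * gap x + 4 / h\<^sup>2 * (gap x * gap x)" using h' by (simp add: field_simps power2_eq_square)
   \<comment> \<open>Only the L1 norm of the gap is controlled, so one factor of its square is
     bounded by 4 M, which is possible where the target cutoff does not vanish.\<close>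
   also have "\<dots> \<le> 1 + 4 / h * gap x + 4 / h\<^sup>2 * (4 * M * gap x)" using gapM[of x] True by (intro add_left_mono mult_left_mono mult_right_mono) auto
   also have "\<dots> = 1 + (4 / h + 16 * M / h\<^sup>2) * gap x" by (simp add: algebra_simps)
   finally have "\<bar>\<alpha> i x\<bar> * (1 + gap x / (h - \<rho>))\<^sup>2 \<le> C\<phi> * (1 + (4 / h + 16 * M / h\<^sup>2) * gap x)"
    using coeff_le(1)[of i x] True C0 by (intro mult_mono) auto
   then show ?thesis using True by (simp add: algebra_simps)
  next
   case False
   then have "\<alpha> i x = 0" by (auto simp: \<alpha>_def phi_supp)
   then show ?thesis using C0 h' by (simp add: indicator_def)
  qed
  have "(LBINT x. \<bar>\<alpha> i x\<bar> * (1 + norm (v x - u0 x) / (h - \<rho>))\<^sup>2) \<le> (LBINT x. C\<phi> * ind X x + C\<phi> * (4 / h + 16 * M / h\<^sup>2) * (ind X x * gap x))"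
  proof (rule integral_mono'[OF _ pw])
   show "integrable lborel (\<lambda>x. C\<phi> * ind X x + C\<phi> * (4 / h + 16 * M / h\<^sup>2) * (ind X x * gap x))"
    by (intro integrable_add integrable_mult_right iX ig)
   show "0 \<le> C\<phi> * ind X x + C\<phi> * (4 / h + 16 * M / h\<^sup>2) * (ind X x * gap x)" for x
    using C0 h' by (intro add_nonneg_nonneg mult_nonneg_nonneg) auto
  qed
  also have "\<dots> = C\<phi> * m + C\<phi> * (4 / h + 16 * M / h\<^sup>2) * g"
   using integral_add[OF integrable_mult_right[OF iX, of C\<phi>] integrable_mult_right[OF ig, of "C\<phi> * (4 / h + 16 * M / h\<^sup>2)"]]
   by (simp add: m_def g_def)
  finally have "TA i \<le> 160 * h * (C\<phi> * m + C\<phi> * (4 / h + 16 * M / h\<^sup>2) * g)" unfolding TA_def using h' by (intro mult_left_mono) auto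
  also have "\<dots> = C\<phi> * (160 * h * m + (640 + 2560 * M / h) * g)" using h' by (simp add: field_simps power2_eq_square)
  finally show ?thesis .
 qed
 have B: "TB i \<le> C\<phi> * (160 * h * m)" for i
 proof -
  have "(LBINT x. \<bar>\<alpha> i x\<bar> * (1 + norm (u0 x - u0 x) / (h - 0))\<^sup>2) \<le> (LBINT x. C\<phi> * ind X x)"
   by (rule integral_mono') (use coeff_le(1)[of i] C0 iX in auto)
  then have "TB i \<le> 160 * h * (C\<phi> * m)" unfolding TB_def using h' by (intro mult_left_mono) (auto simp: m_def)
  then show ?thesis by (simp add: ac_simps)
 qed
 have C: "TC i \<le> C\<phi> * (240 * ln (M / h) * g)" for i
 proof -
  have pw: "\<bar>\<alpha> i x * ((v x $ i - u0 x $ i) / 2)\<bar> * (1 + norm (u0 x - 0) / (M - h)) \<le> (3 / 2 * C\<phi>) * (ind X x * gap x)" for x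
  proof -
   have "\<bar>v x $ i - u0 x $ i\<bar> \<le> gap x" using component_le_norm_cart[of "v x - u0 x" i] by simp
   then have 1: "\<bar>\<alpha> i x\<bar> * \<bar>(v x $ i - u0 x $ i) / 2\<bar> \<le> (C\<phi> * ind X x) * (gap x / 2)"
    using coeff_le(1)[of i x] C0 by (intro mult_mono) auto
   have "norm (u0 x) / (M - h) \<le> 2" using norm_u0[of x] h' M by (subst divide_le_eq) auto
   then have "\<bar>\<alpha> i x * ((v x $ i - u0 x $ i) / 2)\<bar> * (1 + norm (u0 x - 0) / (M - h)) \<le> ((C\<phi> * ind X x) * (gap x / 2)) * 3"
    unfolding abs_mult[of "\<alpha> i x"] by - (rule mult_mono[OF 1]; use C0 h' M in auto)
   then show ?thesis by (simp add: algebra_simps)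
  qed
  have "(LBINT x. \<bar>\<alpha> i x * ((v x $ i - u0 x $ i) / 2)\<bar> * (1 + norm (u0 x - 0) / (M - h))) \<le> (LBINT x. (3 / 2 * C\<phi>) * (ind X x * gap x))"
   by (rule integral_mono'[OF _ pw]) (use C0 ig in auto)
  then have "TC i \<le> 160 * ln (M / h) * (3 / 2 * C\<phi> * g)" unfolding TC_def using lnh by (intro mult_left_mono) (auto simp: g_def)
  then show ?thesis by (simp add: ac_simps)
 qed
 have D: "TD i \<le> C\<phi> * (640 * M * g)" for i
 proof -
  have pw: "\<bar>\<beta> i x\<bar> * (1 + norm (u0 x - 0) / (M - 0))\<^sup>2 \<le> (4 * C\<phi>) * (ind X x * gap x)" for x
  proof -
   have "norm (u0 x) / M \<le> 1" using norm_u0[of x] M by (subst divide_le_eq) auto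
   then have "(1 + norm (u0 x - 0) / (M - 0))\<^sup>2 \<le> 2\<^sup>2" using M by (intro power_mono) auto
   then have "\<bar>\<beta> i x\<bar> * (1 + norm (u0 x - 0) / (M - 0))\<^sup>2 \<le> (C\<phi> * (ind X x * gap x)) * 4"
    using coeff_le(2)[of i x] C0 by (intro mult_mono) auto
   then show ?thesis by simp
  qed
  have "(LBINT x. \<bar>\<beta> i x\<bar> * (1 + norm (u0 x - 0) / (M - 0))\<^sup>2) \<le> (LBINT x. (4 * C\<phi>) * (ind X x * gap x))"
   by (rule integral_mono'[OF _ pw]) (use C0 ig in auto)
  then have "TD i \<le> 160 * M * (4 * C\<phi> * g)" unfolding TD_def using h' by (intro mult_left_mono) (auto simp: g_def)
  then show ?thesis by (simp add: ac_simps)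
 qed
 \<comment> \<open>7 is 1 + 3 M / (M / 2). Its square 49 enters the bound for \<gamma>, and 7/2 the
   bound for \<delta>, which carries a factor 1/2.\<close>
 have vfar: "1 + norm (v x - 0) / (M - \<rho>) \<le> 7" if "norm (v x) \<le> 3 * M" for x
 proof -
  have "norm (v x) / (M - \<rho>) \<le> 6" using that h' M \<rho> by (subst divide_le_eq) auto
  then show ?thesis by simp
 qed
 have E: "TE i \<le> 7840 * (M * (LBINT x. \<bar>\<gamma> i x\<bar>))" for i
 proof -
  have pw: "\<bar>\<gamma> i x\<bar> * (1 + norm (v x - 0) / (M - \<rho>))\<^sup>2 \<le> 49 * \<bar>\<gamma> i x\<bar>" for x
  proof (cases "2 * M \<le> infnorm (v x)")
   case True then show ?thesis using chi_eq(2)[OF M True, of "dv i x"] by (simp add: \<gamma>_def)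
  next
   case False
   then have "(1 + norm (v x - 0) / (M - \<rho>))\<^sup>2 \<le> 7\<^sup>2" using infnorm_norm[of "v x"] h' by (intro power_mono vfar) auto
   then show ?thesis using mult_left_mono[of "(1 + norm (v x - 0) / (M - \<rho>))\<^sup>2" 49 "\<bar>\<gamma> i x\<bar>"] by simp
  qed
  have "integrable lborel (\<lambda>x. 49 * \<bar>\<gamma> i x\<bar>)"
   by (intro integrable_mult_right integrable_abs integrable_continuous_support[OF coeff_cont(3) phi_supp(1) coeff_supp(3)])
  then have "(LBINT x. \<bar>\<gamma> i x\<bar> * (1 + norm (v x - 0) / (M - \<rho>))\<^sup>2) \<le> (LBINT x. 49 * \<bar>\<gamma> i x\<bar>)"
   by (rule integral_mono'[OF _ pw]) auto
  then have "TE i \<le> 160 * M * (49 * (LBINT x. \<bar>\<gamma> i x\<bar>))" unfolding TE_def using h' by (intro mult_left_mono) auto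
  then show ?thesis by simp
 qed
 have F: "TF \<le> 560 * (ln (M / \<rho>) * D)"
 proof -
  have pw: "\<bar>\<delta> x\<bar> * (1 + norm (v x - 0) / (M - \<rho>)) \<le> 7 / 2 * (ind X x * \<bar>divv x\<bar>)" for x
  proof (cases "x \<in> X \<and> chi M (v x) \<noteq> 0")
   case True
   have "\<phi> x * chi M (v x) \<le> 1 * 1" using phi_bounds chi_bounds by (intro mult_mono) auto
   then have "\<bar>\<delta> x\<bar> \<le> \<bar>divv x\<bar> / 2"
    using phi_bounds(1)[of x] chi_bounds(1)[of M "v x"] mult_right_mono[of "\<phi> x * chi M (v x)" 1 "\<bar>divv x\<bar>"] by (simp add: \<delta>_def wt_def abs_mult)
   then have "\<bar>\<delta> x\<bar> * (1 + norm (v x - 0) / (M - \<rho>)) \<le> (\<bar>divv x\<bar> / 2) * 7"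
    using vfar[OF chi_nonzero_norm] True h' by (intro mult_mono) auto
   then show ?thesis using True by simp
  next
   case False
   then have "\<delta> x = 0" by (auto simp: \<delta>_def wt_def phi_supp)
   then show ?thesis by simp
  qed
  have "integrable lborel (\<lambda>x. 7 / 2 * (ind X x * \<bar>divv x\<bar>))"
   by (intro integrable_mult_right integrable_cutoff_cont continuous_on_rabs divv_cont)
  then have "(LBINT x. \<bar>\<delta> x\<bar> * (1 + norm (v x - 0) / (M - \<rho>))) \<le> (LBINT x. 7 / 2 * (ind X x * \<bar>divv x\<bar>))"
   by (rule integral_mono'[OF _ pw]) auto
  then have "TF \<le> 160 * ln (M / \<rho>) * (7 / 2 * D)" unfolding TF_def using lnh by (intro mult_left_mono) (auto simp: D_def)
  then show ?thesis by (simp add: ac_simps)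
 qed
 have eq: "C\<phi> * (640 * h * m + (1280 + 5120 * M / h + 480 * ln (M / h) + 1280 * M) * g)
  = 2 * (C\<phi> * (160 * h * m + (640 + 2560 * M / h) * g)) + 2 * (C\<phi> * (160 * h * m)) + 2 * (C\<phi> * (240 * ln (M / h) * g)) + 2 * (C\<phi> * (640 * M * g))"
  by (simp add: algebra_simps)
 have "transport_cost = TA 1 + TB 1 + TC 1 + TD 1 + TE 1 + (TA 2 + TB 2 + TC 2 + TD 2 + TE 2) + TF"
  unfolding transport_cost_def sum_2 TA_def TB_def TC_def TD_def TE_def TF_def ..
 moreover have "t \<le> 2 * a + 2 * b + 2 * c + 2 * d + 7840 * (x + y) + 560 * f"
  if "t = a1 + b1 + c1 + d1 + e1 + (a2 + b2 + c2 + d2 + e2) + f1" "a1 \<le> a" "a2 \<le> a" "b1 \<le> b" "b2 \<le> b" "c1 \<le> c" "c2 \<le> c" "d1 \<le> d" "d2 \<le> d"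
   "e1 \<le> 7840 * x" "e2 \<le> 7840 * y" "f1 \<le> 560 * f" for t a b c d x y f a1 b1 c1 d1 e1 a2 b2 c2 d2 e2 f1 :: real
  using that by argo
 ultimately show ?thesis unfolding m_def[symmetric] g_def[symmetric] D_def[symmetric] eq
  using A[of 1] A[of 2] B[of 1] B[of 2] C[of 1] C[of 2] D[of 1] D[of 2] E[of 1] E[of 2] F by blast
qed

text \<open>The competitor is (G1 + G) / l: division by l normalises the boundary, and the other
  factor 1/2 comes from the root of \<open>F_star\<close>. Of the correction G only the L1 norm is
  known, so its mass is estimated with the supremum \<open>WM\<close> of sqrt W over the ball
  containing its support.\<close>

lemma INF_F_mass_le:
 fixes W :: "R2 => real" and \<epsilon> e0 :: real
 assumes W: "cont W" "\<And>y. 0 \<le> W y" and l: "0 < l" and e: "0 < \<epsilon>" "0 \<le> e0"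
  and near: "\<And>x Y. infnorm (v x) \<le> 2 * M ==> norm (Y - v x) \<le> 2 * \<rho> ==> W Y \<le> W (v x) + e0"
  and WM: "\<And>y. norm y \<le> 5 * M ==> sqrt (W y) \<le> WM"
  and mass: "(LBINT Y. sqrt (W Y) * aniso_norm (G1 Y)) \<le> m1"
  and cost: "transport_cost \<le> tc"
 shows "(INF T \<in> transition_currents am ap. F_mass W T) \<le> ennreal (1 / (2 * l) * (m1 + 2 * (WM * tc)))"
proof -
 obtain G where G: "integrable lborel G" "\<forall>y. trace (G y) = 0" "\<forall>y. y \<notin> cball 0 (5 * M) \<longrightarrow> G y = 0"
  "(LBINT y. norm (G y)) \<le> transport_cost"
  "\<forall>\<xi>. C1 \<xi> \<longrightarrow> (LBINT y. (G1 y + G y) \<bullet> jacobian \<xi> (at y)) = l * (\<xi> ap $ 1 - \<xi> am $ 1)"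
  using corrected_density by (elim exE conjE)
 define H where "H y = (1 / l) *\<^sub>R (G1 y + G y)" for y
 have Hi: "integrable lborel H" unfolding H_def[abs_def] by (intro integrable_scaleR_right integrable_add G1_integrable G(1))
 have Ht: "trace (H y) = 0" for y
  using trace_G1[of y] G(2)[rule_format, of y] unfolding H_def trace_def sum_2
  by (simp add: distrib_left[symmetric] add_divide_distrib[symmetric])
 have WM0: "0 \<le> WM" using WM[of 0] M W(2)[of 0] by (auto intro: order_trans[OF real_sqrt_ge_zero])
 have mem: "density_current H \<in> transition_currents am ap"
 proof (rule density_current_transition[OF Hi])
  fix \<xi> :: "R2 => R2" assume xi: "C1 \<xi>"
  have "(LBINT y. jacobian \<xi> (at y) \<bullet> H y) = (LBINT y. (1 / l) * ((G1 y + G y) \<bullet> jacobian \<xi> (at y)))"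
   unfolding H_def by (simp add: inner_commute)
  also have "\<dots> = (1 / l) * (l * (\<xi> ap $ 1 - \<xi> am $ 1))"
   unfolding integral_mult_right_zero using G(5)[rule_format, OF xi] by (simp only:)
  finally show "(LBINT y. jacobian \<xi> (at y) \<bullet> H y) = \<xi> ap $ 1 - \<xi> am $ 1" using l by simp
 qed
 have Wm: "W \<in> borel_measurable borel" by (rule borel_measurable_continuous_onI[OF W(1)])
 note iG1 = G1_mass(1)[OF W e near]
 have in2: "integrable lborel (\<lambda>y. 2 * WM * norm (G y))" by (intro integrable_mult_right integrable_norm G(1))
 have pw: "1/2 * sqrt (W y) * aniso_norm (H y) \<le> 1 / (2 * l) * (sqrt (W y) * aniso_norm (G1 y) + 2 * WM * norm (G y))" for y
 proof -
  have sG: "sqrt (W y) * norm (G y) \<le> WM * norm (G y)"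
  proof (cases "norm y \<le> 5 * M")
   case True then show ?thesis by (intro mult_right_mono WM) auto
  next
   case False then show ?thesis using G(3)[rule_format, of y] by simp
  qed
  have "sqrt (W y) * aniso_norm (G1 y + G y) \<le> sqrt (W y) * (aniso_norm (G1 y) + 2 * norm (G y))"
   using W(2) by (intro mult_left_mono aniso_norm_add_le) auto
  also have "\<dots> \<le> sqrt (W y) * aniso_norm (G1 y) + 2 * WM * norm (G y)" using sG by (simp add: distrib_left)
  finally have "1 / (2 * l) * (sqrt (W y) * aniso_norm (G1 y + G y)) \<le> 1 / (2 * l) * (sqrt (W y) * aniso_norm (G1 y) + 2 * WM * norm (G y))"
   using l by (intro mult_left_mono) auto
  moreover have "aniso_norm (H y) = 1 / l * aniso_norm (G1 y + G y)" unfolding H_def using l by (intro aniso_norm_scaleR) simp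
  ultimately show ?thesis by simp
 qed
 have "(INF T \<in> transition_currents am ap. F_mass W T) \<le> F_mass W (density_current H)" by (rule INF_lower[OF mem])
 also have "\<dots> = (\<integral>\<^sup>+y. ennreal (1/2 * sqrt (W y) * aniso_norm (H y)) \<partial>lborel)" by (rule F_mass_density_current[OF Hi Ht Wm W(2)])
 also have "\<dots> \<le> (\<integral>\<^sup>+y. ennreal (1 / (2 * l) * (sqrt (W y) * aniso_norm (G1 y) + 2 * WM * norm (G y))) \<partial>lborel)"
  by (intro nn_integral_mono ennreal_leI pw)
 also have "\<dots> = ennreal (LBINT y. 1 / (2 * l) * (sqrt (W y) * aniso_norm (G1 y) + 2 * WM * norm (G y)))"
  using l WM0 W(2) by (intro nn_integral_eq_integral integrable_mult_right integrable_add iG1 in2) (auto simp: aniso_norm_nonneg)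
 also have "(LBINT y. 1 / (2 * l) * (sqrt (W y) * aniso_norm (G1 y) + 2 * WM * norm (G y)))
  = 1 / (2 * l) * ((LBINT y. sqrt (W y) * aniso_norm (G1 y)) + 2 * WM * (LBINT y. norm (G y)))"
  by (subst integral_mult_right_zero, subst integral_add[OF iG1 in2])
   (auto simp only: integral_mult_right_zero)
 also have "ennreal \<dots> \<le> ennreal (1 / (2 * l) * (m1 + 2 * (WM * tc)))"
 proof (intro ennreal_leI mult_left_mono)
  have "WM * (LBINT y. norm (G y)) \<le> WM * tc" using G(4) cost WM0 by (intro mult_left_mono) auto
  then show "(LBINT y. sqrt (W y) * aniso_norm (G1 y)) + 2 * WM * (LBINT y. norm (G y)) \<le> m1 + 2 * (WM * tc)" using mass by simp
 qed (use l in auto)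
 finally show ?thesis .
qed

text \<open>All estimates at one scale M. \<open>Wc\<close> dominates W wherever the cutoff at scale
  M is nonzero; it may be the potential cut off at a larger scale, so that P and R can be bounded
  with one function for all rings. The constant 125440 is 2 * 7840 * 8, from
  \<open>aniso_norm_add_le\<close>, \<open>transport_cost_le\<close> and
  \<open>gamma_le\<close>.\<close>

lemma INF_scale_le:
 fixes W Wc :: "R2 => real"
 assumes W: "cont W" "\<And>y. 0 \<le> W y" and l: "0 < l" and e: "0 < \<epsilon>" "0 \<le> e0"
  and near: "\<And>x Y. infnorm (v x) \<le> 2 * M ==> norm (Y - v x) \<le> 2 * \<rho> ==> W Y \<le> W (v x) + e0"
  and Wc: "cont Wc" "\<And>y. 0 \<le> Wc y" "\<And>y. infnorm y \<le> 2 * M ==> W y \<le> Wc y"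
  and WM: "\<And>y. norm y \<le> 5 * M ==> sqrt (W y) \<le> WM"
  and Cr: "0 \<le> Cr" "\<And>y. M \<le> infnorm y ==> WM \<le> Cr * sqrt (W y)"
  and gX: "(LBINT x. ind X x * gap x) \<le> gX"
  and S: "(LBINT x. ind X x * sqv x) \<le> S"
  and D: "(LBINT x. ind X x * \<bar>divv x\<bar>) \<le> D"
  and P: "(LBINT x. \<phi> x * Wc (v x)) \<le> P"
  and R: "(LBINT x. \<phi> x * ind {M..2 * M} (infnorm (v x)) * (Wc (v x) / (2 * \<epsilon>) + \<epsilon> * sqv x)) \<le> R"
 shows "(INF T \<in> transition_currents am ap. F_mass W T) \<le> ennreal (1 / (2 * l) *
  (P / (2 * \<epsilon>) + \<epsilon> / 2 * S + e0 / (2 * \<epsilon>) * measure lborel X + 4 * (M * (C\<phi> * (sqrt \<epsilon> * (measure lborel X + \<epsilon> * S))))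
  + 2 * (WM * (C\<phi> * (640 * h * measure lborel X + (1280 + 5120 * M / h + 480 * ln (M / h) + 1280 * M) * gX) + 560 * (ln (M / \<rho>) * D)))
  + 125440 * (Cr * R)))"
proof -
 note iX = integrable_indicator_X
 have h': "0 < h" "h \<le> M" using h \<rho> M by auto
 have lnh: "0 \<le> ln (M / h)" "0 \<le> ln (M / \<rho>)" using h \<rho> M h' by (auto intro!: ln_ge_zero)
 have WM0: "0 \<le> WM" using WM[of 0] M W(2)[of 0] by (auto intro: order_trans[OF real_sqrt_ge_zero])
 have sq0: "0 \<le> sqv x" for x by (simp add: sqv_def)
 have isq: "integrable lborel (\<lambda>x. ind X x * sqv x)" by (rule integrable_cutoff_cont[OF sqv_cont])
 have Wcv: "cont (\<lambda>x. Wc (v x))" by (rule continuous_on_compose2[OF Wc(1) v_cont(1)]) simp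
 have iP: "integrable lborel (\<lambda>x. \<phi> x * Wc (v x))"
  by (rule integrable_continuous_support[OF _ phi_supp(1)]) (auto intro!: continuous_intros phi_cont Wcv simp: phi_supp(2))
 have phiX: "\<phi> x \<le> ind X x" for x using phi_bounds(2)[of x] phi_supp(2)[of x] by (auto simp: indicator_def)
 have wt_le: "wt x \<le> \<phi> x" "0 \<le> wt x" for x
  using mult_left_mono[OF chi_bounds(2) phi_bounds(1)[of x], of M "v x"] phi_bounds(1)[of x] chi_bounds(1)[of M "v x"] by (auto simp: wt_def)
 have en: "(LBINT x. wt x * ((W (v x) + e0) / (2 * \<epsilon>) + \<epsilon> / 2 * sqv x)) \<le> P / (2 * \<epsilon>) + e0 / (2 * \<epsilon>) * measure lborel X + \<epsilon> / 2 * S"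
 proof -
  have pw: "wt x * ((W (v x) + e0) / (2 * \<epsilon>) + \<epsilon> / 2 * sqv x) \<le> (1 / (2 * \<epsilon>)) * (\<phi> x * Wc (v x)) + (e0 / (2 * \<epsilon>)) * ind X x + (\<epsilon> / 2) * (ind X x * sqv x)" for x
  proof -
   have "wt x * W (v x) \<le> \<phi> x * Wc (v x)"
   proof (cases "infnorm (v x) \<le> 2 * M")
    case True then show ?thesis using wt_le[of x] Wc(3) W(2)[of "v x"] phi_bounds(1)[of x] by (intro mult_mono) auto
   next
    case False
    then have "wt x = 0" using chi_eq(2)[OF M, of "v x" 0] by (simp add: wt_def)
    then show ?thesis using phi_bounds(1)[of x] Wc(2) by simp
   qed
   then have 1: "(1 / (2 * \<epsilon>)) * (wt x * W (v x)) \<le> (1 / (2 * \<epsilon>)) * (\<phi> x * Wc (v x))" using e by (intro mult_left_mono) auto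
   have w1: "wt x \<le> ind X x" using wt_le(1)[of x] phiX[of x] by linarith
   have 2: "(e0 / (2 * \<epsilon>)) * wt x \<le> (e0 / (2 * \<epsilon>)) * ind X x" using e w1 by (intro mult_left_mono) auto
   have 3: "(\<epsilon> / 2) * (wt x * sqv x) \<le> (\<epsilon> / 2) * (ind X x * sqv x)" using e w1 sq0 by (intro mult_left_mono mult_right_mono) auto
   have "wt x * ((W (v x) + e0) / (2 * \<epsilon>) + \<epsilon> / 2 * sqv x) = (1 / (2 * \<epsilon>)) * (wt x * W (v x)) + (e0 / (2 * \<epsilon>)) * wt x + (\<epsilon> / 2) * (wt x * sqv x)"
    by (simp add: add_divide_distrib algebra_simps)
   then show ?thesis using 1 2 3 by linarith
  qed
  note i = integrable_mult_right[OF iP, of "1 / (2 * \<epsilon>)"] integrable_mult_right[OF iX, of "e0 / (2 * \<epsilon>)"] integrable_mult_right[OF isq, of "\<epsilon> / 2"]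
  have "(LBINT x. wt x * ((W (v x) + e0) / (2 * \<epsilon>) + \<epsilon> / 2 * sqv x))
   \<le> (LBINT x. (1 / (2 * \<epsilon>)) * (\<phi> x * Wc (v x)) + (e0 / (2 * \<epsilon>)) * ind X x + (\<epsilon> / 2) * (ind X x * sqv x))"
  proof (rule integral_mono'[OF _ pw])
   show "integrable lborel (\<lambda>x. (1 / (2 * \<epsilon>)) * (\<phi> x * Wc (v x)) + (e0 / (2 * \<epsilon>)) * ind X x + (\<epsilon> / 2) * (ind X x * sqv x))"
    by (intro integrable_add i)
   show "0 \<le> (1 / (2 * \<epsilon>)) * (\<phi> x * Wc (v x)) + (e0 / (2 * \<epsilon>)) * ind X x + (\<epsilon> / 2) * (ind X x * sqv x)" for x
    using e phi_bounds(1)[of x] Wc(2)[of "v x"] sq0[of x] by (intro add_nonneg_nonneg mult_nonneg_nonneg) auto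
  qed
  also have "\<dots> = (1 / (2 * \<epsilon>)) * (LBINT x. \<phi> x * Wc (v x)) + (e0 / (2 * \<epsilon>)) * measure lborel X + (\<epsilon> / 2) * (LBINT x. ind X x * sqv x)"
   unfolding integral_add[OF integrable_add[OF i(1,2)] i(3)] integral_add[OF i(1,2)]
    integral_mult_right_zero LINT_indicator_X ..
  also have "\<dots> \<le> (1 / (2 * \<epsilon>)) * P + (e0 / (2 * \<epsilon>)) * measure lborel X + (\<epsilon> / 2) * S"
   using e P S by (intro add_mono mult_left_mono order_refl) auto
  finally show ?thesis by simp
 qed
 have jac: "\<epsilon> * (4 * M * (LBINT x. \<bar>d\<phi> 1 x\<bar> * \<bar>dv 2 x $ 2\<bar> + \<bar>d\<phi> 2 x\<bar> * \<bar>dv 1 x $ 2\<bar>)) \<le> 4 * (M * (C\<phi> * (sqrt \<epsilon> * (measure lborel X + \<epsilon> * S))))"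
 proof -
  have pw: "\<epsilon> * (\<bar>d\<phi> 1 x\<bar> * \<bar>dv 2 x $ 2\<bar> + \<bar>d\<phi> 2 x\<bar> * \<bar>dv 1 x $ 2\<bar>) \<le> (C\<phi> * sqrt \<epsilon>) * (ind X x + \<epsilon> * (ind X x * sqv x))" for x
  proof (cases "x \<in> X")
   case True
   have "\<bar>d\<phi> 1 x\<bar> * \<bar>dv 2 x $ 2\<bar> \<le> C\<phi> * norm (dv 2 x)" "\<bar>d\<phi> 2 x\<bar> * \<bar>dv 1 x $ 2\<bar> \<le> C\<phi> * norm (dv 1 x)"
    using C\<phi> C0 component_le_norm_cart by (auto intro!: mult_mono)
   then have "\<epsilon> * (\<bar>d\<phi> 1 x\<bar> * \<bar>dv 2 x $ 2\<bar> + \<bar>d\<phi> 2 x\<bar> * \<bar>dv 1 x $ 2\<bar>) \<le> \<epsilon> * (C\<phi> * norm (dv 2 x) + C\<phi> * norm (dv 1 x))"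
    using e by (intro mult_left_mono add_mono) auto
   also have "\<dots> = C\<phi> * (\<epsilon> * norm (dv 1 x) + \<epsilon> * norm (dv 2 x))" by (simp add: algebra_simps)
   also have "\<dots> \<le> C\<phi> * (sqrt \<epsilon> * (1 + \<epsilon> * sqv x))" unfolding sqv_def using e C0 by (intro mult_left_mono am_gm_energy(2)[where W=0]) auto
   finally show ?thesis using True by simp
  qed (simp add: phi_supp)
  have iU: "integrable lborel (\<lambda>x. (C\<phi> * sqrt \<epsilon>) * (ind X x + \<epsilon> * (ind X x * sqv x)))"
   by (intro integrable_mult_right integrable_add iX isq)
  have "(LBINT x. \<epsilon> * (\<bar>d\<phi> 1 x\<bar> * \<bar>dv 2 x $ 2\<bar> + \<bar>d\<phi> 2 x\<bar> * \<bar>dv 1 x $ 2\<bar>)) \<le> (LBINT x. (C\<phi> * sqrt \<epsilon>) * (ind X x + \<epsilon> * (ind X x * sqv x)))"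
   by (rule integral_mono'[OF iU pw]) (use C0 e sq0 in \<open>auto intro!: mult_nonneg_nonneg add_nonneg_nonneg\<close>)
  also have "\<dots> = (C\<phi> * sqrt \<epsilon>) * (measure lborel X + \<epsilon> * (LBINT x. ind X x * sqv x))"
   unfolding integral_mult_right_zero integral_add[OF iX integrable_mult_right[OF isq]] LINT_indicator_X ..
  also have "\<dots> \<le> (C\<phi> * sqrt \<epsilon>) * (measure lborel X + \<epsilon> * S)" using C0 e S by (intro mult_left_mono add_left_mono) auto
  finally have "\<epsilon> * (LBINT x. \<bar>d\<phi> 1 x\<bar> * \<bar>dv 2 x $ 2\<bar> + \<bar>d\<phi> 2 x\<bar> * \<bar>dv 1 x $ 2\<bar>) \<le> (C\<phi> * sqrt \<epsilon>) * (measure lborel X + \<epsilon> * S)" by simp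
  then have "(4 * M) * (\<epsilon> * (LBINT x. \<bar>d\<phi> 1 x\<bar> * \<bar>dv 2 x $ 2\<bar> + \<bar>d\<phi> 2 x\<bar> * \<bar>dv 1 x $ 2\<bar>)) \<le> (4 * M) * ((C\<phi> * sqrt \<epsilon>) * (measure lborel X + \<epsilon> * S))"
   using M by (intro mult_left_mono) auto
  then show ?thesis by (simp only: ac_simps)
 qed
 \<comment> \<open>On the ring \<open>WM\<close> is at most \<open>Cr\<close> times sqrt (W (v x)),
   so Young's inequality bounds the weighted cost of \<gamma> by the energy of v in the
   ring.\<close>
 have gam: "WM * (M * (LBINT x. \<bar>\<gamma> 1 x\<bar>) + M * (LBINT x. \<bar>\<gamma> 2 x\<bar>)) \<le> 8 * (Cr * R)"
 proof -
  define r where "r x = \<phi> x * ind {M..2 * M} (infnorm (v x))" for x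
  have r0: "0 \<le> r x" for x using phi_bounds(1)[of x] by (simp add: r_def)
  have ig: "integrable lborel (\<gamma> i)" for i by (rule integrable_continuous_support[OF coeff_cont(3) phi_supp(1) coeff_supp(3)])
  have iR: "integrable lborel (\<lambda>x. r x * (Wc (v x) / (2 * \<epsilon>) + \<epsilon> * sqv x))"
  proof (rule integrable_bound)
   show "integrable lborel (\<lambda>x. \<phi> x * (Wc (v x) / (2 * \<epsilon>) + \<epsilon> * sqv x))"
    using e by (intro integrable_continuous_support[OF _ phi_supp(1)]) (auto intro!: continuous_intros phi_cont Wcv sqv_cont simp: phi_supp(2))
   have [measurable]: "\<phi> \<in> borel_measurable borel" "(\<lambda>x. infnorm (v x)) \<in> borel_measurable borel" "(\<lambda>x. Wc (v x)) \<in> borel_measurable borel" "sqv \<in> borel_measurable borel"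
    by (intro borel_measurable_continuous_onI phi_cont Wcv sqv_cont continuous_on_infnorm v_cont)+
   show "(\<lambda>x. r x * (Wc (v x) / (2 * \<epsilon>) + \<epsilon> * sqv x)) \<in> borel_measurable lborel" unfolding r_def by measurable
   show "AE x in lborel. norm (r x * (Wc (v x) / (2 * \<epsilon>) + \<epsilon> * sqv x)) \<le> norm (\<phi> x * (Wc (v x) / (2 * \<epsilon>) + \<epsilon> * sqv x))"
    using phi_bounds(1) by (intro AE_I2) (auto simp: r_def abs_mult indicator_def)
  qed
  have pw: "WM * (M * \<bar>\<gamma> 1 x\<bar>) + WM * (M * \<bar>\<gamma> 2 x\<bar>) \<le> (8 * Cr) * (r x * (Wc (v x) / (2 * \<epsilon>) + \<epsilon> * sqv x))" for x
  proof (cases "infnorm (v x) \<in> {M..2 * M}")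
   case True
   have "WM * (M * \<bar>\<gamma> 1 x\<bar>) + WM * (M * \<bar>\<gamma> 2 x\<bar>) \<le> WM * (8 * (r x * norm (dv 1 x))) + WM * (8 * (r x * norm (dv 2 x)))"
    unfolding r_def using gamma_le WM0 by (intro add_mono mult_left_mono) auto
   also have "\<dots> = 8 * (r x * (WM * (norm (dv 1 x) + norm (dv 2 x))))" by (simp add: algebra_simps)
   also have "\<dots> \<le> 8 * (r x * ((Cr * sqrt (W (v x))) * (norm (dv 1 x) + norm (dv 2 x))))"
    using r0 Cr(2)[of "v x"] True by (intro mult_left_mono mult_right_mono) auto
   also have "\<dots> = (8 * Cr) * (r x * (sqrt (W (v x)) * (norm (dv 1 x) + norm (dv 2 x))))" by (simp add: algebra_simps)
   also have "\<dots> \<le> (8 * Cr) * (r x * (W (v x) / (2 * \<epsilon>) + \<epsilon> * sqv x))"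
    unfolding sqv_def using r0 Cr(1) e W(2) by (intro mult_left_mono am_gm_energy(1)) auto
   also have "\<dots> \<le> (8 * Cr) * (r x * (Wc (v x) / (2 * \<epsilon>) + \<epsilon> * sqv x))"
    using r0 Cr(1) e Wc(3)[of "v x"] True by (intro mult_left_mono add_right_mono divide_right_mono) auto
   finally show ?thesis .
  next
   case False
   then have "\<gamma> i x = 0" for i using gamma_le[of i x] M by (simp add: mult_le_0_iff)
   then show ?thesis using False by (simp add: r_def)
  qed
  have "(LBINT x. WM * (M * \<bar>\<gamma> 1 x\<bar>) + WM * (M * \<bar>\<gamma> 2 x\<bar>)) \<le> (LBINT x. (8 * Cr) * (r x * (Wc (v x) / (2 * \<epsilon>) + \<epsilon> * sqv x)))"
   by (intro integral_mono integrable_mult_right integrable_add integrable_abs ig iR pw)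
  also have "\<dots> \<le> (8 * Cr) * R" unfolding integral_mult_right_zero using R Cr(1) unfolding r_def by (intro mult_left_mono) auto
  also have "(LBINT x. WM * (M * \<bar>\<gamma> 1 x\<bar>) + WM * (M * \<bar>\<gamma> 2 x\<bar>)) = WM * (M * (LBINT x. \<bar>\<gamma> 1 x\<bar>)) + WM * (M * (LBINT x. \<bar>\<gamma> 2 x\<bar>))"
   by (subst integral_add) (auto intro!: integrable_mult_right integrable_abs ig)
  finally show ?thesis by (simp only: distrib_left mult.assoc)
 qed
 define g where "g = (LBINT x. ind X x * gap x)"
 define B where "B = C\<phi> * (640 * h * measure lborel X + (1280 + 5120 * M / h + 480 * ln (M / h) + 1280 * M) * gX) + 560 * (ln (M / \<rho>) * D)"
 define \<Gamma> where "\<Gamma> = M * (LBINT x. \<bar>\<gamma> 1 x\<bar>) + M * (LBINT x. \<bar>\<gamma> 2 x\<bar>)"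
 have cost: "transport_cost \<le> B + 7840 * \<Gamma>"
 proof -
  have "C\<phi> * (640 * h * measure lborel X + (1280 + 5120 * M / h + 480 * ln (M / h) + 1280 * M) * g) \<le> C\<phi> * (640 * h * measure lborel X + (1280 + 5120 * M / h + 480 * ln (M / h) + 1280 * M) * gX)"
   using gX C0 h' lnh M unfolding g_def by (intro mult_left_mono add_left_mono) auto
  moreover have "ln (M / \<rho>) * (LBINT x. ind X x * \<bar>divv x\<bar>) \<le> ln (M / \<rho>) * D" using D lnh by (intro mult_left_mono)
  ultimately show ?thesis using transport_cost_le unfolding B_def \<Gamma>_def g_def[symmetric] by linarith
 qed
 from INF_F_mass_le[OF W l e near WM order_trans[OF G1_mass(2)[OF W e near] add_mono[OF en jac]] cost]
 have "(INF T \<in> transition_currents am ap. F_mass W T) \<le> ennreal (1 / (2 * l) * ((P / (2 * \<epsilon>) + e0 / (2 * \<epsilon>) * measure lborel X + \<epsilon> / 2 * S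
  + 4 * (M * (C\<phi> * (sqrt \<epsilon> * (measure lborel X + \<epsilon> * S))))) + 2 * (WM * (B + 7840 * \<Gamma>))))" by simp
 also have "\<dots> \<le> ennreal (1 / (2 * l) * (P / (2 * \<epsilon>) + \<epsilon> / 2 * S + e0 / (2 * \<epsilon>) * measure lborel X + 4 * (M * (C\<phi> * (sqrt \<epsilon> * (measure lborel X + \<epsilon> * S))))
  + 2 * (WM * B) + 125440 * (Cr * R)))"
 proof (intro ennreal_leI mult_left_mono)
  have "WM * (B + 7840 * \<Gamma>) = WM * B + 7840 * (WM * \<Gamma>)" by (simp add: algebra_simps)
  then show "(P / (2 * \<epsilon>) + e0 / (2 * \<epsilon>) * measure lborel X + \<epsilon> / 2 * S
  + 4 * (M * (C\<phi> * (sqrt \<epsilon> * (measure lborel X + \<epsilon> * S))))) + 2 * (WM * (B + 7840 * \<Gamma>)) \<le> P / (2 * \<epsilon>) + \<epsilon> / 2 * S + e0 / (2 * \<epsilon>) * measure lborel X + 4 * (M * (C\<phi> * (sqrt \<epsilon> * (measure lborel X + \<epsilon> * S))))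
  + 2 * (WM * B) + 125440 * (Cr * R)" using gam unfolding \<Gamma>_def[symmetric] by linarith
 qed (use l in auto)
 finally show ?thesis unfolding B_def .
qed

end

section \<open>Sobolev maps on the disc\<close>

lemma disc_borel [measurable]: "unit_disc \<in> sets borel" by (rule borel_open) simp

text \<open>The Sobolev space is defined over the completed measure on the disc, whereas convolution
  and Fubini are used for Borel functions on the plane. The representative is assembled coordinate
  by coordinate.\<close>

lemma borel_representative:
 fixes f :: "R2 => 'b::euclidean_space"
 assumes "f \<in> borel_measurable (lebesgue_on unit_disc)"
 shows "\<exists>g. g \<in> borel_measurable borel \<and> (\<forall>x. x \<notin> unit_disc \<longrightarrow> g x = 0) \<and> (AE x in lborel. x \<in> unit_disc \<longrightarrow> g x = f x)"
proof -
 let ?f = "\<lambda>x. if x \<in> unit_disc then f x else 0"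
 have f: "?f \<in> borel_measurable lebesgue" using borel_measurable_if[of unit_disc f] assms by simp
 have ex: "\<exists>g\<in>borel_measurable lborel. AE x in lborel. ?f x \<bullet> b = g x" for b
  by (rule completion_ex_borel_measurable_real) (intro borel_measurable_inner f borel_measurable_const)
 define gb where "gb b = (SOME g. g \<in> borel_measurable lborel \<and> (AE x in lborel. ?f x \<bullet> b = g x))" for b
 have gb: "gb b \<in> borel_measurable lborel" "AE x in lborel. ?f x \<bullet> b = gb b x" for b
  using someI_ex[of "\<lambda>g. g \<in> borel_measurable lborel \<and> (AE x in lborel. ?f x \<bullet> b = g x)"] ex[of b] unfolding gb_def by blast+
 have [measurable]: "gb b \<in> borel_measurable borel" for b using gb(1)[of b] by simp
 have "AE x in lborel. \<forall>b\<in>Basis. ?f x \<bullet> b = gb b x" by (rule AE_finite_allI[OF finite_Basis gb(2)])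
 then have "AE x in lborel. x \<in> unit_disc \<longrightarrow> (\<Sum>b\<in>Basis. gb b x *\<^sub>R b) = f x"
 proof eventually_elim
  case (elim x)
  show ?case
  proof
   assume "x \<in> unit_disc"
   then have "(\<Sum>b\<in>Basis. gb b x *\<^sub>R b) = (\<Sum>b\<in>Basis. (f x \<bullet> b) *\<^sub>R b)" using elim by (intro sum.cong) auto
   then show "(\<Sum>b\<in>Basis. gb b x *\<^sub>R b) = f x" by (simp add: euclidean_representation)
  qed
 qed
 then have "AE x in lborel. x \<in> unit_disc \<longrightarrow> (if x \<in> unit_disc then \<Sum>b\<in>Basis. gb b x *\<^sub>R b else 0) = f x" by eventually_elim simp
 moreover have "(\<lambda>x. if x \<in> unit_disc then \<Sum>b\<in>Basis. gb b x *\<^sub>R b else 0) \<in> borel_measurable borel" by measurable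
 ultimately show ?thesis by (intro exI[of _ "\<lambda>x. if x \<in> unit_disc then \<Sum>b\<in>Basis. gb b x *\<^sub>R b else 0"]) simp
qed

lemma nn_integral_disc:
 fixes f g :: "R2 => ennreal"
 assumes "AE x in lborel. x \<in> unit_disc \<longrightarrow> f x = g x"
 shows "(\<integral>\<^sup>+x. f x \<partial>lebesgue_on unit_disc) = (\<integral>\<^sup>+x. g x * indicator unit_disc x \<partial>lborel)"
proof -
 have "(\<integral>\<^sup>+x. f x \<partial>lebesgue_on unit_disc) = (\<integral>\<^sup>+x. f x * indicator unit_disc x \<partial>lebesgue)" by (rule nn_integral_restrict_space) simp
 also have "\<dots> = (\<integral>\<^sup>+x. f x * indicator unit_disc x \<partial>lborel)" by (rule nn_integral_completion)
 also have "\<dots> = (\<integral>\<^sup>+x. g x * indicator unit_disc x \<partial>lborel)"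
  by (rule nn_integral_cong_AE) (use assms in eventually_elim, auto simp: indicator_def)
 finally show ?thesis .
qed

lemma Lp_norm_finite:
 assumes "Lp_norm p M f < \<infinity>" shows "(\<integral>\<^sup>+x. ennreal (norm (f x) powr p) \<partial>M) < \<infinity>"
 using assms by (auto simp: Lp_norm_def enn_powr_def less_top split: if_splits)

lemma powr_2: "0 \<le> a ==> a powr 2 = a\<^sup>2" for a :: real
 by (cases "a = 0") (auto simp: powr_numeral)

lemma L2_representative:
 fixes f g :: "R2 => 'b::euclidean_space"
 assumes f: "in_Lp 2 (lebesgue_on unit_disc) f" and g: "g \<in> borel_measurable borel" "\<And>x. x \<notin> unit_disc ==> g x = 0"
  and ae: "AE x in lborel. x \<in> unit_disc \<longrightarrow> g x = f x"
 shows "integrable lborel (\<lambda>x. (norm (g x))\<^sup>2)"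
proof (rule integrableI_bounded)
 have "(\<integral>\<^sup>+x. ennreal (norm (f x) powr 2) \<partial>lebesgue_on unit_disc) = (\<integral>\<^sup>+x. ennreal ((norm (g x))\<^sup>2) * indicator unit_disc x \<partial>lborel)"
  by (rule nn_integral_disc) (use ae in eventually_elim, auto simp: powr_2)
 also have "\<dots> = (\<integral>\<^sup>+x. ennreal (norm ((norm (g x))\<^sup>2)) \<partial>lborel)"
  by (rule nn_integral_cong) (use g(2) in \<open>auto simp: indicator_def\<close>)
 finally show "(\<integral>\<^sup>+x. ennreal (norm ((norm (g x))\<^sup>2)) \<partial>lborel) < \<infinity>" using Lp_norm_finite f unfolding in_Lp_def by metis
qed (use g(1) in measurable)

lemma test_function_continuous:
 fixes \<phi> :: "R2 => real"
 assumes "\<phi> \<in> test_functions \<Omega>"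
 shows "cont \<phi>" "cont (\<lambda>x. frechet_derivative \<phi> (at x) e)"
proof -
 have s: "iterated_derivative vs \<phi> differentiable (at x)" for vs x using assms unfolding test_functions_def smooth_def by blast
 show "cont \<phi>" using s[of "[]"] by (auto intro!: continuous_at_imp_continuous_on differentiable_imp_continuous_within)
 show "cont (\<lambda>x. frechet_derivative \<phi> (at x) e)" using s[of "[e]"] by (auto intro!: continuous_at_imp_continuous_on differentiable_imp_continuous_within)
qed

lemma integral_disc_representative:
 fixes f g q :: "R2 => real"
 assumes f: "f \<in> borel_measurable (lebesgue_on unit_disc)" and g: "g \<in> borel_measurable borel" "\<And>x. x \<notin> unit_disc ==> g x = 0"
  and ae: "AE x in lborel. x \<in> unit_disc \<longrightarrow> g x = f x" and q: "q \<in> borel_measurable borel"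
 shows "(LINT x|lebesgue_on unit_disc. f x * q x) = (LBINT x. g x * q x)"
proof -
 let ?f = "\<lambda>x. if x \<in> unit_disc then f x else 0"
 have fm: "?f \<in> borel_measurable lebesgue" using borel_measurable_if[of unit_disc f] f by simp
 have gm: "g \<in> borel_measurable lebesgue" "q \<in> borel_measurable lebesgue" using g(1) q by (auto intro!: measurable_completion)
 have "(LINT x|lebesgue_on unit_disc. f x * q x) = (LINT x|lebesgue. indicator unit_disc x *\<^sub>R (f x * q x))"
  by (rule integral_restrict_space) simp
 also have "\<dots> = (LINT x|lebesgue. ?f x * q x)" by (rule integral_cong) (auto simp: indicator_def)
 also have "\<dots> = (LINT x|lebesgue. g x * q x)"
 proof (rule integral_cong_AE)
  have "AE x in lborel. ?f x * q x = g x * q x" using ae by eventually_elim (use g(2) in auto)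
  then show "AE x in lebesgue. ?f x * q x = g x * q x" by (rule AE_completion)
 qed (intro borel_measurable_times fm gm)+
 also have "\<dots> = (LBINT x. g x * q x)" by (rule integral_completion) (use g(1) q in measurable)
 finally show ?thesis .
qed

lemma component_measurable:
 fixes f :: "'a => 'b::euclidean_space ^ 'n"
 shows "f \<in> borel_measurable M ==> (\<lambda>x. f x $ i) \<in> borel_measurable M"
 by (rule borel_measurable_continuous_on[of "\<lambda>y. y $ i"]) (intro continuous_intros)

definition represents :: "(R2 => R2) => (R2 => real^2^2) => (R2 => R2) => bool" where
 "represents U Gm u \<longleftrightarrow> weak_map U Gm \<and> U \<in> borel_measurable borel \<and> (\<forall>x. x \<notin> unit_disc \<longrightarrow> U x = 0) \<and>
  (AE x in lborel. x \<in> unit_disc \<longrightarrow> U x = u x) \<and> (AE x in lborel. x \<in> unit_disc \<longrightarrow> Gm x = weak_jacobian unit_disc u x)"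

theorem W12_represented:
 assumes u: "u \<in> W12 unit_disc"
 shows "\<exists>U Gm. represents U Gm u"
proof -
 let ?G = "weak_jacobian unit_disc u"
 have "\<exists>G. in_Lp 2 (lebesgue_on unit_disc) G \<and> has_weak_jacobian u G unit_disc" and u2: "in_Lp 2 (lebesgue_on unit_disc) u" using u by (auto simp: W12_def)
 from someI_ex[OF this(1)] have G: "in_Lp 2 (lebesgue_on unit_disc) ?G" "has_weak_jacobian u ?G unit_disc" unfolding weak_jacobian_def by auto
 have um: "u \<in> borel_measurable (lebesgue_on unit_disc)" and Gm: "?G \<in> borel_measurable (lebesgue_on unit_disc)" using u2 G(1) by (auto simp: in_Lp_def)
 obtain U where U: "U \<in> borel_measurable borel" "\<And>x. x \<notin> unit_disc ==> U x = 0" "AE x in lborel. x \<in> unit_disc \<longrightarrow> U x = u x"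
  using borel_representative[OF um] by auto
 obtain H where H: "H \<in> borel_measurable borel" "\<And>x. x \<notin> unit_disc ==> H x = 0" "AE x in lborel. x \<in> unit_disc \<longrightarrow> H x = ?G x"
  using borel_representative[OF Gm] by auto
 have "weak_map U H"
 proof
  show "integrable lborel (\<lambda>x. (norm (H x))\<^sup>2)" by (rule L2_representative[OF G(1) H])
  have i: "integrable lborel (\<lambda>x::R2. ind unit_disc x + (norm (U x))\<^sup>2)"
   by (intro integrable_add L2_representative[OF u2 U] integrable_real_indicator) (use emeasure_bounded_finite[OF bounded_ball, of "0::R2" 1] in auto)
  show "integrable lborel U"
  proof (rule integrable_bound[OF i])
   have "norm (U x) \<le> ind unit_disc x + (norm (U x))\<^sup>2" for x
   proof (cases "x \<in> unit_disc")
    case True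
    have "0 \<le> (norm (U x) - 1)\<^sup>2 + norm (U x)" by simp
    then show ?thesis using True zero_le_power2[of "norm (U x) - 1"] norm_ge_zero[of "U x"] unfolding power2_diff by simp
   qed (simp add: U(2))
   then show "AE x in lborel. norm (U x) \<le> norm (ind unit_disc x + (norm (U x))\<^sup>2)" by (intro AE_I2) (simp add: abs_of_nonneg)
  qed (use U(1) in simp)
  fix \<phi> :: "R2 => real" and i j :: 2 assume t: "\<phi> \<in> test_functions unit_disc"
  note tc = test_function_continuous[OF t, THEN borel_measurable_continuous_onI]
  have "(LBINT x. U x $ i * frechet_derivative \<phi> (at x) (axis j 1)) = (LINT x|lebesgue_on unit_disc. u x $ i * frechet_derivative \<phi> (at x) (axis j 1))"
   by (rule integral_disc_representative[symmetric, OF component_measurable[OF um] component_measurable[OF U(1)] _ _ tc(2)]) (use U(2,3) in auto)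
  also have "\<dots> = - (LINT x|lebesgue_on unit_disc. ?G x $ i $ j * \<phi> x)" using G(2) t unfolding has_weak_jacobian_def by blast
  also have "(LINT x|lebesgue_on unit_disc. ?G x $ i $ j * \<phi> x) = (LBINT x. H x $ i $ j * \<phi> x)"
   by (rule integral_disc_representative[OF component_measurable[OF component_measurable[OF Gm]] component_measurable[OF component_measurable[OF H(1)]] _ _ tc(1)]) (use H(2,3) in auto)
  finally show "(LBINT x. U x $ i * frechet_derivative \<phi> (at x) (axis j 1)) = - (LBINT x. H x $ i $ j * \<phi> x)" .
 qed (use H in auto)
 then show ?thesis using U H unfolding represents_def by blast
qed

lemma energy_represented:
 assumes r: "represents U Gm u" and W: "cont W" "\<And>y. 0 \<le> W y" and e: "0 < \<epsilon>" "0 \<le> E" and en: "energy W \<epsilon> u \<le> ennreal E"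
 shows "integrable lborel (\<lambda>x. ind unit_disc x * W (U x))"
  "(LBINT x. ind unit_disc x * W (U x)) / (2 * \<epsilon>) + \<epsilon> / 2 * (LBINT x. (norm (Gm x))\<^sup>2) \<le> E"
proof -
 interpret weak_map U Gm using r by (simp add: represents_def)
 have Um [measurable]: "U \<in> borel_measurable borel" and aeU: "AE x in lborel. x \<in> unit_disc \<longrightarrow> U x = u x"
  and aeG: "AE x in lborel. x \<in> unit_disc \<longrightarrow> Gm x = weak_jacobian unit_disc u x" using r by (auto simp: represents_def)
 have [measurable]: "(\<lambda>x. W (U x)) \<in> borel_measurable borel" by (rule measurable_compose[OF Um borel_measurable_continuous_onI[OF W(1)]])
 note [measurable] = Gm_meas
 define F where "F x = ind unit_disc x * (\<epsilon> * (norm (Gm x))\<^sup>2 + 1 / \<epsilon> * W (U x))" for x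
 have F0: "0 \<le> F x" for x using e W(2) by (simp add: F_def)
 have Fm: "F \<in> borel_measurable borel" unfolding F_def by measurable
 have "(\<integral>\<^sup>+x. ennreal (\<epsilon> * (norm (weak_jacobian unit_disc u x))\<^sup>2 + 1 / \<epsilon> * W (u x)) \<partial>lebesgue_on unit_disc)
   = (\<integral>\<^sup>+x. ennreal (\<epsilon> * (norm (Gm x))\<^sup>2 + 1 / \<epsilon> * W (U x)) * indicator unit_disc x \<partial>lborel)"
  by (rule nn_integral_disc) (use aeU aeG in eventually_elim, auto)
 also have "\<dots> = (\<integral>\<^sup>+x. ennreal (F x) \<partial>lborel)" by (rule nn_integral_cong) (auto simp: F_def indicator_def)
 finally have enF: "energy W \<epsilon> u = ennreal (1/2) * (\<integral>\<^sup>+x. ennreal (F x) \<partial>lborel)" by (simp add: energy_def)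
 have half: "ennreal 2 * ennreal (1/2) = 1" by (subst ennreal_mult[symmetric]) auto
 have "(\<integral>\<^sup>+x. ennreal (F x) \<partial>lborel) = ennreal 2 * energy W \<epsilon> u" unfolding enF mult.assoc[symmetric] half by simp
 also have "\<dots> \<le> ennreal 2 * ennreal E" using en by (intro mult_left_mono) auto
 finally have le: "(\<integral>\<^sup>+x. ennreal (F x) \<partial>lborel) \<le> ennreal (2 * E)" using e(2) by (simp add: ennreal_mult)
 then have iF: "integrable lborel F" by (intro integrableI_bounded) (use Fm F0 order.strict_trans1[OF le] in auto)
 have "ennreal (LBINT x. F x) \<le> ennreal (2 * E)" using le nn_integral_eq_integral[OF iF] F0 by simp
 then have LF: "(LBINT x. F x) \<le> 2 * E" using e(2) by (simp add: ennreal_le_iff)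
 show iW: "integrable lborel (\<lambda>x. ind unit_disc x * W (U x))"
 proof (rule integrable_bound[OF integrable_mult_right[OF iF, of \<epsilon>]])
  have "ind unit_disc x * W (U x) \<le> \<epsilon> * F x" for x
   using e W(2)[of "U x"] by (auto simp: F_def indicator_def distrib_left)
  then show "AE x in lborel. norm (ind unit_disc x * W (U x)) \<le> norm (\<epsilon> * F x)"
   using e W(2) F0 by (intro AE_I2) (simp add: abs_of_nonneg)
 qed measurable
 have eq: "F x = \<epsilon> * (norm (Gm x))\<^sup>2 + (1 / \<epsilon>) * (ind unit_disc x * W (U x))" for x
  using Gm0[of x] by (auto simp: F_def indicator_def)
 have "(LBINT x. F x) = \<epsilon> * (LBINT x. (norm (Gm x))\<^sup>2) + (1 / \<epsilon>) * (LBINT x. ind unit_disc x * W (U x))"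
  unfolding eq by (subst integral_add[OF integrable_mult_right[OF Gm2] integrable_mult_right[OF iW]]) simp
 with LF show "(LBINT x. ind unit_disc x * W (U x)) / (2 * \<epsilon>) + \<epsilon> / 2 * (LBINT x. (norm (Gm x))\<^sup>2) \<le> E"
  using e by (simp add: field_simps)
qed

lemma L1_distance_represented:
 assumes r: "represents U Gm u" and j: "j \<in> borel_measurable borel" and \<kappa>: "0 < \<kappa>"
  and L: "Lp_norm 1 (lebesgue_on unit_disc) (\<lambda>x. u x - j x) < ennreal \<kappa>"
 shows "integrable lborel (\<lambda>x. ind unit_disc x * norm (U x - j x))" "(LBINT x. ind unit_disc x * norm (U x - j x)) < \<kappa>"
proof -
 have [measurable]: "U \<in> borel_measurable borel" "j \<in> borel_measurable borel" and ae: "AE x in lborel. x \<in> unit_disc \<longrightarrow> U x = u x"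
  using r j by (auto simp: represents_def)
 define t where "t = (\<integral>\<^sup>+x. ennreal (norm (u x - j x) powr 1) \<partial>lebesgue_on unit_disc)"
 have "Lp_norm 1 (lebesgue_on unit_disc) (\<lambda>x. u x - j x) = t" unfolding Lp_norm_def t_def[symmetric] by (auto simp: enn_powr_def less_top)
 with L have t: "t < ennreal \<kappa>" by simp
 have "t = (\<integral>\<^sup>+x. ennreal (norm (U x - j x)) * indicator unit_disc x \<partial>lborel)"
  unfolding t_def by (rule nn_integral_disc) (use ae in eventually_elim, auto)
 also have "\<dots> = (\<integral>\<^sup>+x. ennreal (ind unit_disc x * norm (U x - j x)) \<partial>lborel)" by (rule nn_integral_cong) (auto simp: indicator_def)
 finally have teq: "t = (\<integral>\<^sup>+x. ennreal (ind unit_disc x * norm (U x - j x)) \<partial>lborel)" .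
 show i: "integrable lborel (\<lambda>x. ind unit_disc x * norm (U x - j x))"
 proof (rule integrableI_bounded)
  show "(\<integral>\<^sup>+x. ennreal (norm (ind unit_disc x * norm (U x - j x))) \<partial>lborel) < \<infinity>"
   using order.strict_trans[OF t ennreal_less_top] by (simp add: teq)
 qed measurable
 have "ennreal (LBINT x. ind unit_disc x * norm (U x - j x)) < ennreal \<kappa>" using nn_integral_eq_integral[OF i] t by (simp add: teq)
 then show "(LBINT x. ind unit_disc x * norm (U x - j x)) < \<kappa>" using \<kappa> by (simp add: ennreal_less_iff)
qed

text \<open>Instead of Hoelder's inequality the pointwise bound |t| \<le> \<kappa> + \<kappa>^(1 -
  s) |t|^s is integrated over the disc: the first term covers |t| \<le> \<kappa>, the second |t| >
  \<kappa>. The two integrals are then at most \<open>measure lborel unit_disc\<close> times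
  \<kappa> and \<kappa>.\<close>

lemma divergence_represented:
 assumes r: "represents U Gm u" and s: "1 \<le> s" and \<kappa>: "0 < \<kappa>"
  and L: "Lp_norm s (lebesgue_on unit_disc) (weak_div unit_disc u) \<le> ennreal \<kappa>"
 shows "(LBINT x. \<bar>trace (Gm x)\<bar>) \<le> (measure lborel unit_disc + 1) * \<kappa>"
proof -
 interpret weak_map U Gm using r by (simp add: represents_def)
 have ae: "AE x in lborel. x \<in> unit_disc \<longrightarrow> Gm x = weak_jacobian unit_disc u x" using r by (auto simp: represents_def)
 have itr: "integrable lborel (\<lambda>x. trace (Gm x))" unfolding trace_def sum_2 by (intro integrable_add integrable_Gm)
 then have [measurable]: "(\<lambda>x. trace (Gm x)) \<in> borel_measurable borel" by auto
 define t where "t = (\<integral>\<^sup>+x. ennreal (norm (weak_div unit_disc u x) powr s) \<partial>lebesgue_on unit_disc)"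
 have tL: "enn_powr t (1 / s) \<le> ennreal \<kappa>" using L by (simp add: Lp_norm_def t_def)
 then have tf: "t \<noteq> \<infinity>" by (auto simp: enn_powr_def top_unique)
 have t1: "enn2real t powr (1 / s) \<le> \<kappa>" using tL tf \<kappa> by (simp add: enn_powr_def ennreal_le_iff)
 have "enn2real t = (enn2real t powr (1 / s)) powr s" using s by (simp add: powr_powr)
 also have "\<dots> \<le> \<kappa> powr s" using t1 s by (intro powr_mono2) auto
 finally have t2: "enn2real t \<le> \<kappa> powr s" .
 define f where "f x = \<bar>trace (Gm x)\<bar> powr s" for x
 have "t = (\<integral>\<^sup>+x. ennreal (f x) * indicator unit_disc x \<partial>lborel)"
  unfolding t_def by (rule nn_integral_disc) (use ae in eventually_elim, auto simp: weak_div_def f_def)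
 also have "\<dots> = (\<integral>\<^sup>+x. ennreal (f x) \<partial>lborel)"
 proof (rule nn_integral_cong)
  fix x :: "R2" show "ennreal (f x) * indicator unit_disc x = ennreal (f x)" using Gm0[of x] by (cases "x \<in> unit_disc") (auto simp: f_def trace_def)
 qed
 finally have teq: "t = (\<integral>\<^sup>+x. ennreal (f x) \<partial>lborel)" .
 have f0: "0 \<le> f x" for x by (simp add: f_def)
 have if': "integrable lborel f"
 proof (rule integrableI_bounded)
  show "f \<in> borel_measurable lborel" unfolding f_def by measurable
  show "(\<integral>\<^sup>+x. ennreal (norm (f x)) \<partial>lborel) < \<infinity>" using tf f0 by (simp add: teq less_top)
 qed
 have Lf: "(LBINT x. f x) \<le> \<kappa> powr s" using t2 nn_integral_eq_integral[OF if'] f0 by (simp add: teq)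
 have iD: "integrable lborel (ind unit_disc)"
  by (intro integrable_real_indicator) (use emeasure_bounded_finite[OF bounded_ball, of "0::R2" 1] in auto)
 have pw: "\<bar>trace (Gm x)\<bar> \<le> \<kappa> * ind unit_disc x + \<kappa> powr (1 - s) * f x" for x
 proof (cases "x \<in> unit_disc \<and> \<kappa> < \<bar>trace (Gm x)\<bar>")
  case True
  have "\<kappa> powr (1 - s) * \<bar>trace (Gm x)\<bar> powr (s - 1) \<ge> \<kappa> powr (1 - s) * \<kappa> powr (s - 1)"
   using True \<kappa> s by (intro mult_left_mono powr_mono2) auto
  then have 1: "1 \<le> \<kappa> powr (1 - s) * \<bar>trace (Gm x)\<bar> powr (s - 1)" using \<kappa> by (simp add: powr_add[symmetric])
  have "f x = \<bar>trace (Gm x)\<bar> powr (s - 1) * \<bar>trace (Gm x)\<bar>" using True \<kappa> by (simp add: f_def powr_diff)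
  then have "\<kappa> powr (1 - s) * f x = (\<kappa> powr (1 - s) * \<bar>trace (Gm x)\<bar> powr (s - 1)) * \<bar>trace (Gm x)\<bar>" by simp
  also have "\<dots> \<ge> 1 * \<bar>trace (Gm x)\<bar>" using 1 by (intro mult_right_mono) auto
  finally show ?thesis using True \<kappa> by simp
 next
  case False
  then have "\<bar>trace (Gm x)\<bar> \<le> \<kappa> * ind unit_disc x" using Gm0[of x] by (auto simp: indicator_def trace_def)
  then show ?thesis using f0[of x] by (simp add: add_increasing2)
 qed
 have "(LBINT x. \<bar>trace (Gm x)\<bar>) \<le> (LBINT x. \<kappa> * ind unit_disc x + \<kappa> powr (1 - s) * f x)"
  by (intro integral_mono integrable_abs itr integrable_add integrable_mult_right iD if' pw)
 also have "\<dots> = \<kappa> * measure lborel unit_disc + \<kappa> powr (1 - s) * (LBINT x. f x)"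
  by (subst integral_add[OF integrable_mult_right[OF iD] integrable_mult_right[OF if']]) simp
 also have "\<dots> \<le> \<kappa> * measure lborel unit_disc + \<kappa> powr (1 - s) * \<kappa> powr s" using Lf by (intro add_left_mono mult_left_mono) auto
 also have "\<kappa> powr (1 - s) * \<kappa> powr s = \<kappa>" using \<kappa> by (simp add: powr_add[symmetric])
 finally show ?thesis by (simp add: algebra_simps)
qed

section \<open>Cutoff functions in the disc\<close>

lemma plateau_profile:
 fixes b \<sigma> :: real
 assumes b: "0 \<le> b" and \<sigma>: "0 < \<sigma>"
 shows "\<exists>f f'. (\<forall>t. (f has_real_derivative f' t) (at t)) \<and> cont f \<and> cont f' \<and> (\<forall>t. 0 \<le> f t \<and> f t \<le> 1)
  \<and> (\<forall>t. \<bar>t\<bar> \<le> b \<longrightarrow> f t = 1 \<and> f' t = 0) \<and> (\<forall>t. b + \<sigma> \<le> \<bar>t\<bar> \<longrightarrow> f t = 0 \<and> f' t = 0)"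
proof -
 define w where "w t = 1 - (max 0 ((t - b) / \<sigma>))\<^sup>2 - (max 0 ((- t - b) / \<sigma>))\<^sup>2" for t
 define w' where "w' t = - (2 * max 0 ((t - b) / \<sigma>) * (1 / \<sigma>)) - 2 * max 0 ((- t - b) / \<sigma>) * (- 1 / \<sigma>)" for t
 define f where "f t = (max 0 (w t))\<^sup>2" for t
 define f' where "f' t = 2 * max 0 (w t) * w' t" for t
 have dw: "(w has_real_derivative w' t) (at t)" for t
 proof -
  have "((\<lambda>t. (t - b) / \<sigma>) has_real_derivative 1 / \<sigma>) (at t)" "((\<lambda>t. (- t - b) / \<sigma>) has_real_derivative - 1 / \<sigma>) (at t)"
   using \<sigma> by (auto intro!: derivative_eq_intros)
  note p = this[THEN pos_part_power_deriv_chain(1)]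
  show ?thesis unfolding w_def[abs_def] w'_def using DERIV_diff[OF DERIV_diff[OF DERIV_const p(1)] p(2), of 1] by simp
 qed
 have df: "(f has_real_derivative f' t) (at t)" for t
  unfolding f_def[abs_def] f'_def by (rule pos_part_power_deriv_chain(1)[OF dw])
 have cw: "cont w" "cont w'" unfolding w_def[abs_def] w'_def[abs_def] using \<sigma> by (auto intro!: continuous_intros)
 have c: "cont f" "cont f'" unfolding f_def[abs_def] f'_def[abs_def] by (intro continuous_intros cw)+
 have w1: "w t \<le> 1" for t by (simp add: w_def)
 have f01: "0 \<le> f t \<and> f t \<le> 1" for t using w1[of t] power_le_one[of "max 0 (w t)" 2] by (simp add: f_def)
 have in': "f t = 1 \<and> f' t = 0" if "\<bar>t\<bar> \<le> b" for t
 proof -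
  have "(t - b) / \<sigma> \<le> 0" "(- t - b) / \<sigma> \<le> 0" using that \<sigma> by (auto simp: divide_le_0_iff)
  then have "max 0 ((t - b) / \<sigma>) = 0" "max 0 ((- t - b) / \<sigma>) = 0" by (simp_all add: max_absorb1)
  then show ?thesis by (simp add: f_def f'_def w_def w'_def)
 qed
 have out: "f t = 0 \<and> f' t = 0" if "b + \<sigma> \<le> \<bar>t\<bar>" for t
 proof -
  have "1 \<le> (t - b) / \<sigma> \<or> 1 \<le> (- t - b) / \<sigma>" using that \<sigma> by (auto simp: le_divide_eq abs_if split: if_splits)
  then have "1 \<le> max 0 ((t - b) / \<sigma>) \<or> 1 \<le> max 0 ((- t - b) / \<sigma>)" by auto
  then have "1 \<le> (max 0 ((t - b) / \<sigma>))\<^sup>2 \<or> 1 \<le> (max 0 ((- t - b) / \<sigma>))\<^sup>2" using one_le_power[of _ 2] by blast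
  then have "w t \<le> 0" using zero_le_power2[of "max 0 ((t - b) / \<sigma>)"] zero_le_power2[of "max 0 ((- t - b) / \<sigma>)"] unfolding w_def by argo
  then show ?thesis by (simp add: f_def f'_def)
 qed
 show ?thesis using df c f01 in' out by blast
qed

definition cutoff :: "(R2 => real) => (2 => R2 => real) => R2 set => real => real => bool" where
 "cutoff \<phi> d\<phi> X l C\<phi> \<longleftrightarrow> (\<forall>x j. ((\<lambda>h. \<phi> (x + h *\<^sub>R axis j 1)) has_real_derivative d\<phi> j x) (at 0)) \<and> cont \<phi> \<and> (\<forall>j. cont (d\<phi> j))
  \<and> (\<forall>x. 0 \<le> \<phi> x \<and> \<phi> x \<le> 1) \<and> X \<in> sets borel \<and> bounded X \<and> (\<forall>x. x \<notin> X \<longrightarrow> \<phi> x = 0) \<and> (\<forall>x j. x \<notin> X \<longrightarrow> d\<phi> j x = 0)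
  \<and> (LBINT x. d\<phi> 1 x * ind {x. x $ 1 > 0} x) = - l \<and> (LBINT x. d\<phi> 2 x * ind {x. x $ 1 > 0} x) = 0
  \<and> (\<forall>j x. \<bar>d\<phi> j x\<bar> \<le> C\<phi>)"

text \<open>A product of two plateau profiles on a thin rectangle about the vertical diameter. The
  flux of its gradient through the right half-plane is minus the integral of the vertical profile,
  because the horizontal one falls from 1 to 0 there; the vertical derivative has zero flux.\<close>

theorem cutoff_exists:
 assumes \<sigma>: "0 < \<sigma>" "\<sigma> \<le> 1 / 4"
 shows "\<exists>\<phi> d\<phi> X l C\<phi>. cutoff \<phi> d\<phi> X l C\<phi> \<and> X \<subseteq> cball 0 (1 - \<sigma>) \<and> 2 - 8 * \<sigma> \<le> l"
proof -
 \<comment> \<open>With this half-height of the plateau the corner (2 \<sigma>, 1 - 3 \<sigma>) of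
   the rectangle lies in the ball of radius 1 - \<sigma>, and the flux is at least 2 b.\<close>
 define b where "b = 1 - 4 * \<sigma>"
 have b: "0 \<le> b" using \<sigma> by (simp add: b_def)
 obtain f f' where f: "\<And>t. (f has_real_derivative f' t) (at t)" "cont f" "cont f'" "\<And>t. 0 \<le> f t \<and> f t \<le> 1"
  "\<And>t. \<bar>t\<bar> \<le> \<sigma> ==> f t = 1 \<and> f' t = 0" "\<And>t. \<sigma> + \<sigma> \<le> \<bar>t\<bar> ==> f t = 0 \<and> f' t = 0"
  using plateau_profile[OF less_imp_le[OF \<sigma>(1)] \<sigma>(1)] by blast
 obtain g g' where g: "\<And>t. (g has_real_derivative g' t) (at t)" "cont g" "cont g'" "\<And>t. 0 \<le> g t \<and> g t \<le> 1"
  "\<And>t. \<bar>t\<bar> \<le> b ==> g t = 1 \<and> g' t = 0" "\<And>t. b + \<sigma> \<le> \<bar>t\<bar> ==> g t = 0 \<and> g' t = 0"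
  using plateau_profile[OF b \<sigma>(1)] by blast
 define \<phi> where "\<phi> x = f (x $ 1) * g (x $ 2)" for x :: "R2"
 define d\<phi> where "d\<phi> j x = (if j = 1 then f' (x $ 1) * g (x $ 2) else f (x $ 1) * g' (x $ 2))" for j :: 2 and x :: "R2"
 define X :: "R2 set" where "X = {x. \<bar>x $ 1\<bar> \<le> 2 * \<sigma> \<and> \<bar>x $ 2\<bar> \<le> b + \<sigma>}"
 define l where "l = (LBINT t. g t)"
 have cc: "cont (\<lambda>x::R2. f (x $ i))" "cont (\<lambda>x::R2. f' (x $ i))" "cont (\<lambda>x::R2. g (x $ i))" "cont (\<lambda>x::R2. g' (x $ i))" for i
  by (intro continuous_on_compose2[OF f(2)] continuous_on_compose2[OF f(3)] continuous_on_compose2[OF g(2)] continuous_on_compose2[OF g(3)] continuous_intros; simp)+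
 have pc: "cont \<phi>" unfolding \<phi>_def[abs_def] by (intro continuous_intros cc)
 have dc: "cont (d\<phi> j)" for j unfolding d\<phi>_def[abs_def] by (cases "j = 1") (auto intro!: continuous_intros cc)
 have ax: "axis 1 (1::real) $ (2::2) = 0" "axis 2 (1::real) $ (1::2) = 0" "axis 1 (1::real) $ (1::2) = 1" "axis 2 (1::real) $ (2::2) = 1"
  by (simp_all add: axis_def)
 have shift: "((\<lambda>h. F (s + h)) has_real_derivative F' s) (at 0)" if "\<And>t. (F has_real_derivative F' t) (at t)" for F F' :: "real => real" and s
  using DERIV_shift[of F "F' s" 0 s] that[of s] by (simp add: add.commute)
 have pd: "((\<lambda>h. \<phi> (x + h *\<^sub>R axis j 1)) has_real_derivative d\<phi> j x) (at 0)" for x j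
 proof -
  have "((\<lambda>h. f (x $ 1 + h) * g (x $ 2)) has_real_derivative f' (x $ 1) * g (x $ 2)) (at 0)"
   "((\<lambda>h. f (x $ 1) * g (x $ 2 + h)) has_real_derivative f (x $ 1) * g' (x $ 2)) (at 0)"
   by (auto intro!: derivative_eq_intros shift[OF f(1)] shift[OF g(1)])
  then show ?thesis using exhaust_2[of j] by (auto simp: \<phi>_def d\<phi>_def ax)
 qed
 have p01: "0 \<le> \<phi> x \<and> \<phi> x \<le> 1" for x using f(4)[of "x $ 1"] g(4)[of "x $ 2"] by (auto simp: \<phi>_def intro: mult_le_one)
 have "closed X" unfolding X_def by (intro closed_Collect_conj closed_Collect_le continuous_intros)
 then have Xm: "X \<in> sets borel" by simp
 have out: "\<phi> x = 0" "d\<phi> j x = 0" if "x \<notin> X" for x j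
 proof -
  have "\<sigma> + \<sigma> \<le> \<bar>x $ 1\<bar> \<or> b + \<sigma> \<le> \<bar>x $ 2\<bar>" using that by (auto simp: X_def)
  then show "\<phi> x = 0" "d\<phi> j x = 0" using f(6)[of "x $ 1"] g(6)[of "x $ 2"] by (auto simp: \<phi>_def d\<phi>_def)
 qed
 have XR: "X \<subseteq> cball 0 (1 - \<sigma>)"
 proof
  fix x assume x: "x \<in> X"
  have "(x $ 1)\<^sup>2 \<le> (2 * \<sigma>)\<^sup>2" "(x $ 2)\<^sup>2 \<le> (b + \<sigma>)\<^sup>2" using power_mono[of "\<bar>x $ 1\<bar>" "2 * \<sigma>" 2] power_mono[of "\<bar>x $ 2\<bar>" "b + \<sigma>" 2] x by (auto simp: X_def)
  then have "(norm x)\<^sup>2 \<le> (2 * \<sigma>)\<^sup>2 + (b + \<sigma>)\<^sup>2" unfolding power2_norm_eq_inner by (simp add: inner_vec_def sum_2 power2_eq_square)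
  also have "\<dots> = (1 - \<sigma>)\<^sup>2 - 4 * (\<sigma> * (1 - 3 * \<sigma>))" unfolding b_def by algebra
  also have "\<dots> \<le> (1 - \<sigma>)\<^sup>2" using \<sigma> by simp
  finally have "norm x \<le> 1 - \<sigma>" using \<sigma> by (auto intro: power2_le_imp_le)
  then show "x \<in> cball 0 (1 - \<sigma>)" by simp
 qed
 have bX: "bounded X" using XR bounded_subset bounded_cball by blast
 have int: "integrable lborel f" "integrable lborel f'" "integrable lborel g" "integrable lborel g'"
  using f(6) g(6) b \<sigma> by (auto intro!: integrable_continuous_support[OF f(2), of "cball 0 (\<sigma> + \<sigma>)"] integrable_continuous_support[OF f(3), of "cball 0 (\<sigma> + \<sigma>)"]
   integrable_continuous_support[OF g(2), of "cball 0 (b + \<sigma>)"] integrable_continuous_support[OF g(3), of "cball 0 (b + \<sigma>)"] simp: dist_norm)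
 have ih: "integrable lborel (\<lambda>s. F s * ind {0<..} s)" if "integrable lborel F" for F :: "real => real"
  using integrable_mult_indicator[OF _ that, of "{0<..}"] by (simp add: mult.commute)
 have flux: "(LBINT x. (F (x $ 1) * G (x $ 2)) * ind {x::R2. x $ 1 > 0} x) = (LBINT s. F s * ind {0<..} s) * (LBINT t. G t)"
  if "integrable lborel F" "integrable lborel G" for F G :: "real => real"
 proof -
  have "(LBINT x. (F (x $ 1) * G (x $ 2)) * ind {x::R2. x $ 1 > 0} x) = (LINT x|(lborel :: R2 measure). (F (x $ 1) * ind {0<..} (x $ 1)) * G (x $ 2))"
   by (rule integral_cong) (auto simp: indicator_def)
  also have "\<dots> = (LBINT s. F s * ind {0<..} s) * (LBINT t. G t)"
   using that ih[OF that(1)] by (intro integral_vec2_mult[of "\<lambda>s. F s * ind {0<..} s"]) auto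
  finally show ?thesis .
 qed
 have "(LBINT s. f' s * ind {0<..} s) = (LBINT s. f' s * indicator {0..2 * \<sigma>} s)"
 proof (rule integral_cong)
  fix s show "f' s * ind {0<..} s = f' s * indicator {0..2 * \<sigma>} s" using f(5)[of s] f(6)[of s] \<sigma> by (cases "s = 0") (auto simp: indicator_def)
 qed simp
 also have "\<dots> = f (2 * \<sigma>) - f 0"
  by (rule integral_FTC_Icc_real) (use \<sigma> f(1,3) in \<open>auto simp: continuous_on_eq_continuous_at\<close>)
 finally have I1: "(LBINT s. f' s * ind {0<..} s) = - 1" using f(5)[of 0] f(6)[of "2 * \<sigma>"] \<sigma> by simp
 have "(LBINT t. g' t) = (LBINT t. g' t * indicator {- (b + \<sigma>)..b + \<sigma>} t)"
 proof (rule integral_cong)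
  fix t show "g' t = g' t * indicator {- (b + \<sigma>)..b + \<sigma>} t" using g(6)[of t] by (cases "b + \<sigma> \<le> \<bar>t\<bar>") (auto simp: indicator_def not_le abs_less_iff)
 qed simp
 also have "\<dots> = g (b + \<sigma>) - g (- (b + \<sigma>))"
  by (rule integral_FTC_Icc_real) (use \<sigma> b g(1,3) in \<open>auto simp: continuous_on_eq_continuous_at\<close>)
 finally have I2: "(LBINT t. g' t) = 0" using g(6)[of "b + \<sigma>"] g(6)[of "- (b + \<sigma>)"] b \<sigma> by simp
 have fl1: "(LBINT x. d\<phi> 1 x * ind {x. x $ 1 > 0} x) = - l" using flux[OF int(2,3)] I1 by (simp add: d\<phi>_def l_def)
 have fl2: "(LBINT x. d\<phi> 2 x * ind {x. x $ 1 > 0} x) = 0" using flux[OF int(1,4)] I2 by (simp add: d\<phi>_def)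
 have "2 - 8 * \<sigma> = (LBINT t. ind {- b..b} t)" using b by (simp add: b_def)
 also have "\<dots> \<le> l" unfolding l_def
 proof (rule integral_mono)
  show "ind {- b..b} t \<le> g t" for t using g(4)[of t] g(5)[of t] by (auto simp: indicator_def)
 qed (use int b in \<open>auto intro!: integrable_real_indicator\<close>)
 finally have lb: "2 - 8 * \<sigma> \<le> l" .
 obtain C1 where C1: "0 \<le> C1" "\<And>x. norm (d\<phi> 1 x) \<le> C1" using continuous_bounded_support[OF dc bX out(2)] by metis
 obtain C2 where C2: "0 \<le> C2" "\<And>x. norm (d\<phi> 2 x) \<le> C2" using continuous_bounded_support[OF dc bX out(2)] by metis
 have Cb: "\<bar>d\<phi> j x\<bar> \<le> C1 + C2" for j x using exhaust_2[of j] C1(2)[of x] C2(2)[of x] C1(1) C2(1) by (auto simp: add_increasing add_increasing2)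
 have "cutoff \<phi> d\<phi> X l (C1 + C2)" unfolding cutoff_def using pd pc dc p01 Xm bX out fl1 fl2 Cb by blast
 then show ?thesis using XR lb by blast
qed

section \<open>The limit\<close>

text \<open>A ring spans a factor 2 and the next one starts at a factor 4, so the rings are
  disjoint. The bound also records that the first N rings do not reach \<open>4 ^ N * M0\<close>,
  which the induction needs.\<close>

lemma ring_indicators_sum:
 fixes M0 t :: real
 assumes "0 < M0"
 shows "(\<Sum>k<N. ind {4 ^ k * M0..2 * (4 ^ k * M0)} t) \<le> (if t < 4 ^ N * M0 then 1 else 0)"
proof (induction N)
 case (Suc N)
 have p: "0 < 4 ^ N * M0" using assms by simp
 show ?case
 proof (cases "t < 4 ^ N * M0")
  case True
  then have "t \<notin> {4 ^ N * M0..2 * (4 ^ N * M0)}" "t < 4 ^ Suc N * M0" using p by auto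
  then show ?thesis using Suc True by simp
 next
  case False
  then have "(\<Sum>k<N. ind {4 ^ k * M0..2 * (4 ^ k * M0)} t) \<le> 0" using Suc by simp
  moreover have "ind {4 ^ N * M0..2 * (4 ^ N * M0)} t \<le> (if t < 4 ^ Suc N * M0 then 1 else 0)" using p by (auto simp: indicator_def)
  ultimately show ?thesis unfolding sum.lessThan_Suc by linarith
 qed
qed simp

lemma pigeonhole_sum:
 fixes a :: "nat => real"
 assumes "(\<Sum>k<N. a k) \<le> Q" "0 < N"
 shows "\<exists>k<N. a k \<le> Q / N"
proof (rule ccontr)
 assume "\<not> (\<exists>k<N. a k \<le> Q / N)"
 then have "(\<Sum>k<N. Q / N) < (\<Sum>k<N. a k)" using assms(2) by (intro sum_strict_mono) (auto simp: not_le)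
 then show False using assms by simp
qed

text \<open>A modulus that is linear up to the fixed error \<theta>. It turns L1 closeness of two
  maps into closeness of the integrals of F along them.\<close>

lemma compact_support_modulus:
 fixes F :: "R2 => real"
 assumes F: "cont F" "bounded S" "\<And>x. x \<notin> S ==> F x = 0" and \<theta>: "0 < \<theta>"
 shows "\<exists>C\<ge>0. \<forall>y z. \<bar>F y - F z\<bar> \<le> \<theta> + C * norm (y - z)"
proof -
 obtain B where B: "0 \<le> B" "\<And>x. norm (F x) \<le> B" using continuous_bounded_support[OF F] by metis
 obtain R where R: "\<And>x. x \<in> S ==> norm x \<le> R" using F(2) unfolding bounded_iff by auto
 have "uniformly_continuous_on (cball 0 (R + 1)) F" by (intro compact_uniformly_continuous continuous_on_subset[OF F(1)]) auto
 then obtain d' where d': "0 < d'" "\<forall>x\<in>cball 0 (R + 1). \<forall>x'\<in>cball 0 (R + 1). dist x' x < d' \<longrightarrow> dist (F x') (F x) < \<theta>"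
  using \<theta> unfolding uniformly_continuous_on_def by auto
 define d where "d = min d' 1"
 have d: "0 < d" "d \<le> d'" "d \<le> 1" using d'(1) by (auto simp: d_def)
 show ?thesis
 proof (intro exI[of _ "2 * B / d"] conjI allI)
  show "0 \<le> 2 * B / d" using B d by simp
  fix y z
  show "\<bar>F y - F z\<bar> \<le> \<theta> + 2 * B / d * norm (y - z)"
  proof (cases "norm (y - z) < d")
   case True
   have "\<bar>F y - F z\<bar> \<le> \<theta>"
   proof (cases "y \<in> S \<or> z \<in> S")
    case S: True
    have "norm y \<le> norm z + norm (y - z)" "norm z \<le> norm y + norm (y - z)"
     by (metis norm_triangle_sub add.commute, metis norm_triangle_sub norm_minus_commute add.commute)
    then have "y \<in> cball 0 (R + 1)" "z \<in> cball 0 (R + 1)" using S R[of y] R[of z] True d(3) by auto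
    then have "dist (F y) (F z) < \<theta>" using d'(2) True d(2) by (auto simp: dist_norm)
    then show ?thesis by (simp add: dist_norm)
   next
    case False then show ?thesis using F(3) \<theta> by simp
   qed
   moreover have "0 \<le> 2 * B / d * norm (y - z)" using B d by simp
   ultimately show ?thesis by linarith
  next
   case False
   have "\<bar>F y - F z\<bar> \<le> 2 * B" using B(2)[of y] B(2)[of z] by (simp add: abs_le_iff)
   also have "2 * B = 2 * B / d * d" using d by simp
   also have "\<dots> \<le> 2 * B / d * norm (y - z)" using False B d by (intro mult_left_mono) auto
   finally show ?thesis using \<theta> by simp
  qed
 qed
qed

lemma eventually_power_small:
 fixes c q d :: real
 assumes "0 < q" "0 < d"
 shows "\<forall>\<^sub>F \<epsilon> in at_right 0. c * \<epsilon> powr q \<le> d"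
proof -
 have "((\<lambda>\<epsilon>. \<epsilon> powr q) \<longlongrightarrow> 0) (at_right (0::real))"
  by (rule tendsto_zero_powrI[where b=q]) (use assms in \<open>auto intro!: tendsto_intros eventually_at_right_less[THEN eventually_mono]\<close>)
 then have "((\<lambda>\<epsilon>. c * \<epsilon> powr q) \<longlongrightarrow> c * 0) (at_right (0::real))" by (intro tendsto_mult tendsto_const)
 from order_tendstoD(2)[OF this, of d] assms show ?thesis by (auto elim!: eventually_mono)
qed

lemma locally_Hoelder_continuous_imp_continuous:
 fixes W :: "R2 => real"
 assumes "locally_Hoelder_continuous W"
 shows "cont W"
proof (intro continuous_at_imp_continuous_on ballI)
 fix x :: "R2"
 obtain \<alpha> C where a: "0 < \<alpha>" "\<forall>y\<in>cball x 1. \<forall>z\<in>cball x 1. dist (W y) (W z) \<le> C * dist y z powr \<alpha>"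
  using assms unfolding locally_Hoelder_continuous_def by (meson compact_cball)
 have "((\<lambda>y. dist y x powr \<alpha>) \<longlongrightarrow> 0) (at x)"
 proof (rule tendsto_zero_powrI[where b=\<alpha>])
  show "((\<lambda>y. dist y x) \<longlongrightarrow> 0) (at x)" using tendsto_dist[OF tendsto_ident_at[of x UNIV] tendsto_const[of x]] by simp
 qed (use a in auto)
 then have "((\<lambda>y. C * dist y x powr \<alpha>) \<longlongrightarrow> C * 0) (at x)" by (intro tendsto_mult tendsto_const)
 then have lim: "((\<lambda>y. C * dist y x powr \<alpha>) \<longlongrightarrow> 0) (at x)" by simp
 have ev: "\<forall>\<^sub>F y in at x. norm (W y - W x) \<le> C * dist y x powr \<alpha>"
  unfolding eventually_at by (rule exI[of _ 1]) (use a(2) in \<open>auto simp: dist_norm norm_minus_commute\<close>)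
 have "((\<lambda>y. W y - W x) \<longlongrightarrow> 0) (at x)" by (rule Lim_null_comparison[OF ev lim])
 then show "isCont W x" unfolding isCont_def by (rule LIM_zero_cancel)
qed

section \<open>Growth of the potential and the choice of parameters\<close>

locale potential =
 fixes W :: "R2 => real" and c1 c2 p :: real
 assumes W0: "0 \<le> W y" and Wh: "locally_Hoelder_continuous W" and c: "0 < c1" "0 < c2" "0 < p"
  and Wl: "c1 * norm y powr (2 * p) - 1 \<le> W y" and Wu: "W y \<le> c2 * (norm y powr (2 * p) + 1)"
begin

lemma Wcont: "cont W" by (rule locally_Hoelder_continuous_imp_continuous[OF Wh])

definition WM :: "real => real" where "WM M = sqrt (c2 * ((5 * M) powr (2 * p) + 1))"
definition Cr :: real where "Cr = sqrt (2 * c2 * (5 powr (2 * p) + c1) / c1)"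

lemma WM_bound: "norm y \<le> 5 * M ==> sqrt (W y) \<le> WM M"
 unfolding WM_def using c by (intro real_sqrt_le_mono order_trans[OF Wu] mult_left_mono add_right_mono powr_mono2) auto

lemma WM_mono: "0 \<le> M ==> M \<le> M' ==> WM M \<le> WM M'"
 unfolding WM_def using c by (intro real_sqrt_le_mono mult_left_mono add_right_mono powr_mono2) auto

lemma WM_nonneg: "0 \<le> WM M" unfolding WM_def using c by (intro real_sqrt_ge_zero) (auto intro!: mult_nonneg_nonneg add_nonneg_nonneg)

lemma Cr_nonneg: "0 \<le> Cr" unfolding Cr_def using c by (intro real_sqrt_ge_zero) (auto intro!: mult_nonneg_nonneg add_nonneg_nonneg divide_nonneg_nonneg)

text \<open>Both growth bounds have the same exponent, so the supremum over the ball of radius 5 M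
  and the values outside the square of size M are comparable by a constant independent of M, once
  \<open>c1 * M powr (2 * p)\<close> is large enough to absorb the -1 in the lower bound.\<close>

lemma WM_le_Cr:
 assumes M: "0 < M" "2 \<le> c1 * M powr (2 * p)" and y: "M \<le> infnorm y"
 shows "WM M \<le> Cr * sqrt (W y)"
proof -
 define T A where "T = M powr (2 * p)" and "A = (5::real) powr (2 * p)"
 have "M \<le> norm y" using y infnorm_le_norm[of y] by linarith
 then have "T \<le> norm y powr (2 * p)" unfolding T_def using M c by (intro powr_mono2) auto
 then have "c1 * T \<le> c1 * norm y powr (2 * p)" using c by (intro mult_left_mono) auto
 then have "c1 * T / 2 \<le> W y" using Wl[of y] M(2) unfolding T_def by linarith
 then have "2 * c2 * (A + c1) / c1 * (c1 * T / 2) \<le> 2 * c2 * (A + c1) / c1 * W y"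
  using c by (intro mult_left_mono) (auto simp: A_def intro!: divide_nonneg_nonneg mult_nonneg_nonneg add_nonneg_nonneg)
 moreover have "2 * c2 * (A + c1) / c1 * (c1 * T / 2) = c2 * (A * T) + c2 * (c1 * T)" using c by (simp add: field_simps)
 moreover have "c2 * 1 \<le> c2 * (c1 * T)" using M(2) c unfolding T_def by (intro mult_left_mono) auto
 moreover have "(5 * M) powr (2 * p) = A * T" unfolding A_def T_def using M by (simp add: powr_mult)
 ultimately have "c2 * ((5 * M) powr (2 * p) + 1) \<le> 2 * c2 * (A + c1) / c1 * W y" by (simp add: distrib_left)
 then show ?thesis unfolding WM_def Cr_def A_def[symmetric] real_sqrt_mult[symmetric] by (rule real_sqrt_le_mono)
qed

lemma scale_exists: "\<exists>M0\<ge>B. 1 \<le> M0 \<and> 2 \<le> c1 * M0 powr (2 * p)"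
proof (intro exI conjI)
 define M0 where "M0 = max (max B 1) ((2 / c1) powr (1 / (2 * p)))"
 show "B \<le> M0" "1 \<le> M0" by (auto simp: M0_def)
 have "2 / c1 = ((2 / c1) powr (1 / (2 * p))) powr (2 * p)" using c by (simp add: powr_powr)
 also have "\<dots> \<le> M0 powr (2 * p)" using c by (intro powr_mono2) (auto simp: M0_def)
 finally show "2 \<le> c1 * M0 powr (2 * p)" using c by (simp add: divide_le_eq mult.commute)
qed

lemma Hoelder_ball: "\<exists>\<alpha> C. 0 < \<alpha> \<and> 0 < C \<and> (\<forall>y z. norm y \<le> R \<longrightarrow> norm z \<le> R \<longrightarrow> W z \<le> W y + C * norm (z - y) powr \<alpha>)"
proof -
 obtain \<alpha> C where a: "0 < \<alpha>" "\<forall>y\<in>cball 0 R. \<forall>z\<in>cball 0 R. dist (W y) (W z) \<le> C * dist y z powr \<alpha>"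
  using Wh compact_cball[of 0 R] unfolding locally_Hoelder_continuous_def by meson
 have "W z \<le> W y + max C 1 * norm (z - y) powr \<alpha>" if "norm y \<le> R" "norm z \<le> R" for y z
 proof -
  have "dist (W z) (W y) \<le> C * dist z y powr \<alpha>" using a(2) that by auto
  also have "\<dots> \<le> max C 1 * dist z y powr \<alpha>" by (intro mult_right_mono) auto
  finally show ?thesis by (simp add: dist_norm)
 qed
 then show ?thesis using a(1) by (intro exI[of _ \<alpha>] exI[of _ "max C 1"]) auto
qed

theorem INF_mollified_le:
 fixes N :: nat
 assumes cut: "cutoff \<phi> d\<phi> X l C\<phi>" "X \<subseteq> cball 0 r" "r < 1" and l: "0 < l"
  and M0: "norm am \<le> M0 - 1" "norm ap \<le> M0 - 1" "1 \<le> M0" "2 \<le> c1 * M0 powr (2 * p)" and a1: "am $ 1 = ap $ 1"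
  and N: "0 < N" and Mm: "Mm = 4 ^ N * M0" and h: "0 < h" "2 * h \<le> M0" and \<rho>: "0 < \<rho>" "2 * \<rho> \<le> h"
  and e: "0 < \<epsilon>" "0 \<le> e0" and near: "\<And>y z. norm y \<le> 5 * Mm ==> norm z \<le> 5 * Mm ==> norm (z - y) \<le> 2 * \<rho> ==> W z \<le> W y + e0"
  and rep: "represents U Gm u" and E: "0 \<le> E" "energy W \<epsilon> u \<le> ennreal E" and \<kappa>: "0 < \<kappa>" and \<eta>: "0 < \<eta>"
  and g0: "integrable lborel (\<lambda>x. ind unit_disc x * norm (U x - jump_function am ap x))"
   "(LBINT x. ind unit_disc x * norm (U x - jump_function am ap x)) \<le> \<kappa>"
  and D: "(LBINT x. \<bar>trace (Gm x)\<bar>) \<le> D"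
 shows "(INF T \<in> transition_currents am ap. F_mass W T) \<le> ennreal (1 / (2 * l) *
  (E + \<eta> + e0 / (2 * \<epsilon>) * measure lborel X + 4 * (Mm * (C\<phi> * (sqrt \<epsilon> * (measure lborel X + 2 * E))))
  + 2 * (WM Mm * (C\<phi> * (640 * h * measure lborel X + (1280 + 5120 * Mm / h + 480 * ln (Mm / h) + 1280 * Mm) * (2 * \<kappa>)) + 560 * (ln (Mm / \<rho>) * D)))
  + 125440 * (Cr * (2 * (E + \<eta>) / N))))"
proof -
 interpret weak_map U Gm using rep by (simp add: represents_def)
 have Um: "U \<in> borel_measurable borel" using rep by (simp add: represents_def)
 have Mp: "0 < Mm" "M0 \<le> Mm" unfolding Mm using M0(3) by auto
 have ph: "((\<lambda>h. \<phi> (x + h *\<^sub>R axis j 1)) has_real_derivative d\<phi> j x) (at 0)" "cont \<phi>" "cont (d\<phi> j)" "0 \<le> \<phi> x" "\<phi> x \<le> 1"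
  "bounded X" "X \<in> sets borel" "x \<notin> X ==> \<phi> x = 0" "x \<notin> X ==> d\<phi> j x = 0" "\<bar>d\<phi> j x\<bar> \<le> C\<phi>" for x j
  using cut(1) unfolding cutoff_def by blast+
 have fl: "(LBINT x. d\<phi> 1 x * ind {x. x $ 1 > 0} x) = - l" "(LBINT x. d\<phi> 2 x * ind {x. x $ 1 > 0} x) = 0"
  using cut(1) unfolding cutoff_def by blast+
 define m where "m = measure lborel X"
 have m0: "0 \<le> m" by (simp add: m_def)
 have XD: "X \<subseteq> unit_disc" using cut(2,3) by (auto dest!: subsetD)
 have C0: "0 \<le> C\<phi>" using ph(10)[of 1 0] abs_ge_zero order_trans by blast
 note en = energy_represented[OF rep Wcont W0 e(1) E]
 define WU S where "WU = (LBINT x. ind unit_disc x * W (U x))" and "S = (LBINT x. (norm (Gm x))\<^sup>2)"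
 have enE: "WU / (2 * \<epsilon>) + \<epsilon> / 2 * S \<le> E" using en(2) by (simp add: WU_def S_def)
 have WU0: "0 \<le> WU" unfolding WU_def by (intro integral_nonneg) (simp add: W0)
 have S0: "0 \<le> S" unfolding S_def by (intro integral_nonneg) simp
 have eS: "\<epsilon> * S \<le> 2 * E" using enE divide_nonneg_pos[OF WU0, of "2 * \<epsilon>"] e(1) by simp
 \<comment> \<open>Equal to W up to 2 Mm, which covers all rings, and compactly supported, so that
   it has a modulus on the whole plane although the mollified map is only close to U in L1.\<close>
 define Wc where "Wc y = chi (2 * Mm) y * W y" for y
 have Wcc: "cont Wc" unfolding Wc_def[abs_def] using Mp by (intro continuous_intros Wcont) auto
 have Wc0: "0 \<le> Wc y" "Wc y \<le> W y" for y using chi_bounds[of "2 * Mm" y] W0[of y] by (auto simp: Wc_def mult_left_le_one_le)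
 have Wc1: "Wc y = W y" if "infnorm y \<le> 2 * Mm" for y using chi_eq(1)[of "2 * Mm" y 0] that Mp by (simp add: Wc_def)
 have Wcz: "Wc y = 0" if "y \<notin> cball 0 (6 * Mm)" for y
 proof -
  have "2 * (2 * Mm) \<le> infnorm y" using that infnorm_norm[of y] by simp
  then show ?thesis using chi_eq(2)[of "2 * Mm" y 0] Mp by (simp add: Wc_def)
 qed
 \<comment> \<open>The energy divides the potential by 2 \<epsilon>, so errors in its integral must
   be kept to multiples of \<eta> \<epsilon>: one from \<theta>, one from \<kappa>'.\<close>
 define \<theta> where "\<theta> = \<eta> * \<epsilon> / (m + 1)"
 have \<theta>: "0 < \<theta>" "\<theta> * m \<le> \<eta> * \<epsilon>"
 proof -
  show "0 < \<theta>" using \<eta> e m0 by (simp add: \<theta>_def)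
  have "\<theta> * m \<le> \<theta> * (m + 1)" using \<open>0 < \<theta>\<close> by (intro mult_left_mono) auto
  then show "\<theta> * m \<le> \<eta> * \<epsilon>" using m0 by (simp add: \<theta>_def)
 qed
 obtain C where C: "0 \<le> C" "\<forall>y z. \<bar>Wc y - Wc z\<bar> \<le> \<theta> + C * norm (y - z)"
  using compact_support_modulus[OF Wcc bounded_cball Wcz \<theta>(1)] by blast
 define \<kappa>' where "\<kappa>' = min \<kappa> (\<eta> * \<epsilon> / (C + 1))"
 have k': "0 < \<kappa>'" "\<kappa>' \<le> \<kappa>" "C * \<kappa>' \<le> \<eta> * \<epsilon>"
 proof -
  show "0 < \<kappa>'" "\<kappa>' \<le> \<kappa>" using \<kappa> \<eta> e C(1) by (auto simp: \<kappa>'_def)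
  have "C * \<kappa>' \<le> (C + 1) * (\<eta> * \<epsilon> / (C + 1))" using C(1) \<open>0 < \<kappa>'\<close> by (intro mult_mono) (auto simp: \<kappa>'_def)
  then show "C * \<kappa>' \<le> \<eta> * \<epsilon>" using C(1) by simp
 qed
 obtain v :: "R2 => R2" and dv :: "2 => R2 => R2" and d12 :: "R2 => real"
  where v: "\<And>x j. ((\<lambda>h. v (x + h *\<^sub>R axis j 1)) has_vector_derivative dv j x) (at 0)"
  "cont v" "\<And>j. cont (dv j)"
  "\<And>x. ((\<lambda>h. dv 2 (x + h *\<^sub>R axis 1 1) $ 2) has_real_derivative d12 x) (at 0)"
  "\<And>x. ((\<lambda>h. dv 1 (x + h *\<^sub>R axis 2 1) $ 2) has_real_derivative d12 x) (at 0)"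
  "cont d12"
  "(LBINT x. ind X x * norm (v x - U x)) < \<kappa>'"
  "(LBINT x. ind X x * ((norm (dv 1 x))\<^sup>2 + (norm (dv 2 x))\<^sup>2)) \<le> (LBINT x. (norm (Gm x))\<^sup>2)"
  "(LBINT x. ind X x * \<bar>dv 1 x $ 1 + dv 2 x $ 2\<bar>) \<le> (LBINT x. \<bar>trace (Gm x)\<bar>)"
  by (rule mollified[OF ph(7) cut(2,3) k'(1)]) (rule that)
 \<comment> \<open>One map v serves all rings; only the target scale depends on k.\<close>
 have tm: "transition_map \<phi> d\<phi> X v dv d12 (4 ^ k * M0) \<rho> am ap l h C\<phi>" for k :: nat
 proof -
  have k1: "M0 \<le> 4 ^ k * M0" using M0(3) by simp
  show ?thesis
   by unfold_locales (fact ph v(1-6) fl a1 | use M0 h \<rho> k1 in linarith | use M0(3) in simp)+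
 qed
 interpret T0: transition_map \<phi> d\<phi> X v dv d12 "4 ^ 0 * M0" \<rho> am ap l h C\<phi> by (rule tm)
 define sq where "sq x = (norm (dv 1 x))\<^sup>2 + (norm (dv 2 x))\<^sup>2" for x
 have sq: "T0.sqv = sq" by (simp add: T0.sqv_def sq_def fun_eq_iff)
 have sq0: "0 \<le> sq x" for x by (simp add: sq_def)
 have sqc: "cont sq" using T0.sqv_cont by (simp add: sq)
 have iX: "integrable lborel (ind X)" by (rule T0.integrable_indicator_X)
 have isq: "integrable lborel (\<lambda>x. ind X x * sq x)" by (rule T0.integrable_cutoff_cont[OF sqc])
 have Lsq: "(LBINT x. ind X x * sq x) \<le> S" using v(8) by (simp add: sq_def S_def)
 have ivU: "integrable lborel (\<lambda>x. ind X x * norm (v x - U x))"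
 proof (rule integrable_bound[OF integrable_add[OF T0.integrable_cutoff_cont[OF continuous_on_norm[OF v(2)]] integrable_norm[OF U]]])
  show "AE x in lborel. norm (ind X x * norm (v x - U x)) \<le> norm (ind X x * norm (v x) + norm (U x))"
   by (intro AE_I2) (auto simp: indicator_def intro: norm_triangle_ineq4)
  show "(\<lambda>x. ind X x * norm (v x - U x)) \<in> borel_measurable lborel" using ph(7) Um borel_measurable_continuous_onI[OF v(2)] by measurable
 qed
 have gap: "(LBINT x. ind X x * norm (v x - jump_function am ap x)) \<le> 2 * \<kappa>"
 proof -
  have "(LBINT x. ind X x * norm (v x - jump_function am ap x))
   \<le> (LBINT x. ind X x * norm (v x - U x) + ind unit_disc x * norm (U x - jump_function am ap x))"
  proof (rule integral_mono')
   show "ind X x * norm (v x - jump_function am ap x) \<le> ind X x * norm (v x - U x) + ind unit_disc x * norm (U x - jump_function am ap x)" for x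
    using norm_triangle_ineq[of "v x - U x" "U x - jump_function am ap x"] XD by (auto simp: indicator_def)
  qed (intro integrable_add ivU g0(1), simp)
  also have "\<dots> \<le> 2 * \<kappa>" unfolding integral_add[OF ivU g0(1)] using g0(2) v(7) k'(2) by linarith
  finally show ?thesis .
 qed
 define P where "P = WU + 2 * \<eta> * \<epsilon>"
 have Wcv: "cont (\<lambda>x. Wc (v x))" by (rule continuous_on_compose2[OF Wcc v(2)]) simp
 have ipW: "integrable lborel (\<lambda>x. \<phi> x * Wc (v x))"
  by (rule integrable_continuous_support[OF _ ph(6)]) (auto intro!: continuous_intros ph(2) Wcv simp: ph(8))
 have phX: "\<phi> x \<le> ind X x" for x using ph(5)[of x] ph(8)[of x] by (auto simp: indicator_def)
 have LP: "(LBINT x. \<phi> x * Wc (v x)) \<le> P"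
 proof -
  have pw: "\<phi> x * Wc (v x) \<le> ind unit_disc x * W (U x) + (\<theta> * ind X x + C * (ind X x * norm (v x - U x)))" for x
  proof (cases "x \<in> X")
   case True
   have "Wc (v x) \<le> Wc (U x) + (\<theta> + C * norm (v x - U x))" using C(2)[rule_format, of "v x" "U x"] by linarith
   then have "Wc (v x) \<le> W (U x) + (\<theta> + C * norm (v x - U x))" using Wc0(2)[of "U x"] by linarith
   moreover have "\<phi> x * Wc (v x) \<le> Wc (v x)" using ph(4,5)[of x] Wc0(1)[of "v x"] by (intro mult_left_le_one_le) auto
   ultimately show ?thesis using True XD by (auto simp: indicator_def)
  next
   case False then show ?thesis using ph(8)[of x] W0 by simp
  qed
  note i2 = integrable_add[OF integrable_mult_right[OF iX, of \<theta>] integrable_mult_right[OF ivU, of C]]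
  have "(LBINT x. \<phi> x * Wc (v x)) \<le> (LBINT x. ind unit_disc x * W (U x) + (\<theta> * ind X x + C * (ind X x * norm (v x - U x))))"
   by (intro integral_mono ipW integrable_add[OF en(1) i2] pw)
  also have "\<dots> = WU + (\<theta> * m + C * (LBINT x. ind X x * norm (v x - U x)))"
   unfolding integral_add[OF en(1) i2] integral_add[OF integrable_mult_right[OF iX, of \<theta>] integrable_mult_right[OF ivU, of C]]
   by (simp add: WU_def m_def)
  also have "C * (LBINT x. ind X x * norm (v x - U x)) \<le> C * \<kappa>'" using v(7) C(1) by (intro mult_left_mono) auto
  finally show ?thesis using \<theta>(2) k'(3) unfolding P_def by linarith
 qed
 have PE: "P / (2 * \<epsilon>) + \<epsilon> / 2 * S \<le> E + \<eta>"
 proof -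
  have "P / (2 * \<epsilon>) = WU / (2 * \<epsilon>) + \<eta>" using e by (simp add: P_def field_simps)
  then show ?thesis using enE by linarith
 qed
 define Fr where "Fr k x = \<phi> x * ind {4 ^ k * M0..2 * (4 ^ k * M0)} (infnorm (v x)) * (Wc (v x) / (2 * \<epsilon>) + \<epsilon> * sq x)" for k :: nat and x
 have den0: "0 \<le> Wc (v x) / (2 * \<epsilon>) + \<epsilon> * sq x" for x using Wc0(1) sq0 e by (intro add_nonneg_nonneg) auto
 have iden: "integrable lborel (\<lambda>x. \<phi> x * (Wc (v x) / (2 * \<epsilon>) + \<epsilon> * sq x))"
  using e by (intro integrable_continuous_support[OF _ ph(6)]) (auto intro!: continuous_intros ph(2) Wcv sqc simp: ph(8))
 have iFr: "integrable lborel (Fr k)" for k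
 proof (rule integrable_bound[OF iden])
  have [measurable]: "\<phi> \<in> borel_measurable borel" "(\<lambda>x. infnorm (v x)) \<in> borel_measurable borel" "(\<lambda>x. Wc (v x)) \<in> borel_measurable borel" "sq \<in> borel_measurable borel"
   by (intro borel_measurable_continuous_onI ph(2) Wcv sqc continuous_on_infnorm v(2))+
  show "Fr k \<in> borel_measurable lborel" unfolding Fr_def by measurable
  show "AE x in lborel. norm (Fr k x) \<le> norm (\<phi> x * (Wc (v x) / (2 * \<epsilon>) + \<epsilon> * sq x))"
   using ph(4) by (intro AE_I2) (auto simp: Fr_def abs_mult indicator_def)
 qed
 have "(\<Sum>k<N. LBINT x. Fr k x) = (LBINT x. (\<Sum>k<N. Fr k x))" by (rule integral_sum[symmetric]) (rule iFr)
 also have "\<dots> \<le> (LBINT x. (1 / (2 * \<epsilon>)) * (\<phi> x * Wc (v x)) + \<epsilon> * (ind X x * sq x))"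
 proof (intro integral_mono integrable_sum iFr integrable_add integrable_mult_right ipW isq)
  fix x
  have "(\<Sum>k<N. Fr k x) = (\<Sum>k<N. ind {4 ^ k * M0..2 * (4 ^ k * M0)} (infnorm (v x))) * (\<phi> x * (Wc (v x) / (2 * \<epsilon>) + \<epsilon> * sq x))"
   unfolding Fr_def sum_distrib_right by (simp add: ac_simps)
  also have "\<dots> \<le> 1 * (\<phi> x * (Wc (v x) / (2 * \<epsilon>) + \<epsilon> * sq x))"
   using ring_indicators_sum[where N=N and t="infnorm (v x)" and ?M0.0=M0] M0(3) ph(4)[of x] den0[of x] by (intro mult_right_mono mult_nonneg_nonneg) (auto split: if_splits)
  also have "\<dots> = (1 / (2 * \<epsilon>)) * (\<phi> x * Wc (v x)) + \<epsilon> * (\<phi> x * sq x)" by (simp add: algebra_simps)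
  also have "\<dots> \<le> (1 / (2 * \<epsilon>)) * (\<phi> x * Wc (v x)) + \<epsilon> * (ind X x * sq x)"
   using phX[of x] sq0[of x] e by (intro add_left_mono mult_left_mono mult_right_mono) auto
  finally show "(\<Sum>k<N. Fr k x) \<le> (1 / (2 * \<epsilon>)) * (\<phi> x * Wc (v x)) + \<epsilon> * (ind X x * sq x)" .
 qed
 also have "\<dots> = (1 / (2 * \<epsilon>)) * (LBINT x. \<phi> x * Wc (v x)) + \<epsilon> * (LBINT x. ind X x * sq x)"
  by (subst integral_add[OF integrable_mult_right[OF ipW] integrable_mult_right[OF isq]]) simp
 also have "\<dots> \<le> (1 / (2 * \<epsilon>)) * P + \<epsilon> * S" using LP Lsq e by (intro add_mono mult_left_mono) auto
 \<comment> \<open>The ring weight has \<epsilon> in place of \<epsilon> / 2 in front of the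
   gradient term, hence twice the energy.\<close>
 also have "\<dots> \<le> 2 * (E + \<eta>)"
 proof -
  have "0 \<le> P / (2 * \<epsilon>)" using WU0 \<eta> e by (simp add: P_def)
  then show ?thesis using PE by simp
 qed
 finally obtain k where k: "k < N" "(LBINT x. Fr k x) \<le> 2 * (E + \<eta>) / N"
  using pigeonhole_sum[of "\<lambda>k. LBINT x. Fr k x" N "2 * (E + \<eta>)"] N by blast
 define M where "M = 4 ^ k * M0"
 have M: "0 < M" "M0 \<le> M" "M \<le> Mm"
 proof -
  show "0 < M" "M0 \<le> M" using M0(3) by (auto simp: M_def)
  have "(4::real) ^ k \<le> 4 ^ N" using k(1) by (intro power_increasing) auto
  then show "M \<le> Mm" unfolding M_def Mm using M0(3) by (intro mult_right_mono) auto
 qed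
 interpret T: transition_map \<phi> d\<phi> X v dv d12 M \<rho> am ap l h C\<phi> unfolding M_def by (rule tm)
 have sq': "T.sqv = sq" by (simp add: T.sqv_def sq_def fun_eq_iff)
 have c1M: "2 \<le> c1 * M powr (2 * p)"
 proof -
  have "c1 * M0 powr (2 * p) \<le> c1 * M powr (2 * p)" using c M(2) M0(3) by (intro mult_left_mono powr_mono2) auto
  then show ?thesis using M0(4) by linarith
 qed
 have near': "W Y \<le> W (v x) + e0" if "infnorm (v x) \<le> 2 * M" "norm (Y - v x) \<le> 2 * \<rho>" for x Y
 proof -
  have "norm (v x) \<le> 3 * M" using infnorm_norm[of "v x"] that(1) by linarith
  moreover have "norm Y \<le> norm (v x) + norm (Y - v x)" by (metis norm_triangle_sub add.commute)
  ultimately show ?thesis using that(2) \<rho> h M by (intro near) auto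
 qed
  have "0 \<le> (LBINT x. \<bar>trace (Gm x)\<bar>)" by (intro integral_nonneg) simp
  then have D0: "0 \<le> D" using D by linarith
  \<comment> \<open>From here on each term is increased to the largest scale Mm, so that the bound
    does not depend on the selected ring.\<close>
  have ln: "0 \<le> ln (M / h)" "ln (M / h) \<le> ln (Mm / h)" "0 \<le> ln (M / \<rho>)" "ln (M / \<rho>) \<le> ln (Mm / \<rho>)"
   using M h \<rho> M0(3) by (auto intro!: ln_ge_zero ln_mono divide_right_mono)
  have Kg: "1280 + 5120 * M / h + 480 * ln (M / h) + 1280 * M \<le> 1280 + 5120 * Mm / h + 480 * ln (Mm / h) + 1280 * Mm" "0 \<le> 1280 + 5120 * M / h + 480 * ln (M / h) + 1280 * M"
   using M h ln by (auto intro!: add_mono add_nonneg_nonneg divide_right_mono mult_left_mono)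
  have J: "M * (C\<phi> * (sqrt \<epsilon> * (measure lborel X + \<epsilon> * S))) \<le> Mm * (C\<phi> * (sqrt \<epsilon> * (measure lborel X + 2 * E)))"
   by (rule mult_mono[OF M(3) mult_left_mono[OF mult_left_mono[OF add_left_mono[OF eS]] C0]])
    (use M C0 e S0 in \<open>auto intro!: mult_nonneg_nonneg add_nonneg_nonneg\<close>)
  have t: "0 \<le> C\<phi> * (640 * h * measure lborel X + (1280 + 5120 * M / h + 480 * ln (M / h) + 1280 * M) * (2 * \<kappa>)) + 560 * (ln (M / \<rho>) * D)"
   using C0 h Kg \<kappa> ln D0 M(1) by (intro mult_nonneg_nonneg add_nonneg_nonneg) auto
  have "C\<phi> * (640 * h * measure lborel X + (1280 + 5120 * M / h + 480 * ln (M / h) + 1280 * M) * (2 * \<kappa>)) + 560 * (ln (M / \<rho>) * D)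
   \<le> C\<phi> * (640 * h * measure lborel X + (1280 + 5120 * Mm / h + 480 * ln (Mm / h) + 1280 * Mm) * (2 * \<kappa>)) + 560 * (ln (Mm / \<rho>) * D)"
   by (rule add_mono[OF mult_left_mono[OF add_left_mono[OF mult_right_mono[OF Kg(1)]] C0] mult_left_mono[OF mult_right_mono[OF ln(4) D0]]]) (use \<kappa> in auto)
  then have Wle: "WM M * (C\<phi> * (640 * h * measure lborel X + (1280 + 5120 * M / h + 480 * ln (M / h) + 1280 * M) * (2 * \<kappa>)) + 560 * (ln (M / \<rho>) * D))
   \<le> WM Mm * (C\<phi> * (640 * h * measure lborel X + (1280 + 5120 * Mm / h + 480 * ln (Mm / h) + 1280 * Mm) * (2 * \<kappa>)) + 560 * (ln (Mm / \<rho>) * D))"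
   using t WM_mono[OF less_imp_le[OF M(1)] M(3)] WM_nonneg by (intro mult_mono) auto
 have "(INF T \<in> transition_currents am ap. F_mass W T) \<le> ennreal (1 / (2 * l) *
  (P / (2 * \<epsilon>) + \<epsilon> / 2 * S + e0 / (2 * \<epsilon>) * measure lborel X + 4 * (M * (C\<phi> * (sqrt \<epsilon> * (measure lborel X + \<epsilon> * S))))
  + 2 * (WM M * (C\<phi> * (640 * h * measure lborel X + (1280 + 5120 * M / h + 480 * ln (M / h) + 1280 * M) * (2 * \<kappa>)) + 560 * (ln (M / \<rho>) * D)))
  + 125440 * (Cr * (2 * (E + \<eta>) / N))))"
 proof (rule T.INF_scale_le[OF Wcont W0 l e near' Wcc Wc0(1) _ WM_bound Cr_nonneg WM_le_Cr[OF M(1) c1M] gap])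
  show "W y \<le> Wc y" if "infnorm y \<le> 2 * M" for y using Wc1[of y] that M(3) by simp
  show "(LBINT x. ind X x * T.sqv x) \<le> S" unfolding sq' by (rule Lsq)
  show "(LBINT x. ind X x * \<bar>T.divv x\<bar>) \<le> D" using v(9) D by (simp add: T.divv_def)
  show "(LBINT x. \<phi> x * ind {M..2 * M} (infnorm (v x)) * (Wc (v x) / (2 * \<epsilon>) + \<epsilon> * T.sqv x)) \<le> 2 * (E + \<eta>) / N"
   using k(2) unfolding Fr_def sq' M_def .
 qed (use LP in auto)
 also have "\<dots> \<le> ennreal (1 / (2 * l) *
  (E + \<eta> + e0 / (2 * \<epsilon>) * measure lborel X + 4 * (Mm * (C\<phi> * (sqrt \<epsilon> * (measure lborel X + 2 * E))))
  + 2 * (WM Mm * (C\<phi> * (640 * h * measure lborel X + (1280 + 5120 * Mm / h + 480 * ln (Mm / h) + 1280 * Mm) * (2 * \<kappa>)) + 560 * (ln (Mm / \<rho>) * D)))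
  + 125440 * (Cr * (2 * (E + \<eta>) / N))))"
  by (rule ennreal_leI[OF mult_left_mono[OF add_mono[OF add_mono[OF add_mono[OF add_mono[OF PE order_refl] mult_left_mono[OF J zero_le_numeral]] mult_left_mono[OF Wle zero_le_numeral]] order_refl]]])
   (use l in simp)
 finally show ?thesis .
qed


text \<open>The 1 in the denominator avoids a case distinction when the coefficient q is 0.\<close>

lemma fraction_le: "q * (\<eta> / (q + 1)) \<le> \<eta>" if "0 \<le> q" "0 < \<eta>" for q \<eta> :: real
proof -
 have "q / (q + 1) \<le> 1" using that by simp
 from mult_left_mono[OF this, of \<eta>] that show ?thesis by (simp add: mult.commute)
qed

text \<open>The parameters depend on each other in one order only: the cutoff and the base scale,
  then the number of rings and so the largest scale, then h, then \<kappa>, with the Hoelder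
  constants taken on the resulting largest ball, and finally \<epsilon>. The 8 counts the errors of
  size at most \<eta>: two in the energy bound, one each from the oscillation of W, the null
  Lagrangian and the rings, and three from the transport.\<close>

theorem INF_le_family:
 assumes a1: "am $ 1 = ap $ 1" and u: "u \<in> transition_families am ap"
  and L: "Liminf (at_right 0) (\<lambda>\<epsilon>. energy W \<epsilon> (u \<epsilon>)) = ennreal L0" "0 \<le> L0" and \<eta>: "0 < \<eta>" "\<eta> < 1 / 8"
 shows "(INF T \<in> transition_currents am ap. F_mass W T) \<le> ennreal (1 / (2 * (2 - 8 * \<eta>)) * (L0 + 8 * \<eta>))"
proof -
 define E where "E = L0 + \<eta>"
 have E: "0 \<le> E" using L \<eta> by (simp add: E_def)
 obtain \<phi> d\<phi> X l C\<phi> where cut: "cutoff \<phi> d\<phi> X l C\<phi>" "X \<subseteq> cball 0 (1 - \<eta>)" "2 - 8 * \<eta> \<le> l"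
  using cutoff_exists[of \<eta>] \<eta> by auto
 have l: "0 < l" "0 < 2 - 8 * \<eta>" using cut(3) \<eta> by auto
 have "\<bar>d\<phi> 1 0\<bar> \<le> C\<phi>" using cut(1) unfolding cutoff_def by blast
 then have C0: "0 \<le> C\<phi>" by linarith
 define m where "m = measure lborel X"
 have m: "0 \<le> m" by (simp add: m_def)
 obtain M0 where M0: "max (norm am) (norm ap) + 1 \<le> M0" "1 \<le> M0" "2 \<le> c1 * M0 powr (2 * p)" using scale_exists by blast
 have M0': "norm am \<le> M0 - 1" "norm ap \<le> M0 - 1" using M0(1) by auto
 \<comment> \<open>Enough rings to make the ring term, with the constant of
   \<open>INF_scale_le\<close>, at most \<eta>.\<close>
 obtain N :: nat where N: "125440 * (Cr * (2 * (E + \<eta>))) / \<eta> < real N" using reals_Archimedean2 by blast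
 have "0 \<le> 125440 * (Cr * (2 * (E + \<eta>))) / \<eta>" using Cr_nonneg E \<eta> by (intro divide_nonneg_nonneg mult_nonneg_nonneg) auto
 then have N0: "0 < N" using N by (cases N) auto
 have bN: "125440 * (Cr * (2 * (E + \<eta>) / N)) \<le> \<eta>" using N N0 \<eta> by (simp add: field_simps)
 define Mm where "Mm = 4 ^ N * M0"
 have Mm: "M0 \<le> Mm" "0 < Mm" using M0(2) by (auto simp: Mm_def)
 define Wm where "Wm = WM Mm"
 have Wm: "0 \<le> Wm" using WM_nonneg by (simp add: Wm_def)
 define q1 where "q1 = 1280 * (Wm * (C\<phi> * m))"
 have q1: "0 \<le> q1" unfolding q1_def using Wm C0 m by (intro mult_nonneg_nonneg) auto
 define h where "h = min (M0 / 2) (\<eta> / (q1 + 1))"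
 have h: "0 < h" "2 * h \<le> M0" "h \<le> \<eta> / (q1 + 1)" using M0(2) \<eta> q1 by (auto simp: h_def)
 have bh: "2 * (Wm * (C\<phi> * (640 * h * m))) \<le> \<eta>"
  using order_trans[OF mult_left_mono[OF h(3) q1] fraction_le[OF q1 \<eta>(1)]] by (simp add: q1_def ac_simps)
 define Kg where "Kg = 1280 + 5120 * Mm / h + 480 * ln (Mm / h) + 1280 * Mm"
 have "0 \<le> ln (Mm / h)" using h Mm M0(2) by (intro ln_ge_zero) auto
 then have Kg: "0 \<le> Kg" unfolding Kg_def using Mm h by (intro add_nonneg_nonneg) auto
 define q2 where "q2 = 4 * (Wm * (C\<phi> * Kg))"
 have q2: "0 \<le> q2" unfolding q2_def using Wm C0 Kg by (intro mult_nonneg_nonneg) auto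
 define \<kappa> where "\<kappa> = \<eta> / (q2 + 1)"
 have \<kappa>: "0 < \<kappa>" using \<eta> q2 by (simp add: \<kappa>_def)
 have bk: "2 * (Wm * (C\<phi> * (Kg * (2 * \<kappa>)))) \<le> \<eta>"
  using fraction_le[OF q2 \<eta>(1)] unfolding \<kappa>_def[symmetric] by (simp add: q2_def ac_simps)
 obtain \<alpha> C where H: "0 < \<alpha>" "0 < C" "\<forall>y z. norm y \<le> 5 * Mm \<longrightarrow> norm z \<le> 5 * Mm \<longrightarrow> W z \<le> W y + C * norm (z - y) powr \<alpha>"
  using Hoelder_ball[of "5 * Mm"] by blast
 obtain \<tau> s where ts: "0 < \<tau>" "2 < s" "((\<lambda>\<epsilon>. ennreal (\<epsilon> powr (- \<tau>)) * Lp_norm s (lebesgue_on unit_disc) (weak_div unit_disc (u \<epsilon>))) \<longlongrightarrow> 0) (at_right 0)"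
  using u unfolding transition_families_def by blast
 have uW: "u \<epsilon> \<in> W12 unit_disc" if "0 < \<epsilon>" for \<epsilon> using u that unfolding transition_families_def by blast
 have u1: "((\<lambda>\<epsilon>. Lp_norm 1 (lebesgue_on unit_disc) (\<lambda>x. u \<epsilon> x - jump_function am ap x)) \<longlongrightarrow> 0) (at_right 0)"
  using u unfolding transition_families_def by blast
 \<comment> \<open>With \<rho> = \<open>\<epsilon> powr \<beta>\<close> and \<beta> \<alpha> = 2 the
   oscillation of W at scale \<rho> is of order \<epsilon>^2, negligible after division by
   \<epsilon>. The exponent a bounds ln (Mm / \<rho>) by a multiple of
   \<open>\<epsilon> powr (- \<tau> / 2)\<close>, which uses up only half of the decay of the
   divergence.\<close>
 define \<beta> a where "\<beta> = 2 / \<alpha>" and "a = \<tau> / (2 * \<beta>)"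
 have ba: "0 < \<beta>" "0 < a" "\<beta> * \<alpha> = 2" "\<beta> * a = \<tau> / 2" using H ts by (auto simp: \<beta>_def a_def)
 define \<theta> where "\<theta> = \<eta> / (m + 1)"
 have \<theta>: "0 < \<theta>" "\<theta> * m \<le> \<eta>" using \<eta> m fraction_le[OF m \<eta>(1)] by (auto simp: \<theta>_def mult.commute)
 define md where "md = measure lborel unit_disc"
 have md: "0 \<le> md" by (simp add: md_def)
 have "\<forall>\<^sub>F \<epsilon> in at_right 0. 2 * \<epsilon> powr \<beta> \<le> h" by (rule eventually_power_small[OF ba(1) h(1)])
 moreover have "\<forall>\<^sub>F \<epsilon> in at_right 0. (C * 2 powr \<alpha>) * \<epsilon> powr 1 \<le> \<theta>" by (rule eventually_power_small[OF _ \<theta>(1)]) simp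
 moreover have "\<forall>\<^sub>F \<epsilon> in at_right 0. (4 * (Mm * (C\<phi> * (m + 2 * E)))) * \<epsilon> powr (1 / 2) \<le> \<eta>" by (rule eventually_power_small[OF _ \<eta>(1)]) simp
 moreover have "\<forall>\<^sub>F \<epsilon> in at_right 0. (1120 * (Wm * ((md + 1) * (Mm powr a / a)))) * \<epsilon> powr (\<tau> / 2) \<le> \<eta>" by (rule eventually_power_small[OF _ \<eta>(1)]) (use ts in simp)
 moreover have "\<forall>\<^sub>F \<epsilon> in at_right 0. Lp_norm 1 (lebesgue_on unit_disc) (\<lambda>x. u \<epsilon> x - jump_function am ap x) < ennreal \<kappa>"
  by (rule order_tendstoD(2)[OF u1]) (use \<kappa> in simp)
 moreover have "\<forall>\<^sub>F \<epsilon> in at_right 0. ennreal (\<epsilon> powr (- \<tau>)) * Lp_norm s (lebesgue_on unit_disc) (weak_div unit_disc (u \<epsilon>)) < 1"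
  by (rule order_tendstoD(2)[OF ts(3)]) simp
 moreover have "\<forall>\<^sub>F \<epsilon> in at_right (0::real). 0 < \<epsilon>" by (rule eventually_at_right_less)
 ultimately have ev: "\<forall>\<^sub>F \<epsilon> in at_right 0. 2 * \<epsilon> powr \<beta> \<le> h \<and> (C * 2 powr \<alpha>) * \<epsilon> powr 1 \<le> \<theta> \<and> (4 * (Mm * (C\<phi> * (m + 2 * E)))) * \<epsilon> powr (1 / 2) \<le> \<eta>
   \<and> (1120 * (Wm * ((md + 1) * (Mm powr a / a)))) * \<epsilon> powr (\<tau> / 2) \<le> \<eta> \<and> Lp_norm 1 (lebesgue_on unit_disc) (\<lambda>x. u \<epsilon> x - jump_function am ap x) < ennreal \<kappa>
   \<and> ennreal (\<epsilon> powr (- \<tau>)) * Lp_norm s (lebesgue_on unit_disc) (weak_div unit_disc (u \<epsilon>)) < 1 \<and> 0 < \<epsilon>"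
  by eventually_elim blast
 have "\<exists>\<^sub>F \<epsilon> in at_right 0. energy W \<epsilon> (u \<epsilon>) \<le> ennreal E"
 proof (rule ccontr)
  assume "\<not> ?thesis"
  then have "\<forall>\<^sub>F \<epsilon> in at_right 0. ennreal E \<le> energy W \<epsilon> (u \<epsilon>)" unfolding frequently_def not_not by (rule eventually_mono) simp
  from Liminf_bounded[OF this] have "ennreal E \<le> ennreal L0" unfolding L(1) .
  then show False using L(2) \<eta> by (simp add: E_def ennreal_le_iff)
 qed
 \<comment> \<open>The lower limit bounds the energy only for some arbitrarily small \<epsilon>,
   whereas the other conditions hold for all small \<epsilon>; hence a common value exists.\<close>
 from frequently_ex[OF frequently_eventually_frequently[OF this ev]] obtain \<epsilon> where
  en: "energy W \<epsilon> (u \<epsilon>) \<le> ennreal E" and e: "0 < \<epsilon>" and e1: "2 * \<epsilon> powr \<beta> \<le> h" and e2: "(C * 2 powr \<alpha>) * \<epsilon> powr 1 \<le> \<theta>"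
  and e4: "(4 * (Mm * (C\<phi> * (m + 2 * E)))) * \<epsilon> powr (1 / 2) \<le> \<eta>" and e5: "(1120 * (Wm * ((md + 1) * (Mm powr a / a)))) * \<epsilon> powr (\<tau> / 2) \<le> \<eta>"
  and e6: "Lp_norm 1 (lebesgue_on unit_disc) (\<lambda>x. u \<epsilon> x - jump_function am ap x) < ennreal \<kappa>"
  and e7: "ennreal (\<epsilon> powr (- \<tau>)) * Lp_norm s (lebesgue_on unit_disc) (weak_div unit_disc (u \<epsilon>)) < 1" by blast
 obtain U Gm where rep: "represents U Gm (u \<epsilon>)" using W12_represented[OF uW[OF e]] by blast
 define \<rho> where "\<rho> = \<epsilon> powr \<beta>"
 have \<rho>: "0 < \<rho>" "2 * \<rho> \<le> h" using e e1 by (auto simp: \<rho>_def)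
 have near: "W z \<le> W y + \<theta> * \<epsilon>" if "norm y \<le> 5 * Mm" "norm z \<le> 5 * Mm" "norm (z - y) \<le> 2 * \<rho>" for y z
 proof -
  have "norm (z - y) powr \<alpha> \<le> (2 * \<rho>) powr \<alpha>" using that(3) H(1) by (intro powr_mono2) auto
  also have "\<dots> = 2 powr \<alpha> * (\<epsilon> * \<epsilon>)" using e by (simp add: powr_mult \<rho>_def powr_powr ba(3) powr_2 power2_eq_square)
  finally have "C * norm (z - y) powr \<alpha> \<le> C * (2 powr \<alpha> * (\<epsilon> * \<epsilon>))" using H(2) by (intro mult_left_mono) auto
  also have "\<dots> = ((C * 2 powr \<alpha>) * \<epsilon> powr 1) * \<epsilon>" using e by simp
  also have "\<dots> \<le> \<theta> * \<epsilon>" using e2 e by (intro mult_right_mono) auto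
  finally show ?thesis using H(3)[rule_format, OF that(1,2)] by linarith
 qed
 have jm: "jump_function am ap \<in> borel_measurable borel"
 proof -
  have "{x::R2. x $ 1 > 0} \<in> sets borel" by (intro borel_open open_Collect_less continuous_intros)
  then show ?thesis unfolding jump_function_def[abs_def] by measurable
 qed
 note g0 = L1_distance_represented[OF rep jm \<kappa> e6]
 have Lp: "Lp_norm s (lebesgue_on unit_disc) (weak_div unit_disc (u \<epsilon>)) \<le> ennreal (\<epsilon> powr \<tau>)"
 proof -
  have one: "ennreal (\<epsilon> powr \<tau>) * ennreal (\<epsilon> powr (- \<tau>)) = 1" using e by (subst ennreal_mult[symmetric]) (auto simp: powr_add[symmetric])
  have "Lp_norm s (lebesgue_on unit_disc) (weak_div unit_disc (u \<epsilon>)) = ennreal (\<epsilon> powr \<tau>) * (ennreal (\<epsilon> powr (- \<tau>)) * Lp_norm s (lebesgue_on unit_disc) (weak_div unit_disc (u \<epsilon>)))"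
   unfolding mult.assoc[symmetric] one by simp
  also have "\<dots> \<le> ennreal (\<epsilon> powr \<tau>) * 1" using e7 by (intro mult_left_mono) auto
  finally show ?thesis by simp
 qed
 have D: "(LBINT x. \<bar>trace (Gm x)\<bar>) \<le> (md + 1) * \<epsilon> powr \<tau>"
  unfolding md_def by (rule divergence_represented[OF rep _ _ Lp]) (use ts e in auto)
 have b5: "2 * (Wm * (560 * (ln (Mm / \<rho>) * ((md + 1) * \<epsilon> powr \<tau>)))) \<le> \<eta>"
 proof -
  have "ln (Mm / \<rho>) \<le> (Mm / \<rho>) powr a / a" using \<rho> h Mm M0(2) ba(2) by (intro ln_powr_bound) auto
  also have "(Mm / \<rho>) powr a = Mm powr a / \<epsilon> powr (\<tau> / 2)" using Mm \<rho> by (simp add: powr_divide \<rho>_def powr_powr ba(4))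
  finally have "ln (Mm / \<rho>) * \<epsilon> powr \<tau> \<le> (Mm powr a / \<epsilon> powr (\<tau> / 2) / a) * \<epsilon> powr \<tau>" by (intro mult_right_mono) auto
  also have "(Mm powr a / \<epsilon> powr (\<tau> / 2) / a) * \<epsilon> powr \<tau> = (Mm powr a / a) * \<epsilon> powr (\<tau> / 2)"
  proof -
   have "\<epsilon> powr \<tau> = \<epsilon> powr (\<tau> / 2) * \<epsilon> powr (\<tau> / 2)" by (simp add: powr_add[symmetric])
   then show ?thesis using e by simp
  qed
  finally have "(1120 * (Wm * (md + 1))) * (ln (Mm / \<rho>) * \<epsilon> powr \<tau>) \<le> (1120 * (Wm * (md + 1))) * ((Mm powr a / a) * \<epsilon> powr (\<tau> / 2))"
   using Wm md by (intro mult_left_mono mult_nonneg_nonneg) auto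
  also have "\<dots> = (1120 * (Wm * ((md + 1) * (Mm powr a / a)))) * \<epsilon> powr (\<tau> / 2)" by (simp only: ac_simps)
  also have "\<dots> \<le> \<eta>" by (rule e5)
  also have "(1120 * (Wm * (md + 1))) * (ln (Mm / \<rho>) * \<epsilon> powr \<tau>) = 2 * (Wm * (560 * (ln (Mm / \<rho>) * ((md + 1) * \<epsilon> powr \<tau>))))" by simp
  finally show ?thesis .
 qed
 have b3: "\<theta> * \<epsilon> / (2 * \<epsilon>) * m \<le> \<eta>"
 proof -
  have "\<theta> * \<epsilon> / (2 * \<epsilon>) * m = \<theta> * m / 2" using e by simp
  then show ?thesis using \<theta>(2) \<eta> by linarith
 qed
 have b4: "4 * (Mm * (C\<phi> * (sqrt \<epsilon> * (m + 2 * E)))) \<le> \<eta>" using e4 e by (simp add: powr_half_sqrt ac_simps)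
 have split: "2 * (Wm * (C\<phi> * (640 * h * m + Kg * (2 * \<kappa>)) + 560 * (ln (Mm / \<rho>) * ((md + 1) * \<epsilon> powr \<tau>))))
  = 2 * (Wm * (C\<phi> * (640 * h * m))) + 2 * (Wm * (C\<phi> * (Kg * (2 * \<kappa>)))) + 2 * (Wm * (560 * (ln (Mm / \<rho>) * ((md + 1) * \<epsilon> powr \<tau>))))"
  by (simp only: distrib_left)
 have e0: "0 \<le> \<theta> * \<epsilon>" and r1: "1 - \<eta> < 1" using \<theta> e \<eta> by auto
 have "(INF T \<in> transition_currents am ap. F_mass W T) \<le> ennreal (1 / (2 * l) *
  (E + \<eta> + \<theta> * \<epsilon> / (2 * \<epsilon>) * m + 4 * (Mm * (C\<phi> * (sqrt \<epsilon> * (m + 2 * E))))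
  + 2 * (Wm * (C\<phi> * (640 * h * m + Kg * (2 * \<kappa>)) + 560 * (ln (Mm / \<rho>) * ((md + 1) * \<epsilon> powr \<tau>))))
  + 125440 * (Cr * (2 * (E + \<eta>) / N))))" unfolding m_def Wm_def Kg_def
  by (rule INF_mollified_le[OF cut(1,2) r1 l(1) M0' M0(2,3) a1 N0 Mm_def h(1,2) \<rho> e e0 near rep E en \<kappa> \<eta>(1) g0(1) less_imp_le[OF g0(2)] D])
 also have "\<dots> \<le> ennreal (1 / (2 * (2 - 8 * \<eta>)) * (L0 + 8 * \<eta>))"
 proof (rule ennreal_leI, rule order_trans[OF mult_left_mono mult_right_mono])
  show "E + \<eta> + \<theta> * \<epsilon> / (2 * \<epsilon>) * m + 4 * (Mm * (C\<phi> * (sqrt \<epsilon> * (m + 2 * E))))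
  + 2 * (Wm * (C\<phi> * (640 * h * m + Kg * (2 * \<kappa>)) + 560 * (ln (Mm / \<rho>) * ((md + 1) * \<epsilon> powr \<tau>))))
  + 125440 * (Cr * (2 * (E + \<eta>) / N)) \<le> L0 + 8 * \<eta>"
  proof -
   have "x1 + \<eta> + x3 + x4 + x5 + x6 \<le> L0 + 8 * \<eta>" if "x1 = L0 + \<eta>" "x3 \<le> \<eta>" "x4 \<le> \<eta>" "x5 = y1 + y2 + y3" "y1 \<le> \<eta>" "y2 \<le> \<eta>" "y3 \<le> \<eta>" "x6 \<le> \<eta>" for x1 x3 x4 x5 x6 y1 y2 y3 :: real
    using that by argo
   from this[OF E_def b3 b4 split bh bk b5 bN] show ?thesis .
  qed
  show "1 / (2 * l) \<le> 1 / (2 * (2 - 8 * \<eta>))" using l cut(3) by (intro divide_left_mono) auto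
 qed (use l L \<eta> in auto)
 finally show ?thesis .
qed

text \<open>As \<eta> tends to 0, the factor in \<open>INF_le_family\<close> tends to 1/4: one 1/2
  from the root of \<open>F_star\<close>, the other from the length 2 of the jump line. Nothing is
  to be shown if the lower limit is infinite.\<close>

theorem INF_le_Liminf:
 assumes a1: "am $ 1 = ap $ 1" and u: "u \<in> transition_families am ap"
 shows "4 * (INF T \<in> transition_currents am ap. F_mass W T) \<le> Liminf (at_right 0) (\<lambda>\<epsilon>. energy W \<epsilon> (u \<epsilon>))"
proof (cases "Liminf (at_right 0) (\<lambda>\<epsilon>. energy W \<epsilon> (u \<epsilon>))")
 case (real L0)
 let ?I = "INF T \<in> transition_currents am ap. F_mass W T"
 have "((\<lambda>\<eta>. ennreal (1 / (2 * (2 - 8 * \<eta>)) * (L0 + 8 * \<eta>))) \<longlongrightarrow> ennreal (1 / (2 * (2 - 8 * 0)) * (L0 + 8 * 0))) (at_right 0)"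
  by (intro tendsto_ennrealI tendsto_intros) auto
 moreover have "\<forall>\<^sub>F \<eta> in at_right 0. ?I \<le> ennreal (1 / (2 * (2 - 8 * \<eta>)) * (L0 + 8 * \<eta>))"
  unfolding eventually_at_right_field
  by (rule exI[of _ "1/8"]) (use INF_le_family[OF a1 u real(2) real(1)] in auto)
 ultimately have "?I \<le> ennreal (1 / (2 * (2 - 8 * 0)) * (L0 + 8 * 0))" by (rule tendsto_lowerbound) simp
 then have "4 * ?I \<le> ennreal 4 * ennreal (L0 / 4)" by (intro mult_mono) auto
 also have "\<dots> = ennreal L0" using real(1) by (simp add: ennreal_mult[symmetric] del: ennreal_numeral)
 finally show ?thesis unfolding real(2) .
qed simp

end

theorem theorem3:
  fixes W :: "real^2 \<Rightarrow> real" and am ap :: "real^2" and c1 c2 p :: real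
  assumes "\<And>y. 0 \<le> W y"
    and "locally_Hoelder_continuous W"
    and "c1 > 0" and "c2 > 0" and "p > 0"
    and "\<And>y. c1 * norm y powr (2 * p) - 1 \<le> W y"
    and "\<And>y. W y \<le> c2 * (norm y powr (2 * p) + 1)"
    and "am $ 1 = ap $ 1" and "am $ 2 < ap $ 2"
  shows "transition_energy W am ap \<ge> 2 * (INF T \<in> transition_currents am ap. F_mass W T)"
proof -
  interpret potential W c1 c2 p by unfold_locales (fact assms)+
  let ?I = "INF T \<in> transition_currents am ap. F_mass W T"
  have half: "ennreal (1/2) * 4 = 2"
  proof -
    have "ennreal (1/2) * ennreal 4 = ennreal 2" by (subst ennreal_mult[symmetric]) auto
    then show ?thesis by simp
  qed
  have "2 * ?I = ennreal (1/2) * (4 * ?I)" unfolding mult.assoc[symmetric] half ..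
  also have "\<dots> \<le> transition_energy W am ap"
    unfolding transition_energy_def by (intro mult_left_mono INF_greatest INF_le_Liminf assms(8)) auto
  finally show ?thesis .
qed

end
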